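(* Let $G$ be a non-cyclic GBS group, and let $n\ge2$ be an integer. The following are equivalent: \begin{enumerate} \item $G$ embeds into $BS(n,n)$; \item $G/Z(G)$ is a free product of cyclic groups, with the order of each finite factor dividing $n$; \item $G$ may be represented by a reduced labelled graph $\Gamma$ such that all labels near any given vertex $v$ are equal, and they divide $n$. \end{enumerate}
   Context: $BS(n,n)=\langle a,t\mid ta^nt^{-1}=a^n\rangle$. A generalized Baumslag-Solitar (GBS) group is a finitely generated group acting on a tree (without inversions) with all vertex and edge stabilizers infinite cyclic. $Z(G)$ denotes the center of $G$. A labelled graph is a finite graph $\Gamma$ in which each oriented edge $e$ carries a label $\lambda_e$, a nonzero integer; the labels near a vertex $v$ are the labels $\lambda_e$ of the oriented edges $e$ with origin $v$. A connected labelled graph represents the GBS group which is the fundamental group of the graph of groups with all vertex and edge groups $\mathbb{Z}$, where the inclusion from the edge group of $e$ into the vertex group of the origin of $e$ is multiplication by $\lambda_e$. $\Gamma$ is reduced if every edge $e$ with $\lambda_e=\pm1$ is a loop. *)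

theory Defs
  imports
    "HOL-Algebra.Elementary_Groups"
    "HOL-Algebra.Group_Action"
    "Graph_Theory.Graph_Theory"
begin

section \<open>Groups given by words and relations\<close>

text \<open>
  \<open>word_cong A R\<close> is the congruence on the free monoid \<open>lists A\<close> generated by the pairs in \<open>R\<close>.
\<close>

inductive_set word_cong :: "'x set \<Rightarrow> ('x list \<times> 'x list) set \<Rightarrow> ('x list \<times> 'x list) set"
  for A R where
  refl: "w \<in> lists A \<Longrightarrow> (w, w) \<in> word_cong A R"
| rewrite: "\<lbrakk>(r, s) \<in> R; r \<in> lists A; s \<in> lists A; u \<in> lists A; v \<in> lists A\<rbrakk>
            \<Longrightarrow> (u @ r @ v, u @ s @ v) \<in> word_cong A R"
| sym: "(w, w') \<in> word_cong A R \<Longrightarrow> (w', w) \<in> word_cong A R"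
| trans: "\<lbrakk>(w, w') \<in> word_cong A R; (w', w'') \<in> word_cong A R\<rbrakk> \<Longrightarrow> (w, w'') \<in> word_cong A R"

definition word_quotient :: "'x set \<Rightarrow> ('x list \<times> 'x list) set \<Rightarrow> 'x list set monoid" where
  "word_quotient A R =
     \<lparr>carrier = lists A // word_cong A R,
      monoid.mult = (\<lambda>X Y. \<Union>u\<in>X. \<Union>v\<in>Y. word_cong A R `` {u @ v}),
      one = word_cong A R `` {[]}\<rparr>"

text \<open>
  In a group presentation the letter \<open>(x, True)\<close> stands for the generator \<open>x\<close> and \<open>(x, False)\<close>
  for its inverse; a pair \<open>(r, s)\<close> is the relation \<open>r = s\<close>.
\<close>

definition presented_group ::
    "'x set \<Rightarrow> (('x \<times> bool) list \<times> ('x \<times> bool) list) set \<Rightarrow> ('x \<times> bool) list set monoid" where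
  "presented_group X R =
     word_quotient (X \<times> UNIV) (R \<union> {([(x, b), (x, \<not> b)], []) | x b. x \<in> X})"

datatype bs_gen = BS_a | BS_t

text \<open>Baumslag--Solitar groups \<open>\<langle>a, t | t a\<^sup>m t\<inverse> = a\<^sup>n\<rangle>\<close>, for nonnegative exponents only.\<close>

definition BS :: "nat \<Rightarrow> nat \<Rightarrow> (bs_gen \<times> bool) list set monoid" where
  "BS m n = presented_group UNIV
     {([(BS_t, True)] @ replicate m (BS_a, True) @ [(BS_t, False)], replicate n (BS_a, True))}"

definition free_product :: "'i set \<Rightarrow> ('i \<Rightarrow> ('g, 'm) monoid_scheme) \<Rightarrow> ('i \<times> 'g) list set monoid"
  where
  "free_product I K = word_quotient (SIGMA i:I. carrier (K i))
     ({([(i, \<one>\<^bsub>K i\<^esub>)], []) | i. i \<in> I} \<union>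
      {([(i, g), (i, h)], [(i, g \<otimes>\<^bsub>K i\<^esub> h)]) | i g h.
         i \<in> I \<and> g \<in> carrier (K i) \<and> h \<in> carrier (K i)})"

definition group_center :: "('a, 'b) monoid_scheme \<Rightarrow> 'a set" where
  "group_center G = {z \<in> carrier G. \<forall>g \<in> carrier G. z \<otimes>\<^bsub>G\<^esub> g = g \<otimes>\<^bsub>G\<^esub> z}"

definition finitely_generated :: "('a, 'b) monoid_scheme \<Rightarrow> bool" where
  "finitely_generated G \<longleftrightarrow> (\<exists>S. finite S \<and> S \<subseteq> carrier G \<and> generate G S = carrier G)"


section \<open>Trees and GBS groups\<close>

text \<open>
  Graphs are taken in the sense of Serre: a \<^locale>\<open>bidirected_digraph\<close> consists of oriented edges
  (arcs) with a fixed-point free reversal \<open>arev\<close>; loops and multiple edges are allowed. A geometric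
  edge is a pair \<open>{e, arev e}\<close>, so a circuit is a closed walk without repeated vertices which
  never runs through an arc and then straight back. The notion of tree in the library would count
  \<open>[e, arev e]\<close> as a cycle and is therefore not the right one here.
\<close>

definition serre_tree :: "('v, 'e) pre_digraph \<Rightarrow> ('e \<Rightarrow> 'e) \<Rightarrow> bool" where
  "serre_tree T arev \<longleftrightarrow>
     Digraph_Component.connected T \<and>
     \<not> (\<exists>p. pre_digraph.cycle T p \<and> successively (\<lambda>e f. f \<noteq> arev e) p)"

text \<open>An action without inversions on a tree, with \<open>\<phi>\<close> and \<open>\<psi>\<close> acting on vertices and arcs.\<close>

definition tree_action ::
    "('a, 'b) monoid_scheme \<Rightarrow> ('v, 'e) pre_digraph \<Rightarrow> ('e \<Rightarrow> 'e) \<Rightarrow>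
     ('a \<Rightarrow> 'v \<Rightarrow> 'v) \<Rightarrow> ('a \<Rightarrow> 'e \<Rightarrow> 'e) \<Rightarrow> bool" where
  "tree_action G T arev \<phi> \<psi> \<longleftrightarrow>
     bidirected_digraph T arev \<and> serre_tree T arev \<and>
     group_action G (verts T) \<phi> \<and> group_action G (arcs T) \<psi> \<and>
     (\<forall>g \<in> carrier G. \<forall>e \<in> arcs T.
        tail T (\<psi> g e) = \<phi> g (tail T e) \<and>
        \<psi> g (arev e) = arev (\<psi> g e) \<and>
        \<psi> g e \<noteq> arev e)"

definition infinite_cyclic :: "('a, 'b) monoid_scheme \<Rightarrow> bool" where
  "infinite_cyclic G \<longleftrightarrow> cyclic_group G \<and> infinite (carrier G)"

text \<open>
  HOL cannot quantify existentially over the types of vertices and arcs of the tree, so they are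
  parameters. A theorem assuming \<open>gbs_group TYPE('v) TYPE('e) G\<close> with type variables \<open>'v\<close>, \<open>'e\<close>
  applies to every group acting as required on some tree of any type.
\<close>

definition gbs_group :: "'v itself \<Rightarrow> 'e itself \<Rightarrow> ('a, 'b) monoid_scheme \<Rightarrow> bool" where
  "gbs_group (_ :: 'v itself) (_ :: 'e itself) G \<longleftrightarrow>
     group G \<and> finitely_generated G \<and>
     (\<exists>(T :: ('v, 'e) pre_digraph) arev \<phi> \<psi>.
        tree_action G T arev \<phi> \<psi> \<and>
        (\<forall>v \<in> verts T. infinite_cyclic (G\<lparr>carrier := stabilizer G \<phi> v\<rparr>)) \<and>
        (\<forall>e \<in> arcs T. infinite_cyclic (G\<lparr>carrier := stabilizer G \<psi> e\<rparr>)))"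


section \<open>Graphs of groups and labelled graphs\<close>

definition spanning_arcs :: "('v, 'e) pre_digraph \<Rightarrow> ('e \<Rightarrow> 'e) \<Rightarrow> 'e set \<Rightarrow> bool" where
  "spanning_arcs \<Gamma> arev F \<longleftrightarrow>
     F \<subseteq> arcs \<Gamma> \<and> arev ` F \<subseteq> F \<and> serre_tree (\<Gamma>\<lparr>arcs := F\<rparr>) arev"

text \<open>
  The fundamental group of the graph of groups with vertex groups \<open>GV v\<close>, edge groups
  \<open>GE e = GE (arev e)\<close> and monomorphisms \<open>\<alpha> e\<close> from \<open>GE e\<close> into \<open>GV (tail \<Gamma> e)\<close>, relative to the
  maximal subtree with set of arcs \<open>F\<close> (Serre): it is generated by the vertex groups and by letters
  \<open>t\<^sub>e\<close>, subject to \<open>t\<^sub>e t\<^bsub>arev e\<^esub> = 1\<close>, to \<open>t\<^sub>e \<alpha>\<^bsub>arev e\<^esub>(g) t\<^bsub>arev e\<^esub> = \<alpha>\<^sub>e(g)\<close>, and to \<open>t\<^sub>e = 1\<close> for \<open>e \<in> F\<close>.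
  Up to isomorphism it does not depend on \<open>F\<close>.
\<close>

definition pi1_graph_of_groups ::
    "('v, 'e) pre_digraph \<Rightarrow> ('e \<Rightarrow> 'e) \<Rightarrow> ('v \<Rightarrow> ('g, 'm) monoid_scheme) \<Rightarrow>
     ('e \<Rightarrow> ('h, 'k) monoid_scheme) \<Rightarrow> ('e \<Rightarrow> 'h \<Rightarrow> 'g) \<Rightarrow> 'e set \<Rightarrow>
     ('v \<times> 'g + 'e) list set monoid" where
  "pi1_graph_of_groups \<Gamma> arev GV GE \<alpha> F =
     word_quotient
       (Inl ` (SIGMA v:verts \<Gamma>. carrier (GV v)) \<union> Inr ` arcs \<Gamma>)
       ({([Inl (v, \<one>\<^bsub>GV v\<^esub>)], []) | v. v \<in> verts \<Gamma>} \<union>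
        {([Inl (v, g), Inl (v, h)], [Inl (v, g \<otimes>\<^bsub>GV v\<^esub> h)]) | v g h.
           v \<in> verts \<Gamma> \<and> g \<in> carrier (GV v) \<and> h \<in> carrier (GV v)} \<union>
        {([Inr e, Inr (arev e)], []) | e. e \<in> arcs \<Gamma>} \<union>
        {([Inr e, Inl (head \<Gamma> e, \<alpha> (arev e) g), Inr (arev e)], [Inl (tail \<Gamma> e, \<alpha> e g)]) | e g.
           e \<in> arcs \<Gamma> \<and> g \<in> carrier (GE e)} \<union>
        {([Inr e], []) | e. e \<in> F})"

locale labelled_graph = fin_digraph \<Gamma> + bidirected_digraph \<Gamma> arev
  for \<Gamma> :: "('v, 'e) pre_digraph" and arev :: "'e \<Rightarrow> 'e" +
  fixes lab :: "'e \<Rightarrow> int"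
  assumes lab_nonzero: "e \<in> arcs \<Gamma> \<Longrightarrow> lab e \<noteq> 0"

definition reduced_labelled_graph :: "('v, 'e) pre_digraph \<Rightarrow> ('e \<Rightarrow> int) \<Rightarrow> bool" where
  "reduced_labelled_graph \<Gamma> lab \<longleftrightarrow>
     (\<forall>e \<in> arcs \<Gamma>. lab e = 1 \<or> lab e = -1 \<longrightarrow> tail \<Gamma> e = head \<Gamma> e)"

definition represents ::
    "('v, 'e) pre_digraph \<Rightarrow> ('e \<Rightarrow> 'e) \<Rightarrow> ('e \<Rightarrow> int) \<Rightarrow> ('a, 'b) monoid_scheme \<Rightarrow> bool" where
  "represents \<Gamma> arev lab G \<longleftrightarrow>
     Digraph_Component.connected \<Gamma> \<and>
     (\<exists>F. spanning_arcs \<Gamma> arev F \<and>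
        G \<cong> pi1_graph_of_groups \<Gamma> arev (\<lambda>_. integer_group) (\<lambda>_. integer_group)
              (\<lambda>e k. lab e * k) F)"

end

theory Submission
  imports Defs "HOL-Algebra.Multiplicative_Group" "HOL-Library.Countable_Set"
begin

text \<open>Let \<open>H = \<langle>z, a\<^sub>i, t\<^sub>j | z central, a\<^sub>i\<^bsup>\<nu> i\<^esup> = z\<rangle>\<close> with all \<open>\<nu> i\<close> dividing \<open>n\<close>; it is a central extension of a free
  product of cyclic groups by \<open>\<langle>z\<rangle>\<close>. Every graph as in (3) gives such a group (all edge groups coincide and are central), and
  conversely \<open>H\<close> is represented by a star with loops at its centre. Such an \<open>H\<close> embeds into \<open>BS(n,n)\<close>: let \<open>BS(n,n)\<close>
  act on copies of \<open>H\<close> indexed by a set in which \<open>a\<close> has orbits of the lengths \<open>\<nu> i\<close>, so that the elements stabilising one copy induce all of \<open>H\<close> on it.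

  If \<open>G\<close> is contained in \<open>BS(n,n)\<close>, a Kurosh argument with a Schreier transversal adapted to the \<open>a\<close>-orbits on the cosets
  of \<open>G\<close> writes \<open>G\<close> modulo its intersection with the central subgroup \<open>\<langle>a\<^sup>n\<rangle>\<close> as a free product of cyclic groups, and this
  intersection is the centre unless \<open>G\<close> is abelian.

  Conversely, let \<open>G/Z(G)\<close> be a nontrivial free product of cyclic groups. The elliptic elements of \<open>G\<close> are commensurable with
  one element \<open>v\<close>, whose commensurator is \<open>G\<close>. As \<open>G\<close> is finitely generated and \<open>G/Z(G)\<close> finitely presented, \<open>Z(G)\<close> is
  finitely generated; its elements are pairwise commensurable, so it is cyclic, and it is nontrivial since a torsion-free
  nontrivial free product contains no commensurated cyclic subgroup. Because \<open>G\<close> is torsion-free, a generator of a finite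
  factor of order \<open>m\<close> lifts to an \<open>m\<close>-th root of a generator of \<open>Z(G)\<close>, so \<open>G\<close> is a group \<open>H\<close>. A noncyclic abelian \<open>G\<close> is
  \<open>\<int>\<^sup>2\<close>, which is \<open>H\<close> with one \<open>a\<^sub>i\<close>, \<open>\<nu> i = 1\<close>, and one \<open>t\<^sub>j\<close>.\<close>

section \<open>Words modulo a congruence\<close>

text \<open>That two elements of a presented group differ is shown by an action: the letters act on
  a set, the relations are checked there pointwise, and an element is recovered from its effect on
  one point. This yields the normal form in free products, the injectivity of H -> BS(n,n), and a
  cocycle on the cosets of a subgroup of BS(n,n) with values in a free product. In the last two
  cases the relation t a^n t^-1 = a^n holds because the length of each a-orbit times the exponent
  attached to it is n, so that a^n acts centrally, respectively trivially.

  A subgroup of BS(n,n) is first enlarged by a^n, which makes all a-orbits on its cosets finite.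

  In the converse direction the tree is soon replaced by algebra. The central fact is that an
  element g commuting with some w not commensurable with v acts on the axis of w, so that some w^q
  g^m with m > 0 is commensurable with v.

  If at most one factor of the free product is nontrivial, G/Z(G) is cyclic, so G is abelian; its
  quotient is then the free product of no factors.\<close>

declare in_listsI [rule del] in_listsD [rule del]

lemma word_cong_lists: "(w, w') \<in> word_cong A R \<Longrightarrow> w \<in> lists A \<and> w' \<in> lists A"
  by (induction rule: word_cong.induct) auto

lemma equiv_word_cong: "equiv (lists A) (word_cong A R)"
proof (rule equivI)
  show "word_cong A R \<subseteq> lists A \<times> lists A" using word_cong_lists by fastforce
  show "refl_on (lists A) (word_cong A R)" by (auto simp: refl_on_def intro: word_cong.refl)
  show "sym (word_cong A R)" by (auto simp: sym_def intro: word_cong.sym)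
  show "trans (word_cong A R)" by (auto simp: trans_def intro: word_cong.trans)
qed

definition wcls :: "'x set \<Rightarrow> ('x list \<times> 'x list) set \<Rightarrow> 'x list \<Rightarrow> 'x list set" where
  "wcls A R w = word_cong A R `` {w}"

lemma wcls_eq_iff:
  "\<lbrakk>w \<in> lists A; w' \<in> lists A\<rbrakk> \<Longrightarrow> wcls A R w = wcls A R w' \<longleftrightarrow> (w, w') \<in> word_cong A R"
  unfolding wcls_def using eq_equiv_class_iff[OF equiv_word_cong] by metis

lemma word_cong_context:
  "(w, w') \<in> word_cong A R \<Longrightarrow> x \<in> lists A \<Longrightarrow> y \<in> lists A \<Longrightarrow> (x @ w @ y, x @ w' @ y) \<in> word_cong A R"
proof (induction rule: word_cong.induct)
  case (rewrite r s u v)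
  then show ?case
    using word_cong.rewrite[of r s R A "x @ u" "v @ y"] by simp
qed (auto intro: word_cong.intros)

lemma word_cong_append:
  assumes "(u, u') \<in> word_cong A R" "(v, v') \<in> word_cong A R"
  shows "(u @ v, u' @ v') \<in> word_cong A R"
  using word_cong_context[OF assms(1), of "[]" v] word_cong_context[OF assms(2), of u' "[]"]
    word_cong_lists[OF assms(1)] word_cong_lists[OF assms(2)] word_cong.trans by fastforce

lemma carrier_word_quotient: "carrier (word_quotient A R) = wcls A R ` lists A"
  by (auto simp: word_quotient_def quotient_def wcls_def)

lemma wcls_closed [simp]: "w \<in> lists A \<Longrightarrow> wcls A R w \<in> carrier (word_quotient A R)"
  by (auto simp: carrier_word_quotient)

lemma wcls_mult:
  assumes "u \<in> lists A" "v \<in> lists A"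
  shows "wcls A R u \<otimes>\<^bsub>word_quotient A R\<^esub> wcls A R v = wcls A R (u @ v)"
proof -
  have "wcls A R (u' @ v') = wcls A R (u @ v)" if "u' \<in> wcls A R u" "v' \<in> wcls A R v" for u' v'
  proof -
    have "(u, u') \<in> word_cong A R" "(v, v') \<in> word_cong A R" using that by (auto simp: wcls_def)
    from word_cong_append[OF this] show ?thesis
      using word_cong_lists wcls_eq_iff by metis
  qed
  moreover have "u \<in> wcls A R u" "v \<in> wcls A R v"
    using assms by (auto simp: wcls_def intro: word_cong.refl)
  ultimately have "(\<Union>u'\<in>wcls A R u. \<Union>v'\<in>wcls A R v. wcls A R (u' @ v')) = wcls A R (u @ v)"
    by blast
  then show ?thesis
    by (simp add: word_quotient_def wcls_def[symmetric])
qed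

lemma one_word_quotient: "\<one>\<^bsub>word_quotient A R\<^esub> = wcls A R []"
  by (simp add: word_quotient_def wcls_def)

lemma monoid_word_quotient: "monoid (word_quotient A R)"
proof (rule monoidI)
  fix x y z
  assume "x \<in> carrier (word_quotient A R)" "y \<in> carrier (word_quotient A R)" "z \<in> carrier (word_quotient A R)"
  then obtain u v w where "x = wcls A R u" "y = wcls A R v" "z = wcls A R w"
    "u \<in> lists A" "v \<in> lists A" "w \<in> lists A"
    by (auto simp: carrier_word_quotient)
  then show "x \<otimes>\<^bsub>word_quotient A R\<^esub> y \<otimes>\<^bsub>word_quotient A R\<^esub> z = x \<otimes>\<^bsub>word_quotient A R\<^esub> (y \<otimes>\<^bsub>word_quotient A R\<^esub> z)"
    by (simp add: wcls_mult)
qed (auto simp: carrier_word_quotient one_word_quotient wcls_mult)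

lemma wcls_rel:
  assumes "(r, s) \<in> R" "r \<in> lists A" "s \<in> lists A"
  shows "wcls A R r = wcls A R s"
  using word_cong.rewrite[OF assms, of "[]" "[]"] assms by (simp add: wcls_eq_iff)

lemma word_quotient_induct [consumes 1, case_names one letter]:
  assumes "p \<in> carrier (word_quotient A R)" "Q \<one>\<^bsub>word_quotient A R\<^esub>"
    and "\<And>x p. x \<in> A \<Longrightarrow> p \<in> carrier (word_quotient A R) \<Longrightarrow> Q p \<Longrightarrow> Q (wcls A R [x] \<otimes>\<^bsub>word_quotient A R\<^esub> p)"
  shows "Q p"
proof -
  obtain w where w: "p = wcls A R w" "w \<in> lists A" using assms(1) by (auto simp: carrier_word_quotient)
  have "Q (wcls A R w)" using w(2)
  proof (induction w)
    case Nil
    then show ?case using assms(2) by (simp add: one_word_quotient)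
  next
    case (Cons x w)
    then show ?case using assms(3)[of x "wcls A R w"] by (simp add: wcls_mult)
  qed
  then show ?thesis using w by simp
qed

text \<open>A monoid generated by units is a group, so two-sided inverses are asked for the letters
  only.\<close>

lemma group_word_quotient:
  assumes "\<And>x. x \<in> A \<Longrightarrow> \<exists>y\<in>lists A. wcls A R (x # y) = wcls A R [] \<and> wcls A R (y @ [x]) = wcls A R []"
  shows "group (word_quotient A R)"
proof -
  interpret monoid "word_quotient A R" by (rule monoid_word_quotient)
  have *: "p \<in> Units (word_quotient A R)" if "p \<in> carrier (word_quotient A R)" for p
    using that
  proof (induction rule: word_quotient_induct)
    case (letter x p)
    obtain y where y: "y \<in> lists A" "wcls A R (x # y) = wcls A R []" "wcls A R (y @ [x]) = wcls A R []"
      using assms[OF letter(1)] by auto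
    then have "wcls A R [x] \<in> Units (word_quotient A R)"
      using letter(1) by (auto simp: Units_def wcls_mult one_word_quotient intro!: bexI[of _ "wcls A R y"])
    then show ?case using letter by auto
  qed auto
  show ?thesis by (rule groupI) (auto simp: m_assoc dest!: * Units_l_inv_ex)
qed

definition word_eval :: "('h, 'm) monoid_scheme \<Rightarrow> ('x \<Rightarrow> 'h) \<Rightarrow> 'x list \<Rightarrow> 'h" where
  "word_eval H f w = foldr (\<lambda>x y. f x \<otimes>\<^bsub>H\<^esub> y) w \<one>\<^bsub>H\<^esub>"

lemma word_eval_simps [simp]:
  "word_eval H f [] = \<one>\<^bsub>H\<^esub>"
  "word_eval H f (x # w) = f x \<otimes>\<^bsub>H\<^esub> word_eval H f w"
  by (simp_all add: word_eval_def)

context monoid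
begin

lemma word_eval_closed: "f \<in> A \<rightarrow> carrier G \<Longrightarrow> w \<in> lists A \<Longrightarrow> word_eval G f w \<in> carrier G"
  by (induction w) auto

lemma word_eval_append:
  "f \<in> A \<rightarrow> carrier G \<Longrightarrow> u \<in> lists A \<Longrightarrow> v \<in> lists A \<Longrightarrow>
    word_eval G f (u @ v) = word_eval G f u \<otimes> word_eval G f v"
  by (induction u) (auto simp: word_eval_closed m_assoc Pi_iff)

lemma word_eval_replicate: "f x \<in> carrier G \<Longrightarrow> word_eval G f (replicate k x) = f x [^] k"
proof (induction k)
  case (Suc k)
  then show ?case using nat_pow_Suc2[of "f x" k] by simp
qed simp

lemma word_eval_cong:
  assumes f: "f \<in> A \<rightarrow> carrier G"
    and rel: "\<And>r s. (r, s) \<in> R \<Longrightarrow> r \<in> lists A \<Longrightarrow> s \<in> lists A \<Longrightarrow> word_eval G f r = word_eval G f s"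
  shows "(w, w') \<in> word_cong A R \<Longrightarrow> word_eval G f w = word_eval G f w'"
proof (induction rule: word_cong.induct)
  case (rewrite r s u v)
  then show ?case using rel[of r s] by (simp add: word_eval_append[OF f])
qed auto

text \<open>Universal property of the quotient. The value on a class is computed from a chosen word,
  and by \<open>word_eval_cong\<close> the choice is immaterial.\<close>

lemma word_quotient_lift:
  assumes f: "f \<in> A \<rightarrow> carrier G"
    and rel: "\<And>r s. (r, s) \<in> R \<Longrightarrow> r \<in> lists A \<Longrightarrow> s \<in> lists A \<Longrightarrow> word_eval G f r = word_eval G f s"
  shows "\<exists>h\<in>hom (word_quotient A R) G. \<forall>w\<in>lists A. h (wcls A R w) = word_eval G f w"
proof -
  define h where "h X = word_eval G f (SOME w. w \<in> lists A \<and> X = wcls A R w)" for X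
  have h: "h (wcls A R w) = word_eval G f w" if w: "w \<in> lists A" for w
  proof -
    define w' where "w' = (SOME w'. w' \<in> lists A \<and> wcls A R w = wcls A R w')"
    have "w' \<in> lists A \<and> wcls A R w = wcls A R w'"
      unfolding w'_def by (rule someI[where x=w]) (use w in auto)
    then have "(w, w') \<in> word_cong A R" using w wcls_eq_iff by metis
    then show ?thesis using word_eval_cong[OF f rel] by (simp add: h_def w'_def)
  qed
  moreover have "h \<in> hom (word_quotient A R) G"
    by (rule homI) (auto simp: carrier_word_quotient wcls_mult h word_eval_append[OF f] word_eval_closed[OF f])
  ultimately show ?thesis by blast
qed

end

lemma word_quotient_hom_eq:
  assumes "group (word_quotient A R)" "group H"
    and h: "h \<in> hom (word_quotient A R) H" and h': "h' \<in> hom (word_quotient A R) H"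
    and "\<And>x. x \<in> A \<Longrightarrow> h (wcls A R [x]) = h' (wcls A R [x])"
    and "p \<in> carrier (word_quotient A R)"
  shows "h p = h' p"
  using assms(6)
proof (induction rule: word_quotient_induct)
  case one
  then show ?case using assms hom_one by metis
next
  case (letter x p)
  then show ?case using assms(5)[of x] hom_mult[OF h, of "wcls A R [x]" p] hom_mult[OF h', of "wcls A R [x]" p] by simp
qed

text \<open>Here the letters act on a set \<open>S\<close> only as functions; neither \<open>S\<close> nor the action need come from a group.\<close>

lemma word_cong_action:
  assumes act: "\<And>x s. x \<in> A \<Longrightarrow> s \<in> S \<Longrightarrow> act x s \<in> S"
    and rel: "\<And>r t s. (r, t) \<in> R \<Longrightarrow> r \<in> lists A \<Longrightarrow> t \<in> lists A \<Longrightarrow> s \<in> S \<Longrightarrow> foldr act r s = foldr act t s"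
  shows "(w, w') \<in> word_cong A R \<Longrightarrow> s \<in> S \<Longrightarrow> foldr act w s = foldr act w' s"
proof (induction arbitrary: s rule: word_cong.induct)
  case (rewrite r t u v)
  have "foldr act v s \<in> S" using rewrite(5,6) by (induction v) (auto simp: act)
  then show ?case using rel[of r t] rewrite by simp
qed auto

lemma foldr_closed:
  assumes "\<And>x s. x \<in> A \<Longrightarrow> s \<in> S \<Longrightarrow> act x s \<in> S" "w \<in> lists A" "s \<in> S"
  shows "foldr act w s \<in> S"
  using assms(2) by (induction w) (auto simp: assms)

lemma word_quotient_action:
  assumes act: "\<And>x s. x \<in> A \<Longrightarrow> s \<in> S \<Longrightarrow> act x s \<in> S"
    and rel: "\<And>r t s. (r, t) \<in> R \<Longrightarrow> r \<in> lists A \<Longrightarrow> t \<in> lists A \<Longrightarrow> s \<in> S \<Longrightarrow> foldr act r s = foldr act t s"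
  shows "\<exists>\<Phi>. (\<forall>w\<in>lists A. \<forall>s\<in>S. \<Phi> (wcls A R w) s = foldr act w s) \<and>
    (\<forall>p\<in>carrier (word_quotient A R). \<forall>s\<in>S. \<Phi> p s \<in> S) \<and>
    (\<forall>s\<in>S. \<Phi> \<one>\<^bsub>word_quotient A R\<^esub> s = s) \<and>
    (\<forall>p\<in>carrier (word_quotient A R). \<forall>q\<in>carrier (word_quotient A R). \<forall>s\<in>S.
       \<Phi> (p \<otimes>\<^bsub>word_quotient A R\<^esub> q) s = \<Phi> p (\<Phi> q s))"
proof -
  define \<Phi> where "\<Phi> X = foldr act (SOME w. w \<in> lists A \<and> X = wcls A R w)" for X
  have \<Phi>: "\<Phi> (wcls A R w) s = foldr act w s" if w: "w \<in> lists A" "s \<in> S" for w s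
  proof -
    define w' where "w' = (SOME w'. w' \<in> lists A \<and> wcls A R w = wcls A R w')"
    have "w' \<in> lists A \<and> wcls A R w = wcls A R w'"
      unfolding w'_def by (rule someI[where x=w]) (use w in auto)
    then have "(w, w') \<in> word_cong A R" using w wcls_eq_iff by metis
    then show ?thesis using word_cong_action[of A S act R w w' s] act rel w by (simp add: \<Phi>_def w'_def)
  qed
  note c = foldr_closed[OF act]
  show ?thesis
    by (rule exI[of _ \<Phi>]) (auto simp: carrier_word_quotient one_word_quotient wcls_mult \<Phi> c)
qed

lemma mutually_inverse_homs_iso:
  assumes "h \<in> hom G H" "k \<in> hom H G"
    and "\<And>x. x \<in> carrier G \<Longrightarrow> k (h x) = x" "\<And>y. y \<in> carrier H \<Longrightarrow> h (k y) = y"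
  shows "G \<cong> H"
proof -
  have "bij_betw h (carrier G) (carrier H)"
    by (rule bij_betw_byWitness[where f'=k]) (use assms in \<open>auto simp: hom_def\<close>)
  then show ?thesis using assms(1) by (auto simp: is_iso_def iso_def)
qed

section \<open>Presented groups\<close>

definition pres_rels :: "'x set \<Rightarrow> (('x \<times> bool) list \<times> ('x \<times> bool) list) set \<Rightarrow> (('x \<times> bool) list \<times> ('x \<times> bool) list) set" where
  "pres_rels X R = R \<union> {([(x, b), (x, \<not> b)], []) | x b. x \<in> X}"

definition pcls :: "'x set \<Rightarrow> (('x \<times> bool) list \<times> ('x \<times> bool) list) set \<Rightarrow> ('x \<times> bool) list \<Rightarrow> ('x \<times> bool) list set" where
  "pcls X R w = wcls (X \<times> UNIV) (pres_rels X R) w"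

abbreviation pgen :: "'x set \<Rightarrow> (('x \<times> bool) list \<times> ('x \<times> bool) list) set \<Rightarrow> 'x \<Rightarrow> ('x \<times> bool) list set" where
  "pgen X R x \<equiv> pcls X R [(x, True)]"

lemma presented_group_alt: "presented_group X R = word_quotient (X \<times> UNIV) (pres_rels X R)"
  by (simp add: presented_group_def pres_rels_def)

lemma pcls_cancel: "x \<in> X \<Longrightarrow> pcls X R [(x, b), (x, \<not> b)] = pcls X R []"
  unfolding pcls_def by (rule wcls_rel) (auto simp: pres_rels_def)

lemma group_presented: "group (presented_group X R)"
  unfolding presented_group_alt
proof (rule group_word_quotient)
  fix y assume "y \<in> X \<times> (UNIV :: bool set)"
  then obtain x b where y: "y = (x, b)" "x \<in> X" by auto
  show "\<exists>z\<in>lists (X \<times> UNIV). wcls (X \<times> UNIV) (pres_rels X R) (y # z) = wcls (X \<times> UNIV) (pres_rels X R) [] \<and>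
      wcls (X \<times> UNIV) (pres_rels X R) (z @ [y]) = wcls (X \<times> UNIV) (pres_rels X R) []"
    using pcls_cancel[OF y(2), of R b] pcls_cancel[OF y(2), of R "\<not> b"] y
    by (intro bexI[of _ "[(x, \<not> b)]"]) (auto simp: pcls_def)
qed

lemma pcls_closed [simp]: "w \<in> lists (X \<times> UNIV) \<Longrightarrow> pcls X R w \<in> carrier (presented_group X R)"
  by (simp add: presented_group_alt pcls_def)

lemma pcls_mult:
  "u \<in> lists (X \<times> UNIV) \<Longrightarrow> v \<in> lists (X \<times> UNIV) \<Longrightarrow>
    pcls X R u \<otimes>\<^bsub>presented_group X R\<^esub> pcls X R v = pcls X R (u @ v)"
  by (simp add: presented_group_alt pcls_def wcls_mult)

lemma pgen_closed [simp]: "x \<in> X \<Longrightarrow> pgen X R x \<in> carrier (presented_group X R)"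
  by simp

lemma pgen_inv: assumes "x \<in> X" shows "inv\<^bsub>presented_group X R\<^esub> pgen X R x = pcls X R [(x, False)]"
proof -
  interpret group "presented_group X R" by (rule group_presented)
  have "pcls X R [(x, False)] \<otimes>\<^bsub>presented_group X R\<^esub> pgen X R x = \<one>\<^bsub>presented_group X R\<^esub>"
    using assms pcls_cancel[OF assms, of R False]
    by (simp add: presented_group_alt one_word_quotient wcls_mult pcls_def)
  then show ?thesis using inv_equality assms by simp
qed

lemma presented_group_induct [consumes 1, case_names one gen inv]:
  assumes "p \<in> carrier (presented_group X R)" "Q \<one>\<^bsub>presented_group X R\<^esub>"
    and "\<And>x p. x \<in> X \<Longrightarrow> p \<in> carrier (presented_group X R) \<Longrightarrow> Q p \<Longrightarrow> Q (pgen X R x \<otimes>\<^bsub>presented_group X R\<^esub> p)"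
    and "\<And>x p. x \<in> X \<Longrightarrow> p \<in> carrier (presented_group X R) \<Longrightarrow> Q p \<Longrightarrow>
       Q (inv\<^bsub>presented_group X R\<^esub> pgen X R x \<otimes>\<^bsub>presented_group X R\<^esub> p)"
  shows "Q p"
  using assms(1) unfolding presented_group_alt
proof (induction rule: word_quotient_induct)
  case one
  then show ?case using assms(2) by (simp add: presented_group_alt)
next
  case (letter y p)
  then obtain x b where "y = (x, b)" "x \<in> X" by auto
  then show ?case using letter assms(3,4)[of x p] pgen_inv[of x X R]
    by (cases b) (auto simp: presented_group_alt pcls_def)
qed

lemma presented_group_hom_eq:
  assumes H: "group H" and h: "h \<in> hom (presented_group X R) H" and h': "h' \<in> hom (presented_group X R) H"
    and eq: "\<And>x. x \<in> X \<Longrightarrow> h (pgen X R x) = h' (pgen X R x)"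
    and "p \<in> carrier (presented_group X R)"
  shows "h p = h' p"
proof -
  interpret h: group_hom "presented_group X R" H h
    using H h group_presented by (auto simp: group_hom_def group_hom_axioms_def)
  interpret h': group_hom "presented_group X R" H h'
    using H h' group_presented by (auto simp: group_hom_def group_hom_axioms_def)
  show ?thesis using assms(5)
    by (induction rule: presented_group_induct) (simp_all add: eq)
qed

definition letter_val :: "('h, 'm) monoid_scheme \<Rightarrow> ('x \<Rightarrow> 'h) \<Rightarrow> 'x \<times> bool \<Rightarrow> 'h" where
  "letter_val H f = (\<lambda>(x, b). if b then f x else inv\<^bsub>H\<^esub> f x)"

lemma letter_val_simps [simp]:
  "letter_val H f (x, True) = f x" "letter_val H f (x, False) = inv\<^bsub>H\<^esub> f x"
  by (simp_all add: letter_val_def)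

text \<open>Von Dyck's theorem. The relations that \<open>pres_rels\<close> adds hold in any group,
  because \<open>letter_val\<close> sends \<open>(x, False)\<close> to the inverse of the value of
  \<open>(x, True)\<close>.\<close>

lemma presented_group_lift:
  assumes "group H" and f: "f \<in> X \<rightarrow> carrier H"
    and rel: "\<And>r s. (r, s) \<in> R \<Longrightarrow> r \<in> lists (X \<times> UNIV) \<Longrightarrow> s \<in> lists (X \<times> UNIV) \<Longrightarrow>
      word_eval H (letter_val H f) r = word_eval H (letter_val H f) s"
  shows "\<exists>h\<in>hom (presented_group X R) H. \<forall>x\<in>X. h (pgen X R x) = f x"
proof -
  interpret group H by fact
  have v: "letter_val H f \<in> X \<times> UNIV \<rightarrow> carrier H" using f by (auto simp: letter_val_def Pi_iff)
  have "\<exists>h\<in>hom (presented_group X R) H. \<forall>w\<in>lists (X \<times> UNIV). h (pcls X R w) = word_eval H (letter_val H f) w"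
    unfolding presented_group_alt pcls_def
  proof (rule word_quotient_lift[OF v])
    fix r s assume "(r, s) \<in> pres_rels X R" and l: "r \<in> lists (X \<times> UNIV)" "s \<in> lists (X \<times> UNIV)"
    then consider "(r, s) \<in> R" | x b where "x \<in> X" "r = [(x, b), (x, \<not> b)]" "s = []"
      by (auto simp: pres_rels_def)
    then show "word_eval H (letter_val H f) r = word_eval H (letter_val H f) s"
    proof cases
      case (2 x b)
      then have "f x \<in> carrier H" using f by auto
      then show ?thesis using 2 by (cases b) auto
    qed (use rel l in auto)
  qed
  then obtain h where h: "h \<in> hom (presented_group X R) H"
    "\<And>w. w \<in> lists (X \<times> UNIV) \<Longrightarrow> h (pcls X R w) = word_eval H (letter_val H f) w" by auto
  have "h (pgen X R x) = f x" if "x \<in> X" for x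
    using f that by (subst h(2)) (auto simp: Pi_iff)
  then show ?thesis using h(1) by blast
qed

lemma pcls_eval:
  assumes "w \<in> lists (X \<times> UNIV)"
  shows "pcls X R w = word_eval (presented_group X R) (letter_val (presented_group X R) (pgen X R)) w"
  using assms
proof (induction w)
  case Nil
  then show ?case by (simp add: presented_group_alt one_word_quotient pcls_def)
next
  case (Cons y w)
  then obtain x b where y: "y = (x, b)" "x \<in> X" by auto
  have "pcls X R (y # w) = pcls X R [y] \<otimes>\<^bsub>presented_group X R\<^esub> pcls X R w"
    using Cons.hyps pcls_mult[of "[y]" X w R] by simp
  moreover have "pcls X R [y] = letter_val (presented_group X R) (pgen X R) y"
    using y pgen_inv[of x X R] by (cases b) auto
  ultimately show ?case using Cons by simp
qed

lemma presented_group_rel: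
  assumes "(r, s) \<in> R" "r \<in> lists (X \<times> UNIV)" "s \<in> lists (X \<times> UNIV)"
  shows "word_eval (presented_group X R) (letter_val (presented_group X R) (pgen X R)) r =
    word_eval (presented_group X R) (letter_val (presented_group X R) (pgen X R)) s"
proof -
  have "pcls X R r = pcls X R s" unfolding pcls_def by (rule wcls_rel) (use assms in \<open>auto simp: pres_rels_def\<close>)
  then show ?thesis using assms by (simp add: pcls_eval)
qed

section \<open>Free products\<close>

definition fp_alph :: "'i set \<Rightarrow> ('i \<Rightarrow> ('g, 'm) monoid_scheme) \<Rightarrow> ('i \<times> 'g) set" where
  "fp_alph I K = (SIGMA i:I. carrier (K i))"

definition fp_rels :: "'i set \<Rightarrow> ('i \<Rightarrow> ('g, 'm) monoid_scheme) \<Rightarrow> (('i \<times> 'g) list \<times> ('i \<times> 'g) list) set" where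
  "fp_rels I K = {([(i, \<one>\<^bsub>K i\<^esub>)], []) | i. i \<in> I} \<union>
      {([(i, g), (i, h)], [(i, g \<otimes>\<^bsub>K i\<^esub> h)]) | i g h.
         i \<in> I \<and> g \<in> carrier (K i) \<and> h \<in> carrier (K i)}"

definition fcls :: "'i set \<Rightarrow> ('i \<Rightarrow> ('g, 'm) monoid_scheme) \<Rightarrow> ('i \<times> 'g) list \<Rightarrow> ('i \<times> 'g) list set" where
  "fcls I K w = wcls (fp_alph I K) (fp_rels I K) w"

lemma free_product_alt: "free_product I K = word_quotient (fp_alph I K) (fp_rels I K)"
  by (simp add: free_product_def fp_alph_def fp_rels_def)

lemma mem_fp_alph [simp]: "(i, g) \<in> fp_alph I K \<longleftrightarrow> i \<in> I \<and> g \<in> carrier (K i)"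
  by (auto simp: fp_alph_def)

text \<open>Left multiplication of a reduced word by one letter, with the cancellation carried out.
  This is van der Waerden's action, which proves the normal form theorem. A trivial letter has to
  act as the identity, hence the separate branches for trivial \<open>g\<close>.\<close>

fun fp_act :: "('i \<Rightarrow> ('g, 'm) monoid_scheme) \<Rightarrow> 'i \<times> 'g \<Rightarrow> ('i \<times> 'g) list \<Rightarrow> ('i \<times> 'g) list" where
  "fp_act K (i, g) [] = (if g = \<one>\<^bsub>K i\<^esub> then [] else [(i, g)])"
| "fp_act K (i, g) ((j, h) # w) =
     (if j = i then (if g \<otimes>\<^bsub>K i\<^esub> h = \<one>\<^bsub>K i\<^esub> then w else (i, g \<otimes>\<^bsub>K i\<^esub> h) # w)
      else if g = \<one>\<^bsub>K i\<^esub> then (j, h) # w else (i, g) # (j, h) # w)"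

locale free_prod =
  fixes I :: "'i set" and K :: "'i \<Rightarrow> ('g, 'm) monoid_scheme"
  assumes factor_group: "\<And>i. i \<in> I \<Longrightarrow> group (K i)"
begin

abbreviation FP where "FP \<equiv> free_product I K"
abbreviation fc where "fc \<equiv> fcls I K"
abbreviation alph where "alph \<equiv> fp_alph I K"

lemma fcls_closed [simp]: "w \<in> lists alph \<Longrightarrow> fc w \<in> carrier FP"
  by (simp add: free_product_alt fcls_def)

lemma fcls_mult: "u \<in> lists alph \<Longrightarrow> v \<in> lists alph \<Longrightarrow> fc u \<otimes>\<^bsub>FP\<^esub> fc v = fc (u @ v)"
  by (simp add: free_product_alt fcls_def wcls_mult)

lemma one_free_product: "\<one>\<^bsub>FP\<^esub> = fc []"
  by (simp add: free_product_alt fcls_def one_word_quotient)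

lemma fgen_mult:
  assumes "i \<in> I" "g \<in> carrier (K i)" "h \<in> carrier (K i)"
  shows "fc [(i, g), (i, h)] = fc [(i, g \<otimes>\<^bsub>K i\<^esub> h)]"
proof -
  interpret group "K i" using assms factor_group by auto
  show ?thesis unfolding fcls_def by (rule wcls_rel) (use assms in \<open>auto simp: fp_rels_def\<close>)
qed

lemma fgen_one: assumes "i \<in> I" shows "fc [(i, \<one>\<^bsub>K i\<^esub>)] = fc []"
proof -
  interpret group "K i" using assms factor_group by auto
  show ?thesis unfolding fcls_def by (rule wcls_rel) (use assms in \<open>auto simp: fp_rels_def\<close>)
qed

lemma group_FP: "group FP"
  unfolding free_product_alt
proof (rule group_word_quotient)
  fix y assume "y \<in> alph"
  then obtain i g where y: "y = (i, g)" "i \<in> I" "g \<in> carrier (K i)" by (cases y) auto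
  interpret group "K i" using y factor_group by auto
  show "\<exists>z\<in>lists alph. wcls alph (fp_rels I K) (y # z) = wcls alph (fp_rels I K) [] \<and>
      wcls alph (fp_rels I K) (z @ [y]) = wcls alph (fp_rels I K) []"
    using y fgen_mult[of i g "inv\<^bsub>K i\<^esub> g"] fgen_mult[of i "inv\<^bsub>K i\<^esub> g" g] fgen_one[of i]
    by (intro bexI[of _ "[(i, inv\<^bsub>K i\<^esub> g)]"]) (auto simp: fcls_def)
qed

lemma fgen_hom: "i \<in> I \<Longrightarrow> (\<lambda>g. fc [(i, g)]) \<in> hom (K i) FP"
  by (rule homI) (auto simp: fcls_mult fgen_mult)

lemma free_product_induct [consumes 1, case_names one letter]:
  assumes "p \<in> carrier FP" "Q \<one>\<^bsub>FP\<^esub>"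
    and "\<And>i g p. i \<in> I \<Longrightarrow> g \<in> carrier (K i) \<Longrightarrow> p \<in> carrier FP \<Longrightarrow> Q p \<Longrightarrow> Q (fc [(i, g)] \<otimes>\<^bsub>FP\<^esub> p)"
  shows "Q p"
  using assms(1) unfolding free_product_alt
proof (induction rule: word_quotient_induct)
  case one
  then show ?case using assms(2) by (simp add: free_product_alt)
next
  case (letter y p)
  then show ?case using assms(3)[of "fst y" "snd y" p]
    by (cases y) (auto simp: free_product_alt fcls_def)
qed

lemma free_product_lift:
  assumes "group H" and f: "\<And>i. i \<in> I \<Longrightarrow> f i \<in> hom (K i) H"
  obtains h where "h \<in> hom FP H" "\<And>i g. i \<in> I \<Longrightarrow> g \<in> carrier (K i) \<Longrightarrow> h (fc [(i, g)]) = f i g"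
proof -
  interpret H: group H by fact
  have cl: "f i g \<in> carrier H" if "i \<in> I" "g \<in> carrier (K i)" for i g
    using f that by (auto simp: hom_def)
  have "\<exists>h\<in>hom FP H. \<forall>w\<in>lists alph. h (fc w) = word_eval H (\<lambda>(i, g). f i g) w"
    unfolding free_product_alt fcls_def
  proof (rule H.word_quotient_lift)
    show "(\<lambda>(i, g). f i g) \<in> alph \<rightarrow> carrier H" using cl by auto
    fix r s assume "(r, s) \<in> fp_rels I K" "r \<in> lists alph" "s \<in> lists alph"
    then consider i where "i \<in> I" "r = [(i, \<one>\<^bsub>K i\<^esub>)]" "s = []" |
      i g h where "i \<in> I" "g \<in> carrier (K i)" "h \<in> carrier (K i)" "r = [(i, g), (i, h)]" "s = [(i, g \<otimes>\<^bsub>K i\<^esub> h)]"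
      by (auto simp: fp_rels_def)
    then show "word_eval H (\<lambda>(i, g). f i g) r = word_eval H (\<lambda>(i, g). f i g) s"
    proof cases
      case (1 i)
      then show ?thesis using hom_one[OF f factor_group \<open>group H\<close>, of i] by simp
    next
      case (2 i g h)
      then show ?thesis using hom_mult[OF f, of i g h] cl by simp
    qed
  qed
  then obtain h where h: "h \<in> hom FP H" "\<And>w. w \<in> lists alph \<Longrightarrow> h (fc w) = word_eval H (\<lambda>(i, g). f i g) w"
    by auto
  show ?thesis by (rule that[OF h(1)]) (use h(2) cl in auto)
qed

section \<open>Reduced words and the normal form theorem\<close>

definition red :: "('i \<times> 'g) list \<Rightarrow> bool" where
  "red w \<longleftrightarrow> w \<in> lists alph \<and> (\<forall>x\<in>set w. snd x \<noteq> \<one>\<^bsub>K (fst x)\<^esub>) \<and> successively (\<lambda>x y. fst x \<noteq> fst y) w"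

lemma red_Nil [simp]: "red []" by (simp add: red_def)

lemma red_Cons: "red ((i, g) # w) \<longleftrightarrow> i \<in> I \<and> g \<in> carrier (K i) \<and> g \<noteq> \<one>\<^bsub>K i\<^esub> \<and> red w \<and> (w = [] \<or> fst (hd w) \<noteq> i)"
  by (auto simp: red_def successively_Cons)

lemma red_append: "red (u @ v) \<longleftrightarrow> red u \<and> red v \<and> (u = [] \<or> v = [] \<or> fst (last u) \<noteq> fst (hd v))"
  by (auto simp: red_def successively_append_iff)

lemma red_lists: "red w \<Longrightarrow> w \<in> lists alph" by (simp add: red_def)

lemma fp_act_red: assumes "red w" "x \<in> alph" shows "red (fp_act K x w)"
proof -
  obtain i g where x: "x = (i, g)" "i \<in> I" "g \<in> carrier (K i)" using assms by (cases x) auto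
  interpret group "K i" using x factor_group by auto
  show ?thesis using assms(1) x by (cases "(K, x, w)" rule: fp_act.cases) (auto simp: red_Cons)
qed

lemma fp_act_mult:
  assumes "red w" "i \<in> I" "g \<in> carrier (K i)" "h \<in> carrier (K i)"
  shows "fp_act K (i, g) (fp_act K (i, h) w) = fp_act K (i, g \<otimes>\<^bsub>K i\<^esub> h) w"
proof -
  interpret group "K i" using assms factor_group by auto
  show ?thesis
  proof (cases w)
    case Nil
    then show ?thesis using assms by auto
  next
    case (Cons y w')
    obtain j k where y: "y = (j, k)" by (cases y)
    show ?thesis
    proof (cases "j = i")
      case True
      then have k: "k \<in> carrier (K i)" "w' = [] \<or> fst (hd w') \<noteq> i" using assms(1) Cons y by (auto simp: red_Cons)
      show ?thesis
      proof (cases "h \<otimes>\<^bsub>K i\<^esub> k = \<one>\<^bsub>K i\<^esub>")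
        case hk: True
        then have "g \<otimes>\<^bsub>K i\<^esub> h \<otimes>\<^bsub>K i\<^esub> k = g" using assms k by (simp add: m_assoc)
        \<comment> \<open>When h has cancelled the first letter, the next letter lies in another
          factor, so the action of g does not merge with it.\<close>
        then show ?thesis using Cons y True k(2) hk by (cases w') auto
      next
        case hk: False
        then show ?thesis using Cons y True assms k by (auto simp: m_assoc)
      qed
    qed (use Cons y assms in auto)
  qed
qed

lemma fc_act: assumes "w \<in> lists alph" "x \<in> alph" shows "fc (fp_act K x w) = fc (x # w)"
proof -
  obtain i g where x: "x = (i, g)" "i \<in> I" "g \<in> carrier (K i)" using assms by (cases x) auto
  interpret group "K i" using x factor_group by auto
  interpret FP: group FP by (rule group_FP)
  have 1: "fc ((i, g) # u) = fc [(i, g)] \<otimes>\<^bsub>FP\<^esub> fc u" if "u \<in> lists alph" "i \<in> I" "g \<in> carrier (K i)" for i g u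
    using that by (simp add: fcls_mult)
  show ?thesis
  proof (cases w)
    case Nil
    then show ?thesis using x fgen_one[of i] by auto
  next
    case (Cons y w')
    obtain j h where y: "y = (j, h)" by (cases y)
    have jh: "j \<in> I" "h \<in> carrier (K j)" "w' \<in> lists alph" using assms Cons y by auto
    have 2: "fc ((i, \<one>\<^bsub>K i\<^esub>) # u) = fc u" if "u \<in> lists alph" for u
      using 1[OF that x(2), of "\<one>\<^bsub>K i\<^esub>"] x fgen_one[of i] that by (simp add: one_free_product[symmetric])
    have 3: "fc ((i, g) # (i, h) # w') = fc ((i, g \<otimes>\<^bsub>K i\<^esub> h) # w')" if "j = i"
      using fgen_mult[of i g h] fcls_mult[of "[(i, g), (i, h)]" w'] fcls_mult[of "[(i, g \<otimes>\<^bsub>K i\<^esub> h)]" w'] that jh x by simp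
    show ?thesis using Cons y x jh 2 3 by auto
  qed
qed

lemma fp_act_foldr_red: "red w \<Longrightarrow> foldr (fp_act K) w [] = w"
proof (induction w)
  case (Cons x w)
  obtain i g where x: "x = (i, g)" by (cases x)
  show ?case using Cons x by (cases w) (auto simp: red_Cons)
qed simp

text \<open>The class of a word determines its action on reduced words, and a reduced word is what
  its own letters make of the empty word.\<close>

lemma red_unique:
  assumes "red w" "red w'" "fc w = fc w'"
  shows "w = w'"
proof -
  have "(w, w') \<in> word_cong alph (fp_rels I K)"
    using assms wcls_eq_iff[of w alph w' "fp_rels I K"] by (simp add: fcls_def red_lists)
  then have "foldr (fp_act K) w [] = foldr (fp_act K) w' []"
  proof (rule word_cong_action[where S = "{w. red w}", rotated 2])
    fix r t s assume "(r, t) \<in> fp_rels I K" "s \<in> {w. red w}"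
    then consider i where "i \<in> I" "r = [(i, \<one>\<^bsub>K i\<^esub>)]" "t = []" |
      i g h where "i \<in> I" "g \<in> carrier (K i)" "h \<in> carrier (K i)" "r = [(i, g), (i, h)]" "t = [(i, g \<otimes>\<^bsub>K i\<^esub> h)]"
      by (auto simp: fp_rels_def)
    then show "foldr (fp_act K) r s = foldr (fp_act K) t s"
    proof cases
      case (1 i)
      interpret group "K i" using 1 factor_group by auto
      show ?thesis using 1 \<open>s \<in> _\<close> by (cases "(K, (i, \<one>\<^bsub>K i\<^esub>), s)" rule: fp_act.cases) (auto simp: red_Cons)
    qed (use fp_act_mult \<open>s \<in> _\<close> in auto)
  qed (auto intro: fp_act_red)
  then show ?thesis using assms fp_act_foldr_red by simp
qed

lemma red_exists: assumes "p \<in> carrier FP" obtains w where "red w" "p = fc w"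
proof -
  have "\<exists>w. red w \<and> p = fc w" using assms
  proof (induction rule: free_product_induct)
    case one
    then show ?case by (auto simp: one_free_product intro!: exI[of _ "[]"])
  next
    case (letter i g p)
    then obtain w where "red w" "p = fc w" by auto
    then show ?case using letter
      by (intro exI[of _ "fp_act K (i, g) w"]) (auto simp: fp_act_red fc_act red_lists fcls_mult)
  qed
  then show ?thesis using that by blast
qed

section \<open>Powers, centre and elements of infinite order in free products\<close>

lemma fcls_pow: "w \<in> lists alph \<Longrightarrow> fc w [^]\<^bsub>FP\<^esub> (k::nat) = fc (concat (replicate k w))"
proof (induction k)
  case 0
  interpret group FP by (rule group_FP)
  show ?case by (simp add: one_free_product)
next
  case (Suc k)
  interpret group FP by (rule group_FP)
  have "concat (replicate k w) \<in> lists alph" using Suc.prems by (induction k) auto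
  then show ?case using Suc nat_pow_Suc2[of "fc w" k] by (simp add: fcls_mult)
qed

lemma hd_concat_replicate: "w \<noteq> [] \<Longrightarrow> k > 0 \<Longrightarrow> hd (concat (replicate k w)) = hd w"
  by (cases k) auto

lemma last_concat_replicate: "w \<noteq> [] \<Longrightarrow> k > 0 \<Longrightarrow> last (concat (replicate k w)) = last w"
proof (induction k)
  case (Suc k)
  then show ?case by (cases "k = 0") (auto simp: last_append)
qed simp

lemma red_power:
  assumes "red w" "fst (last w) \<noteq> fst (hd w)"
  shows "red (concat (replicate k w))"
proof (induction k)
  case (Suc k)
  then show ?case using assms hd_concat_replicate[of w k]
    by (cases "w = []"; cases "k = 0") (auto simp: red_append)
qed simp

text \<open>A central reduced word w commutes with every letter. If w begins and ends in the same
  factor, a letter l of another factor can be attached on either side without cancellation, and w l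
  = l w forces w to begin with l. Otherwise the first letter of w is used: appending it makes w
  longer, while multiplying by it on the left merges it with the head and does not.\<close>

lemma center_trivial:
  assumes ij: "i \<in> I" "j \<in> I" "i \<noteq> j"
    and x: "x \<in> carrier (K i)" "x \<noteq> \<one>\<^bsub>K i\<^esub>" and y: "y \<in> carrier (K j)" "y \<noteq> \<one>\<^bsub>K j\<^esub>"
    and z: "z \<in> carrier FP" "\<And>g. g \<in> carrier FP \<Longrightarrow> z \<otimes>\<^bsub>FP\<^esub> g = g \<otimes>\<^bsub>FP\<^esub> z"
  shows "z = \<one>\<^bsub>FP\<^esub>"
proof (rule ccontr)
  assume nz: "z \<noteq> \<one>\<^bsub>FP\<^esub>"
  obtain w where w: "red w" "z = fc w" using red_exists z(1) by blast
  have ne: "w \<noteq> []" using nz w by (auto simp: one_free_product)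
  have comm: "fc (w @ [l]) = fc (l # w)" if "l \<in> alph" for l
    using z(2)[of "fc [l]"] that w red_lists[OF w(1)] by (simp add: fcls_mult)
  show False
  proof (cases "fst (last w) = fst (hd w)")
    case True
    obtain l where l: "l \<in> alph" "snd l \<noteq> \<one>\<^bsub>K (fst l)\<^esub>" "fst l \<noteq> fst (hd w)"
    proof (cases "fst (hd w) = i")
      case True then show ?thesis using that[of "(j, y)"] ij y by auto
    next
      case False then show ?thesis using that[of "(i, x)"] ij x by auto
    qed
    then have "red (w @ [l])" "red (l # w)" using w True ne by (cases l, auto simp: red_append red_Cons)+
    then have "w @ [l] = l # w" using comm[OF l(1)] red_unique by auto
    then have "hd w = l" using ne by (metis hd_append2 list.sel(1))
    then show False using l by auto
  next
    case False
    obtain u g w' where w': "w = (u, g) # w'" using ne by (cases w) auto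
    have l: "(u, g) \<in> alph" "red [(u, g)]" using w w' by (auto simp: red_Cons)
    have "red (w @ [(u, g)])" unfolding red_append using w(1) False l(2) w' by simp
    moreover have "red (fp_act K (u, g) w)" using fp_act_red w l by auto
    moreover have "fc (w @ [(u, g)]) = fc (fp_act K (u, g) w)"
      using comm[OF l(1)] fc_act[OF red_lists[OF w(1)] l(1)] by simp
    ultimately have "w @ [(u, g)] = fp_act K (u, g) w" using red_unique by blast
    then have "length (w @ [(u, g)]) = length (fp_act K (u, g) w)" by simp
    then show False using w' by (auto split: if_splits)
  qed
qed

text \<open>The product of nontrivial elements of two factors is cyclically reduced, so its powers
  are reduced words of growing length.\<close>

lemma infinite_order_element:
  assumes ij: "i \<in> I" "j \<in> I" "i \<noteq> j"
    and x: "x \<in> carrier (K i)" "x \<noteq> \<one>\<^bsub>K i\<^esub>" and y: "y \<in> carrier (K j)" "y \<noteq> \<one>\<^bsub>K j\<^esub>"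
  obtains q where "q \<in> carrier FP" "\<And>k::nat. k > 0 \<Longrightarrow> q [^]\<^bsub>FP\<^esub> k \<noteq> \<one>\<^bsub>FP\<^esub>"
proof -
  define w where "w = [(i, x), (j, y)]"
  have w: "red w" "fst (last w) \<noteq> fst (hd w)" using assms by (auto simp: w_def red_Cons)
  show ?thesis
  proof (rule that[of "fc w"])
    show "fc w \<in> carrier FP" using w red_lists by auto
    fix k :: nat assume k: "k > 0"
    show "fc w [^]\<^bsub>FP\<^esub> k \<noteq> \<one>\<^bsub>FP\<^esub>"
    proof
      assume "fc w [^]\<^bsub>FP\<^esub> k = \<one>\<^bsub>FP\<^esub>"
      then have "concat (replicate k w) = []"
        using red_unique[OF red_power[OF w, of k] red_Nil] w red_lists by (simp add: fcls_pow one_free_product)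
      then show False using k by (cases k) (auto simp: w_def)
    qed
  qed
qed

definition winv :: "('i \<times> 'g) list \<Rightarrow> ('i \<times> 'g) list" where
  "winv w = rev (map (\<lambda>(i, g). (i, inv\<^bsub>K i\<^esub> g)) w)"

lemma red_winv: "red w \<Longrightarrow> red (winv w)"
proof (induction w)
  case (Cons x w)
  obtain i g where x: "x = (i, g)" by (cases x)
  have *: "i \<in> I" "g \<in> carrier (K i)" "g \<noteq> \<one>\<^bsub>K i\<^esub>" "red w" using Cons.prems x by (auto simp: red_Cons)
  interpret group "K i" using * factor_group by auto
  show ?case using Cons x *
    by (cases w) (auto simp: red_append red_Cons winv_def)
qed (simp add: winv_def)

lemma fc_winv: assumes "w \<in> lists alph" shows "fc (winv w) = inv\<^bsub>FP\<^esub> fc w" "winv w \<in> lists alph"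
proof -
  interpret FP: group FP by (rule group_FP)
  have "fc (winv w) = inv\<^bsub>FP\<^esub> fc w \<and> winv w \<in> lists alph" using assms
  proof (induction w)
    case Nil
    then show ?case by (simp add: winv_def one_free_product[symmetric])
  next
    case (Cons x w)
    obtain i g where x: "x = (i, g)" "i \<in> I" "g \<in> carrier (K i)" using Cons by (cases x) auto
    interpret group "K i" using x factor_group by auto
    have inv: "inv\<^bsub>FP\<^esub> fc [(i, g)] = fc [(i, inv\<^bsub>K i\<^esub> g)]"
      by (rule FP.inv_equality) (use x fgen_one in \<open>auto simp: fcls_mult fgen_mult one_free_product\<close>)
    have w: "w \<in> lists alph" using Cons by simp
    have "fc (x # w) = fc [x] \<otimes>\<^bsub>FP\<^esub> fc w" using x w by (simp add: fcls_mult)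
    then have "inv\<^bsub>FP\<^esub> fc (x # w) = inv\<^bsub>FP\<^esub> fc w \<otimes>\<^bsub>FP\<^esub> inv\<^bsub>FP\<^esub> fc [x]"
      using x w by (simp add: FP.inv_mult_group)
    also have "\<dots> = fc (winv w) \<otimes>\<^bsub>FP\<^esub> fc [(i, inv\<^bsub>K i\<^esub> g)]" using Cons.IH x(1) inv by simp
    also have "\<dots> = fc (winv w @ [(i, inv\<^bsub>K i\<^esub> g)])" by (rule fcls_mult) (use Cons.IH x in auto)
    finally show ?case using Cons.IH x by (simp add: winv_def)
  qed
  then show "fc (winv w) = inv\<^bsub>FP\<^esub> fc w" "winv w \<in> lists alph" by auto
qed

end

section \<open>Commensurated elements, and their absence in torsion-free free products\<close>

definition commensurated :: "('a, 'b) monoid_scheme \<Rightarrow> 'a \<Rightarrow> bool" where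
  "commensurated G v \<longleftrightarrow> (\<forall>g\<in>carrier G. \<exists>(k::int) (l::int). k \<noteq> 0 \<and> l \<noteq> 0 \<and>
     g \<otimes>\<^bsub>G\<^esub> v [^]\<^bsub>G\<^esub> k = v [^]\<^bsub>G\<^esub> l \<otimes>\<^bsub>G\<^esub> g)"

context group
begin

lemma int_pow_nonneg: "0 \<le> k \<Longrightarrow> v [^] (k::int) = v [^] nat k"
  by (metis int_pow_int nat_0_le)

lemma int_pow_nonpos: assumes "v \<in> carrier G" "k \<le> 0" shows "v [^] (k::int) = (inv v) [^] nat (-k)"
proof -
  have "v [^] k = v [^] (- int (nat (-k)))" using assms by simp
  also have "\<dots> = inv (v [^] nat (-k))" using assms by (metis int_pow_neg int_pow_int)
  also have "\<dots> = (inv v) [^] nat (-k)" by (rule nat_pow_inv[OF assms(1), symmetric])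
  finally show ?thesis .
qed

text \<open>Powers of words are concatenations of copies, so natural exponents are wanted. A
  negative k is removed by inverting both powers; a negative l becomes a power of the inverse of
  v.\<close>

lemma commensurated_nat:
  assumes "commensurated G v" "v \<in> carrier G" "g \<in> carrier G"
  obtains k l :: nat where "k > 0" "l > 0" "g \<otimes> v [^] k = v [^] l \<otimes> g \<or> g \<otimes> v [^] k = (inv v) [^] l \<otimes> g"
proof -
  obtain k l :: int where kl: "k \<noteq> 0" "l \<noteq> 0" "g \<otimes> v [^] k = v [^] l \<otimes> g"
    using assms by (auto simp: commensurated_def)
  have "\<exists>(k::int) (l::int). k > 0 \<and> l \<noteq> 0 \<and> g \<otimes> v [^] k = v [^] l \<otimes> g"
  proof (cases "k > 0")
    case False
    have "v [^] (-l) \<otimes> g = v [^] (-l) \<otimes> (g \<otimes> v [^] k) \<otimes> v [^] (-k)"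
      using assms by (simp add: m_assoc int_pow_mult[symmetric])
    also have "\<dots> = v [^] (-l) \<otimes> (v [^] l \<otimes> g) \<otimes> v [^] (-k)" by (simp add: kl)
    also have "\<dots> = (v [^] (-l) \<otimes> v [^] l) \<otimes> g \<otimes> v [^] (-k)"
      using assms by (simp add: m_assoc del: int_pow_neg)
    also have "v [^] (-l) \<otimes> v [^] l = \<one>" using assms by (simp add: int_pow_mult[symmetric] del: int_pow_neg)
    finally have "g \<otimes> v [^] (-k) = v [^] (-l) \<otimes> g" using assms by simp
    then show ?thesis using kl False by (intro exI[of _ "-k"] exI[of _ "-l"]) auto
  qed (use kl in blast)
  then obtain k l :: int where kl: "k > 0" "l \<noteq> 0" "g \<otimes> v [^] k = v [^] l \<otimes> g"
    by (elim exE conjE) (rule that)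
  have k: "v [^] k = v [^] nat k" using kl(1) by (intro int_pow_nonneg) auto
  show ?thesis
  proof (cases "l > 0")
    case True
    then have "v [^] l = v [^] nat l" by (intro int_pow_nonneg) auto
    then have "g \<otimes> v [^] nat k = v [^] nat l \<otimes> g" using kl(3) unfolding k by simp
    then show ?thesis using that[of "nat k" "nat l"] kl(1) True by simp
  next
    case False
    then have "v [^] l = (inv v) [^] nat (-l)" using kl(2) assms by (intro int_pow_nonpos) auto
    then have "g \<otimes> v [^] nat k = (inv v) [^] nat (-l) \<otimes> g" using kl(3) unfolding k by simp
    then show ?thesis using that[of "nat k" "nat (-l)"] kl(1,2) False by simp
  qed
qed

lemma conj_int_pow:
  assumes "c \<in> carrier G" "v \<in> carrier G"
  shows "(inv c \<otimes> v \<otimes> c) [^] (k::int) = inv c \<otimes> v [^] k \<otimes> c"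
proof -
  have "(\<lambda>x. inv c \<otimes> x \<otimes> c) \<in> hom G G"
  proof (rule homI)
    fix x y assume xy: "x \<in> carrier G" "y \<in> carrier G"
    have "c \<otimes> (inv c \<otimes> z) = z" if "z \<in> carrier G" for z
      using assms that by (simp add: m_assoc[symmetric])
    then show "inv c \<otimes> (x \<otimes> y) \<otimes> c = inv c \<otimes> x \<otimes> c \<otimes> (inv c \<otimes> y \<otimes> c)"
      using assms xy by (simp add: m_assoc)
  qed (use assms in auto)
  then interpret h: group_hom G G "\<lambda>x. inv c \<otimes> x \<otimes> c" by unfold_locales
  show ?thesis using h.hom_int_pow[of v k] assms by simp
qed

lemma commensurated_conj:
  assumes v: "commensurated G v" "v \<in> carrier G" and c: "c \<in> carrier G"
  shows "commensurated G (inv c \<otimes> v \<otimes> c)"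
  unfolding commensurated_def
proof
  fix g assume g: "g \<in> carrier G"
  have "c \<otimes> g \<otimes> inv c \<in> carrier G" using g c by simp
  then obtain k l :: int where kl: "k \<noteq> 0" "l \<noteq> 0" "c \<otimes> g \<otimes> inv c \<otimes> v [^] k = v [^] l \<otimes> (c \<otimes> g \<otimes> inv c)"
    using v unfolding commensurated_def by blast
  have "g \<otimes> (inv c \<otimes> v [^] k \<otimes> c) = inv c \<otimes> (c \<otimes> g \<otimes> inv c \<otimes> v [^] k) \<otimes> c"
    using g c v by (simp add: m_assoc[symmetric])
  also have "\<dots> = inv c \<otimes> (v [^] l \<otimes> (c \<otimes> g \<otimes> inv c)) \<otimes> c" by (simp only: kl)
  also have "\<dots> = inv c \<otimes> v [^] l \<otimes> c \<otimes> g" using g c v by (simp add: m_assoc)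
  finally show "\<exists>(k::int) (l::int). k \<noteq> 0 \<and> l \<noteq> 0 \<and> g \<otimes> (inv c \<otimes> v \<otimes> c) [^] k = (inv c \<otimes> v \<otimes> c) [^] l \<otimes> g"
    using kl conj_int_pow[OF c v(2)] by (intro exI[of _ k] exI[of _ l]) auto
qed

end

context free_prod
begin

text \<open>Induction on the length of w. A single letter is tested against a letter of another
  factor: the two sides would be reduced words beginning in different factors. If w is cyclically
  reduced, it is tested against its own first letter g. The word for g w^k begins with g^2 and ends
  like w. But w^l g ends in g, which lies in another factor than the last letter of w; and in w^-l g
  the final g cancels, leaving a word that begins in the factor of that last letter. If the first
  and last letters of w lie in the same factor, conjugation by the first one gives a shorter word,
  which is again commensurated.\<close>

lemma no_commensurated_word:
  assumes tf: "\<And>i g k. i \<in> I \<Longrightarrow> g \<in> carrier (K i) \<Longrightarrow> g \<noteq> \<one>\<^bsub>K i\<^esub> \<Longrightarrow> k > 0 \<Longrightarrow> g [^]\<^bsub>K i\<^esub> (k::nat) \<noteq> \<one>\<^bsub>K i\<^esub>"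
    and ij: "i \<in> I" "j \<in> I" "i \<noteq> j"
    and x: "x \<in> carrier (K i)" "x \<noteq> \<one>\<^bsub>K i\<^esub>" and y: "y \<in> carrier (K j)" "y \<noteq> \<one>\<^bsub>K j\<^esub>"
    and w: "red w" "w \<noteq> []" and com: "commensurated FP (fc w)"
  shows False
  using w com
proof (induction "length w" arbitrary: w rule: less_induct)
  case less
  interpret FP: group FP by (rule group_FP)
  define a where "a = fst (hd w)"
  obtain g w' where w': "w = (a, g) # w'" using less(3) a_def by (cases w) auto
  have a: "a \<in> I" "g \<in> carrier (K a)" "g \<noteq> \<one>\<^bsub>K a\<^esub>" "red w'" "red [(a, g)]" using less(2) w' by (auto simp: red_Cons)
  interpret Ka: group "K a" using a factor_group by auto
  have wl: "w \<in> lists alph" "fc w \<in> carrier FP" using less(2) red_lists by auto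
  have pow: "fc u [^]\<^bsub>FP\<^esub> k = fc (concat (replicate k u))" if "u \<in> lists alph" for u and k :: nat using fcls_pow that .
  have pl: "concat (replicate k u) \<in> lists alph" if "u \<in> lists alph" for u and k :: nat using that by (induction k) auto
  consider (single) "w' = []" | (cyc) "w' \<noteq> []" "fst (last w) \<noteq> a" | (conj) "w' \<noteq> []" "fst (last w) = a" by blast
  then show False
  proof cases
    case single
    obtain b h where l: "b \<in> I" "h \<in> carrier (K b)" "h \<noteq> \<one>\<^bsub>K b\<^esub>" "b \<noteq> a"
      using ij x y by metis
    obtain k l :: nat where kl: "k > 0" "l > 0"
      "fc [(b, h)] \<otimes>\<^bsub>FP\<^esub> fc w [^]\<^bsub>FP\<^esub> k = fc w [^]\<^bsub>FP\<^esub> l \<otimes>\<^bsub>FP\<^esub> fc [(b, h)] \<or>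
       fc [(b, h)] \<otimes>\<^bsub>FP\<^esub> fc w [^]\<^bsub>FP\<^esub> k = (inv\<^bsub>FP\<^esub> fc w) [^]\<^bsub>FP\<^esub> l \<otimes>\<^bsub>FP\<^esub> fc [(b, h)]"
      using FP.commensurated_nat[OF less(4) wl(2), of "fc [(b, h)]"] l by auto
    have gp: "fc [(a, u)] [^]\<^bsub>FP\<^esub> n = fc [(a, u [^]\<^bsub>K a\<^esub> n)]" if "u \<in> carrier (K a)" for u and n :: nat
    proof -
      interpret h: group_hom "K a" FP "\<lambda>g. fc [(a, g)]"
        using fgen_hom[OF a(1)] by unfold_locales
      show ?thesis using h.hom_nat_pow[OF that] by simp
    qed
    have inv: "inv\<^bsub>FP\<^esub> fc w = fc [(a, inv\<^bsub>K a\<^esub> g)]" using fc_winv(1)[OF wl(1)] w' single by (simp add: winv_def)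
    have "\<exists>u. u \<in> carrier (K a) \<and> u \<noteq> \<one>\<^bsub>K a\<^esub> \<and> fc [(b, h)] \<otimes>\<^bsub>FP\<^esub> fc [(a, g [^]\<^bsub>K a\<^esub> k)] = fc [(a, u)] \<otimes>\<^bsub>FP\<^esub> fc [(b, h)]"
      using kl(3)
    proof
      assume "fc [(b, h)] \<otimes>\<^bsub>FP\<^esub> fc w [^]\<^bsub>FP\<^esub> k = fc w [^]\<^bsub>FP\<^esub> l \<otimes>\<^bsub>FP\<^esub> fc [(b, h)]"
      then show ?thesis using tf[OF a(1-3) kl(2)] a gp[OF a(2)] w' single
        by (intro exI[of _ "g [^]\<^bsub>K a\<^esub> l"]) auto
    next
      assume *: "fc [(b, h)] \<otimes>\<^bsub>FP\<^esub> fc w [^]\<^bsub>FP\<^esub> k = (inv\<^bsub>FP\<^esub> fc w) [^]\<^bsub>FP\<^esub> l \<otimes>\<^bsub>FP\<^esub> fc [(b, h)]"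
      have "inv\<^bsub>K a\<^esub> g \<noteq> \<one>\<^bsub>K a\<^esub>" using a by simp
      then show ?thesis using * tf[OF a(1) _ _ kl(2), of "inv\<^bsub>K a\<^esub> g"] a gp w' single inv
        by (intro exI[of _ "(inv\<^bsub>K a\<^esub> g) [^]\<^bsub>K a\<^esub> l"]) auto
    qed
    then obtain u where u: "u \<in> carrier (K a)" "u \<noteq> \<one>\<^bsub>K a\<^esub>" "fc [(b, h), (a, g [^]\<^bsub>K a\<^esub> k)] = fc [(a, u), (b, h)]"
      using l a by (auto simp: fcls_mult)
    then have "[(b, h), (a, g [^]\<^bsub>K a\<^esub> k)] = [(a, u), (b, h)]"
      using red_unique[OF _ _ u(3)] u l a tf[OF a(1-3) kl(1)] by (auto simp: red_Cons)
    then show False using l by auto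
  next
    case cyc
    have lw: "last w = last w'" using w' cyc by simp
    have cyc2: "fst (last w) \<noteq> fst (hd w)" using cyc a_def by simp
    obtain k l :: nat where kl: "k > 0" "l > 0"
      "fc [(a, g)] \<otimes>\<^bsub>FP\<^esub> fc w [^]\<^bsub>FP\<^esub> k = fc w [^]\<^bsub>FP\<^esub> l \<otimes>\<^bsub>FP\<^esub> fc [(a, g)] \<or>
       fc [(a, g)] \<otimes>\<^bsub>FP\<^esub> fc w [^]\<^bsub>FP\<^esub> k = (inv\<^bsub>FP\<^esub> fc w) [^]\<^bsub>FP\<^esub> l \<otimes>\<^bsub>FP\<^esub> fc [(a, g)]"
      using FP.commensurated_nat[OF less(4) wl(2), of "fc [(a, g)]"] a by auto
    define W where "W = concat (replicate k w)"
    have redW: "red W" unfolding W_def by (rule red_power[OF less(2) cyc2])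
    have hdW: "hd W = (a, g)" "W \<noteq> []" "last W = last w"
      using hd_concat_replicate[of w k] last_concat_replicate[of w k] less(3) kl w' by (auto simp: W_def)
    obtain W' where W': "W = (a, g) # W'" using hdW by (cases W) auto
    have "W' \<noteq> []" using hdW(3) W' cyc(2) by (metis fst_conv last.simps)
    define V where "V = (a, g \<otimes>\<^bsub>K a\<^esub> g) # W'"
    \<comment> \<open>The letter g merges with the head of \<open>W\<close>; the result is still a
      letter because \<open>tf\<close> makes g^2 nontrivial.\<close>
    have "g [^]\<^bsub>K a\<^esub> (2::nat) \<noteq> \<one>\<^bsub>K a\<^esub>" by (rule tf) (use a in auto)
    then have "g \<otimes>\<^bsub>K a\<^esub> g \<noteq> \<one>\<^bsub>K a\<^esub>" using a by (simp add: numeral_2_eq_2)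
    then have V: "red V" "hd V = (a, g \<otimes>\<^bsub>K a\<^esub> g)" "last V = last w" "fc ((a, g) # W) = fc V"
      using redW W' a fc_act[OF red_lists[OF redW], of "(a, g)"] hdW(3) \<open>W' \<noteq> []\<close>
      by (auto simp: V_def red_Cons)
    have lhs: "fc [(a, g)] \<otimes>\<^bsub>FP\<^esub> fc w [^]\<^bsub>FP\<^esub> k = fc V"
      using V(4) pow[OF wl(1), of k] a red_lists[OF redW] by (simp add: fcls_mult W_def)
    show False using kl(3)
    proof
      assume "fc [(a, g)] \<otimes>\<^bsub>FP\<^esub> fc w [^]\<^bsub>FP\<^esub> k = fc w [^]\<^bsub>FP\<^esub> l \<otimes>\<^bsub>FP\<^esub> fc [(a, g)]"
      then have "fc V = fc (concat (replicate l w) @ [(a, g)])"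
        using lhs pow[OF wl(1), of l] pl[OF wl(1), of l] a by (simp add: fcls_mult)
      moreover have "red (concat (replicate l w) @ [(a, g)])"
        using red_power[OF less(2) cyc2, of l] last_concat_replicate[of w l] less(3) kl a cyc(2) by (auto simp: red_append)
      ultimately have "V = concat (replicate l w) @ [(a, g)]" using V red_unique by blast
      then have "last V = (a, g)" by simp
      then show False using V(3) cyc by simp
    next
      assume "fc [(a, g)] \<otimes>\<^bsub>FP\<^esub> fc w [^]\<^bsub>FP\<^esub> k = (inv\<^bsub>FP\<^esub> fc w) [^]\<^bsub>FP\<^esub> l \<otimes>\<^bsub>FP\<^esub> fc [(a, g)]"
      then have *: "fc V = fc (concat (replicate l (winv w)) @ [(a, g)])"
        using lhs pow[of "winv w" l] pl[of "winv w" l] fc_winv[OF wl(1)] a by (simp add: fcls_mult)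
      have ww: "hd (winv w) = (fst (last w), inv\<^bsub>K (fst (last w))\<^esub> snd (last w))" "last (winv w) = (a, inv\<^bsub>K a\<^esub> g)" "winv w \<noteq> []"
        using less(3) w' by (auto simp: winv_def hd_rev last_rev last_map case_prod_beta)
      define U where "U = concat (replicate l (winv w))"
      have rU: "red U" unfolding U_def using red_power[OF red_winv[OF less(2)], of l] ww cyc by auto
      have U: "hd U = hd (winv w)" "last U = (a, inv\<^bsub>K a\<^esub> g)" "U \<noteq> []"
        using hd_concat_replicate[of "winv w" l] last_concat_replicate[of "winv w" l] ww kl by (auto simp: U_def)
      then obtain U' where U': "U = U' @ [(a, inv\<^bsub>K a\<^esub> g)]" by (metis append_butlast_last_id)
      have "U' \<noteq> []" using U(1) U' ww(1) cyc(2) by auto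
      have rU': "red U'" using rU U' by (simp add: red_append)
      have "fc (U @ [(a, g)]) = fc U' \<otimes>\<^bsub>FP\<^esub> fc [(a, inv\<^bsub>K a\<^esub> g), (a, g)]"
        using U' a red_lists[OF rU'] by (simp add: fcls_mult)
      also have "\<dots> = fc U'" using fgen_mult[of a "inv\<^bsub>K a\<^esub> g" g] a fgen_one[of a] red_lists[OF rU'] by (simp add: one_free_product[symmetric])
      finally have "V = U'" using * red_unique[OF V(1) rU'] U_def by simp
      then have "hd V = hd U" using U' \<open>U' \<noteq> []\<close> by simp
      then show False using V(2) U(1) ww(1) cyc(2) by simp
    qed
  next
    case conj
    define v where "v = butlast w'"
    define h where "h = snd (last w)"
    have wv: "w' = v @ [(a, h)]" using conj w' by (simp add: v_def h_def) (metis append_butlast_last_id last_ConsR prod.collapse)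
    have "red (v @ [(a, h)])" using a(4) wv by simp
    then have v: "red v" "h \<in> carrier (K a)" "h \<noteq> \<one>\<^bsub>K a\<^esub>" "v = [] \<or> fst (last v) \<noteq> a" by (auto simp: red_append red_Cons)
    have vne: "v \<noteq> []" using less(2) w' wv by (auto simp: red_Cons)
    have vl: "v \<in> lists alph" using v red_lists by auto
    define c where "c = fc [(a, g)]"
    have c: "c \<in> carrier FP" using a by (simp add: c_def)
    have cw: "fc w = c \<otimes>\<^bsub>FP\<^esub> fc w'" using a vl v w' wv by (simp add: c_def fcls_mult)
    have "inv\<^bsub>FP\<^esub> c \<otimes>\<^bsub>FP\<^esub> fc w \<otimes>\<^bsub>FP\<^esub> c = fc w' \<otimes>\<^bsub>FP\<^esub> c"
      unfolding cw using c vl v a wv by (simp add: FP.m_assoc[symmetric])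
    also have "\<dots> = fc v \<otimes>\<^bsub>FP\<^esub> fc [(a, h), (a, g)]" using a vl v wv by (simp add: c_def fcls_mult)
    also have "\<dots> = fc v \<otimes>\<^bsub>FP\<^esub> fc [(a, h \<otimes>\<^bsub>K a\<^esub> g)]" using a v by (simp add: fgen_mult)
    finally have eq: "inv\<^bsub>FP\<^esub> c \<otimes>\<^bsub>FP\<^esub> fc w \<otimes>\<^bsub>FP\<^esub> c = fc v \<otimes>\<^bsub>FP\<^esub> fc [(a, h \<otimes>\<^bsub>K a\<^esub> g)]" .
    have com: "commensurated FP (inv\<^bsub>FP\<^esub> c \<otimes>\<^bsub>FP\<^esub> fc w \<otimes>\<^bsub>FP\<^esub> c)"
      by (rule FP.commensurated_conj) (use less wl c in auto)
    show False
    proof (cases "h \<otimes>\<^bsub>K a\<^esub> g = \<one>\<^bsub>K a\<^esub>")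
      case True
      then have "inv\<^bsub>FP\<^esub> c \<otimes>\<^bsub>FP\<^esub> fc w \<otimes>\<^bsub>FP\<^esub> c = fc v" using eq fgen_one[of a] a vl by (simp add: one_free_product[symmetric])
      then show False using less(1)[of v] com v vne w' wv by auto
    next
      case False
      then have "inv\<^bsub>FP\<^esub> c \<otimes>\<^bsub>FP\<^esub> fc w \<otimes>\<^bsub>FP\<^esub> c = fc (v @ [(a, h \<otimes>\<^bsub>K a\<^esub> g)])" using eq a v vl by (simp add: fcls_mult)
      moreover have "red (v @ [(a, h \<otimes>\<^bsub>K a\<^esub> g)])" using v a False by (auto simp: red_append red_Cons)
      ultimately show False using less(1)[of "v @ [(a, h \<otimes>\<^bsub>K a\<^esub> g)]"] com v w' wv by auto
    qed
  qed
qed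

lemma no_commensurated:
  assumes tf: "\<And>i g k. i \<in> I \<Longrightarrow> g \<in> carrier (K i) \<Longrightarrow> g \<noteq> \<one>\<^bsub>K i\<^esub> \<Longrightarrow> k > 0 \<Longrightarrow> g [^]\<^bsub>K i\<^esub> (k::nat) \<noteq> \<one>\<^bsub>K i\<^esub>"
    and ij: "i \<in> I" "j \<in> I" "i \<noteq> j"
    and x: "x \<in> carrier (K i)" "x \<noteq> \<one>\<^bsub>K i\<^esub>" and y: "y \<in> carrier (K j)" "y \<noteq> \<one>\<^bsub>K j\<^esub>"
    and v: "v \<in> carrier FP" "v \<noteq> \<one>\<^bsub>FP\<^esub>"
  shows "\<not> commensurated FP v"
proof
  assume com: "commensurated FP v"
  obtain w where w: "red w" "v = fc w" using red_exists v by blast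
  then have "w \<noteq> []" using v by (auto simp: one_free_product)
  show False by (rule no_commensurated_word[OF tf ij x y w(1) \<open>w \<noteq> []\<close>]) (use com w in auto)
qed

end

section \<open>Trees\<close>

context bidirected_digraph
begin

definition nonbacktracking :: "'b list \<Rightarrow> bool" where
  "nonbacktracking p \<longleftrightarrow> successively (\<lambda>e f. f \<noteq> arev e) p"

text \<open>Reduced walks; in a tree they are the geodesic segments.\<close>

definition rwalk :: "'a \<Rightarrow> 'b list \<Rightarrow> 'a \<Rightarrow> bool" where
  "rwalk u p v \<longleftrightarrow> awalk u p v \<and> nonbacktracking p"

lemma nonbacktracking_append:
  "nonbacktracking (p @ q) \<longleftrightarrow> nonbacktracking p \<and> nonbacktracking q \<and>
    (p = [] \<or> q = [] \<or> hd q \<noteq> arev (last p))"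
  by (auto simp: nonbacktracking_def successively_append_iff)

lemma nonbacktracking_simps [simp]: "nonbacktracking []" "nonbacktracking [e]"
  by (simp_all add: nonbacktracking_def)

text \<open>If the vertices after the first are distinct, the walk is a cycle. Otherwise a
  repetition cuts out a shorter closed walk, which is nonbacktracking because it is a contiguous
  piece.\<close>

lemma rwalk_closed_Nil:
  assumes tree: "\<not> (\<exists>p. cycle p \<and> nonbacktracking p)"
  shows "rwalk u p u \<Longrightarrow> p = []"
proof (induction "length p" arbitrary: u p rule: less_induct)
  case less
  show ?case
  proof (rule ccontr)
    assume "p \<noteq> []"
    then obtain e p' where p: "p = e # p'" by (cases p) auto
    have w: "awalk u p u" "nonbacktracking p" using less.prems by (auto simp: rwalk_def)
    then have "\<not> distinct (tl (awalk_verts u p))" using tree \<open>p \<noteq> []\<close> by (auto simp: cycle_def)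
    then have nd: "\<not> distinct (awalk_verts (head G e) p')" by (simp add: p)
    have "awalk (head G e) p' u" using w p by (auto simp: awalk_Cons_iff)
    from awalk_not_distinct_decomp[OF this nd] obtain q r s x where
      d: "p' = q @ r @ s" "0 < length r" "awalk x r x" by blast
    have "p = (e # q) @ r @ s" using d p by simp
    then have "nonbacktracking r" using w(2) by (metis nonbacktracking_append)
    then have "r = []" using less.hyps[of r x] d p by (simp add: rwalk_def)
    then show False using d by simp
  qed
qed

lemma not_nonbacktracking_decomp: "\<not> nonbacktracking p \<Longrightarrow> \<exists>a e b. p = a @ [e, arev e] @ b"
proof (induction p)
  case (Cons x p)
  show ?case
  proof (cases "nonbacktracking p")
    case True
    then obtain p' where "p = arev x # p'" using Cons.prems
      by (cases p) (auto simp: nonbacktracking_def)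
    then show ?thesis by (intro exI[of _ "[]"]) auto
  next
    case False
    then obtain a e b where "p = a @ [e, arev e] @ b" using Cons by blast
    then show ?thesis by (intro exI[of _ "x # a"]) auto
  qed
qed simp

lemma awalk_cancel: "awalk u (a @ [e, arev e] @ b) v \<Longrightarrow> awalk u (a @ b) v"
  by (auto simp: awalk_Cons_iff)

lemma rwalk_exists: "awalk u p v \<Longrightarrow> \<exists>q. rwalk u q v"
proof (induction "length p" arbitrary: p rule: less_induct)
  case less
  show ?case
  proof (cases "nonbacktracking p")
    case False
    then obtain a e b where p: "p = a @ [e, arev e] @ b" using not_nonbacktracking_decomp by blast
    then have "awalk u (a @ b) v" using less.prems by (intro awalk_cancel[of u a e b v]) simp
    then show ?thesis using less.hyps[of "a @ b"] p by simp
  qed (use less in \<open>auto simp: rwalk_def\<close>)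
qed

definition revw :: "'b list \<Rightarrow> 'b list" where "revw p = rev (map arev p)"

lemma awalk_revw: "awalk u p v \<Longrightarrow> awalk v (revw p) u"
proof (induction p arbitrary: u)
  case (Cons e p)
  then have "awalk v (revw p) (head G e)" "e \<in> arcs G" "tail G e = u" by (auto simp: awalk_Cons_iff)
  then show ?case by (auto simp: revw_def awalk_Cons_iff awalk_Nil_iff)
qed (auto simp: revw_def awalk_Nil_iff)

lemma nonbacktracking_revw: "nonbacktracking p \<Longrightarrow> nonbacktracking (revw p)"
  unfolding nonbacktracking_def revw_def successively_rev successively_map
  by (erule successively_mono) auto

lemma revw_Cons: "revw (e # p) = revw p @ [arev e]" by (simp add: revw_def)

text \<open>Common initial arcs are stripped. Where the first arcs differ, the reverse of one walk
  followed by the other is a closed nonbacktracking walk, hence empty.\<close>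

lemma rwalk_unique:
  assumes tree: "\<not> (\<exists>p. cycle p \<and> nonbacktracking p)"
  shows "rwalk u p v \<Longrightarrow> rwalk u q v \<Longrightarrow> p = q"
proof (induction p arbitrary: u q)
  case Nil
  then have "u = v" by (auto simp: rwalk_def awalk_Nil_iff)
  then show ?case using rwalk_closed_Nil[OF tree] Nil by auto
next
  case (Cons e p)
  show ?case
  proof (cases q)
    case Nil
    then have "u = v" using Cons by (auto simp: rwalk_def awalk_Nil_iff)
    then show ?thesis using rwalk_closed_Nil[OF tree] Cons by blast
  next
    case q: (Cons f q')
    show ?thesis
    proof (cases "e = f")
      case True
      have "rwalk (head G e) p v" "rwalk (head G e) q' v"
        using Cons.prems q True nonbacktracking_append[of "[e]" p] nonbacktracking_append[of "[f]" q']
        by (auto simp: rwalk_def awalk_Cons_iff)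
      then show ?thesis using Cons.IH q True by simp
    next
      case False
      have "awalk v (revw (e # p) @ q) v"
        using Cons.prems awalk_revw unfolding rwalk_def by (meson awalk_appendI)
      moreover have "nonbacktracking (revw (e # p) @ q)"
        unfolding nonbacktracking_append using Cons.prems nonbacktracking_revw[of "e # p"] False q
        by (auto simp: rwalk_def revw_Cons)
      ultimately show ?thesis using rwalk_closed_Nil[OF tree, of v "revw (e # p) @ q"] q by (simp add: rwalk_def)
    qed
  qed
qed

lemma connected_awalk:
  assumes "Digraph_Component.connected G" "u \<in> verts G" "v \<in> verts G"
  obtains p where "awalk u p v"
proof -
  have "strongly_connected G" using symmetric_connected_imp_strongly_connected[OF sym_arcs assms(1)] .
  then have "u \<rightarrow>\<^sup>*\<^bsub>G\<^esub> v" using assms by auto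
  then show ?thesis using that by (auto simp: reachable_awalk)
qed

end

section \<open>Groups acting on a tree: axes and fixed points\<close>

locale tree_act = Group.group G + T: bidirected_digraph T arev
  for G (structure) and T :: "('v, 'e) pre_digraph" and arev +
  fixes \<phi> :: "'a \<Rightarrow> 'v \<Rightarrow> 'v" and \<psi> :: "'a \<Rightarrow> 'e \<Rightarrow> 'e"
  assumes act: "tree_action G T arev \<phi> \<psi>"
begin

lemma tree: "\<not> (\<exists>p. T.cycle p \<and> T.nonbacktracking p)"
  using act by (auto simp: tree_action_def serre_tree_def T.nonbacktracking_def)

lemma walk_exists: assumes "u \<in> verts T" "v \<in> verts T" obtains p where "T.awalk u p v"
  using T.connected_awalk act assms by (auto simp: tree_action_def serre_tree_def)

sublocale V: group_action G "verts T" \<phi> using act by (simp add: tree_action_def)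
sublocale A: group_action G "arcs T" \<psi> using act by (simp add: tree_action_def)

lemma vact_closed [simp]: "g \<in> carrier G \<Longrightarrow> x \<in> verts T \<Longrightarrow> \<phi> g x \<in> verts T"
  using V.element_image by blast
lemma aact_closed [simp]: "g \<in> carrier G \<Longrightarrow> e \<in> arcs T \<Longrightarrow> \<psi> g e \<in> arcs T"
  using A.element_image by blast
lemma vact_mult: "g \<in> carrier G \<Longrightarrow> h \<in> carrier G \<Longrightarrow> x \<in> verts T \<Longrightarrow> \<phi> (g \<otimes> h) x = \<phi> g (\<phi> h x)"
  using V.composition_rule by simp
lemma vact_one [simp]: "x \<in> verts T \<Longrightarrow> \<phi> \<one> x = x"
  using V.id_eq_one by (metis restrict_apply')
lemma tail_act: "g \<in> carrier G \<Longrightarrow> e \<in> arcs T \<Longrightarrow> tail T (\<psi> g e) = \<phi> g (tail T e)"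
  using act by (simp add: tree_action_def)
lemma arev_act: "g \<in> carrier G \<Longrightarrow> e \<in> arcs T \<Longrightarrow> \<psi> g (arev e) = arev (\<psi> g e)"
  using act by (simp add: tree_action_def)
lemma no_inversion: "g \<in> carrier G \<Longrightarrow> e \<in> arcs T \<Longrightarrow> \<psi> g e \<noteq> arev e"
  using act by (simp add: tree_action_def)
lemma head_act: "g \<in> carrier G \<Longrightarrow> e \<in> arcs T \<Longrightarrow> head T (\<psi> g e) = \<phi> g (head T e)"
  using tail_act[of g "arev e"] arev_act[of g e] by simp
lemma aact_inj: "g \<in> carrier G \<Longrightarrow> e \<in> arcs T \<Longrightarrow> f \<in> arcs T \<Longrightarrow> \<psi> g e = \<psi> g f \<longleftrightarrow> e = f"
  using A.inj_prop by (auto simp: inj_on_def)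

lemma awalk_act: "g \<in> carrier G \<Longrightarrow> T.awalk u p v \<Longrightarrow> T.awalk (\<phi> g u) (map (\<psi> g) p) (\<phi> g v)"
  by (induction p arbitrary: u) (auto simp: T.awalk_Cons_iff T.awalk_Nil_iff tail_act head_act)

lemma rwalk_act: assumes "g \<in> carrier G" "T.rwalk u p v" shows "T.rwalk (\<phi> g u) (map (\<psi> g) p) (\<phi> g v)"
proof -
  have "set p \<subseteq> arcs T" using assms by (auto simp: T.rwalk_def)
  moreover have "successively (\<lambda>e f. f \<noteq> arev e) p" using assms by (simp add: T.rwalk_def T.nonbacktracking_def)
  ultimately have "successively (\<lambda>e f. \<psi> g f \<noteq> arev (\<psi> g e)) p"
    using assms(1) by (elim successively_mono) (metis T.arev_in_arcs aact_inj arev_act subsetD)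
  then show ?thesis using assms awalk_act[OF assms(1)]
    by (simp add: T.rwalk_def T.nonbacktracking_def successively_map)
qed

lemma rwalk_unique: "T.rwalk u p v \<Longrightarrow> T.rwalk u q v \<Longrightarrow> p = q"
  using T.rwalk_unique[OF tree] .

lemma rwalk_append_iff:
  "T.rwalk u (p @ q) v \<longleftrightarrow> (\<exists>x. T.rwalk u p x \<and> T.rwalk x q v) \<and> (p = [] \<or> q = [] \<or> hd q \<noteq> arev (last p))"
  by (auto simp: T.rwalk_def T.nonbacktracking_append)

text \<open>A walk of minimal length from a vertex to its image lies on the axis of \<open>g\<close>.\<close>

lemma axis_segment:
  assumes g: "g \<in> carrier G" and nofix: "\<And>x. x \<in> verts T \<Longrightarrow> \<phi> g x \<noteq> x"
  obtains x p where "x \<in> verts T" "T.rwalk x p (\<phi> g x)" "p \<noteq> []"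
    "\<And>y q. T.rwalk y q (\<phi> g y) \<Longrightarrow> length p \<le> length q" "\<psi> g (hd p) \<noteq> arev (last p)"
proof -
  have "\<exists>x. x \<in> verts T" using act by (auto simp: tree_action_def serre_tree_def connected_conv)
  then obtain x0 where x0: "x0 \<in> verts T" by blast
  obtain w0 where "T.awalk x0 w0 (\<phi> g x0)" using walk_exists[of x0 "\<phi> g x0"] x0 g by auto
  then obtain q0 where q0: "T.rwalk x0 q0 (\<phi> g x0)" using T.rwalk_exists by blast
  define P where "P = (\<lambda>(x, q). T.rwalk x q (\<phi> g x))"
  obtain xp where xp: "P xp" "\<And>y. P y \<Longrightarrow> length (snd xp) \<le> length (snd y)"
    using ex_has_least_nat[of P "(x0, q0)" "\<lambda>y. length (snd y)"] q0 by (auto simp: P_def)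
  obtain x p where p: "xp = (x, p)" by (cases xp)
  have w: "T.rwalk x p (\<phi> g x)" and min: "\<And>y q. T.rwalk y q (\<phi> g y) \<Longrightarrow> length p \<le> length q"
    using xp p by (auto simp: P_def)
  have x: "x \<in> verts T" using w by (auto simp: T.rwalk_def)
  have ne: "p \<noteq> []" using w nofix[OF x] by (auto simp: T.rwalk_def T.awalk_Nil_iff)
  have arcs: "set p \<subseteq> arcs T" using w by (auto simp: T.rwalk_def)
  \<comment> \<open>If g carried the first arc to the reverse of the last one, deleting both arcs
    would leave a shorter reduced walk from a vertex to its image; if there is only one arc, g would
    invert it.\<close>
  have "\<psi> g (hd p) \<noteq> arev (last p)"
  proof
    assume eq: "\<psi> g (hd p) = arev (last p)"
    obtain e p' where e: "p = e # p'" using ne by (cases p) auto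
    have e': "e \<in> arcs T" using arcs e by simp
    show False
    proof (cases "p' = []")
      case True
      then show False using eq e no_inversion[OF g e'] by simp
    next
      case False
      then obtain m f where m: "p' = m @ [f]" by (metis append_butlast_last_id)
      have "T.rwalk (head T e) m (tail T f)" and f: "f \<in> arcs T"
        using w e m T.nonbacktracking_append[of "[e]" "m @ [f]"] T.nonbacktracking_append[of m "[f]"]
        by (auto simp: T.rwalk_def T.awalk_Cons_iff)
      moreover have "tail T f = \<phi> g (head T e)"
        using eq e m head_act[OF g e'] f by simp
      ultimately have "length p \<le> length m" using min by simp
      then show False using e m by simp
    qed
  qed
  then show ?thesis using that x w ne min by blast
qed

text \<open>The segments p, g p, g^2 p, ... fit together without backtracking. The first arc is kept
  in the statement because the next junction depends on it.\<close>

lemma power_walk: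
  assumes g: "g \<in> carrier G" and w: "T.rwalk x p (\<phi> g x)" "p \<noteq> []" "\<psi> g (hd p) \<noteq> arev (last p)" and k: "k > (0::nat)"
  shows "\<exists>q. T.rwalk x q (\<phi> (g [^] k) x) \<and> q \<noteq> [] \<and> hd q = hd p"
  using k
proof (induction k)
  case (Suc k)
  have x: "x \<in> verts T" using w by (auto simp: T.rwalk_def)
  show ?case
  proof (cases "k = 0")
    case True
    then show ?thesis using w g by auto
  next
    case False
    then obtain q where q: "T.rwalk x q (\<phi> (g [^] k) x)" "q \<noteq> []" "hd q = hd p" using Suc by blast
    have "\<phi> (g [^] Suc k) x = \<phi> g (\<phi> (g [^] k) x)" using nat_pow_Suc2[OF g, of k] g x vact_mult by simp
    then have "T.rwalk (\<phi> g x) (map (\<psi> g) q) (\<phi> (g [^] Suc k) x)" using rwalk_act[OF g q(1)] by simp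
    then have "T.rwalk x (p @ map (\<psi> g) q) (\<phi> (g [^] Suc k) x)"
      unfolding rwalk_append_iff using w q by (auto simp: hd_map)
    then show ?thesis using w by auto
  qed
qed simp

text \<open>Without a fixed vertex, each positive power of g moves a vertex of the axis along a
  nonempty reduced walk; for the trivial power this walk would be closed.\<close>

lemma finite_order_fixes:
  assumes g: "g \<in> carrier G" and k: "k > (0::nat)" "g [^] k = \<one>"
  shows "\<exists>x\<in>verts T. \<phi> g x = x"
proof (rule ccontr)
  assume "\<not> ?thesis"
  then obtain x p where w: "x \<in> verts T" "T.rwalk x p (\<phi> g x)" "p \<noteq> []" "\<psi> g (hd p) \<noteq> arev (last p)"
    using axis_segment[OF g] by metis
  obtain q where "T.rwalk x q (\<phi> (g [^] k) x)" "q \<noteq> []" using power_walk[OF g w(2-4) k(1)] by blast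
  then show False using T.rwalk_closed_Nil[OF tree, of x q] k(2) w(1) by simp
qed

text \<open>Since g commutes with w, it maps the axis of w to itself. The vertices of the axis fall
  into finitely many orbits under the powers of w, so two of the vertices g^i x lie in the same
  orbit, and comparing them gives a product of a power of w and a positive power of g with a fixed
  vertex.\<close>

lemma commuting_elliptic_combination:
  assumes g: "g \<in> carrier G" and w: "w \<in> carrier G" and comm: "g \<otimes> w = w \<otimes> g"
    and nofix: "\<And>x. x \<in> verts T \<Longrightarrow> \<phi> w x \<noteq> x"
  shows "\<exists>m>(0::nat). \<exists>q::int. \<exists>y\<in>verts T. \<phi> (w [^] q \<otimes> g [^] m) y = y"
proof -
  obtain x p where x: "x \<in> verts T" and p: "T.rwalk x p (\<phi> w x)" "p \<noteq> []" "\<psi> w (hd p) \<noteq> arev (last p)"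
    using axis_segment[OF w nofix] by metis
  define Z where "Z = set (T.awalk_verts x p)"
  \<comment> \<open>The vertices of the axis: all translates under powers of w of the vertices of
    one segment from x to its image.\<close>
  define L where "L = {\<phi> (w [^] i) z | (i::int) z. z \<in> Z}"
  have Z: "Z \<subseteq> verts T" "finite Z" using p by (auto simp: Z_def T.rwalk_def)
  have wp: "w [^] (i::int) \<otimes> w [^] (j::int) = w [^] (i + j)" for i j using w by (simp add: int_pow_mult)
  have wL: "\<phi> (w [^] (j::int)) y \<in> L" if y: "y \<in> L" for y j
  proof -
    obtain i :: int and z where "y = \<phi> (w [^] i) z" "z \<in> Z" using y by (auto simp: L_def)
    then have "\<phi> (w [^] j) y = \<phi> (w [^] (j + i)) z"
      using vact_mult[of "w [^] j" "w [^] i" z] wp[of j i] w Z by auto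
    then show ?thesis using \<open>z \<in> Z\<close> unfolding L_def by blast
  qed
  have w1: "w [^] (1::int) = w" using w by simp
  have LV: "L \<subseteq> verts T" using Z w by (auto simp: L_def)
  have ZL: "Z \<subseteq> L"
  proof
    fix z assume "z \<in> Z"
    then have "z = \<phi> (w [^] (0::int)) z" using Z by auto
    then show "z \<in> L" using \<open>z \<in> Z\<close> unfolding L_def by blast
  qed
  \<comment> \<open>A vertex z of the segment cuts it into a and b; then b followed by the translate
    of a is a segment from z to its image with the same length, and powers of w carry it to the
    other vertices of the axis.\<close>
  have seg: "\<exists>p'. T.rwalk y p' (\<phi> w y) \<and> length p' = length p \<and> (\<forall>e\<in>set p'. tail T e \<in> L \<and> head T e \<in> L)"
    if y: "y \<in> L" for y
  proof -
    obtain i :: int and z where z: "y = \<phi> (w [^] i) z" "z \<in> Z" using y by (auto simp: L_def)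
    have pw: "T.awalk x p (\<phi> w x)" using p by (simp add: T.rwalk_def)
    have ends: "tail T e \<in> Z \<and> head T e \<in> Z" if "e \<in> set p" for e
      using T.awalk_verts_arc1[of e p x] T.awalk_verts_arc2[OF pw, of e] that by (auto simp: Z_def)
    obtain a b where ab: "p = a @ b" "T.awalk x a z" "T.awalk z b (\<phi> w x)"
      using T.awalk_decomp[OF pw, of z] z(2) by (auto simp: Z_def)
    have rab: "T.rwalk x a z" "T.rwalk z b (\<phi> w x)"
      using ab p(1) by (auto simp: T.rwalk_def T.nonbacktracking_append)
    have j: "hd (map (\<psi> w) a) \<noteq> arev (last b)" if "a \<noteq> []" "b \<noteq> []"
      using that ab(1) p(3) by (simp add: hd_map)
    have r: "T.rwalk z (b @ map (\<psi> w) a) (\<phi> w z)"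
      unfolding rwalk_append_iff using rwalk_act[OF w rab(1)] rab(2) j by auto
    have re: "e \<in> arcs T \<and> tail T e \<in> L \<and> head T e \<in> L" if e: "e \<in> set (b @ map (\<psi> w) a)" for e
    proof (cases "e \<in> set b")
      case True
      then show ?thesis using ends[of e] ZL ab(1,3) by (auto simp: T.awalk_def)
    next
      case False
      then obtain f where f: "e = \<psi> w f" "f \<in> set a" using e by auto
      then have "f \<in> arcs T" using ab(2) by (auto simp: T.awalk_def)
      then show ?thesis using f ends[of f] ZL wL[of _ 1] w1 tail_act[OF w] head_act[OF w] w ab(1) by auto
    qed
    define p' where "p' = map (\<psi> (w [^] i)) (b @ map (\<psi> w) a)"
    have "\<phi> (w [^] i) (\<phi> w z) = \<phi> w (\<phi> (w [^] i) z)"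
    proof -
      have "w [^] i \<otimes> w = w \<otimes> w [^] i" using wp[of i 1] wp[of 1 i] w1 by (simp add: add.commute)
      then show ?thesis using vact_mult[of "w [^] i" w z] vact_mult[of w "w [^] i" z] w z(2) Z by auto
    qed
    then have "T.rwalk y p' (\<phi> w y)" using rwalk_act[OF _ r, of "w [^] i"] w z(1) by (simp add: p'_def)
    moreover have "tail T e \<in> L \<and> head T e \<in> L" if e: "e \<in> set p'" for e
    proof -
      obtain f where f: "e = \<psi> (w [^] i) f" "f \<in> set (b @ map (\<psi> w) a)" using e unfolding p'_def set_map by blast
      then show ?thesis using re[OF f(2)] wL tail_act[of "w [^] i" f] head_act[of "w [^] i" f] w by auto
    qed
    ultimately show ?thesis using ab(1) by (intro exI[of _ p']) (auto simp: p'_def)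
  qed
  \<comment> \<open>The axis is recognised by the displacement: outside it, the reduced walk from y
    to w y goes to the axis along s, runs along the axis, and returns by the translate of the
    reverse of s, so it is longer than p.\<close>
  have claim: "y \<in> L" if y: "T.rwalk y q (\<phi> w y)" "length q = length p" for y q
  proof (rule ccontr)
    assume nL: "y \<notin> L"
    have yV: "y \<in> verts T" using y by (auto simp: T.rwalk_def)
    have "x \<in> Z" using p(1) T.hd_in_awalk_verts(1) by (auto simp: Z_def T.rwalk_def)
    then have xL: "x \<in> L" using ZL by auto
    define P where "P s \<longleftrightarrow> (\<exists>z\<in>L. T.awalk y s z)" for s
    obtain s0 where "T.awalk y s0 x" using walk_exists[OF yV x] by blast
    then have "P s0" using xL by (auto simp: P_def)
    then obtain s where s: "P s" "\<And>s'. P s' \<Longrightarrow> length s \<le> length s'"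
      using ex_has_least_nat[of P s0 length] by blast
    obtain z where z: "z \<in> L" "T.awalk y s z" using s(1) by (auto simp: P_def)
    have sne: "s \<noteq> []" using z nL by (auto simp: T.awalk_Nil_iff)
    have tl: "tail T e \<notin> L" if e: "e \<in> set s" for e
    proof
      assume "tail T e \<in> L"
      obtain a b where "s = a @ e # b" using e by (meson split_list)
      then have "T.awalk y a (tail T e)" "length a < length s" using z(2) by (auto simp: T.awalk_Cons_iff)
      then show False using s(2)[of a] \<open>tail T e \<in> L\<close> by (auto simp: P_def)
    qed
    have nb: "T.nonbacktracking s"
    proof (rule ccontr)
      assume "\<not> T.nonbacktracking s"
      then obtain a e b where "s = a @ [e, arev e] @ b" using T.not_nonbacktracking_decomp by blast
      moreover then have "T.awalk y (a @ b) z" using z(2) by (intro T.awalk_cancel[of y a e b z]) simp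
      ultimately have "P (a @ b)" "length (a @ b) < length s" using z(1) unfolding P_def by auto
      then show False using s(2) by fastforce
    qed
    define f where "f = last s"
    have f: "f \<in> set s" "f \<in> arcs T" "tail T f \<notin> L" using sne z(2) tl by (auto simp: f_def T.awalk_def)
    obtain p' where p': "T.rwalk z p' (\<phi> w z)" "length p' = length p" "\<And>e. e \<in> set p' \<Longrightarrow> tail T e \<in> L \<and> head T e \<in> L"
      using seg[OF z(1)] by blast
    have pne: "p' \<noteq> []" using p'(2) p(2) by auto
    have p'a: "set p' \<subseteq> arcs T" using p'(1) by (auto simp: T.rwalk_def)
    define r where "r = map (\<psi> w) (T.revw s)"
    have rr: "T.rwalk (\<phi> w z) r (\<phi> w y)"
      unfolding r_def by (rule rwalk_act[OF w]) (use z nb T.awalk_revw T.nonbacktracking_revw in \<open>auto simp: T.rwalk_def\<close>)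
    have rne: "r \<noteq> []" "hd r = \<psi> w (arev f)" using sne by (auto simp: r_def T.revw_def hd_map hd_rev last_map f_def)
    have j1: "hd p' \<noteq> arev f"
    proof
      assume "hd p' = arev f"
      then have "head T (arev f) \<in> L" using p'(3)[OF hd_in_set[OF pne]] by simp
      then show False using f by simp
    qed
    have j2: "hd r \<noteq> arev (last p')"
    proof
      assume *: "hd r = arev (last p')"
      have "head T (hd r) = \<phi> w (tail T f)" using rne f head_act[OF w, of "arev f"] by simp
      moreover have "last p' \<in> arcs T" using pne p'a by auto
      then have "head T (arev (last p')) \<in> L" using p'(3)[of "last p'"] pne by simp
      ultimately have "\<phi> w (tail T f) \<in> L" using * by simp
      then have "\<phi> (w [^] (-1::int)) (\<phi> w (tail T f)) \<in> L" using wL by blast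
      moreover have "\<phi> (w [^] (-1::int)) (\<phi> w (tail T f)) = tail T f"
        using vact_mult[of "w [^] (-1::int)" w "tail T f"] wp[of "-1" 1] w1 w f by simp
      ultimately show False using f by simp
    qed
    have "T.rwalk y (s @ p' @ r) (\<phi> w y)"
      unfolding rwalk_append_iff using z nb p'(1) rr j1 j2 sne pne rne by (auto simp: T.rwalk_def f_def)
    then have "s @ p' @ r = q" using rwalk_unique y(1) by blast
    then show False using y(2) p'(2) sne by auto
  qed
  \<comment> \<open>As g^i commutes with w, it carries the segment at x to a segment of equal length
    at g^i x.\<close>
  have gL: "\<phi> (g [^] (i::nat)) x \<in> L" for i
  proof (rule claim)
    have gi: "g [^] i \<in> carrier G" using g by simp
    have "g [^] i \<otimes> w = w \<otimes> g [^] i" using comm g w by (metis group_commutes_pow)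
    then have "\<phi> (g [^] i) (\<phi> w x) = \<phi> w (\<phi> (g [^] i) x)"
      using vact_mult[of "g [^] i" w x] vact_mult[of w "g [^] i" x] gi w x by simp
    then show "T.rwalk (\<phi> (g [^] i) x) (map (\<psi> (g [^] i)) p) (\<phi> w (\<phi> (g [^] i) x))"
      using rwalk_act[OF gi p(1)] by simp
  qed simp
  have "\<exists>k::int. \<exists>z. z \<in> Z \<and> \<phi> (g [^] (i::nat)) x = \<phi> (w [^] k) z" for i using gL[of i] by (auto simp: L_def)
  then obtain kk :: "nat \<Rightarrow> int" and zz where kz: "\<And>i::nat. zz i \<in> Z" "\<And>i::nat. \<phi> (g [^] i) x = \<phi> (w [^] kk i) (zz i)"
    by metis
  \<comment> \<open>Pigeonhole: the representatives \<open>zz i\<close> lie in the finite set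
    \<open>Z\<close>.\<close>
  have "\<not> inj zz"
  proof
    assume "inj zz"
    then have "infinite (range zz)" by (rule range_inj_infinite)
    then show False using kz(1) Z(2) by (meson finite_subset image_subsetI)
  qed
  then obtain i j where ij: "i < j" "zz i = zz j" unfolding inj_def by (metis linorder_neqE_nat)
  define y where "y = \<phi> (g [^] i) x"
  have yV: "y \<in> verts T" using g x by (simp add: y_def)
  have gj: "\<phi> (g [^] j) x = \<phi> (g [^] (j - i)) y"
    using vact_mult[of "g [^] (j - i)" "g [^] i" x] g x ij by (simp add: y_def nat_pow_mult)
  have "\<phi> (w [^] (kk i - kk j) \<otimes> g [^] (j - i)) y = \<phi> (w [^] (kk i - kk j)) (\<phi> (g [^] j) x)"
    using vact_mult[of "w [^] (kk i - kk j)" "g [^] (j - i)" y] g w yV gj by simp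
  also have "\<dots> = \<phi> (w [^] (kk i - kk j)) (\<phi> (w [^] kk j) (zz j))" using kz by simp
  also have "\<dots> = \<phi> (w [^] (kk i - kk j) \<otimes> w [^] kk j) (zz j)"
    by (rule vact_mult[symmetric]) (use w Z kz in auto)
  also have "\<dots> = \<phi> (w [^] kk i) (zz i)" unfolding wp using ij by simp
  also have "\<dots> = y" using kz by (simp add: y_def)
  finally show ?thesis using ij(1) yV
    by (intro exI[of _ "j - i"] conjI exI[of _ "kk i - kk j"] bexI[of _ y]) auto
qed

end

text \<open>Only k has to be nonzero: l may vanish, so the identity and all elements of finite order
  are included. For v generating a vertex stabiliser, every element that fixes a vertex satisfies
  the condition.\<close>

definition commensurable :: "('a, 'b) monoid_scheme \<Rightarrow> 'a \<Rightarrow> 'a \<Rightarrow> bool" where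
  "commensurable G v g \<longleftrightarrow> (\<exists>(k::int) (l::int). k \<noteq> 0 \<and> g [^]\<^bsub>G\<^esub> k = v [^]\<^bsub>G\<^esub> l)"

section \<open>From stabilisers to algebraic properties of the group\<close>

context group
begin

lemma infinite_cyclic_subgroup:
  assumes "subgroup S G" "infinite_cyclic (G\<lparr>carrier := S\<rparr>)"
  obtains c where "c \<in> S" "c \<in> carrier G" "S = range (\<lambda>n::int. c [^] n)" "\<And>n::int. c [^] n = \<one> \<Longrightarrow> n = 0"
proof -
  interpret S: Group.group "G\<lparr>carrier := S\<rparr>" using assms(1) subgroup_imp_group by blast
  obtain c where c: "c \<in> S" "S = range (\<lambda>n::int. c [^]\<^bsub>G\<lparr>carrier := S\<rparr>\<^esub> n)"
    using assms(2) S.cyclic_group by (auto simp: infinite_cyclic_def)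
  have cG: "c \<in> carrier G" using c(1) assms(1) subgroup.subset by blast
  have S: "S = range (\<lambda>n::int. c [^] n)" using c int_pow_consistent[OF assms(1)] by simp
  have inf: "infinite S" using assms(2) by (simp add: infinite_cyclic_def)
  have "ord c = 0"
  proof (rule ccontr)
    assume o: "ord c \<noteq> 0"
    have "S \<subseteq> (\<lambda>n::int. c [^] n) ` {0..<int (ord c)}"
    proof
      fix x assume "x \<in> S"
      then obtain n :: int where n: "x = c [^] n" using S by auto
      have "c [^] (n mod int (ord c)) = c [^] n" unfolding int_pow_eq[OF cG]
        by (simp add: minus_mod_eq_mult_div)
      then show "x \<in> (\<lambda>n::int. c [^] n) ` {0..<int (ord c)}" using o n
        by (intro image_eqI[of _ _ "n mod int (ord c)"]) auto
    qed
    then show False using inf finite_subset by blast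
  qed
  then show ?thesis using that c(1) S cG int_pow_eq_id[OF cG] by auto
qed

end

context tree_act
begin

text \<open>The element v generates the stabiliser of one vertex. Stabilisers of adjacent vertices
  share the infinite cyclic stabiliser of the edge, so along any walk some nonzero power of v
  remains in the stabiliser. An element fixing x then lies in one cyclic group with a nonzero power
  of v.\<close>

lemma elliptic_commensurable:
  assumes stabV: "\<And>x. x \<in> verts T \<Longrightarrow> infinite_cyclic (G\<lparr>carrier := stabilizer G \<phi> x\<rparr>)"
    and stabE: "\<And>e. e \<in> arcs T \<Longrightarrow> infinite_cyclic (G\<lparr>carrier := stabilizer G \<psi> e\<rparr>)"
  obtains v where "v \<in> carrier G" "\<And>n::int. v [^] n = \<one> \<Longrightarrow> n = 0"
    "\<And>g x. g \<in> carrier G \<Longrightarrow> x \<in> verts T \<Longrightarrow> \<phi> g x = x \<Longrightarrow> commensurable G v g"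
    "commensurated G v"
proof -
  have "\<exists>x. x \<in> verts T" using act by (auto simp: tree_action_def serre_tree_def connected_conv)
  then obtain o' where o': "o' \<in> verts T" by blast
  obtain v where v: "v \<in> stabilizer G \<phi> o'" "v \<in> carrier G" "stabilizer G \<phi> o' = range (\<lambda>n::int. v [^] n)"
    "\<And>n::int. v [^] n = \<one> \<Longrightarrow> n = 0"
    using infinite_cyclic_subgroup[OF V.stabilizer_subgroup[OF o'] stabV[OF o']] by metis
  have fixes_pow: "\<exists>k::int. k \<noteq> 0 \<and> v [^] k \<in> stabilizer G \<phi> x" if "T.awalk u p x" "u = o'" for u p x
    using that
  proof (induction p arbitrary: x rule: rev_induct)
    case Nil
    then show ?case using v by (intro exI[of _ 1]) (auto simp: T.awalk_Nil_iff)
  next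
    case (snoc e p)
    then have e: "T.awalk u p (tail T e)" "e \<in> arcs T" "head T e = x" by (auto simp: T.awalk_Cons_iff T.awalk_Nil_iff)
    obtain k :: int where k: "k \<noteq> 0" "v [^] k \<in> stabilizer G \<phi> (tail T e)" using snoc e by blast
    have t: "tail T e \<in> verts T" using e by auto
    obtain c where c: "c \<in> carrier G" "stabilizer G \<phi> (tail T e) = range (\<lambda>n::int. c [^] n)"
      using infinite_cyclic_subgroup[OF V.stabilizer_subgroup[OF t] stabV[OF t]] by metis
    obtain d where d: "d \<in> stabilizer G \<psi> e" "d \<in> carrier G" "stabilizer G \<psi> e = range (\<lambda>n::int. d [^] n)"
      "\<And>n::int. d [^] n = \<one> \<Longrightarrow> n = 0"
      using infinite_cyclic_subgroup[OF A.stabilizer_subgroup[OF e(2)] stabE[OF e(2)]] by metis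
    have "d \<in> stabilizer G \<phi> (tail T e)" using d tail_act[of d e] e by (auto simp: stabilizer_def)
    then obtain b :: int where b: "d = c [^] b" using c by auto
    have b0: "b \<noteq> 0" using b d(4)[of 1] d(2) by auto
    obtain a :: int where a: "v [^] k = c [^] a" using k c by auto
    \<comment> \<open>Both sides are \<open>c [^] (a * b)\<close>.\<close>
    have "v [^] (k * b) = d [^] a"
      using a b v(2) c(1) by (simp add: int_pow_pow[symmetric]) (simp add: int_pow_pow mult.commute)
    then have "v [^] (k * b) \<in> stabilizer G \<psi> e" using d(3) by auto
    then have "v [^] (k * b) \<in> stabilizer G \<phi> x" using head_act[of "v [^] (k * b)" e] e by (auto simp: stabilizer_def)
    then show ?case using k b0 by (intro exI[of _ "k * b"]) auto
  qed
  have pow: "\<exists>k::int. k \<noteq> 0 \<and> v [^] k \<in> stabilizer G \<phi> x" if x: "x \<in> verts T" for x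
    using walk_exists[OF o' x] fixes_pow by blast
  have ell: "commensurable G v g" if g: "g \<in> carrier G" "x \<in> verts T" "\<phi> g x = x" for g x
  proof -
    obtain k :: int where k: "k \<noteq> 0" "v [^] k \<in> stabilizer G \<phi> x" using pow g by blast
    obtain c where c: "c \<in> carrier G" "stabilizer G \<phi> x = range (\<lambda>n::int. c [^] n)"
      using infinite_cyclic_subgroup[OF V.stabilizer_subgroup[OF g(2)] stabV[OF g(2)]] by metis
    have "g \<in> stabilizer G \<phi> x" using g by (simp add: stabilizer_def)
    then obtain a :: int where a: "g = c [^] a" using c by auto
    obtain b :: int where b: "v [^] k = c [^] b" using k c by auto
    have "b \<noteq> 0" using b v(4)[of k] k by auto
    moreover have "g [^] b = v [^] (k * a)"
      using a b v(2) c(1) by (simp add: int_pow_pow[symmetric]) (simp add: int_pow_pow mult.commute)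
    ultimately show ?thesis unfolding commensurable_def by blast
  qed
  have "commensurated G v" unfolding commensurated_def
  proof
    fix g assume g: "g \<in> carrier G"
    \<comment> \<open>A nonzero power of v fixes the translate of the base vertex by g; conjugated
      back by g it fixes the base vertex and is therefore a power of v.\<close>
    define x where "x = \<phi> g o'"
    have x: "x \<in> verts T" using g o' by (simp add: x_def)
    obtain k :: int where k: "k \<noteq> 0" "v [^] k \<in> stabilizer G \<phi> x" using pow x by blast
    then have kx: "\<phi> (v [^] k) x = x" by (simp add: stabilizer_def)
    have "\<phi> (inv g \<otimes> v [^] k \<otimes> g) o' = o'"
    proof -
      have "\<phi> (inv g \<otimes> v [^] k \<otimes> g) o' = \<phi> (inv g) (\<phi> (v [^] k) (\<phi> g o'))"
        using vact_mult[of "inv g \<otimes> v [^] k" g o'] vact_mult[of "inv g" "v [^] k" "\<phi> g o'"] g v o' by simp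
      also have "\<dots> = \<phi> (inv g) (\<phi> g o')" using kx by (simp add: x_def)
      also have "\<dots> = o'" using vact_mult[of "inv g" g o'] g o' by simp
      finally show ?thesis .
    qed
    then have "inv g \<otimes> v [^] k \<otimes> g \<in> stabilizer G \<phi> o'" using g v(2) by (simp add: stabilizer_def)
    then obtain l :: int where l: "inv g \<otimes> v [^] k \<otimes> g = v [^] l" using v(3) by auto
    have "l \<noteq> 0"
    proof
      assume "l = 0"
      then have "inv g \<otimes> v [^] k \<otimes> g = \<one>" using l by simp
      then have "v [^] k = \<one>" using g v(2)
        by (metis inv_closed inv_equality inv_inv int_pow_closed m_assoc m_closed r_inv_ex r_inv l_one r_one)
      then show False using v(4) k by blast
    qed
    moreover have "g \<otimes> v [^] l = v [^] k \<otimes> g"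
      using g v(2) by (simp add: l[symmetric] m_assoc[symmetric])
    ultimately show "\<exists>(k::int) (l::int). k \<noteq> 0 \<and> l \<noteq> 0 \<and> g \<otimes> v [^] k = v [^] l \<otimes> g"
      using k by blast
  qed
  then show ?thesis using that v ell by blast
qed

end

text \<open>Extracts from the tree everything that is used of it later; apart from finite
  generation, the study of G modulo its centre rests on these properties alone.\<close>

lemma gbs_group_algebraic:
  fixes G :: "('a, 'b) monoid_scheme"
  assumes "gbs_group TYPE('v) TYPE('e) G"
  obtains v where "v \<in> carrier G" "\<And>n::int. v [^]\<^bsub>G\<^esub> n = \<one>\<^bsub>G\<^esub> \<Longrightarrow> n = 0" "commensurated G v"
    "\<And>g n. g \<in> carrier G \<Longrightarrow> n > (0::nat) \<Longrightarrow> g [^]\<^bsub>G\<^esub> n = \<one>\<^bsub>G\<^esub> \<Longrightarrow> g = \<one>\<^bsub>G\<^esub>"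
    "\<And>g w. g \<in> carrier G \<Longrightarrow> w \<in> carrier G \<Longrightarrow> g \<otimes>\<^bsub>G\<^esub> w = w \<otimes>\<^bsub>G\<^esub> g \<Longrightarrow> \<not> commensurable G v w \<Longrightarrow>
       \<exists>m>(0::nat). \<exists>q::int. commensurable G v (w [^]\<^bsub>G\<^esub> q \<otimes>\<^bsub>G\<^esub> g [^]\<^bsub>G\<^esub> m)"
proof -
  obtain T :: "('v, 'e) pre_digraph" and arev \<phi> \<psi> where T: "tree_action G T arev \<phi> \<psi>" "Group.group G"
    and stabV: "\<And>x. x \<in> verts T \<Longrightarrow> infinite_cyclic (G\<lparr>carrier := stabilizer G \<phi> x\<rparr>)"
    and stabE: "\<And>e. e \<in> arcs T \<Longrightarrow> infinite_cyclic (G\<lparr>carrier := stabilizer G \<psi> e\<rparr>)"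
    using assms by (auto simp: gbs_group_def)
  interpret bidirected_digraph T arev using T by (simp add: tree_action_def)
  interpret tree_act G T arev \<phi> \<psi>
    using T by (intro tree_act.intro tree_act_axioms.intro bidirected_digraph) auto
  obtain v where v: "v \<in> carrier G" "\<And>n::int. v [^]\<^bsub>G\<^esub> n = \<one>\<^bsub>G\<^esub> \<Longrightarrow> n = 0"
    "\<And>g x. g \<in> carrier G \<Longrightarrow> x \<in> verts T \<Longrightarrow> \<phi> g x = x \<Longrightarrow> commensurable G v g" "commensurated G v"
    using elliptic_commensurable[OF stabV stabE] by blast
  show ?thesis
  proof (rule that[OF v(1,2,4)])
    fix g and n :: nat assume g: "g \<in> carrier G" "n > 0" "g [^]\<^bsub>G\<^esub> n = \<one>\<^bsub>G\<^esub>"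
    obtain x where x: "x \<in> verts T" "\<phi> g x = x" using finite_order_fixes[OF g] by blast
    obtain c where c: "c \<in> carrier G" "stabilizer G \<phi> x = range (\<lambda>n::int. c [^]\<^bsub>G\<^esub> n)"
      "\<And>n::int. c [^]\<^bsub>G\<^esub> n = \<one>\<^bsub>G\<^esub> \<Longrightarrow> n = 0"
      using infinite_cyclic_subgroup[OF V.stabilizer_subgroup[OF x(1)] stabV[OF x(1)]] by metis
    have "g \<in> stabilizer G \<phi> x" using g x by (simp add: stabilizer_def)
    then obtain a :: int where a: "g = c [^]\<^bsub>G\<^esub> a" using c by auto
    have "c [^]\<^bsub>G\<^esub> (a * int n) = \<one>\<^bsub>G\<^esub>" using g(3) a c(1) by (metis int_pow_int int_pow_pow)
    then have "a * int n = 0" by (rule c(3))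
    then show "g = \<one>\<^bsub>G\<^esub>" using a g(2) by simp
  next
    fix g w assume gw: "g \<in> carrier G" "w \<in> carrier G" "g \<otimes>\<^bsub>G\<^esub> w = w \<otimes>\<^bsub>G\<^esub> g" "\<not> commensurable G v w"
    have "\<phi> w x \<noteq> x" if "x \<in> verts T" for x using v(3)[OF gw(2) that] gw(4) by blast
    then obtain m :: nat and q :: int and y where "m > 0" "y \<in> verts T"
      "\<phi> (w [^]\<^bsub>G\<^esub> q \<otimes>\<^bsub>G\<^esub> g [^]\<^bsub>G\<^esub> m) y = y"
      using commuting_elliptic_combination[OF gw(1-3)] by blast
    then show "\<exists>m>(0::nat). \<exists>q::int. commensurable G v (w [^]\<^bsub>G\<^esub> q \<otimes>\<^bsub>G\<^esub> g [^]\<^bsub>G\<^esub> m)"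
      using v(3)[of "w [^]\<^bsub>G\<^esub> q \<otimes>\<^bsub>G\<^esub> g [^]\<^bsub>G\<^esub> m" y] gw by blast
  qed
qed

section \<open>The central extensions with presentation \<open>z\<close> central, \<open>a\<^sub>i\<^bsup>\<nu> i\<^esup> = z\<close>\<close>

datatype hub_gen = HZ | HA nat | HT nat

definition hub_gens :: "nat set \<Rightarrow> nat set \<Rightarrow> hub_gen set" where
  "hub_gens I J = insert HZ (HA ` I \<union> HT ` J)"

definition hub_rels :: "nat set \<Rightarrow> (nat \<Rightarrow> nat) \<Rightarrow> nat set \<Rightarrow> ((hub_gen \<times> bool) list \<times> (hub_gen \<times> bool) list) set" where
  "hub_rels I \<nu> J = {([(HZ, True), (x, True)], [(x, True), (HZ, True)]) | x. x \<in> hub_gens I J} \<union>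
     {(replicate (\<nu> i) (HA i, True), [(HZ, True)]) | i. i \<in> I}"

text \<open>The group H of the overview, with \<open>HZ\<close>, \<open>HA i\<close> and
  \<open>HT j\<close> for its generators. Keeping z as a generator beside its roots makes centrality
  a relation between two letters.\<close>

definition hub :: "nat set \<Rightarrow> (nat \<Rightarrow> nat) \<Rightarrow> nat set \<Rightarrow> (hub_gen \<times> bool) list set monoid" where
  "hub I \<nu> J = presented_group (hub_gens I J) (hub_rels I \<nu> J)"

definition hgen :: "nat set \<Rightarrow> (nat \<Rightarrow> nat) \<Rightarrow> nat set \<Rightarrow> hub_gen \<Rightarrow> (hub_gen \<times> bool) list set" where
  "hgen I \<nu> J x = pgen (hub_gens I J) (hub_rels I \<nu> J) x"

lemma hub_gens_simps [simp]: "HZ \<in> hub_gens I J" "HA i \<in> hub_gens I J \<longleftrightarrow> i \<in> I" "HT j \<in> hub_gens I J \<longleftrightarrow> j \<in> J"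
  by (auto simp: hub_gens_def)

lemma group_hub: "group (hub I \<nu> J)" by (simp add: hub_def group_presented)

lemma hgen_closed [simp]: "x \<in> hub_gens I J \<Longrightarrow> hgen I \<nu> J x \<in> carrier (hub I \<nu> J)"
  by (simp add: hub_def hgen_def)

lemma replicate_in_lists: "x \<in> A \<Longrightarrow> replicate k x \<in> lists A"
  by (induction k) auto

lemma hub_lift:
  assumes "group H" and z: "z \<in> carrier H" and a: "\<And>i. i \<in> I \<Longrightarrow> a i \<in> carrier H" and t: "\<And>j. j \<in> J \<Longrightarrow> t j \<in> carrier H"
    and za: "\<And>i. i \<in> I \<Longrightarrow> z \<otimes>\<^bsub>H\<^esub> a i = a i \<otimes>\<^bsub>H\<^esub> z" and zt: "\<And>j. j \<in> J \<Longrightarrow> z \<otimes>\<^bsub>H\<^esub> t j = t j \<otimes>\<^bsub>H\<^esub> z"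
    and pow: "\<And>i. i \<in> I \<Longrightarrow> a i [^]\<^bsub>H\<^esub> \<nu> i = z"
  obtains h where "h \<in> hom (hub I \<nu> J) H" "h (hgen I \<nu> J HZ) = z"
    "\<And>i. i \<in> I \<Longrightarrow> h (hgen I \<nu> J (HA i)) = a i" "\<And>j. j \<in> J \<Longrightarrow> h (hgen I \<nu> J (HT j)) = t j"
proof -
  interpret H: group H by fact
  define f where "f = case_hub_gen z a t"
  have f: "f x \<in> carrier H" if "x \<in> hub_gens I J" for x using that z a t by (auto simp: f_def hub_gens_def)
  have rel: "word_eval H (letter_val H f) r = word_eval H (letter_val H f) s" if rs: "(r, s) \<in> hub_rels I \<nu> J" for r s
  proof -
    from rs consider x where "x \<in> hub_gens I J" "r = [(HZ, True), (x, True)]" "s = [(x, True), (HZ, True)]"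
      | i where "i \<in> I" "r = replicate (\<nu> i) (HA i, True)" "s = [(HZ, True)]"
      by (auto simp: hub_rels_def)
    then show ?thesis
    proof cases
      case (1 x)
      then show ?thesis using z a t za zt by (auto simp: f_def hub_gens_def)
    next
      case (2 i)
      have "word_eval H (letter_val H f) r = letter_val H f (HA i, True) [^]\<^bsub>H\<^esub> \<nu> i"
        unfolding 2 by (rule H.word_eval_replicate) (use 2 a in \<open>simp add: f_def\<close>)
      then show ?thesis using 2 pow z by (simp add: f_def)
    qed
  qed
  obtain h where h: "h \<in> hom (presented_group (hub_gens I J) (hub_rels I \<nu> J)) H"
    "\<And>x. x \<in> hub_gens I J \<Longrightarrow> h (pgen (hub_gens I J) (hub_rels I \<nu> J) x) = f x"
    using presented_group_lift[OF \<open>group H\<close>, of f "hub_gens I J" "hub_rels I \<nu> J"] f rel by blast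
  show ?thesis
  proof (rule that)
    show "h \<in> hom (hub I \<nu> J) H" using h(1) by (simp only: hub_def)
  qed (use h(2) in \<open>auto simp: f_def hgen_def\<close>)
qed

lemma hub_hom_eq:
  assumes "group H" "h \<in> hom (hub I \<nu> J) H" "h' \<in> hom (hub I \<nu> J) H"
    and "h (hgen I \<nu> J HZ) = h' (hgen I \<nu> J HZ)"
    and "\<And>i. i \<in> I \<Longrightarrow> h (hgen I \<nu> J (HA i)) = h' (hgen I \<nu> J (HA i))"
    and "\<And>j. j \<in> J \<Longrightarrow> h (hgen I \<nu> J (HT j)) = h' (hgen I \<nu> J (HT j))"
    and "p \<in> carrier (hub I \<nu> J)"
  shows "h p = h' p"
  using assms unfolding hub_def hgen_def
  by - (rule presented_group_hom_eq[of H h "hub_gens I J" "hub_rels I \<nu> J" h'], auto simp: hub_gens_def)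

lemma hub_pow: assumes "i \<in> I" shows "hgen I \<nu> J (HA i) [^]\<^bsub>hub I \<nu> J\<^esub> \<nu> i = hgen I \<nu> J HZ"
proof -
  interpret group "hub I \<nu> J" by (rule group_hub)
  let ?v = "letter_val (hub I \<nu> J) (hgen I \<nu> J)"
  have "word_eval (hub I \<nu> J) ?v (replicate (\<nu> i) (HA i, True)) = word_eval (hub I \<nu> J) ?v [(HZ, True)]"
    unfolding hub_def hgen_def
    by (rule presented_group_rel) (use assms in \<open>auto simp: hub_rels_def intro!: replicate_in_lists\<close>)
  moreover have "word_eval (hub I \<nu> J) ?v (replicate (\<nu> i) (HA i, True)) = ?v (HA i, True) [^]\<^bsub>hub I \<nu> J\<^esub> \<nu> i"
    by (rule word_eval_replicate) (use assms in simp)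
  ultimately show ?thesis by simp
qed

lemma (in group) commutes_inv:
  assumes "c \<otimes> x = x \<otimes> c" "c \<in> carrier G" "x \<in> carrier G"
  shows "c \<otimes> inv x = inv x \<otimes> c"
  using assms by (metis inv_closed inv_solve_left inv_solve_right m_assoc m_closed)

lemma (in group) commutes_mult:
  assumes "c \<otimes> x = x \<otimes> c" "c \<otimes> y = y \<otimes> c" "c \<in> carrier G" "x \<in> carrier G" "y \<in> carrier G"
  shows "c \<otimes> (x \<otimes> y) = x \<otimes> y \<otimes> c"
  using assms by (metis m_assoc)

lemma presented_group_central:
  assumes c: "c \<in> carrier (presented_group X R)"
    and gen: "\<And>x. x \<in> X \<Longrightarrow> c \<otimes>\<^bsub>presented_group X R\<^esub> pgen X R x = pgen X R x \<otimes>\<^bsub>presented_group X R\<^esub> c"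
    and "p \<in> carrier (presented_group X R)"
  shows "c \<otimes>\<^bsub>presented_group X R\<^esub> p = p \<otimes>\<^bsub>presented_group X R\<^esub> c"
proof -
  interpret group "presented_group X R" by (rule group_presented)
  show ?thesis using assms(3)
  proof (induction rule: presented_group_induct)
    case (gen x p)
    then show ?case using assms(2)[of x] c by (intro commutes_mult) auto
  next
    case (inv x p)
    then show ?case using assms(2)[of x] c by (intro commutes_mult commutes_inv) auto
  qed (use c in auto)
qed

lemma hub_central:
  assumes "p \<in> carrier (hub I \<nu> J)"
  shows "hgen I \<nu> J HZ \<otimes>\<^bsub>hub I \<nu> J\<^esub> p = p \<otimes>\<^bsub>hub I \<nu> J\<^esub> hgen I \<nu> J HZ"
  unfolding hub_def hgen_def
proof (rule presented_group_central)
  let ?P = "presented_group (hub_gens I J) (hub_rels I \<nu> J)"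
  interpret group ?P by (rule group_presented)
  fix x assume x: "x \<in> hub_gens I J"
  have "word_eval ?P (letter_val ?P (pgen (hub_gens I J) (hub_rels I \<nu> J))) [(HZ, True), (x, True)] =
      word_eval ?P (letter_val ?P (pgen (hub_gens I J) (hub_rels I \<nu> J))) [(x, True), (HZ, True)]"
    by (rule presented_group_rel) (use x in \<open>auto simp: hub_rels_def\<close>)
  then show "pgen (hub_gens I J) (hub_rels I \<nu> J) HZ \<otimes>\<^bsub>?P\<^esub> pgen (hub_gens I J) (hub_rels I \<nu> J) x =
     pgen (hub_gens I J) (hub_rels I \<nu> J) x \<otimes>\<^bsub>?P\<^esub> pgen (hub_gens I J) (hub_rels I \<nu> J) HZ"
    using x by simp
qed (use assms in \<open>auto simp: hub_def\<close>)

section \<open>Baumslag--Solitar groups\<close>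

definition bs_rels :: "nat \<Rightarrow> ((bs_gen \<times> bool) list \<times> (bs_gen \<times> bool) list) set" where
  "bs_rels n = {([(BS_t, True)] @ replicate n (BS_a, True) @ [(BS_t, False)], replicate n (BS_a, True))}"

definition bsa where "bsa n = pgen UNIV (bs_rels n) BS_a"
definition bst where "bst n = pgen UNIV (bs_rels n) BS_t"

lemma BS_alt: "BS n n = presented_group UNIV (bs_rels n)"
  by (simp add: BS_def bs_rels_def)

lemma group_BS: "group (BS n n)" by (simp add: BS_alt group_presented)

lemma bs_gens_closed [simp]: "bsa n \<in> carrier (BS n n)" "bst n \<in> carrier (BS n n)"
  by (auto simp: BS_alt bsa_def bst_def)

lemma BS_induct [consumes 1, case_names one a t ai ti]:
  assumes "p \<in> carrier (BS n n)" "Q \<one>\<^bsub>BS n n\<^esub>"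
    and "\<And>p. p \<in> carrier (BS n n) \<Longrightarrow> Q p \<Longrightarrow> Q (bsa n \<otimes>\<^bsub>BS n n\<^esub> p)"
    and "\<And>p. p \<in> carrier (BS n n) \<Longrightarrow> Q p \<Longrightarrow> Q (bst n \<otimes>\<^bsub>BS n n\<^esub> p)"
    and "\<And>p. p \<in> carrier (BS n n) \<Longrightarrow> Q p \<Longrightarrow> Q (inv\<^bsub>BS n n\<^esub> bsa n \<otimes>\<^bsub>BS n n\<^esub> p)"
    and "\<And>p. p \<in> carrier (BS n n) \<Longrightarrow> Q p \<Longrightarrow> Q (inv\<^bsub>BS n n\<^esub> bst n \<otimes>\<^bsub>BS n n\<^esub> p)"
  shows "Q p"
  using assms(1) unfolding BS_alt
proof (induction rule: presented_group_induct)
  case one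
  then show ?case using assms(2) by (simp add: BS_alt)
next
  case (gen x p)
  then show ?case using assms(3,4)[of p] by (cases x) (auto simp: BS_alt bsa_def bst_def)
next
  case (inv x p)
  then show ?case using assms(5,6)[of p] by (cases x) (auto simp: BS_alt bsa_def bst_def)
qed

lemma bsa_pow_central:
  assumes "p \<in> carrier (BS n n)"
  shows "bsa n [^]\<^bsub>BS n n\<^esub> n \<otimes>\<^bsub>BS n n\<^esub> p = p \<otimes>\<^bsub>BS n n\<^esub> bsa n [^]\<^bsub>BS n n\<^esub> n"
proof -
  interpret group "BS n n" by (rule group_BS)
  let ?v = "letter_val (BS n n) (pgen UNIV (bs_rels n))"
  have v: "?v \<in> UNIV \<times> UNIV \<rightarrow> carrier (BS n n)"
    by (auto simp: letter_val_def BS_alt intro!: group.inv_closed[OF group_presented])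
  have l: "replicate n (BS_a, True) \<in> lists (UNIV \<times> UNIV)" by (intro replicate_in_lists) auto
  have r: "word_eval (BS n n) ?v (replicate n (BS_a, True)) = bsa n [^]\<^bsub>BS n n\<^esub> n"
    using word_eval_replicate[of ?v "(BS_a, True)" n] by (simp add: bsa_def[symmetric])
  have "word_eval (BS n n) ?v ([(BS_t, True)] @ replicate n (BS_a, True) @ [(BS_t, False)]) =
      word_eval (BS n n) ?v (replicate n (BS_a, True))"
    unfolding BS_alt by (rule presented_group_rel) (use l in \<open>auto simp: bs_rels_def\<close>)
  then have "bst n \<otimes>\<^bsub>BS n n\<^esub> (bsa n [^]\<^bsub>BS n n\<^esub> n \<otimes>\<^bsub>BS n n\<^esub> inv\<^bsub>BS n n\<^esub> bst n) = bsa n [^]\<^bsub>BS n n\<^esub> n"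
    using word_eval_append[OF v l, of "[(BS_t, False)]"] r by (simp add: bst_def[symmetric])
  then have *: "bsa n [^]\<^bsub>BS n n\<^esub> n \<otimes>\<^bsub>BS n n\<^esub> bst n = bst n \<otimes>\<^bsub>BS n n\<^esub> bsa n [^]\<^bsub>BS n n\<^esub> n"
    by (metis bs_gens_closed inv_closed inv_solve_right m_assoc m_closed nat_pow_closed)
  show ?thesis unfolding BS_alt
  proof (rule presented_group_central[OF _ _ assms[unfolded BS_alt]])
    fix x :: bs_gen
    show "bsa n [^]\<^bsub>presented_group UNIV (bs_rels n)\<^esub> n \<otimes>\<^bsub>presented_group UNIV (bs_rels n)\<^esub> pgen UNIV (bs_rels n) x =
      pgen UNIV (bs_rels n) x \<otimes>\<^bsub>presented_group UNIV (bs_rels n)\<^esub> bsa n [^]\<^bsub>presented_group UNIV (bs_rels n)\<^esub> n"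
      using * nat_pow_comm[of "bsa n" n 1] by (cases x) (auto simp: BS_alt[symmetric] bsa_def[symmetric] bst_def[symmetric])
  qed (auto simp: BS_alt[symmetric])
qed

text \<open>Applied to sets whose points carry a coordinate in some group: a and t permute the other
  coordinates and multiply this one. The inverse letters act by maps of their own, which must be
  given explicitly.\<close>

lemma BS_action:
  assumes maps: "\<And>s. s \<in> S \<Longrightarrow> fa s \<in> S" "\<And>s. s \<in> S \<Longrightarrow> fa' s \<in> S" "\<And>s. s \<in> S \<Longrightarrow> ft s \<in> S" "\<And>s. s \<in> S \<Longrightarrow> ft' s \<in> S"
    and inverse: "\<And>s. s \<in> S \<Longrightarrow> fa (fa' s) = s" "\<And>s. s \<in> S \<Longrightarrow> fa' (fa s) = s"
      "\<And>s. s \<in> S \<Longrightarrow> ft (ft' s) = s" "\<And>s. s \<in> S \<Longrightarrow> ft' (ft s) = s"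
    and rel: "\<And>s. s \<in> S \<Longrightarrow> ft ((fa ^^ n) (ft' s)) = (fa ^^ n) s"
  obtains \<Phi> where "\<And>s. s \<in> S \<Longrightarrow> \<Phi> (bsa n) s = fa s" "\<And>s. s \<in> S \<Longrightarrow> \<Phi> (bst n) s = ft s"
    "\<And>p s. p \<in> carrier (BS n n) \<Longrightarrow> s \<in> S \<Longrightarrow> \<Phi> p s \<in> S"
    "\<And>s. s \<in> S \<Longrightarrow> \<Phi> \<one>\<^bsub>BS n n\<^esub> s = s"
    "\<And>p q s. p \<in> carrier (BS n n) \<Longrightarrow> q \<in> carrier (BS n n) \<Longrightarrow> s \<in> S \<Longrightarrow> \<Phi> (p \<otimes>\<^bsub>BS n n\<^esub> q) s = \<Phi> p (\<Phi> q s)"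
proof -
  define act where "act = (\<lambda>(x, b) s. case x of BS_a \<Rightarrow> (if b then fa s else fa' s) | BS_t \<Rightarrow> (if b then ft s else ft' s))"
  have act: "act (BS_a, True) = fa" "act (BS_a, False) = fa'" "act (BS_t, True) = ft" "act (BS_t, False) = ft'"
    by (auto simp: act_def)
  have cl: "act x s \<in> S" if "s \<in> S" for x s
    using that maps by (cases x; cases "fst x") (auto simp: act_def)
  have rel': "foldr act r s = foldr act t s" if rt: "(r, t) \<in> pres_rels UNIV (bs_rels n)" "s \<in> S" for r t s
    using rt(1) unfolding pres_rels_def
  proof
    assume "(r, t) \<in> bs_rels n"
    then show ?thesis using rel[OF rt(2)] by (simp add: bs_rels_def foldr_replicate act)
  next
    assume "(r, t) \<in> {([(x, b), (x, \<not> b)], []) |x b. x \<in> UNIV}"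
    then obtain x b where "r = [(x, b), (x, \<not> b)]" "t = []" by auto
    then show ?thesis using inverse rt(2) by (cases x; cases b) (auto simp: act)
  qed
  have "\<exists>\<Phi>. (\<forall>w\<in>lists (UNIV \<times> UNIV). \<forall>s\<in>S. \<Phi> (pcls UNIV (bs_rels n) w) s = foldr act w s) \<and>
    (\<forall>p\<in>carrier (BS n n). \<forall>s\<in>S. \<Phi> p s \<in> S) \<and> (\<forall>s\<in>S. \<Phi> \<one>\<^bsub>BS n n\<^esub> s = s) \<and>
    (\<forall>p\<in>carrier (BS n n). \<forall>q\<in>carrier (BS n n). \<forall>s\<in>S. \<Phi> (p \<otimes>\<^bsub>BS n n\<^esub> q) s = \<Phi> p (\<Phi> q s))"
    unfolding BS_alt presented_group_alt pcls_def
    by (rule word_quotient_action) (use cl rel' in blast)+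
  then obtain \<Phi> where \<Phi>: "\<forall>w\<in>lists (UNIV \<times> UNIV). \<forall>s\<in>S. \<Phi> (pcls UNIV (bs_rels n) w) s = foldr act w s"
    "\<forall>p\<in>carrier (BS n n). \<forall>s\<in>S. \<Phi> p s \<in> S" "\<forall>s\<in>S. \<Phi> \<one>\<^bsub>BS n n\<^esub> s = s"
    "\<forall>p\<in>carrier (BS n n). \<forall>q\<in>carrier (BS n n). \<forall>s\<in>S. \<Phi> (p \<otimes>\<^bsub>BS n n\<^esub> q) s = \<Phi> p (\<Phi> q s)"
    by (elim exE conjE) (rule that)
  show ?thesis by (rule that[of \<Phi>]) (use \<Phi> in \<open>auto simp: bsa_def bst_def act\<close>)
qed

lemma funpow_fixed_step:
  assumes "\<And>s. s \<in> S \<Longrightarrow> f s \<in> S" "s \<in> S"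
  shows "(f ^^ k) s \<in> S"
  using assms by (induction k) auto

section \<open>Embedding into the Baumslag--Solitar group\<close>

lemma (in group) conj_nat_pow:
  assumes "c \<in> carrier G" "v \<in> carrier G"
  shows "(inv c \<otimes> v \<otimes> c) [^] (k::nat) = inv c \<otimes> v [^] k \<otimes> c"
  using conj_int_pow[OF assms, of "int k"] by (simp add: int_pow_int)

text \<open>The group \<open>BS n n\<close> acts on \<open>X \<times> P\<close>, where \<open>P\<close> is the group to be embedded and \<open>X\<close> is a set of pairs
  \<open>(i, r)\<close> on which \<open>a\<close> has the orbits \<open>{i} \<times> {0..<m i}\<close>. Running once through the \<open>i\<close>-th orbit multiplies by
  \<open>ca i\<close>, and fixing \<open>(i, 1)\<close> with \<open>t\<close> multiplies by \<open>ct i\<close>. The orbits at even \<open>i\<close> produce the generators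
  \<open>a\<^sub>i\<close> and those at odd \<open>i\<close> the generators \<open>t\<^sub>j\<close>; the elements of \<open>BS n n\<close> which move \<open>((0, 0), q)\<close> to
  \<open>((0, 0), p q)\<close> for all \<open>q\<close> then form a preimage of \<open>P\<close>.\<close>

lemma hub_embeds_BS:
  assumes n: "n \<ge> 2" and \<nu>: "\<And>i. i \<in> I \<Longrightarrow> \<nu> i dvd n"
  shows "mon (hub I \<nu> J) (BS n n) \<noteq> {}"
proof -
  interpret B: group "BS n n" by (rule group_BS)
  let ?P = "hub I \<nu> J"
  interpret P: group ?P by (rule group_hub)
  let ?g = "hgen I \<nu> J"
  let ?z = "?g HZ"
  \<comment> \<open>The orbits are indexed by all integers so that their shift by t is invertible.
    The index 2k stands for the k-th root, 2j + 1 for the j-th stable letter, and all other indices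
    are padding.\<close>
  define ev where "ev i \<longleftrightarrow> i \<ge> 0 \<and> even i \<and> nat (i div 2) \<in> I" for i :: int
  \<comment> \<open>The length is chosen so that a^n runs \<open>\<nu> i\<close> times round the
    orbit of the i-th root and once round every other orbit. It thus multiplies by z everywhere,
    which is central, and so commutes with t.\<close>
  define m where "m i = (if ev i then n div \<nu> (nat (i div 2)) else n)" for i :: int
  define ca where "ca i = (if ev i then ?g (HA (nat (i div 2))) else ?z)" for i :: int
  define ct where "ct i = (if i \<ge> 0 \<and> odd i \<and> nat (i div 2) \<in> J then ?g (HT (nat (i div 2))) else \<one>\<^bsub>?P\<^esub>)" for i :: int
  have ca [simp]: "ca i \<in> carrier ?P" for i by (auto simp: ca_def ev_def)
  have ct [simp]: "ct i \<in> carrier ?P" for i by (auto simp: ct_def)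
  have m0: "m i > 0" for i
    using n \<nu>[of "nat (i div 2)"] by (auto simp: m_def ev_def intro!: Nat.gr0I dest!: dvd_div_eq_0_iff[THEN iffD1, rotated])
  have mca: "\<exists>k. n = m i * k \<and> ca i [^]\<^bsub>?P\<^esub> k = ?z" for i
  proof (cases "ev i")
    case True
    then show ?thesis using hub_pow[of "nat (i div 2)" I \<nu> J] \<nu>[of "nat (i div 2)"]
      by (intro exI[of _ "\<nu> (nat (i div 2))"]) (auto simp: m_def ca_def ev_def)
  qed (auto simp: m_def ca_def intro!: exI[of _ 1])
  define S where "S = {(i :: int, r :: nat, p). r < m i \<and> p \<in> carrier ?P}"
  define fa where "fa = (\<lambda>(i, r, p). if Suc r = m i then (i, 0, ca i \<otimes>\<^bsub>?P\<^esub> p) else (i, Suc r, p))"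
  define fa' where "fa' = (\<lambda>(i, r, p). if r = 0 then (i, m i - 1, inv\<^bsub>?P\<^esub> ca i \<otimes>\<^bsub>?P\<^esub> p) else (i, r - 1, p))"
  \<comment> \<open>Position 0 serves to travel between the orbits, position 1 to produce the stable
    letters; the remaining positions are fixed.\<close>
  define ft where "ft = (\<lambda>(i :: int, r :: nat, p). if r = 0 then (i + 1, 0, p) else if r = 1 then (i, 1, ct i \<otimes>\<^bsub>?P\<^esub> p) else (i, r, p))"
  define ft' where "ft' = (\<lambda>(i :: int, r :: nat, p). if r = 0 then (i - 1, 0, p) else if r = 1 then (i, 1, inv\<^bsub>?P\<^esub> ct i \<otimes>\<^bsub>?P\<^esub> p) else (i, r, p))"
  have fS: "fa s \<in> S" "fa' s \<in> S" "ft s \<in> S" "ft' s \<in> S" if "s \<in> S" for s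
    using that m0 by (auto simp: S_def fa_def fa'_def ft_def ft'_def split: if_splits)
  have finv: "fa (fa' s) = s" "fa' (fa s) = s" "ft (ft' s) = s" "ft' (ft s) = s" if "s \<in> S" for s
    using that m0 by (auto simp: S_def fa_def fa'_def ft_def ft'_def P.m_assoc[symmetric] split: if_splits)
  have fa_step: "(fa ^^ k) (i, r, p) = (i, r + k, p)" if "r + k < m i" for k i r p
    using that by (induction k) (auto simp: fa_def)
  have fa_wrap: "(fa ^^ (m i - r)) (i, r, p) = (i, 0, ca i \<otimes>\<^bsub>?P\<^esub> p)" if "r < m i" for i r p
  proof -
    define k where "k = m i - r - 1"
    have k: "m i - r = Suc k" using that by (simp add: k_def)
    then have "r + k < m i" "Suc (r + k) = m i" using that by linarith+
    moreover have "(fa ^^ (m i - r)) (i, r, p) = fa ((fa ^^ k) (i, r, p))" unfolding k by simp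
    ultimately show ?thesis using fa_step[of r k i p] by (simp add: fa_def)
  qed
  have fa_m: "(fa ^^ m i) (i, r, p) = (i, r, ca i \<otimes>\<^bsub>?P\<^esub> p)" if "r < m i" for i r p
  proof -
    have "(fa ^^ m i) (i, r, p) = (fa ^^ r) ((fa ^^ (m i - r)) (i, r, p))"
      using that by (simp flip: funpow_add o_apply[of "fa ^^ r"])
    then show ?thesis using fa_wrap[OF that] fa_step[of 0 r i] that by simp
  qed
  have fa_mk: "(fa ^^ (m i * k)) (i, r, p) = (i, r, ca i [^]\<^bsub>?P\<^esub> k \<otimes>\<^bsub>?P\<^esub> p)" if "r < m i" "p \<in> carrier ?P" for i r p k
  proof (induction k)
    case (Suc k)
    have "(fa ^^ (m i * Suc k)) (i, r, p) = (fa ^^ m i) ((fa ^^ (m i * k)) (i, r, p))"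
      by (simp add: funpow_add)
    then show ?case using Suc fa_m that P.nat_pow_Suc2[of "ca i" k] by (simp add: P.m_assoc)
  qed (use that in simp)
  have fa_n: "(fa ^^ n) (i, r, p) = (i, r, ?z \<otimes>\<^bsub>?P\<^esub> p)" if "r < m i" "p \<in> carrier ?P" for i r p
    using mca[of i] fa_mk[OF that] by auto
  have zc: "?z \<otimes>\<^bsub>?P\<^esub> (p \<otimes>\<^bsub>?P\<^esub> q) = p \<otimes>\<^bsub>?P\<^esub> (?z \<otimes>\<^bsub>?P\<^esub> q)" if "p \<in> carrier ?P" "q \<in> carrier ?P" for p q
    using that hub_central[OF that(1)] by (simp add: P.m_assoc[symmetric])
  have rel: "ft ((fa ^^ n) (ft' s)) = (fa ^^ n) s" if s: "s \<in> S" for s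
  proof -
    obtain i r p where s': "s = (i, r, p)" "r < m i" "p \<in> carrier ?P" using s by (auto simp: S_def)
    then show ?thesis using m0 zc by (auto simp: ft_def ft'_def fa_n P.m_assoc[symmetric] zc)
  qed
  obtain \<Phi> where \<Phi>a: "\<And>s. s \<in> S \<Longrightarrow> \<Phi> (bsa n) s = fa s" and \<Phi>t: "\<And>s. s \<in> S \<Longrightarrow> \<Phi> (bst n) s = ft s"
    and \<Phi>S: "\<And>p s. p \<in> carrier (BS n n) \<Longrightarrow> s \<in> S \<Longrightarrow> \<Phi> p s \<in> S"
    and \<Phi>1: "\<And>s. s \<in> S \<Longrightarrow> \<Phi> \<one>\<^bsub>BS n n\<^esub> s = s"
    and \<Phi>m: "\<And>p q s. p \<in> carrier (BS n n) \<Longrightarrow> q \<in> carrier (BS n n) \<Longrightarrow> s \<in> S \<Longrightarrow> \<Phi> (p \<otimes>\<^bsub>BS n n\<^esub> q) s = \<Phi> p (\<Phi> q s)"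
    by (rule BS_action[OF fS finv rel]) (assumption | rule that)+
  have \<Phi>inv: "\<Phi> (inv\<^bsub>BS n n\<^esub> x) s' = s" if "x \<in> carrier (BS n n)" "s \<in> S" "\<Phi> x s = s'" for x s s'
    using \<Phi>m[of "inv\<^bsub>BS n n\<^esub> x" x s] that \<Phi>1 by simp
  have \<Phi>pow: "\<Phi> (x [^]\<^bsub>BS n n\<^esub> (k::nat)) s = (\<Phi> x ^^ k) s" if "x \<in> carrier (BS n n)" "s \<in> S" for x k s
  proof (induction k)
    case (Suc k)
    show ?case using Suc B.nat_pow_Suc2[OF that(1), of k] \<Phi>m[of x "x [^]\<^bsub>BS n n\<^esub> k" s] that by simp
  qed (use that \<Phi>1 in simp)
  have \<Phi>apow: "\<Phi> (bsa n [^]\<^bsub>BS n n\<^esub> k) s = (fa ^^ k) s" if "s \<in> S" for k s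
  proof -
    have "(\<Phi> (bsa n) ^^ k) s = (fa ^^ k) s"
      by (induction k) (use \<Phi>a funpow_fixed_step[of S fa, OF fS(1) that] in auto)
    then show ?thesis using \<Phi>pow that by simp
  qed
  define tp where "tp k = bst n [^]\<^bsub>BS n n\<^esub> (k::nat)" for k
  have tpc [simp]: "tp k \<in> carrier (BS n n)" for k by (simp add: tp_def)
  have s0: "(i, 0, q) \<in> S" if "q \<in> carrier ?P" for i q using m0 that by (simp add: S_def)
  have \<Phi>tp: "\<Phi> (tp k) (0, 0, q) = (int k, 0, q)" if q: "q \<in> carrier ?P" for k q
  proof (induction k)
    case (Suc k)
    have "\<Phi> (tp (Suc k)) (0, 0, q) = \<Phi> (bst n) (\<Phi> (tp k) (0, 0, q))"
      using B.nat_pow_Suc2[of "bst n" k] \<Phi>m[of "bst n" "tp k" "(0, 0, q)"] s0[OF q] by (simp add: tp_def)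
    then show ?case using Suc \<Phi>t[OF s0[OF q]] by (simp add: ft_def)
  qed (use \<Phi>1[OF s0[OF q]] in \<open>simp add: tp_def\<close>)
  have \<Phi>tpi: "\<Phi> (inv\<^bsub>BS n n\<^esub> tp k) (int k, 0, q) = (0, 0, q)" if q: "q \<in> carrier ?P" for k q
    using \<Phi>inv[OF tpc s0[OF q] \<Phi>tp[OF q]] .
  \<comment> \<open>Travel to the orbit with index 2i, run once round it, and return.\<close>
  define ga where "ga i = inv\<^bsub>BS n n\<^esub> tp (2 * i) \<otimes>\<^bsub>BS n n\<^esub> bsa n [^]\<^bsub>BS n n\<^esub> (n div \<nu> i) \<otimes>\<^bsub>BS n n\<^esub> tp (2 * i)" for i
  \<comment> \<open>Moves the base point to position 1 of the orbit with index 2j + 1, where t fixes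
    the position and multiplies by the stable letter.\<close>
  define c where "c j = bsa n \<otimes>\<^bsub>BS n n\<^esub> tp (2 * j + 1)" for j
  define gt where "gt j = inv\<^bsub>BS n n\<^esub> c j \<otimes>\<^bsub>BS n n\<^esub> bst n \<otimes>\<^bsub>BS n n\<^esub> c j" for j
  have cc [simp]: "c j \<in> carrier (BS n n)" for j by (simp add: c_def)
  obtain \<gamma> where \<gamma>: "\<gamma> \<in> hom ?P (BS n n)" "\<gamma> ?z = bsa n [^]\<^bsub>BS n n\<^esub> n"
    "\<And>i. i \<in> I \<Longrightarrow> \<gamma> (?g (HA i)) = ga i" "\<And>j. j \<in> J \<Longrightarrow> \<gamma> (?g (HT j)) = gt j"
  proof (rule hub_lift[OF group_BS, of "bsa n [^]\<^bsub>BS n n\<^esub> n" n I ga J gt \<nu>])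
    fix i assume i: "i \<in> I"
    have "ga i [^]\<^bsub>BS n n\<^esub> \<nu> i = inv\<^bsub>BS n n\<^esub> tp (2 * i) \<otimes>\<^bsub>BS n n\<^esub> bsa n [^]\<^bsub>BS n n\<^esub> n \<otimes>\<^bsub>BS n n\<^esub> tp (2 * i)"
      unfolding ga_def using \<nu>[OF i] by (simp add: B.conj_nat_pow B.nat_pow_pow)
    also have "\<dots> = bsa n [^]\<^bsub>BS n n\<^esub> n"
      using bsa_pow_central[of "tp (2 * i)" n] by (simp add: B.m_assoc) (simp add: B.m_assoc[symmetric])
    finally show "ga i [^]\<^bsub>BS n n\<^esub> \<nu> i = bsa n [^]\<^bsub>BS n n\<^esub> n" .
  qed (auto simp: ga_def gt_def bsa_pow_central)
  interpret \<gamma>: group_hom ?P "BS n n" \<gamma> using \<gamma>(1) by unfold_locales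
  have act_gen: "\<Phi> (\<gamma> (?g x)) (0, 0, q) = (0, 0, ?g x \<otimes>\<^bsub>?P\<^esub> q)" if x: "x \<in> hub_gens I J" and q: "q \<in> carrier ?P" for x q
  proof (cases x)
    case HZ
    then show ?thesis using \<gamma>(2) \<Phi>apow[OF s0[OF q], of n] fa_n[OF m0 q] by simp
  next
    case (HA i)
    then have i: "i \<in> I" using x by simp
    have evi: "ev (int (2 * i))" "m (int (2 * i)) = n div \<nu> i" "ca (int (2 * i)) = ?g (HA i)"
      using i by (auto simp: ev_def m_def ca_def)
    have "\<Phi> (ga i) (0, 0, q) = \<Phi> (inv\<^bsub>BS n n\<^esub> tp (2 * i)) (\<Phi> (bsa n [^]\<^bsub>BS n n\<^esub> (n div \<nu> i)) (\<Phi> (tp (2 * i)) (0, 0, q)))"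
      unfolding ga_def using s0[OF q] by (simp add: \<Phi>m \<Phi>S)
    also have "\<dots> = (0, 0, ?g (HA i) \<otimes>\<^bsub>?P\<^esub> q)"
      using \<Phi>tp[OF q] \<Phi>apow[OF s0[OF q]] fa_m[OF m0, of "int (2 * i)" q] evi \<Phi>tpi[of "?g (HA i) \<otimes>\<^bsub>?P\<^esub> q" "2 * i"] q i by simp
    finally show ?thesis using \<gamma>(3)[OF i] HA by simp
  next
    case (HT j)
    then have j: "j \<in> J" using x by simp
    let ?i = "int (2 * j + 1)"
    have od: "m ?i = n" "ct ?i = ?g (HT j)" using j by (auto simp: m_def ev_def ct_def nat_add_distrib)
    have cq: "\<Phi> (c j) (0, 0, q') = (?i, 1, q')" if "q' \<in> carrier ?P" for q'
      unfolding c_def using \<Phi>m[of "bsa n" "tp (2 * j + 1)"] s0[OF that] \<Phi>tp[OF that] \<Phi>a[OF s0[OF that]] od n by (simp add: fa_def)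
    \<comment> \<open>Position 1 exists here because the orbit has length n and n is at least
      2.\<close>
    have s1: "(?i, 1, q') \<in> S" if "q' \<in> carrier ?P" for q' using that od n by (simp add: S_def)
    have "\<Phi> (gt j) (0, 0, q) = \<Phi> (inv\<^bsub>BS n n\<^esub> c j) (\<Phi> (bst n) (\<Phi> (c j) (0, 0, q)))"
      unfolding gt_def using s0[OF q] by (simp add: \<Phi>m \<Phi>S)
    also have "\<dots> = \<Phi> (inv\<^bsub>BS n n\<^esub> c j) (?i, 1, ?g (HT j) \<otimes>\<^bsub>?P\<^esub> q)"
      using cq[OF q] \<Phi>t[OF s1[OF q]] od by (simp add: ft_def)
    also have "\<dots> = (0, 0, ?g (HT j) \<otimes>\<^bsub>?P\<^esub> q)"
      by (rule \<Phi>inv[OF cc s0 cq]) (use q j in auto)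
    finally show ?thesis using \<gamma>(4)[OF j] HT by simp
  qed
  have act: "\<forall>q\<in>carrier ?P. \<Phi> (\<gamma> p) (0, 0, q) = (0, 0, p \<otimes>\<^bsub>?P\<^esub> q)" if "p \<in> carrier ?P" for p
    using that unfolding hub_def
  proof (induction rule: presented_group_induct)
    case one
    then show ?case using \<Phi>1[OF s0] by (simp add: hub_def[symmetric])
  next
    case (gen x p)
    have *: "pgen (hub_gens I J) (hub_rels I \<nu> J) x = ?g x" by (simp add: hgen_def)
    show ?case using gen act_gen[OF gen(1)] s0 by (simp add: * hub_def[symmetric] \<Phi>m P.m_assoc)
  next
    case (inv x p)
    have *: "pgen (hub_gens I J) (hub_rels I \<nu> J) x = ?g x" by (simp add: hgen_def)
    have "\<Phi> (inv\<^bsub>BS n n\<^esub> \<gamma> (?g x)) (0, 0, q) = (0, 0, inv\<^bsub>?P\<^esub> ?g x \<otimes>\<^bsub>?P\<^esub> q)" if q: "q \<in> carrier ?P" for q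
      by (rule \<Phi>inv[OF _ s0]) (use act_gen[OF inv(1), of "inv\<^bsub>?P\<^esub> ?g x \<otimes>\<^bsub>?P\<^esub> q"] inv q in \<open>auto simp: P.m_assoc[symmetric]\<close>)
    then show ?case using inv s0 by (simp add: * hub_def[symmetric] \<Phi>m P.m_assoc)
  qed
  \<comment> \<open>The image of the base point with group coordinate 1 displays p.\<close>
  have "inj_on \<gamma> (carrier ?P)"
  proof (rule inj_onI)
    fix p q assume pq: "p \<in> carrier ?P" "q \<in> carrier ?P" "\<gamma> p = \<gamma> q"
    have "(0::int, 0::nat, p \<otimes>\<^bsub>?P\<^esub> \<one>\<^bsub>?P\<^esub>) = (0, 0, q \<otimes>\<^bsub>?P\<^esub> \<one>\<^bsub>?P\<^esub>)" using act pq P.one_closed by metis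
    then show "p = q" using pq by simp
  qed
  then have "\<gamma> \<in> mon ?P (BS n n)" using \<gamma>(1) by (simp add: mon_def)
  then show ?thesis by blast
qed

section \<open>Labelled graphs\<close>

definition pi_alph :: "('v, 'e) pre_digraph \<Rightarrow> ('v \<times> int + 'e) set" where
  "pi_alph \<Gamma> = Inl ` (verts \<Gamma> \<times> UNIV) \<union> Inr ` arcs \<Gamma>"

definition pi_rels :: "('v, 'e) pre_digraph \<Rightarrow> ('e \<Rightarrow> 'e) \<Rightarrow> ('e \<Rightarrow> int) \<Rightarrow> 'e set \<Rightarrow>
    (('v \<times> int + 'e) list \<times> ('v \<times> int + 'e) list) set" where
  "pi_rels \<Gamma> arev lab F =
       {([Inl (v, 0)], []) | v. v \<in> verts \<Gamma>} \<union>
        {([Inl (v, g), Inl (v, h)], [Inl (v, g + h)]) | v g h. v \<in> verts \<Gamma>} \<union>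
        {([Inr e, Inr (arev e)], []) | e. e \<in> arcs \<Gamma>} \<union>
        {([Inr e, Inl (head \<Gamma> e, lab (arev e) * g), Inr (arev e)], [Inl (tail \<Gamma> e, lab e * g)]) | e g.
           e \<in> arcs \<Gamma>} \<union>
        {([Inr e], []) | e. e \<in> F}"

abbreviation pi1Z where
  "pi1Z \<Gamma> arev lab F \<equiv> pi1_graph_of_groups \<Gamma> arev (\<lambda>_. integer_group) (\<lambda>_. integer_group) (\<lambda>e k. lab e * k) F"

lemma pi1Z_alt: "pi1Z \<Gamma> arev lab F = word_quotient (pi_alph \<Gamma>) (pi_rels \<Gamma> arev lab F)"
  by (simp add: pi1_graph_of_groups_def pi_alph_def pi_rels_def)

lemma pi_alph_simps [simp]: "Inl (v, k) \<in> pi_alph \<Gamma> \<longleftrightarrow> v \<in> verts \<Gamma>" "Inr e \<in> pi_alph \<Gamma> \<longleftrightarrow> e \<in> arcs \<Gamma>"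
  by (auto simp: pi_alph_def)

locale spanned_labelled_graph = labelled_graph \<Gamma> arev lab
  for \<Gamma> :: "('v, 'e) pre_digraph" and arev lab +
  fixes F
  assumes span: "spanning_arcs \<Gamma> arev F"
begin

abbreviation P1 where "P1 \<equiv> pi1Z \<Gamma> arev lab F"
abbreviation pc where "pc \<equiv> wcls (pi_alph \<Gamma>) (pi_rels \<Gamma> arev lab F)"

lemma F_arcs: "e \<in> F \<Longrightarrow> e \<in> arcs \<Gamma>" "e \<in> F \<Longrightarrow> arev e \<in> F"
  using span by (auto simp: spanning_arcs_def)

lemma F_arev_iff: "arev e \<in> F \<longleftrightarrow> e \<in> F"
  using F_arcs(2)[of e] F_arcs(2)[of "arev e"] by auto

lemma pc_closed: "w \<in> lists (pi_alph \<Gamma>) \<Longrightarrow> pc w \<in> carrier P1" by (simp add: pi1Z_alt)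
lemma pc_mult: "u \<in> lists (pi_alph \<Gamma>) \<Longrightarrow> v \<in> lists (pi_alph \<Gamma>) \<Longrightarrow> pc u \<otimes>\<^bsub>P1\<^esub> pc v = pc (u @ v)"
  by (simp add: pi1Z_alt wcls_mult)
lemma pc_one: "\<one>\<^bsub>P1\<^esub> = pc []" by (simp add: pi1Z_alt one_word_quotient)

lemma vert_rel: "v \<in> verts \<Gamma> \<Longrightarrow> pc [Inl (v, k), Inl (v, l)] = pc [Inl (v, k + l)]"
  by (rule wcls_rel) (auto simp: pi_rels_def)
lemma vert_zero: "v \<in> verts \<Gamma> \<Longrightarrow> pc [Inl (v, 0)] = pc []"
  by (rule wcls_rel) (auto simp: pi_rels_def)
lemma arc_rel: "e \<in> arcs \<Gamma> \<Longrightarrow> pc [Inr e, Inr (arev e)] = pc []"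
  by (rule wcls_rel) (auto simp: pi_rels_def)
lemma conj_rel: "e \<in> arcs \<Gamma> \<Longrightarrow> pc [Inr e, Inl (head \<Gamma> e, lab (arev e) * k), Inr (arev e)] = pc [Inl (tail \<Gamma> e, lab e * k)]"
  by (rule wcls_rel) (auto simp: pi_rels_def)
lemma tree_rel: "e \<in> F \<Longrightarrow> pc [Inr e] = pc []"
  by (rule wcls_rel) (auto simp: pi_rels_def F_arcs)

lemma group_P1: "group P1"
  unfolding pi1Z_alt
proof (rule group_word_quotient)
  fix x assume "x \<in> pi_alph \<Gamma>"
  then consider v k where "x = Inl (v, k)" "v \<in> verts \<Gamma>" | e where "x = Inr e" "e \<in> arcs \<Gamma>"
    by (auto simp: pi_alph_def)
  then show "\<exists>y\<in>lists (pi_alph \<Gamma>). pc (x # y) = pc [] \<and> pc (y @ [x]) = pc []"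
  proof cases
    case (1 v k)
    then show ?thesis using vert_rel[of v k "-k"] vert_rel[of v "-k" k] vert_zero[of v]
      by (intro bexI[of _ "[Inl (v, -k)]"]) auto
  next
    case (2 e)
    then show ?thesis using arc_rel[of e] arc_rel[of "arev e"]
      by (intro bexI[of _ "[Inr (arev e)]"]) auto
  qed
qed

abbreviation Vg where "Vg v k \<equiv> pc [Inl (v, k)]"
abbreviation Eg where "Eg e \<equiv> pc [Inr e]"

lemma Vg_closed [simp]: "v \<in> verts \<Gamma> \<Longrightarrow> Vg v k \<in> carrier P1" by (rule pc_closed) auto
lemma Eg_closed [simp]: "e \<in> arcs \<Gamma> \<Longrightarrow> Eg e \<in> carrier P1" by (rule pc_closed) auto

lemma Vg_pow: assumes "v \<in> verts \<Gamma>" shows "Vg v k [^]\<^bsub>P1\<^esub> (l::int) = Vg v (l * k)"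
proof -
  have "Vg v \<in> hom integer_group P1"
    by (rule homI) (use assms in \<open>auto simp: pc_mult vert_rel\<close>)
  then have "Vg v (k [^]\<^bsub>integer_group\<^esub> l) = Vg v k [^]\<^bsub>P1\<^esub> l"
    by (rule hom_int_pow) (auto simp: group_P1)
  then show ?thesis by simp
qed

lemma P1_lift:
  assumes "group H" and fv: "\<And>v. v \<in> verts \<Gamma> \<Longrightarrow> fv v \<in> carrier H" and fe: "\<And>e. e \<in> arcs \<Gamma> \<Longrightarrow> fe e \<in> carrier H"
    and arc: "\<And>e. e \<in> arcs \<Gamma> \<Longrightarrow> fe e \<otimes>\<^bsub>H\<^esub> fe (arev e) = \<one>\<^bsub>H\<^esub>"
    and conj: "\<And>e k. e \<in> arcs \<Gamma> \<Longrightarrow>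
      fe e \<otimes>\<^bsub>H\<^esub> (fv (head \<Gamma> e) [^]\<^bsub>H\<^esub> (lab (arev e) * k) \<otimes>\<^bsub>H\<^esub> fe (arev e)) = fv (tail \<Gamma> e) [^]\<^bsub>H\<^esub> (lab e * k)"
    and tree: "\<And>e. e \<in> F \<Longrightarrow> fe e = \<one>\<^bsub>H\<^esub>"
  shows "\<exists>h\<in>hom P1 H. (\<forall>v\<in>verts \<Gamma>. \<forall>k. h (Vg v k) = fv v [^]\<^bsub>H\<^esub> k) \<and> (\<forall>e\<in>arcs \<Gamma>. h (Eg e) = fe e)"
proof -
  interpret H: group H by fact
  define f where "f = case_sum (\<lambda>(v, k::int). fv v [^]\<^bsub>H\<^esub> k) fe"
  have f: "f \<in> pi_alph \<Gamma> \<rightarrow> carrier H" using fv fe by (auto simp: f_def pi_alph_def)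
  have "\<exists>h\<in>hom P1 H. \<forall>w\<in>lists (pi_alph \<Gamma>). h (pc w) = word_eval H f w"
    unfolding pi1Z_alt
  proof (rule H.word_quotient_lift[OF f])
    fix r s assume "(r, s) \<in> pi_rels \<Gamma> arev lab F"
    then consider v where "v \<in> verts \<Gamma>" "r = [Inl (v, 0)]" "s = []"
      | v k l where "v \<in> verts \<Gamma>" "r = [Inl (v, k), Inl (v, l)]" "s = [Inl (v, k + l)]"
      | e where "e \<in> arcs \<Gamma>" "r = [Inr e, Inr (arev e)]" "s = []"
      | e k where "e \<in> arcs \<Gamma>" "r = [Inr e, Inl (head \<Gamma> e, lab (arev e) * k), Inr (arev e)]" "s = [Inl (tail \<Gamma> e, lab e * k)]"
      | e where "e \<in> F" "r = [Inr e]" "s = []"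
      unfolding pi_rels_def by blast
    then show "word_eval H f r = word_eval H f s"
    proof cases
      case (2 v k l)
      then show ?thesis using fv[of v] by (simp add: f_def H.int_pow_mult)
    next
      case (3 e)
      then show ?thesis using arc[of e] fe[of "arev e"] by (simp add: f_def)
    next
      case (4 e k)
      then show ?thesis using conj[of e k] fe[of "arev e"] fv[of "tail \<Gamma> e"] by (simp add: f_def)
    next
      case (5 e)
      then show ?thesis using tree[of e] by (simp add: f_def)
    qed (use fv in \<open>simp add: f_def\<close>)
  qed
  then obtain h where h: "h \<in> hom P1 H" "\<And>w. w \<in> lists (pi_alph \<Gamma>) \<Longrightarrow> h (pc w) = word_eval H f w"
    by auto
  show ?thesis
  proof (intro bexI[OF _ h(1)] conjI ballI allI)
    fix v k assume "v \<in> verts \<Gamma>"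
    then show "h (Vg v k) = fv v [^]\<^bsub>H\<^esub> k" using fv[of v] by (subst h(2)) (auto simp: f_def)
  next
    fix e assume "e \<in> arcs \<Gamma>"
    then show "h (Eg e) = fe e" using fe[of e] by (subst h(2)) (auto simp: f_def)
  qed
qed

lemma P1_hom_eq:
  assumes "group H" and h: "h \<in> hom P1 H" and h': "h' \<in> hom P1 H"
    and "\<And>v. v \<in> verts \<Gamma> \<Longrightarrow> h (Vg v 1) = h' (Vg v 1)" and "\<And>e. e \<in> arcs \<Gamma> \<Longrightarrow> h (Eg e) = h' (Eg e)"
    and "p \<in> carrier P1"
  shows "h p = h' p"
proof -
  have pw: "h (Vg v k) = h' (Vg v k)" if "v \<in> verts \<Gamma>" for v k
  proof -
    have V: "Vg v k = Vg v 1 [^]\<^bsub>P1\<^esub> k" using Vg_pow[OF that, of 1 k] by simp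
    show ?thesis unfolding V using assms(4)[OF that] that
      by (simp add: hom_int_pow[OF h _ group_P1 \<open>group H\<close>] hom_int_pow[OF h' _ group_P1 \<open>group H\<close>])
  qed
  show ?thesis
  proof (rule word_quotient_hom_eq[OF group_P1[unfolded pi1Z_alt] \<open>group H\<close>
        h[unfolded pi1Z_alt] h'[unfolded pi1Z_alt] _ assms(6)[unfolded pi1Z_alt]])
    fix x assume "x \<in> pi_alph \<Gamma>"
    then show "h (pc [x]) = h' (pc [x])" using pw assms(5) by (auto simp: pi_alph_def)
  qed
qed

text \<open>If all labels near a vertex \<open>v\<close> are equal to \<open>lb v\<close>, then the elements \<open>lb v\<close> of all vertex groups coincide
  in the fundamental group and form the central generator \<open>z\<close>.\<close>

lemma uniform_power:
  assumes lb: "\<And>e. e \<in> arcs \<Gamma> \<Longrightarrow> lab e = lb (tail \<Gamma> e)" and "u \<in> verts \<Gamma>" "v \<in> verts \<Gamma>"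
  shows "Vg u (lb u) = Vg v (lb v)"
proof -
  \<comment> \<open>Along an arc of the subtree the stable letter is trivial, so the conjugation
    relation for k = 1 identifies the two powers.\<close>
  have edge: "Vg (head \<Gamma> e) (lb (head \<Gamma> e)) = Vg (tail \<Gamma> e) (lb (tail \<Gamma> e))" if "e \<in> F" for e
  proof -
    have e: "e \<in> arcs \<Gamma>" using F_arcs that by blast
    interpret P: group P1 by (rule group_P1)
    have "pc [Inr e] \<otimes>\<^bsub>P1\<^esub> pc [Inl (head \<Gamma> e, lab (arev e) * 1)] \<otimes>\<^bsub>P1\<^esub> pc [Inr (arev e)] = pc [Inl (tail \<Gamma> e, lab e * 1)]"
      using conj_rel[OF e, of 1] e by (simp add: pc_mult)
    then show ?thesis using tree_rel[OF that] tree_rel[OF F_arcs(2)[OF that]] lb[OF e] lb[of "arev e"] e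
      by (simp add: pc_one[symmetric])
  qed
  have "(u, v) \<in> rtrancl_on (verts \<Gamma>) ((arcs_ends (\<Gamma>\<lparr>arcs := F\<rparr>))\<^sup>s)"
    using span assms(2,3) by (simp add: spanning_arcs_def serre_tree_def connected_conv)
  then show ?thesis
  proof (induction rule: rtrancl_on_induct)
    case (step y z)
    then obtain e where "e \<in> F" "(y = tail \<Gamma> e \<and> z = head \<Gamma> e) \<or> (y = head \<Gamma> e \<and> z = tail \<Gamma> e)"
      by (auto simp: symcl_def arcs_ends_def arc_to_ends_def)
    then show ?case using step edge[of e] by auto
  qed simp
qed

end

text \<open>One stable letter is kept for each geometric edge outside the subtree; as arcs are
  natural numbers, \<open>e < arev e\<close> picks its orientation. Homomorphisms in both directions
  are defined on generators, where they are seen to be mutually inverse.\<close>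

lemma pi1_iso_hub:
  fixes \<Gamma> :: "(nat, nat) pre_digraph"
  assumes "labelled_graph \<Gamma> arev lab" "spanning_arcs \<Gamma> arev F"
    and lb: "\<And>e. e \<in> arcs \<Gamma> \<Longrightarrow> lab e = lb (tail \<Gamma> e)" and nz: "\<And>v. lb v \<noteq> 0"
  shows "pi1Z \<Gamma> arev lab F \<cong> hub (verts \<Gamma>) (\<lambda>v. nat \<bar>lb v\<bar>) {e \<in> arcs \<Gamma> - F. e < arev e}"
proof -
  interpret spanned_labelled_graph \<Gamma> arev lab F
    using assms by (simp add: spanned_labelled_graph_def spanned_labelled_graph_axioms_def)
  define \<nu> where "\<nu> = (\<lambda>v. nat \<bar>lb v\<bar>)"
  define J where "J = {e \<in> arcs \<Gamma> - F. e < arev e}"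
  let ?H = "hub (verts \<Gamma>) \<nu> J"
  let ?g = "hgen (verts \<Gamma>) \<nu> J"
  interpret H: group ?H by (rule group_hub)
  interpret P: group P1 by (rule group_P1)
  \<comment> \<open>Exponents in \<open>hub\<close> are natural numbers, whereas labels may be
    negative: the generator of the vertex group goes to \<open>a\<^sub>v\<close> or to its inverse,
    according to the sign.\<close>
  define fv where "fv v = ?g (HA v) [^]\<^bsub>?H\<^esub> sgn (lb v)" for v
  define fe where "fe e = (if e \<in> F then \<one>\<^bsub>?H\<^esub> else if e < arev e then ?g (HT e) else inv\<^bsub>?H\<^esub> ?g (HT (arev e)))" for e
  have J: "e \<in> J" if "e \<in> arcs \<Gamma>" "e \<notin> F" "e < arev e" for e using that by (simp add: J_def)
  have J': "arev e \<in> J" if "e \<in> arcs \<Gamma>" "e \<notin> F" "\<not> e < arev e" for e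
  proof -
    have "arev e \<noteq> e" using that(1) by (rule arev_neq)
    then have "arev e < arev (arev e)" using that(3) by simp
    then show ?thesis using that F_arev_iff by (simp add: J_def)
  qed
  have fe_c: "fe e \<in> carrier ?H" if "e \<in> arcs \<Gamma>" for e
    using J[OF that] J'[OF that] by (auto simp: fe_def)
  have fe_arc: "fe e \<otimes>\<^bsub>?H\<^esub> fe (arev e) = \<one>\<^bsub>?H\<^esub>" if "e \<in> arcs \<Gamma>" for e
  proof -
    have "arev e \<noteq> e" using that by (rule arev_neq)
    then show ?thesis using J[OF that] J'[OF that] by (auto simp: fe_def F_arev_iff)
  qed
  have fv_pow: "fv v [^]\<^bsub>?H\<^esub> (lb v * k) = ?g HZ [^]\<^bsub>?H\<^esub> k" if v: "v \<in> verts \<Gamma>" for v k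
  proof -
    have "fv v [^]\<^bsub>?H\<^esub> (lb v * k) = ?g (HA v) [^]\<^bsub>?H\<^esub> (sgn (lb v) * lb v * k)"
      using v by (simp add: fv_def H.int_pow_pow mult.assoc)
    also have "sgn (lb v) * lb v = int (\<nu> v)" by (simp add: \<nu>_def sgn_if)
    also have "?g (HA v) [^]\<^bsub>?H\<^esub> (int (\<nu> v) * k) = (?g (HA v) [^]\<^bsub>?H\<^esub> (int (\<nu> v))) [^]\<^bsub>?H\<^esub> k"
      using v by (simp only: H.int_pow_pow hgen_closed hub_gens_simps)
    also have "\<dots> = ?g HZ [^]\<^bsub>?H\<^esub> k" using hub_pow[OF v, of \<nu> J] by (simp only: int_pow_int)
    finally show ?thesis .
  qed
  have zk: "?g HZ [^]\<^bsub>?H\<^esub> (k::int) \<otimes>\<^bsub>?H\<^esub> p = p \<otimes>\<^bsub>?H\<^esub> ?g HZ [^]\<^bsub>?H\<^esub> k" if "p \<in> carrier ?H" for p k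
  proof -
    have "p \<otimes>\<^bsub>?H\<^esub> ?g HZ [^]\<^bsub>?H\<^esub> (n::nat) = ?g HZ [^]\<^bsub>?H\<^esub> n \<otimes>\<^bsub>?H\<^esub> p" for n
      by (rule H.group_commutes_pow[symmetric]) (use hub_central[OF that] that in auto)
    then have *: "p \<otimes>\<^bsub>?H\<^esub> ?g HZ [^]\<^bsub>?H\<^esub> int n = ?g HZ [^]\<^bsub>?H\<^esub> int n \<otimes>\<^bsub>?H\<^esub> p" for n by (simp add: int_pow_int)
    show ?thesis
    proof (cases k)
      case (neg n)
      then show ?thesis using H.commutes_inv[OF *[of "Suc n"] that] by (simp add: H.int_pow_neg del: of_nat_Suc)
    qed (use * in auto)
  qed
  have fv_c: "fv v \<in> carrier ?H" if "v \<in> verts \<Gamma>" for v using that by (simp add: fv_def)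
  have conj: "fe e \<otimes>\<^bsub>?H\<^esub> (fv (head \<Gamma> e) [^]\<^bsub>?H\<^esub> (lab (arev e) * k) \<otimes>\<^bsub>?H\<^esub> fe (arev e)) = fv (tail \<Gamma> e) [^]\<^bsub>?H\<^esub> (lab e * k)"
    if e: "e \<in> arcs \<Gamma>" for e k
  proof -
    have "fe e \<otimes>\<^bsub>?H\<^esub> (?g HZ [^]\<^bsub>?H\<^esub> k \<otimes>\<^bsub>?H\<^esub> fe (arev e)) = fe e \<otimes>\<^bsub>?H\<^esub> fe (arev e) \<otimes>\<^bsub>?H\<^esub> ?g HZ [^]\<^bsub>?H\<^esub> k"
      using zk[of "fe (arev e)" k] fe_c[OF e] fe_c[of "arev e"] e by (simp add: H.m_assoc)
    then show ?thesis using fe_arc[OF e] e lb[OF e] lb[of "arev e"] fv_pow by simp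
  qed
  have "\<exists>h\<in>hom P1 ?H. (\<forall>v\<in>verts \<Gamma>. \<forall>k. h (Vg v k) = fv v [^]\<^bsub>?H\<^esub> k) \<and> (\<forall>e\<in>arcs \<Gamma>. h (Eg e) = fe e)"
    by (rule P1_lift[OF group_hub fv_c fe_c fe_arc conj]) (simp_all add: fe_def)
  then obtain h where h: "h \<in> hom P1 ?H" "\<And>v k. v \<in> verts \<Gamma> \<Longrightarrow> h (Vg v k) = fv v [^]\<^bsub>?H\<^esub> k"
    "\<And>e. e \<in> arcs \<Gamma> \<Longrightarrow> h (Eg e) = fe e" by auto
  have "verts \<Gamma> \<noteq> {}" using span by (simp add: spanning_arcs_def serre_tree_def connected_conv)
  then obtain v0 where v0: "v0 \<in> verts \<Gamma>" by blast
  define zz where "zz = Vg v0 (lb v0)"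
  have zV: "zz = Vg v (lb v)" if "v \<in> verts \<Gamma>" for v
    unfolding zz_def by (rule uniform_power[where lb = lb, OF lb v0 that])
  have zE: "zz \<otimes>\<^bsub>P1\<^esub> Eg e = Eg e \<otimes>\<^bsub>P1\<^esub> zz" if e: "e \<in> arcs \<Gamma>" for e
  proof -
    have zc: "zz \<in> carrier P1" using v0 by (simp add: zz_def)
    \<comment> \<open>Both ends of e carry the same element z, so the conjugation relation for k = 1
      says that \<open>t\<^sub>e\<close> commutes with it.\<close>
    have *: "Eg e \<otimes>\<^bsub>P1\<^esub> (zz \<otimes>\<^bsub>P1\<^esub> Eg (arev e)) = zz"
      using conj_rel[OF e, of 1] zV[of "head \<Gamma> e"] zV[of "tail \<Gamma> e"] lb[OF e] lb[of "arev e"] e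
      by (simp add: pc_mult)
    have **: "Eg (arev e) \<otimes>\<^bsub>P1\<^esub> Eg e = \<one>\<^bsub>P1\<^esub>" using arc_rel[of "arev e"] e by (simp add: pc_mult pc_one)
    have "zz \<otimes>\<^bsub>P1\<^esub> Eg e = Eg e \<otimes>\<^bsub>P1\<^esub> (zz \<otimes>\<^bsub>P1\<^esub> Eg (arev e)) \<otimes>\<^bsub>P1\<^esub> Eg e" by (simp only: *)
    also have "\<dots> = Eg e \<otimes>\<^bsub>P1\<^esub> (zz \<otimes>\<^bsub>P1\<^esub> (Eg (arev e) \<otimes>\<^bsub>P1\<^esub> Eg e))" using e zc by (simp add: P.m_assoc)
    also have "\<dots> = Eg e \<otimes>\<^bsub>P1\<^esub> zz" using ** zc by simp
    finally show ?thesis .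
  qed
  obtain k where k: "k \<in> hom ?H P1" "k (?g HZ) = zz" "\<And>v. v \<in> verts \<Gamma> \<Longrightarrow> k (?g (HA v)) = Vg v (sgn (lb v))"
    "\<And>e. e \<in> J \<Longrightarrow> k (?g (HT e)) = Eg e"
  proof (rule hub_lift[OF group_P1, of zz "verts \<Gamma>" "\<lambda>v. Vg v (sgn (lb v))" J Eg \<nu>])
    show "zz \<in> carrier P1" using v0 by (simp add: zz_def)
    fix v assume v: "v \<in> verts \<Gamma>"
    show "zz \<otimes>\<^bsub>P1\<^esub> Vg v (sgn (lb v)) = Vg v (sgn (lb v)) \<otimes>\<^bsub>P1\<^esub> zz"
      using zV[OF v] v by (simp add: pc_mult vert_rel add.commute)
    have "Vg v (sgn (lb v)) [^]\<^bsub>P1\<^esub> int (\<nu> v) = Vg v (lb v)"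
      using v by (simp add: Vg_pow \<nu>_def) (simp add: abs_mult_sgn)
    then show "Vg v (sgn (lb v)) [^]\<^bsub>P1\<^esub> \<nu> v = zz" using zV[OF v] by (simp add: int_pow_int)
  qed (use zE in \<open>auto simp: J_def\<close>)
  interpret h: group_hom P1 ?H h using h(1) by unfold_locales
  interpret k: group_hom ?H P1 k using k(1) by unfold_locales
  have kh: "k (h p) = p" if p: "p \<in> carrier P1" for p
  proof -
    have "(k \<circ> h) p = id p"
    proof (rule P1_hom_eq[OF group_P1 _ _ _ _ p])
      show "k \<circ> h \<in> hom P1 P1" using h(1) k(1) by (rule Group.hom_compose)
      show "id \<in> hom P1 P1" by (auto simp: hom_def)
      fix v assume v: "v \<in> verts \<Gamma>"
      have "k (fv v) = Vg v (sgn (lb v) * sgn (lb v))" using v k(3)[OF v] by (simp add: fv_def k.hom_int_pow Vg_pow)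
      then show "(k \<circ> h) (Vg v 1) = id (Vg v 1)" using h(2)[OF v, of 1] fv_c[OF v] by (simp add: nz)
    next
      fix e assume e: "e \<in> arcs \<Gamma>"
      have inv: "inv\<^bsub>P1\<^esub> Eg (arev e) = Eg e"
        by (rule P.inv_equality) (use arc_rel[OF e] e in \<open>auto simp: pc_mult pc_one\<close>)
      have "k (fe e) = Eg e"
        using J[OF e] J'[OF e] k(4) tree_rel[of e] inv by (auto simp: fe_def pc_one k.hom_inv)
      then show "(k \<circ> h) (Eg e) = id (Eg e)" using h(3)[OF e] by simp
    qed
    then show ?thesis by simp
  qed
  have hk: "h (k q) = q" if q: "q \<in> carrier ?H" for q
  proof -
    have "(h \<circ> k) q = id q"
    proof (rule hub_hom_eq[OF group_hub _ _ _ _ _ q])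
      show "h \<circ> k \<in> hom ?H ?H" using k(1) h(1) by (rule Group.hom_compose)
      show "id \<in> hom ?H ?H" by (auto simp: hom_def)
      show "(h \<circ> k) (?g HZ) = id (?g HZ)" using k(2) h(2)[OF v0] fv_pow[OF v0, of 1] by (simp add: zz_def)
      show "(h \<circ> k) (?g (HA v)) = id (?g (HA v))" if v: "v \<in> verts \<Gamma>" for v
        using k(3)[OF v] h(2)[OF v] v by (simp add: fv_def H.int_pow_pow nz)
      show "(h \<circ> k) (?g (HT e)) = id (?g (HT e))" if e: "e \<in> J" for e
        using k(4)[OF e] h(3)[of e] e by (simp add: fe_def J_def)
    qed
    then show ?thesis by simp
  qed
  have "P1 \<cong> ?H" by (rule mutually_inverse_homs_iso[OF h(1) k(1) kh hk])
  then show ?thesis by (simp add: \<nu>_def J_def)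
qed

lemma mon_iso_trans:
  assumes "G \<cong> H" "mon H K \<noteq> {}"
  shows "mon G K \<noteq> {}"
proof -
  obtain f g where f: "f \<in> iso G H" and g: "g \<in> mon H K" using assms by (auto simp: is_iso_def)
  have "g \<circ> f \<in> mon G K"
    using f g by (auto simp: mon_def iso_def bij_betw_def intro: Group.hom_compose comp_inj_on)
  then show ?thesis by blast
qed

lemma uniform_graph_embeds:
  fixes \<Gamma> :: "(nat, nat) pre_digraph"
  assumes lg: "labelled_graph \<Gamma> arev lab" and rep: "represents \<Gamma> arev lab G" and n: "n \<ge> 2"
    and eq: "\<And>e f. e \<in> arcs \<Gamma> \<Longrightarrow> f \<in> arcs \<Gamma> \<Longrightarrow> tail \<Gamma> e = tail \<Gamma> f \<Longrightarrow> lab e = lab f"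
    and dvd: "\<And>e. e \<in> arcs \<Gamma> \<Longrightarrow> lab e dvd int n"
  shows "mon G (BS n n) \<noteq> {}"
proof -
  interpret labelled_graph \<Gamma> arev lab by fact
  \<comment> \<open>The common label at v. A vertex without arcs gets the value 1, which is nonzero
    and divides n.\<close>
  define lb where "lb v = (if \<exists>e\<in>arcs \<Gamma>. tail \<Gamma> e = v then lab (SOME e. e \<in> arcs \<Gamma> \<and> tail \<Gamma> e = v) else 1)" for v
  have some: "(SOME e. e \<in> arcs \<Gamma> \<and> tail \<Gamma> e = v) \<in> arcs \<Gamma> \<and> tail \<Gamma> (SOME e. e \<in> arcs \<Gamma> \<and> tail \<Gamma> e = v) = v"
    if "\<exists>e\<in>arcs \<Gamma>. tail \<Gamma> e = v" for v
    by (rule someI_ex) (use that in blast)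
  have lb: "lab e = lb (tail \<Gamma> e)" if "e \<in> arcs \<Gamma>" for e
    using some[of "tail \<Gamma> e"] eq[OF that, of "SOME f. f \<in> arcs \<Gamma> \<and> tail \<Gamma> f = tail \<Gamma> e"] that by (auto simp: lb_def)
  have nz: "lb v \<noteq> 0" for v using some[of v] lab_nonzero by (auto simp: lb_def)
  have lbd: "lb v dvd int n" for v using some[of v] dvd by (auto simp: lb_def)
  obtain F where F: "spanning_arcs \<Gamma> arev F" "G \<cong> pi1Z \<Gamma> arev lab F" using rep by (auto simp: represents_def)
  have "mon (hub (verts \<Gamma>) (\<lambda>v. nat \<bar>lb v\<bar>) {e \<in> arcs \<Gamma> - F. e < arev e}) (BS n n) \<noteq> {}"
  proof (rule hub_embeds_BS[OF n])
    fix v show "nat \<bar>lb v\<bar> dvd n" using lbd[of v] by (metis abs_dvd_iff int_dvd_int_iff int_nat_eq nat_abs_dvd_iff abs_ge_zero)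
  qed
  then show ?thesis using mon_iso_trans[OF F(2)] mon_iso_trans[OF pi1_iso_hub[OF lg F(1) lb nz]] by blast
qed

text \<open>The graph realising a hub group is a star with loops at its centre \<open>b\<close>. The arcs \<open>4 i\<close> and \<open>4 i + 1\<close> join
  \<open>b\<close> to \<open>i\<close>, while the loops are indexed by numbers \<open>j\<close> congruent to 2 modulo 4 and have reverse \<open>j + 1\<close>.\<close>

definition star_arcs :: "nat set \<Rightarrow> nat \<Rightarrow> nat set" where
  "star_arcs I b = (\<lambda>i. 4 * i) ` (I - {b}) \<union> (\<lambda>i. 4 * i + 1) ` (I - {b})"

definition star :: "nat set \<Rightarrow> nat \<Rightarrow> nat set \<Rightarrow> (nat, nat) pre_digraph" where
  "star I b J = \<lparr>verts = I, arcs = star_arcs I b \<union> J \<union> Suc ` J,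
     tail = (\<lambda>e. if e mod 4 = 1 then e div 4 else b), head = (\<lambda>e. if e mod 4 = 0 then e div 4 else b)\<rparr>"

text \<open>Outside the arcs the reversal is the identity, as \<open>bidirected_digraph\<close>
  prescribes.\<close>

definition star_rev :: "nat set \<Rightarrow> nat \<Rightarrow> nat set \<Rightarrow> nat \<Rightarrow> nat" where
  "star_rev I b J e = (if e \<in> star_arcs I b \<union> J \<union> Suc ` J then (if even e then e + 1 else e - 1) else e)"

lemma mod_4_simps:
  "Suc (4 * i) mod 4 = Suc 0" "Suc (4 * i) div 4 = i" "Suc (Suc (4 * i)) mod 4 = 2" "Suc (Suc (Suc (4 * i))) mod 4 = 3"
  by presburger+

lemma star_simps [simp]:
  "verts (star I b J) = I" "arcs (star I b J) = star_arcs I b \<union> J \<union> Suc ` J"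
  "tail (star I b J) e = (if e mod 4 = 1 then e div 4 else b)"
  "head (star I b J) e = (if e mod 4 = 0 then e div 4 else b)"
  by (simp_all add: star_def)

lemma star_arcs_cases:
  assumes J: "\<forall>j\<in>J. j mod 4 = 2" and e: "e \<in> arcs (star I b J)"
  obtains (out) i where "i \<in> I" "i \<noteq> b" "e = 4 * i" | (into) i where "i \<in> I" "i \<noteq> b" "e = 4 * i + 1"
    | (loop) j k where "j \<in> J" "e = j" "j = 4 * k + 2" | (loop') j k where "j \<in> J" "e = Suc j" "j = 4 * k + 2"
proof -
  have J': "\<exists>k. j = 4 * k + 2" if "j \<in> J" for j using J[rule_format, OF that] by presburger
  show ?thesis using e J' out into loop loop' unfolding star_simps star_arcs_def by blast
qed

lemma star_bidirected:
  assumes J: "\<forall>j\<in>J. j mod 4 = 2" and b: "b \<in> I"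
  shows "bidirected_digraph (star I b J) (star_rev I b J)"
proof -
  interpret wf_digraph "star I b J"
  proof
    fix e assume e: "e \<in> arcs (star I b J)"
    show "tail (star I b J) e \<in> verts (star I b J)"
      by (rule star_arcs_cases[OF J e]) (use b in \<open>auto simp: mod_4_simps\<close>)
    show "head (star I b J) e \<in> verts (star I b J)"
      by (rule star_arcs_cases[OF J e]) (use b in \<open>auto simp: mod_4_simps\<close>)
  qed
  have rev: "e \<in> arcs (star I b J) \<Longrightarrow> star_rev I b J e = (if even e then e + 1 else e - 1)" for e
    by (simp add: star_rev_def)
  show ?thesis
  proof (rule bidirected_digraphI)
    fix e assume e: "e \<in> arcs (star I b J)"
    have "star_rev I b J e \<noteq> e \<and> star_rev I b J e \<in> arcs (star I b J) \<and> star_rev I b J (star_rev I b J e) = e \<and>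
       tail (star I b J) (star_rev I b J e) = head (star I b J) e"
    using J e
    proof (cases rule: star_arcs_cases)
      case (out i)
      then have "4 * i \<in> star_arcs I b" "Suc (4 * i) \<in> star_arcs I b" by (auto simp: star_arcs_def)
      then show ?thesis using out by (simp add: star_rev_def mod_4_simps)
    next
      case (into i)
      then have "4 * i \<in> star_arcs I b" "Suc (4 * i) \<in> star_arcs I b" by (auto simp: star_arcs_def)
      then show ?thesis using into by (simp add: star_rev_def mod_4_simps)
    next
      case (loop j k)
      then have "Suc (Suc (4 * k)) \<in> J" by simp
      then show ?thesis using loop by (simp add: star_rev_def mod_4_simps)
    next
      case (loop' j k)
      then have "Suc (Suc (4 * k)) \<in> J" by simp
      then show ?thesis using loop' by (simp add: star_rev_def mod_4_simps)
    qed
    then show "star_rev I b J e \<noteq> e" "star_rev I b J (star_rev I b J e) = e"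
      "tail (star I b J) (star_rev I b J e) = head (star I b J) e" by auto
  qed (simp add: star_rev_def)
qed

lemma star_connected:
  assumes b: "b \<in> I" and A: "star_arcs I b \<subseteq> A"
  shows "Digraph_Component.connected ((star I b J)\<lparr>arcs := A\<rparr>)"
proof -
  let ?R = "rtrancl_on I ((arcs_ends ((star I b J)\<lparr>arcs := A\<rparr>))\<^sup>s)"
  have edge: "(b, i) \<in> ?R \<and> (i, b) \<in> ?R" if i: "i \<in> I" for i
  proof (cases "i = b")
    case True
    then show ?thesis using b by auto
  next
    case False
    then have "4 * i \<in> A" using A i by (auto simp: star_arcs_def)
    then have "(b, i) \<in> arcs_ends ((star I b J)\<lparr>arcs := A\<rparr>)"
      by (auto simp: arcs_ends_def arc_to_ends_def intro!: image_eqI[of _ _ "4 * i"])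
    then have "(b, i) \<in> (arcs_ends ((star I b J)\<lparr>arcs := A\<rparr>))\<^sup>s" "(i, b) \<in> (arcs_ends ((star I b J)\<lparr>arcs := A\<rparr>))\<^sup>s"
      by (auto simp: symcl_def)
    then show ?thesis using b i by (meson converse_rtrancl_on_into_rtrancl_on rtrancl_on_refl)
  qed
  have "(u, v) \<in> ?R" if "u \<in> I" "v \<in> I" for u v
    using rtrancl_on_trans edge[OF that(1)] edge[OF that(2)] by (metis (no_types, lifting))
  then show ?thesis unfolding connected_conv using b by auto
qed

text \<open>A leaf i can be left only by the arc \<open>4 * i + 1\<close>, the reverse of the arc
  \<open>4 * i\<close> by which it is entered. In a closed walk without backtracking an arc into a
  leaf is therefore the last one. This leaves walks of length at most two, none of which is closed
  without turning back.\<close>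

lemma star_spanning:
  assumes J: "\<forall>j\<in>J. j mod 4 = 2" and b: "b \<in> I"
  shows "spanning_arcs (star I b J) (star_rev I b J) (star_arcs I b)"
proof -
  let ?T = "(star I b J)\<lparr>arcs := star_arcs I b\<rparr>"
  let ?r = "star_rev I b J"
  have no_cycle: "\<not> (pre_digraph.cycle ?T p \<and> successively (\<lambda>e f. f \<noteq> ?r e) p)" for p
  proof
    assume p: "pre_digraph.cycle ?T p \<and> successively (\<lambda>e f. f \<noteq> ?r e) p"
    then obtain u where u: "pre_digraph.awalk ?T u p u" "p \<noteq> []" by (auto simp: pre_digraph.cycle_def)
    then have arcs: "set p \<subseteq> star_arcs I b" and cas: "pre_digraph.cas ?T u p u" by (auto simp: pre_digraph.awalk_def)
    have leaf: False if "4 * i \<in> set p" "p = q @ 4 * i # f # s" for q i f s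
    proof -
      have "pre_digraph.cas ?T (head ?T (4 * i)) (f # s) u"
        using cas that(2) by (simp add: pre_digraph.cas_append_iff pre_digraph.cas.simps)
      then have "tail (star I b J) f = i" by (simp add: pre_digraph.cas.simps)
      moreover have "f \<in> star_arcs I b" "4 * i \<in> star_arcs I b" using arcs that by auto
      moreover have "f \<noteq> ?r (4 * i)" using p that(2) by (simp add: successively_append_iff)
      ultimately show False by (auto simp: star_arcs_def star_rev_def mod_4_simps split: if_splits)
    qed
    obtain e p' where e: "p = e # p'" using u by (cases p) auto
    have tails: "pre_digraph.cas ?T (head ?T e) p' u" "tail ?T e = u" using cas e by (simp_all add: pre_digraph.cas.simps)
    have "e \<in> star_arcs I b" using arcs e by auto
    then consider i where "i \<noteq> b" "e = 4 * i" | i where "i \<noteq> b" "e = 4 * i + 1" by (auto simp: star_arcs_def)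
    then show False
    proof cases
      case (1 i)
      then have "p' = []" using leaf[of i "[]"] e by (cases p') auto
      then show False using tails 1 by (simp add: pre_digraph.cas.simps)
    next
      case (2 i)
      have h: "head ?T e = b" "tail ?T e = i" using 2 by (auto simp: mod_4_simps)
      show False
      proof (cases p')
        case Nil
        then show ?thesis using tails h 2 by (simp add: pre_digraph.cas.simps)
      next
        case (Cons f s)
        then have "tail ?T f = b" "pre_digraph.cas ?T (head ?T f) s u" using tails h by (simp_all add: pre_digraph.cas.simps)
        moreover have "f \<in> star_arcs I b" using arcs e Cons by auto
        ultimately obtain k where k: "k \<noteq> b" "f = 4 * k"
        proof -
          assume f: "tail ?T f = b" "f \<in> star_arcs I b" and *: "\<And>k. k \<noteq> b \<Longrightarrow> f = 4 * k \<Longrightarrow> thesis"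
          from f(2) consider k where "k \<noteq> b" "f = 4 * k" | k where "k \<noteq> b" "f = 4 * k + 1"
            by (auto simp: star_arcs_def)
          then show thesis using f(1) * by cases (auto simp: mod_4_simps)
        qed
        have "s = []" using leaf[of k "[e]"] e Cons k by (cases s) auto
        then have "k = u" using \<open>pre_digraph.cas ?T (head ?T f) s u\<close> k by (simp add: pre_digraph.cas.simps)
        then have "k = i" using tails h by simp
        have "4 * i + 1 \<in> star_arcs I b" using arcs e 2 by auto
        then have "f = ?r e" using k \<open>k = i\<close> 2 by (simp add: star_rev_def)
        then show False using p e Cons by (simp add: successively_Cons)
      qed
    qed
  qed
  have "?r ` star_arcs I b \<subseteq> star_arcs I b" by (auto simp: star_rev_def star_arcs_def)
  moreover have "serre_tree ?T ?r"
    using star_connected[OF b, of "star_arcs I b" J] no_cycle by (auto simp: serre_tree_def)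
  ultimately show ?thesis by (auto simp: spanning_arcs_def)
qed

text \<open>Every arc of the star is labelled by the exponent \<open>\<nu> v\<close> of its origin
  v. The bound \<open>\<nu> i \<ge> 2\<close> provides reducedness; it is asked for as soon as some
  arc is not a loop.\<close>

lemma hub_labelled_graph:
  assumes G: "group G" and iso: "G \<cong> hub I \<nu> J" and fin: "finite I" "finite J" and b: "b \<in> I"
    and J: "\<forall>j\<in>J. j mod 4 = 2"
    and \<nu>: "\<And>i. i \<in> I \<Longrightarrow> \<nu> i dvd n" "n > 0" "\<And>i. i \<in> I \<Longrightarrow> I \<noteq> {b} \<Longrightarrow> \<nu> i \<ge> 2"
  shows "\<exists>(\<Gamma> :: (nat, nat) pre_digraph) arev lab.
               labelled_graph \<Gamma> arev lab \<and> reduced_labelled_graph \<Gamma> lab \<and>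
               represents \<Gamma> arev lab G \<and>
               (\<forall>e \<in> arcs \<Gamma>. \<forall>f \<in> arcs \<Gamma>. tail \<Gamma> e = tail \<Gamma> f \<longrightarrow> lab e = lab f) \<and>
               (\<forall>e \<in> arcs \<Gamma>. lab e dvd int n)"
proof -
  let ?G = "star I b J"
  let ?r = "star_rev I b J"
  let ?F = "star_arcs I b"
  interpret bidirected_digraph ?G ?r by (rule star_bidirected[OF J b])
  \<comment> \<open>The value 1 off \<open>I\<close> makes \<open>lb\<close> nonzero everywhere, as
    \<open>pi1_iso_hub\<close> demands.\<close>
  define lb where "lb v = (if v \<in> I then int (\<nu> v) else 1)" for v
  define lab where "lab e = lb (tail ?G e)" for e
  have \<nu>0: "\<nu> i > 0" if "i \<in> I" for i using \<nu>(1)[OF that] \<nu>(2) by (auto intro!: Nat.gr0I)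
  have nz: "lb v \<noteq> 0" for v using \<nu>0[of v] by (simp add: lb_def)
  have lg: "labelled_graph ?G ?r lab"
  proof unfold_locales
    show "finite (verts ?G)" "finite (arcs ?G)" using fin by (simp_all add: star_arcs_def)
    fix e show "lab e \<noteq> 0" using nz by (simp add: lab_def)
  qed
  have sp: "spanning_arcs ?G ?r ?F" by (rule star_spanning[OF J b])
  \<comment> \<open>Each loop j is smaller than its reverse j + 1, so the orientation selected in
    \<open>pi1_iso_hub\<close> is j itself.\<close>
  have Jeq: "{e \<in> arcs ?G - ?F. e < ?r e} = J"
  proof
    show "{e \<in> arcs ?G - ?F. e < ?r e} \<subseteq> J"
    proof
      fix e assume e: "e \<in> {e \<in> arcs ?G - ?F. e < ?r e}"
      then have "e \<in> arcs ?G" by blast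
      from J this show "e \<in> J"
        by (rule star_arcs_cases) (use e in \<open>auto simp: star_arcs_def star_rev_def\<close>)
    qed
    show "J \<subseteq> {e \<in> arcs ?G - ?F. e < ?r e}"
    proof
      fix j assume j: "j \<in> J"
      have "j mod 4 = 2" using J j by blast
      then have "j \<notin> ?F" "even j" unfolding star_arcs_def by (auto, presburger+)
      then show "j \<in> {e \<in> arcs ?G - ?F. e < ?r e}" using j by (simp add: star_rev_def)
    qed
  qed
  have hub_eq: "hub I (\<lambda>v. nat \<bar>lb v\<bar>) J = hub I \<nu> J"
  proof -
    have "hub_rels I (\<lambda>v. nat \<bar>lb v\<bar>) J = hub_rels I \<nu> J" by (auto simp: hub_rels_def lb_def)
    then show ?thesis by (simp add: hub_def)
  qed
  have piso: "pi1Z ?G ?r lab ?F \<cong> hub I \<nu> J"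
    using pi1_iso_hub[OF lg sp, of lb] nz hub_eq Jeq by (simp add: lab_def)
  have grp: "group (pi1Z ?G ?r lab ?F)"
    by (rule spanned_labelled_graph.group_P1)
      (use lg sp in \<open>simp add: spanned_labelled_graph_def spanned_labelled_graph_axioms_def\<close>)
  have "G \<cong> pi1Z ?G ?r lab ?F" using iso group.iso_sym[OF grp piso] iso_trans by blast
  moreover have "Digraph_Component.connected ?G"
  proof -
    have "Digraph_Component.connected (?G\<lparr>arcs := star_arcs I b \<union> J \<union> Suc ` J\<rparr>)"
      by (rule star_connected[OF b]) auto
    then show ?thesis by (simp add: star_def)
  qed
  ultimately have rep: "represents ?G ?r lab G" using sp by (auto simp: represents_def)
  have red: "reduced_labelled_graph ?G lab" unfolding reduced_labelled_graph_def
  proof (intro ballI impI)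
    fix e assume e: "e \<in> arcs ?G" and l: "lab e = 1 \<or> lab e = -1"
    have t: "tail ?G e \<in> I" using e wellformed(1) by simp
    show "tail ?G e = head ?G e"
    proof (cases "I = {b}")
      case True
      then have "head ?G e \<in> {b}" "tail ?G e \<in> {b}" using wellformed[OF e] unfolding star_simps(1) by auto
      then show ?thesis by simp
    next
      case False
      then have "\<nu> (tail ?G e) \<ge> 2" using \<nu>(3)[OF t] by simp
      then show ?thesis using l t unfolding lab_def lb_def by auto
    qed
  qed
  have dvd: "lab e dvd int n" if "e \<in> arcs ?G" for e
  proof -
    have "tail ?G e \<in> I" using that wellformed(1) by simp
    then show ?thesis using \<nu>(1)[of "tail ?G e"] unfolding lab_def lb_def by simp
  qed
  show ?thesis using lg red rep dvd by (intro exI[of _ ?G] exI[of _ ?r] exI[of _ lab]) (auto simp: lab_def)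
qed

section \<open>Subgroups of the Baumslag--Solitar group\<close>

text \<open>The subgroup contains z = \<open>a\<^sup>n\<close>. Being central, z then fixes every
  coset, and all a-orbits on the cosets have a length dividing n.\<close>

locale bs_subgroup =
  fixes n :: nat and H :: "(bs_gen \<times> bool) list set set"
  assumes n0: "n > 0" and sub: "subgroup H (BS n n)" and zH: "bsa n [^]\<^bsub>BS n n\<^esub> n \<in> H"
begin

sublocale B: Group.group "BS n n" by (rule group_BS)

abbreviation a where "a \<equiv> bsa n"
abbreviation t where "t \<equiv> bst n"
abbreviation z where "z \<equiv> a [^]\<^bsub>BS n n\<^esub> n"

definition mv where "mv g x = g <#\<^bsub>BS n n\<^esub> x"
definition X where "X = (\<lambda>b. mv b H) ` carrier (BS n n)"

lemma X_sub: "x \<in> X \<Longrightarrow> x \<subseteq> carrier (BS n n)"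
  using B.l_coset_subset_G subgroup.subset[OF sub] by (auto simp: X_def mv_def)

lemma mv_mult: "x \<in> X \<Longrightarrow> g \<in> carrier (BS n n) \<Longrightarrow> h \<in> carrier (BS n n) \<Longrightarrow> mv (g \<otimes>\<^bsub>BS n n\<^esub> h) x = mv g (mv h x)"
  using B.lcos_m_assoc[OF X_sub] by (simp add: mv_def)

lemma mv_one: "x \<in> X \<Longrightarrow> mv \<one>\<^bsub>BS n n\<^esub> x = x"
  using B.lcos_mult_one[OF X_sub] by (simp add: mv_def)

lemma H_X: "H \<in> X"
  using B.lcos_mult_one[OF subgroup.subset[OF sub]] by (auto simp: X_def mv_def intro!: image_eqI[of _ _ "\<one>\<^bsub>BS n n\<^esub>"])

lemma mv_closed: assumes "x \<in> X" "g \<in> carrier (BS n n)" shows "mv g x \<in> X"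
proof -
  obtain b where b: "x = mv b H" "b \<in> carrier (BS n n)" using assms by (auto simp: X_def)
  then show ?thesis using mv_mult[OF H_X assms(2) b(2)] assms by (auto simp: X_def)
qed

lemma mv_inv: assumes "x \<in> X" "g \<in> carrier (BS n n)"
  shows "mv (inv\<^bsub>BS n n\<^esub> g) (mv g x) = x" "mv g (mv (inv\<^bsub>BS n n\<^esub> g) x) = x"
  using assms mv_one by (simp_all flip: mv_mult)

lemma mv_H_iff: assumes "g \<in> carrier (BS n n)" shows "mv g H = H \<longleftrightarrow> g \<in> H"
proof
  assume "mv g H = H"
  moreover have "g \<otimes>\<^bsub>BS n n\<^esub> \<one>\<^bsub>BS n n\<^esub> \<in> mv g H"
    using subgroup.one_closed[OF sub] unfolding mv_def l_coset_def by blast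
  ultimately show "g \<in> H" using assms by simp
next
  assume "g \<in> H" then show "mv g H = H" unfolding mv_def using B.coset_join3[OF assms sub] by simp
qed

lemma X_E: assumes "x \<in> X" obtains b where "b \<in> carrier (BS n n)" "x = mv b H"
  using assms by (auto simp: X_def)

definition sa where "sa x = mv a x"

lemma sa_closed: "x \<in> X \<Longrightarrow> sa x \<in> X" by (simp add: sa_def mv_closed)

lemma sa_pow: "x \<in> X \<Longrightarrow> (sa ^^ k) x = mv (a [^]\<^bsub>BS n n\<^esub> k) x"
proof (induction k)
  case (Suc k)
  have "a [^]\<^bsub>BS n n\<^esub> Suc k = a \<otimes>\<^bsub>BS n n\<^esub> a [^]\<^bsub>BS n n\<^esub> k" by (rule B.nat_pow_Suc2) simp
  then show ?case using Suc by (simp add: sa_def mv_mult)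
qed (simp add: mv_one)

lemma sa_pow_closed: "x \<in> X \<Longrightarrow> (sa ^^ k) x \<in> X" by (induction k) (auto simp: sa_closed)

lemma mv_z: assumes "x \<in> X" shows "mv z x = x"
proof -
  obtain b where b: "b \<in> carrier (BS n n)" "x = mv b H" using X_E[OF assms] .
  have "mv z x = mv (z \<otimes>\<^bsub>BS n n\<^esub> b) H" using b H_X by (simp add: mv_mult)
  also have "\<dots> = mv (b \<otimes>\<^bsub>BS n n\<^esub> z) H" using bsa_pow_central[OF b(1)] by simp
  also have "\<dots> = mv b (mv z H)" using b H_X by (simp add: mv_mult)
  also have "mv z H = H" using zH by (simp add: mv_H_iff)
  finally show ?thesis using b by simp
qed

lemma sa_pow_n: "x \<in> X \<Longrightarrow> (sa ^^ n) x = x" by (simp add: sa_pow mv_z)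

lemma sa_pow_nk: "x \<in> X \<Longrightarrow> (sa ^^ (n * k)) x = x"
  by (induction k) (simp_all add: funpow_add sa_pow_n)

lemma sa_pow_cancel: assumes "x \<in> X" "i \<le> j" "(sa ^^ i) x = (sa ^^ j) x" shows "(sa ^^ (j - i)) x = x"
proof -
  have "(sa ^^ j) x = (sa ^^ i) ((sa ^^ (j - i)) x)" using assms(2) by (simp flip: funpow_add o_apply[of "sa ^^ i"])
  then have "mv (a [^]\<^bsub>BS n n\<^esub> i) x = mv (a [^]\<^bsub>BS n n\<^esub> i) ((sa ^^ (j - i)) x)"
    using assms sa_pow_closed by (simp add: sa_pow)
  then have "mv (inv\<^bsub>BS n n\<^esub> (a [^]\<^bsub>BS n n\<^esub> i)) (mv (a [^]\<^bsub>BS n n\<^esub> i) x) =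
     mv (inv\<^bsub>BS n n\<^esub> (a [^]\<^bsub>BS n n\<^esub> i)) (mv (a [^]\<^bsub>BS n n\<^esub> i) ((sa ^^ (j - i)) x))" by simp
  then show ?thesis using mv_inv(1)[of _ "a [^]\<^bsub>BS n n\<^esub> i"] assms(1) sa_pow_closed by simp
qed

definition per where "per x = (LEAST k. k > 0 \<and> (sa ^^ k) x = x)"

lemma per: assumes "x \<in> X" shows "per x > 0" "(sa ^^ per x) x = x"
  using LeastI[of "\<lambda>k. k > 0 \<and> (sa ^^ k) x = x" n] n0 sa_pow_n[OF assms] by (auto simp: per_def)

lemma per_least: "k > 0 \<Longrightarrow> (sa ^^ k) x = x \<Longrightarrow> per x \<le> k"
  unfolding per_def by (rule Least_le) simp

lemma per_mult: "x \<in> X \<Longrightarrow> (sa ^^ (per x * k)) x = x"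
  by (induction k) (simp_all add: funpow_add per)

lemma per_mod: assumes "x \<in> X" shows "(sa ^^ (k mod per x)) x = (sa ^^ k) x"
proof -
  have "(sa ^^ k) x = (sa ^^ (k mod per x + per x * (k div per x))) x" by simp
  also have "\<dots> = (sa ^^ (k mod per x)) ((sa ^^ (per x * (k div per x))) x)" by (simp only: funpow_add o_apply)
  finally show ?thesis using per_mult[OF assms] by simp
qed

lemma per_dvd: assumes "x \<in> X" shows "per x dvd n"
proof (rule ccontr)
  assume "\<not> ?thesis"
  then have "n mod per x > 0" by (simp add: dvd_eq_mod_eq_0)
  moreover have "(sa ^^ (n mod per x)) x = x" using per_mod[OF assms] sa_pow_n[OF assms] by simp
  ultimately have "per x \<le> n mod per x" by (rule per_least)
  then show False using mod_less_divisor[OF per(1)[OF assms], of n] by simp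
qed

lemma per_inj: assumes "x \<in> X" "i < per x" "j < per x" "(sa ^^ i) x = (sa ^^ j) x" shows "i = j"
proof -
  have *: "\<not> i < j" if "(sa ^^ i) x = (sa ^^ j) x" "j < per x" for i j
  proof
    assume "i < j"
    then have "(sa ^^ (j - i)) x = x" using sa_pow_cancel[OF assms(1)] that by simp
    then show False using per_least[of "j - i" x] \<open>i < j\<close> that by simp
  qed
  show ?thesis using *[of i j] *[of j i] assms by simp
qed

text \<open>Forward iterates give the full orbit, because \<open>sa ^^ n\<close> is the identity on
  \<open>X\<close>.\<close>

definition orb where "orb x = range (\<lambda>k. (sa ^^ k) x)"

lemma orb_self: "x \<in> orb x" unfolding orb_def by (rule range_eqI[of _ _ 0]) simp

lemma orb_X: "x \<in> X \<Longrightarrow> y \<in> orb x \<Longrightarrow> y \<in> X" by (auto simp: orb_def sa_pow_closed)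

lemma orb_sym: assumes "x \<in> X" "y \<in> orb x" shows "x \<in> orb y"
proof -
  obtain k where k: "y = (sa ^^ k) x" using assms by (auto simp: orb_def)
  have "k \<le> n * k" using n0 by simp
  then have "(sa ^^ (n * k - k)) y = (sa ^^ (n * k)) x" unfolding k by (simp flip: funpow_add o_apply[of "sa ^^ (n * k - k)"])
  then have "x = (sa ^^ (n * k - k)) y" using sa_pow_nk[OF assms(1)] by simp
  then show ?thesis unfolding orb_def by blast
qed

lemma orb_trans: "y \<in> orb x \<Longrightarrow> w \<in> orb y \<Longrightarrow> w \<in> orb x"
  unfolding orb_def by clarify (metis funpow_add o_apply rangeI)

lemma orb_eq: "x \<in> X \<Longrightarrow> y \<in> orb x \<Longrightarrow> orb y = orb x"
  using orb_sym orb_trans by blast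

lemma orb_sa: "sa x \<in> orb x" unfolding orb_def by (rule range_eqI[of _ _ 1]) simp

section \<open>A spanning tree of the graph of orbits and the coset representatives\<close>

text \<open>The elements of \<open>lev N\<close> are reached from the base point with at most \<open>N\<close> steps along \<open>t\<close>.\<close>

primrec lev where
  "lev 0 = orb H"
| "lev (Suc N) = lev N \<union> {y. \<exists>x\<in>lev N. y \<in> orb (mv t x) \<or> y \<in> orb (mv (inv\<^bsub>BS n n\<^esub> t) x)}"

lemma lev_X: "x \<in> lev N \<Longrightarrow> x \<in> X"
proof (induction N arbitrary: x)
  case 0
  then show ?case using orb_X[OF H_X] by simp
next
  case (Suc N)
  from Suc.prems consider "x \<in> lev N" | y where "y \<in> lev N" "x \<in> orb (mv t y)"
    | y where "y \<in> lev N" "x \<in> orb (mv (inv\<^bsub>BS n n\<^esub> t) y)" by auto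
  then show ?case using Suc.IH orb_X mv_closed B.inv_closed bs_gens_closed by cases blast+
qed

lemma lev_orb: "x \<in> lev N \<Longrightarrow> y \<in> orb x \<Longrightarrow> y \<in> lev N"
  by (induction N arbitrary: x) (auto dest: orb_trans)

lemma mv_inv_a: assumes "x \<in> X" shows "mv (inv\<^bsub>BS n n\<^esub> a) x \<in> orb x"
proof -
  have "sa (mv (inv\<^bsub>BS n n\<^esub> a) x) = x" using mv_inv(2)[OF assms] by (simp add: sa_def)
  then show ?thesis using orb_sym[of "mv (inv\<^bsub>BS n n\<^esub> a) x" x] orb_sa[of "mv (inv\<^bsub>BS n n\<^esub> a) x"] mv_closed[OF assms] by simp
qed

lemma lev_exists: assumes "x \<in> X" shows "\<exists>N. x \<in> lev N"
proof -
  obtain b where b: "b \<in> carrier (BS n n)" "x = mv b H" using X_E[OF assms] .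
  have "\<exists>N. mv b H \<in> lev N" using b(1)
  proof (induction rule: BS_induct)
    case one
    then show ?case using orb_self[of H] mv_one[OF H_X] by (intro exI[of _ 0]) simp
  next
    case (a p)
    then obtain N where "mv p H \<in> lev N" by blast
    then have "sa (mv p H) \<in> lev N" using lev_orb orb_sa by blast
    then show ?case using a H_X by (auto simp: mv_mult sa_def)
  next
    case (t p)
    then obtain N where "mv p H \<in> lev N" by blast
    then have "mv t (mv p H) \<in> lev (Suc N)" using orb_self by auto
    then show ?case using t H_X by (metis mv_mult bs_gens_closed(2))
  next
    case (ai p)
    then obtain N where N: "mv p H \<in> lev N" by blast
    then have "mv (inv\<^bsub>BS n n\<^esub> a) (mv p H) \<in> lev N" using lev_orb mv_inv_a[OF lev_X[OF N]] by blast
    then show ?case using ai H_X by (auto simp: mv_mult)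
  next
    case (ti p)
    then obtain N where "mv p H \<in> lev N" by blast
    then have "mv (inv\<^bsub>BS n n\<^esub> t) (mv p H) \<in> lev (Suc N)" using orb_self by auto
    then show ?case using ti H_X by (metis mv_mult bs_gens_closed(2) B.inv_closed)
  qed
  then show ?thesis using b by simp
qed

text \<open>Distance from the base orbit in the graph whose vertices are the a-orbits and whose
  edges come from t.\<close>

definition L where "L x = (LEAST N. x \<in> lev N)"

lemma L_lev: "x \<in> X \<Longrightarrow> x \<in> lev (L x)"
  using lev_exists LeastI_ex[of "\<lambda>N. x \<in> lev N"] by (simp add: L_def)

lemma L_le: "x \<in> lev N \<Longrightarrow> L x \<le> N" unfolding L_def by (rule Least_le)

lemma L_orb: assumes "x \<in> X" "y \<in> orb x" shows "L y = L x"
  using L_le[OF lev_orb[OF L_lev[OF assms(1)] assms(2)]]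
    L_le[OF lev_orb[OF L_lev[OF orb_X[OF assms]] orb_sym[OF assms]]] by simp

definition te where "te e = (if e then t else inv\<^bsub>BS n n\<^esub> t)"

lemma te_closed [simp]: "te e \<in> carrier (BS n n)" by (simp add: te_def)

definition is_parent where
  "is_parent C q \<longleftrightarrow> fst q \<in> X \<and> mv (te (snd q)) (fst q) \<in> C \<and> L (fst q) < L (mv (te (snd q)) (fst q))"

text \<open>The choice, for each orbit other than the base orbit, of one arc arriving from a nearer
  orbit: a spanning tree of the graph of orbits. The pair gives the coset where the arc starts and
  the direction in which t is applied.\<close>

definition par where "par C = (SOME q. is_parent C q)"

lemma par: assumes "x \<in> X" "x \<notin> orb H" shows "is_parent (orb x) (par (orb x))"
proof -
  have "L x \<noteq> 0" using L_lev[OF assms(1)] assms(2) by (metis lev.simps(1))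
  then obtain N where N: "L x = Suc N" by (cases "L x") auto
  have "x \<in> lev (Suc N)" "x \<notin> lev N" using L_lev[OF assms(1)] L_le[of x N] N by (metis, fastforce)
  then obtain y where y: "y \<in> lev N" "x \<in> orb (mv t y) \<or> x \<in> orb (mv (inv\<^bsub>BS n n\<^esub> t) y)" by auto
  then obtain e where e: "x \<in> orb (mv (te e) y)" by (metis te_def)
  have yX: "y \<in> X" "mv (te e) y \<in> X" using lev_X y(1) mv_closed by auto
  have "mv (te e) y \<in> orb x" using orb_sym[OF yX(2) e] .
  moreover have "L y < L (mv (te e) y)" using L_le[OF y(1)] N L_orb[OF assms(1) \<open>mv (te e) y \<in> orb x\<close>] by simp
  ultimately have "is_parent (orb x) (y, e)" using yX by (simp add: is_parent_def)
  then show ?thesis unfolding par_def by (rule someI)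
qed

text \<open>The point at which the spanning tree enters the orbit; the base orbit is not entered and
  gets the coset \<open>H\<close>.\<close>

definition bp where "bp C = (if C = orb H then H else mv (te (snd (par C))) (fst (par C)))"

lemma orb_H_iff: "x \<in> X \<Longrightarrow> orb x = orb H \<longleftrightarrow> x \<in> orb H"
  using orb_eq[OF H_X] orb_self by blast

lemma bp_orb: assumes "x \<in> X" shows "bp (orb x) \<in> orb x"
  using par[OF assms] orb_H_iff[OF assms] orb_self[of H] by (auto simp: bp_def is_parent_def)

lemma bp_X: "x \<in> X \<Longrightarrow> bp (orb x) \<in> X" using bp_orb orb_X by blast

lemma orb_bp: "x \<in> X \<Longrightarrow> orb (bp (orb x)) = orb x" using orb_eq bp_orb by blast

definition idx where "idx x = (LEAST i. x = (sa ^^ i) (bp (orb x)))"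

lemma idx: assumes "x \<in> X" shows "x = (sa ^^ idx x) (bp (orb x))" "idx x < per (bp (orb x))"
proof -
  have "x \<in> orb (bp (orb x))" using orb_sym[OF assms bp_orb[OF assms]] .
  then obtain k where k: "x = (sa ^^ k) (bp (orb x))" by (auto simp: orb_def)
  show "x = (sa ^^ idx x) (bp (orb x))" unfolding idx_def by (rule LeastI[of _ k]) (rule k)
  have "x = (sa ^^ (k mod per (bp (orb x)))) (bp (orb x))" using k per_mod[OF bp_X[OF assms]] by simp
  then have "idx x \<le> k mod per (bp (orb x))" unfolding idx_def by (rule Least_le)
  also have "\<dots> < per (bp (orb x))" using per(1)[OF bp_X[OF assms]] by simp
  finally show "idx x < per (bp (orb x))" .
qed

lemma idx_unique: assumes "x \<in> X" "i < per (bp (orb x))" "x = (sa ^^ i) (bp (orb x))" shows "idx x = i"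
  using per_inj[OF bp_X[OF assms(1)], of "idx x" i] idx[OF assms(1)] assms by simp

lemma idx_bp: "x \<in> X \<Longrightarrow> idx (bp (orb x)) = 0"
  using idx_unique[of "bp (orb x)" 0] per(1) bp_X orb_bp by simp

lemma orb_sa_eq: "x \<in> X \<Longrightarrow> orb (sa x) = orb x" using orb_eq orb_sa by blast

lemma idx_sa: assumes "x \<in> X"
  shows "sa x \<noteq> bp (orb x) \<Longrightarrow> idx (sa x) = Suc (idx x)" "sa x = bp (orb x) \<Longrightarrow> Suc (idx x) = per (bp (orb x))"
proof -
  let ?b = "bp (orb x)"
  have s: "sa x = (sa ^^ Suc (idx x)) ?b" using idx(1)[OF assms] by simp
  have lt: "Suc (idx x) \<le> per ?b" using idx(2)[OF assms] by simp
  show "idx (sa x) = Suc (idx x)" if "sa x \<noteq> ?b"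
  proof -
    have "Suc (idx x) \<noteq> per ?b" using that s per(2)[OF bp_X[OF assms]] by metis
    then show ?thesis using idx_unique[OF sa_closed[OF assms], of "Suc (idx x)"] s lt orb_sa_eq[OF assms] by simp
  qed
  show "Suc (idx x) = per ?b" if "sa x = ?b"
    using per_least[of "Suc (idx x)" ?b] that s lt by simp
qed

text \<open>The coset representatives \<open>u x\<close> follow the spanning tree that has one arc for each \<open>a\<close>-orbit other than that of
  the base point; within an orbit they follow \<open>a\<close>, starting from the endpoint of that arc.\<close>

definition u where
  "u = wfrec (measure L) (\<lambda>f x. a [^]\<^bsub>BS n n\<^esub> idx x \<otimes>\<^bsub>BS n n\<^esub>
     (if orb x = orb H then \<one>\<^bsub>BS n n\<^esub> else te (snd (par (orb x))) \<otimes>\<^bsub>BS n n\<^esub> f (fst (par (orb x)))))"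

lemma par_less: assumes "x \<in> X" "orb x \<noteq> orb H"
  shows "fst (par (orb x)) \<in> X" "L (fst (par (orb x))) < L x" "mv (te (snd (par (orb x)))) (fst (par (orb x))) = bp (orb x)"
proof -
  have p: "is_parent (orb x) (par (orb x))" using par assms orb_H_iff by blast
  then show "fst (par (orb x)) \<in> X" by (simp add: is_parent_def)
  show "L (fst (par (orb x))) < L x" using p L_orb[OF assms(1), of "mv (te (snd (par (orb x)))) (fst (par (orb x)))"]
    by (simp add: is_parent_def)
qed (use assms in \<open>simp add: bp_def\<close>)

lemma u_eq: assumes "x \<in> X"
  shows "u x = a [^]\<^bsub>BS n n\<^esub> idx x \<otimes>\<^bsub>BS n n\<^esub>
     (if orb x = orb H then \<one>\<^bsub>BS n n\<^esub> else te (snd (par (orb x))) \<otimes>\<^bsub>BS n n\<^esub> u (fst (par (orb x))))"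
  unfolding u_def by (subst wfrec, simp) (use par_less(2)[OF assms] in \<open>auto simp: cut_def\<close>)

lemma u_closed: "x \<in> X \<Longrightarrow> u x \<in> carrier (BS n n)"
proof (induction "L x" arbitrary: x rule: less_induct)
  case less
  then show ?case using par_less[of x] by (auto simp: u_eq[of x])
qed

lemma u_H: "u H = \<one>\<^bsub>BS n n\<^esub>"
  using u_eq[OF H_X] idx_bp[OF H_X] by (simp add: bp_def)

lemma u_sa: assumes "x \<in> X" "sa x \<noteq> bp (orb x)" shows "u (sa x) = a \<otimes>\<^bsub>BS n n\<^esub> u x"
proof -
  have "a [^]\<^bsub>BS n n\<^esub> Suc (idx x) = a \<otimes>\<^bsub>BS n n\<^esub> a [^]\<^bsub>BS n n\<^esub> idx x" by (rule B.nat_pow_Suc2) simp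
  then show ?thesis using idx_sa(1)[OF assms] u_eq[OF assms(1)] u_eq[OF sa_closed[OF assms(1)]] orb_sa_eq[OF assms(1)]
    par_less(1)[OF assms(1)] u_closed by (auto simp: B.m_assoc)
qed

lemma u_orb: assumes "x \<in> X" shows "u x = a [^]\<^bsub>BS n n\<^esub> idx x \<otimes>\<^bsub>BS n n\<^esub> u (bp (orb x))"
  using u_eq[OF assms] u_eq[OF bp_X[OF assms]] idx_bp[OF assms] orb_bp[OF assms] par_less(1)[OF assms] u_closed
  by auto

text \<open>The disjuncts are the two directions in which the spanning tree can run through the arc
  from \<open>x\<close> to \<open>mv t x\<close>.\<close>

definition tree_arc where
  "tree_arc x \<longleftrightarrow> (orb (mv t x) \<noteq> orb H \<and> par (orb (mv t x)) = (x, True)) \<or>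
     (orb x \<noteq> orb H \<and> par (orb x) = (mv t x, False))"

lemma u_tree: assumes x: "x \<in> X" and "tree_arc x" shows "u (mv t x) = t \<otimes>\<^bsub>BS n n\<^esub> u x"
  using assms(2) unfolding tree_arc_def
proof
  have tX: "mv t x \<in> X" using mv_closed x by simp
  assume *: "orb (mv t x) \<noteq> orb H \<and> par (orb (mv t x)) = (x, True)"
  then have b: "bp (orb (mv t x)) = mv t x" by (simp add: bp_def te_def)
  then have "idx (mv t x) = 0" using idx_bp[OF tX] by simp
  then show ?thesis using u_eq[OF tX] * x u_closed by (simp add: te_def)
next
  have tX: "mv t x \<in> X" using mv_closed x by simp
  assume *: "orb x \<noteq> orb H \<and> par (orb x) = (mv t x, False)"
  then have b: "bp (orb x) = x" using mv_inv(1)[OF x, of t] by (simp add: bp_def te_def)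
  then have "idx x = 0" using idx_bp[OF x] by simp
  then have "u x = inv\<^bsub>BS n n\<^esub> t \<otimes>\<^bsub>BS n n\<^esub> u (mv t x)" using u_eq[OF x] * tX u_closed by (simp add: te_def)
  then show ?thesis using tX u_closed by (simp add: B.m_assoc[symmetric])
qed

section \<open>The free product attached to the orbits and its cocycle\<close>

lemma countable_X: "countable X"
proof -
  have "(UNIV :: bs_gen set) = {BS_a, BS_t}" using bs_gen.exhaust by blast
  then have "finite (UNIV :: bs_gen set)" by (metis finite.emptyI finite_insert)
  then have "countable (lists (UNIV \<times> UNIV :: (bs_gen \<times> bool) set))"
    by (intro countable_lists countable_SIGMA countable_finite) auto
  then have "countable (carrier (BS n n))" by (simp add: BS_alt presented_group_alt carrier_word_quotient)
  then show ?thesis by (simp add: X_def)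
qed

text \<open>An enumeration of the cosets: the factors of the free product are to be indexed by
  natural numbers.\<close>

definition nx where "nx = to_nat_on X"
definition xn where "xn = from_nat_into X"

lemma xn_nx: "x \<in> X \<Longrightarrow> xn (nx x) = x"
  using from_nat_into_to_nat_on[OF countable_X] by (simp add: nx_def xn_def)

text \<open>Even indices give one factor per a-orbit, recorded by its entry point x. Running once
  round the orbit takes \<open>a\<close> to the power \<open>per x\<close>, and
  \<open>n div per x\<close> rounds give z; this is the order of the factor in \<open>Kx\<close>.
  Odd indices give an infinite cyclic factor for each t-arc outside the spanning tree.\<close>

definition Ix where "Ix = (\<lambda>x. 2 * nx x) ` {x \<in> X. bp (orb x) = x} \<union> (\<lambda>x. 2 * nx x + 1) ` {x \<in> X. \<not> tree_arc x}"
definition Kx where "Kx i = (if even i then integer_mod_group (n div per (xn (i div 2))) else integer_group)"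

lemma Kx_even: "x \<in> X \<Longrightarrow> Kx (2 * nx x) = integer_mod_group (n div per x)" by (simp add: Kx_def xn_nx)

lemma Kx_odd: "Kx (Suc (2 * nx x)) = integer_group" by (simp add: Kx_def)

sublocale fp: free_prod Ix Kx by (rule free_prod.intro) (auto simp: Kx_def)
sublocale FP: Group.group "free_product Ix Kx" by (rule fp.group_FP)

abbreviation FP where "FP \<equiv> free_product Ix Kx"

text \<open>The generator of the factor. If \<open>per x = n\<close> the factor is trivial and 1 is
  not in its carrier, hence the reduction.\<close>

definition Y where "Y x = fcls Ix Kx [(2 * nx x, 1 mod int (n div per x))]"
definition E where "E x = fcls Ix Kx [(2 * nx x + 1, 1)]"

lemma quot_pos: "x \<in> X \<Longrightarrow> n div per x > 0"
  using per_dvd n0 by (metis dvd_div_eq_0_iff gr0I)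

lemma Y_index: assumes "x \<in> X" "bp (orb x) = x"
  shows "2 * nx x \<in> Ix" "1 mod int (n div per x) \<in> carrier (Kx (2 * nx x))"
  using assms quot_pos[OF assms(1)] by (auto simp: Ix_def Kx_even carrier_integer_mod_group)

lemma Y_pow: assumes "x \<in> X" "bp (orb x) = x"
  shows "Y x [^]\<^bsub>FP\<^esub> (k::int) = fcls Ix Kx [(2 * nx x, k mod int (n div per x))]"
proof -
  have "Y x [^]\<^bsub>FP\<^esub> k = fcls Ix Kx [(2 * nx x, (1 mod int (n div per x)) [^]\<^bsub>Kx (2 * nx x)\<^esub> k)]"
    unfolding Y_def
    by (rule hom_int_pow[OF fp.fgen_hom, symmetric]) (use Y_index[OF assms] fp.group_FP fp.factor_group in auto)
  then show ?thesis by (simp add: Kx_even[OF assms(1)] int_pow_integer_mod_group mod_mult_right_eq)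
qed

lemma Y_closed: "x \<in> X \<Longrightarrow> bp (orb x) = x \<Longrightarrow> Y x \<in> carrier FP"
  using Y_index unfolding Y_def by (intro fp.fcls_closed) auto

lemma E_closed: "x \<in> X \<Longrightarrow> \<not> tree_arc x \<Longrightarrow> E x \<in> carrier FP"
  unfolding E_def by (intro fp.fcls_closed) (auto simp: Ix_def Kx_odd)

lemma Y_pow_one: assumes "x \<in> X" "bp (orb x) = x" shows "Y x [^]\<^bsub>FP\<^esub> (n div per x) = \<one>\<^bsub>FP\<^esub>"
proof -
  have "Y x [^]\<^bsub>FP\<^esub> int (n div per x) = fcls Ix Kx [(2 * nx x, \<one>\<^bsub>Kx (2 * nx x)\<^esub>)]"
    using Y_pow[OF assms, of "int (n div per x)"] by (simp add: Kx_even[OF assms(1)])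
  then show ?thesis using fp.fgen_one[OF Y_index(1)[OF assms]] by (simp add: int_pow_int fp.one_free_product)
qed

text \<open>The values of the cocycle on a and t: trivial along the representatives, and a generator
  of a factor where a step closes an orbit or leaves the spanning tree.\<close>

definition ca where "ca x = (if sa x = bp (orb x) then Y (bp (orb x)) else \<one>\<^bsub>FP\<^esub>)"
definition ct where "ct x = (if tree_arc x then \<one>\<^bsub>FP\<^esub> else E x)"

lemma ca_closed: "x \<in> X \<Longrightarrow> ca x \<in> carrier FP" using Y_closed bp_X orb_bp by (simp add: ca_def)
lemma ct_closed: "x \<in> X \<Longrightarrow> ct x \<in> carrier FP" using E_closed by (simp add: ct_def)

text \<open>BS(n,n) acts on pairs of a coset and an element of \<open>FP\<close>: a and t move the
  coset and multiply the second component by \<open>ca\<close> and \<open>ct\<close>. The relation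
  holds because a^n acts trivially: it runs \<open>n div per x\<close> times round the orbit entered
  at x, and \<open>Y x\<close> to this power is 1. Every element acts on the fibre over a coset as a
  left translation, and these translations form the cocycle.\<close>

lemma cocycle_exists:
  "\<exists>c. (\<forall>g\<in>carrier (BS n n). \<forall>x\<in>X. c g x \<in> carrier FP) \<and>
    (\<forall>g\<in>carrier (BS n n). \<forall>h\<in>carrier (BS n n). \<forall>x\<in>X. c (g \<otimes>\<^bsub>BS n n\<^esub> h) x = c g (mv h x) \<otimes>\<^bsub>FP\<^esub> c h x) \<and>
    (\<forall>x\<in>X. c a x = ca x) \<and> (\<forall>x\<in>X. c t x = ct x)"
proof -
  define S where "S = X \<times> carrier FP"
  define fa where "fa = (\<lambda>(x, p). (sa x, ca x \<otimes>\<^bsub>FP\<^esub> p))"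
  define fa' where "fa' = (\<lambda>(x, p). (mv (inv\<^bsub>BS n n\<^esub> a) x, inv\<^bsub>FP\<^esub> ca (mv (inv\<^bsub>BS n n\<^esub> a) x) \<otimes>\<^bsub>FP\<^esub> p))"
  define ft where "ft = (\<lambda>(x, p). (mv t x, ct x \<otimes>\<^bsub>FP\<^esub> p))"
  define ft' where "ft' = (\<lambda>(x, p). (mv (inv\<^bsub>BS n n\<^esub> t) x, inv\<^bsub>FP\<^esub> ct (mv (inv\<^bsub>BS n n\<^esub> t) x) \<otimes>\<^bsub>FP\<^esub> p))"
  have fS: "fa s \<in> S" "fa' s \<in> S" "ft s \<in> S" "ft' s \<in> S" if "s \<in> S" for s
    using that by (auto simp: S_def fa_def fa'_def ft_def ft'_def sa_closed ca_closed ct_closed mv_closed)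
  have finv: "fa (fa' s) = s" "fa' (fa s) = s" "ft (ft' s) = s" "ft' (ft s) = s" if "s \<in> S" for s
    using that by (auto simp: S_def fa_def fa'_def ft_def ft'_def sa_def mv_inv ca_closed ct_closed mv_closed FP.m_assoc[symmetric])
  have fa_b: "(fa ^^ k) (b, p) = ((sa ^^ k) b, p)" if "b \<in> X" "bp (orb b) = b" "k < per b" "p \<in> carrier FP" for b k p
    using that(3)
  proof (induction k)
    case (Suc k)
    have "(sa ^^ Suc k) b \<noteq> b" using per_inj[OF that(1), of "Suc k" 0] Suc.prems by auto
    moreover have "orb ((sa ^^ k) b) = orb b" using orb_eq[OF that(1)] by (auto simp: orb_def)
    ultimately have "ca ((sa ^^ k) b) = \<one>\<^bsub>FP\<^esub>" using that(2) by (simp add: ca_def)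
    then show ?case using Suc that(4) by (simp add: fa_def)
  qed simp
  have fa_per: "(fa ^^ per b) (b, p) = (b, Y b \<otimes>\<^bsub>FP\<^esub> p)" if b: "b \<in> X" "bp (orb b) = b" "p \<in> carrier FP" for b p
  proof -
    obtain k where k: "per b = Suc k" using per(1)[OF b(1)] by (cases "per b") auto
    have "orb ((sa ^^ k) b) = orb b" using orb_eq[OF b(1)] by (auto simp: orb_def)
    moreover have "sa ((sa ^^ k) b) = b" using per(2)[OF b(1)] k by simp
    ultimately have "ca ((sa ^^ k) b) = Y b" using b(2) by (simp add: ca_def)
    then show ?thesis using fa_b[OF b(1,2) _ b(3), of k] \<open>sa ((sa ^^ k) b) = b\<close> by (simp add: k fa_def)
  qed
  have fa_perk: "(fa ^^ (per b * k)) (b, p) = (b, Y b [^]\<^bsub>FP\<^esub> k \<otimes>\<^bsub>FP\<^esub> p)" if b: "b \<in> X" "bp (orb b) = b" "p \<in> carrier FP" for b p k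
  proof (induction k)
    case (Suc k)
    have "(fa ^^ (per b * Suc k)) (b, p) = (fa ^^ per b) ((fa ^^ (per b * k)) (b, p))" by (simp add: funpow_add)
    also have "\<dots> = (b, Y b \<otimes>\<^bsub>FP\<^esub> (Y b [^]\<^bsub>FP\<^esub> k \<otimes>\<^bsub>FP\<^esub> p))" using Suc fa_per[OF b(1,2)] b(3) Y_closed[OF b(1,2)] by simp
    also have "Y b \<otimes>\<^bsub>FP\<^esub> (Y b [^]\<^bsub>FP\<^esub> k \<otimes>\<^bsub>FP\<^esub> p) = Y b [^]\<^bsub>FP\<^esub> Suc k \<otimes>\<^bsub>FP\<^esub> p"
      using FP.nat_pow_Suc2[OF Y_closed[OF b(1,2)], of k] Y_closed[OF b(1,2)] b(3) by (simp add: FP.m_assoc)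
    finally show ?case .
  qed (use that in simp)
  have fa_n: "(fa ^^ n) s = s" if s: "s \<in> S" for s
  proof -
    obtain x p where x: "s = (x, p)" "x \<in> X" "p \<in> carrier FP" using s by (auto simp: S_def)
    \<comment> \<open>The claim is computed at the entry point b and transported to x by a power of
      \<open>fa\<close>, which commutes with \<open>fa ^^ n\<close>.\<close>
    define b where "b = bp (orb x)"
    have b: "b \<in> X" "bp (orb b) = b" using bp_X[OF x(2)] orb_bp[OF x(2)] by (auto simp: b_def)
    have s': "s = (fa ^^ idx x) (b, p)" using fa_b[OF b _ x(3), of "idx x"] idx[OF x(2)] x(1) by (simp add: b_def)
    have "(fa ^^ (per b * (n div per b))) (b, p) = (b, p)" using fa_perk[OF b x(3)] Y_pow_one[OF b] x(3) by simp
    then have nb: "(fa ^^ n) (b, p) = (b, p)" using per_dvd[OF b(1)] by simp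
    have "(fa ^^ n) s = (fa ^^ (n + idx x)) (b, p)" unfolding s' by (simp only: funpow_add o_apply)
    also have "\<dots> = (fa ^^ (idx x + n)) (b, p)" by (simp only: add.commute)
    also have "\<dots> = (fa ^^ idx x) ((fa ^^ n) (b, p))" by (simp only: funpow_add o_apply)
    finally show ?thesis using nb s' by simp
  qed
  have rel: "ft ((fa ^^ n) (ft' s)) = (fa ^^ n) s" if "s \<in> S" for s
    using fa_n[OF that] fa_n[OF fS(4)[OF that]] finv(3)[OF that] by simp
  obtain \<Phi> where \<Phi>a: "\<And>s. s \<in> S \<Longrightarrow> \<Phi> a s = fa s" and \<Phi>t: "\<And>s. s \<in> S \<Longrightarrow> \<Phi> t s = ft s"
    and \<Phi>S: "\<And>p s. p \<in> carrier (BS n n) \<Longrightarrow> s \<in> S \<Longrightarrow> \<Phi> p s \<in> S"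
    and \<Phi>1: "\<And>s. s \<in> S \<Longrightarrow> \<Phi> \<one>\<^bsub>BS n n\<^esub> s = s"
    and \<Phi>m: "\<And>p q s. p \<in> carrier (BS n n) \<Longrightarrow> q \<in> carrier (BS n n) \<Longrightarrow> s \<in> S \<Longrightarrow> \<Phi> (p \<otimes>\<^bsub>BS n n\<^esub> q) s = \<Phi> p (\<Phi> q s)"
    by (rule BS_action[OF fS finv rel]) (assumption | rule that)+
  \<comment> \<open>States that g acts on each fibre as a left translation; this passes from a and t
    to products and inverses.\<close>
  define good where "good g \<longleftrightarrow> g \<in> carrier (BS n n) \<and>
    (\<forall>x\<in>X. \<exists>q\<in>carrier FP. \<forall>r\<in>carrier FP. \<Phi> g (x, r) = (mv g x, q \<otimes>\<^bsub>FP\<^esub> r))" for g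
  have good_a: "good a" unfolding good_def using \<Phi>a ca_closed by (auto simp: S_def fa_def sa_def)
  have good_t: "good t" unfolding good_def using \<Phi>t ct_closed by (auto simp: S_def ft_def)
  have good_mult: "good (g \<otimes>\<^bsub>BS n n\<^esub> h)" if g: "good g" and h: "good h" for g h
    unfolding good_def
  proof (intro conjI ballI)
    show "g \<otimes>\<^bsub>BS n n\<^esub> h \<in> carrier (BS n n)" using g h by (simp add: good_def)
    fix x assume x: "x \<in> X"
    obtain q where q: "q \<in> carrier FP" "\<And>r. r \<in> carrier FP \<Longrightarrow> \<Phi> h (x, r) = (mv h x, q \<otimes>\<^bsub>FP\<^esub> r)"
      using h x by (auto simp: good_def)
    have "mv h x \<in> X" using h x mv_closed by (simp add: good_def)
    then obtain q' where q': "q' \<in> carrier FP" "\<And>r. r \<in> carrier FP \<Longrightarrow> \<Phi> g (mv h x, r) = (mv g (mv h x), q' \<otimes>\<^bsub>FP\<^esub> r)"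
      using g by (auto simp: good_def)
    show "\<exists>q\<in>carrier FP. \<forall>r\<in>carrier FP. \<Phi> (g \<otimes>\<^bsub>BS n n\<^esub> h) (x, r) = (mv (g \<otimes>\<^bsub>BS n n\<^esub> h) x, q \<otimes>\<^bsub>FP\<^esub> r)"
      using q q' g h x by (intro bexI[of _ "q' \<otimes>\<^bsub>FP\<^esub> q"]) (auto simp: good_def S_def \<Phi>m mv_mult FP.m_assoc)
  qed
  have good_inv: "good (inv\<^bsub>BS n n\<^esub> g)" if g: "good g" for g
    unfolding good_def
  proof (intro conjI ballI)
    show "inv\<^bsub>BS n n\<^esub> g \<in> carrier (BS n n)" using g by (simp add: good_def)
    fix x assume x: "x \<in> X"
    define y where "y = mv (inv\<^bsub>BS n n\<^esub> g) x"
    have gc: "g \<in> carrier (BS n n)" using g by (simp add: good_def)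
    have y: "y \<in> X" "mv g y = x" using x gc mv_closed mv_inv by (auto simp: y_def)
    obtain q where q: "q \<in> carrier FP" "\<And>r. r \<in> carrier FP \<Longrightarrow> \<Phi> g (y, r) = (mv g y, q \<otimes>\<^bsub>FP\<^esub> r)"
      using g y by (auto simp: good_def)
    have "\<Phi> (inv\<^bsub>BS n n\<^esub> g) (x, r) = (y, inv\<^bsub>FP\<^esub> q \<otimes>\<^bsub>FP\<^esub> r)" if r: "r \<in> carrier FP" for r
    proof -
      have "\<Phi> g (y, inv\<^bsub>FP\<^esub> q \<otimes>\<^bsub>FP\<^esub> r) = (x, r)" using q y r by (simp add: FP.m_assoc[symmetric])
      then have "\<Phi> (inv\<^bsub>BS n n\<^esub> g) (x, r) = \<Phi> (inv\<^bsub>BS n n\<^esub> g \<otimes>\<^bsub>BS n n\<^esub> g) (y, inv\<^bsub>FP\<^esub> q \<otimes>\<^bsub>FP\<^esub> r)"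
        using \<Phi>m[of "inv\<^bsub>BS n n\<^esub> g" g "(y, inv\<^bsub>FP\<^esub> q \<otimes>\<^bsub>FP\<^esub> r)"] gc q y r by (simp add: S_def)
      then show ?thesis using \<Phi>1[of "(y, inv\<^bsub>FP\<^esub> q \<otimes>\<^bsub>FP\<^esub> r)"] gc q y r by (simp add: S_def)
    qed
    then show "\<exists>q\<in>carrier FP. \<forall>r\<in>carrier FP. \<Phi> (inv\<^bsub>BS n n\<^esub> g) (x, r) = (mv (inv\<^bsub>BS n n\<^esub> g) x, q \<otimes>\<^bsub>FP\<^esub> r)"
      using q by (intro bexI[of _ "inv\<^bsub>FP\<^esub> q"]) (auto simp: y_def)
  qed
  have good_one: "good \<one>\<^bsub>BS n n\<^esub>" unfolding good_def using \<Phi>1 by (auto simp: S_def mv_one intro!: bexI[of _ "\<one>\<^bsub>FP\<^esub>"])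
  have good: "good g" if "g \<in> carrier (BS n n)" for g using that
    by (induction rule: BS_induct) (intro good_one good_mult good_inv good_a good_t; assumption)+
  \<comment> \<open>The translation is read off at the identity of \<open>FP\<close>.\<close>
  define c where "c g x = snd (\<Phi> g (x, \<one>\<^bsub>FP\<^esub>))" for g x
  have c: "c g x \<in> carrier FP \<and> (\<forall>r\<in>carrier FP. \<Phi> g (x, r) = (mv g x, c g x \<otimes>\<^bsub>FP\<^esub> r))" if g: "g \<in> carrier (BS n n)" "x \<in> X" for g x
  proof -
    obtain q where q: "q \<in> carrier FP" "\<And>r. r \<in> carrier FP \<Longrightarrow> \<Phi> g (x, r) = (mv g x, q \<otimes>\<^bsub>FP\<^esub> r)"
      using good[OF g(1)] g(2) by (auto simp: good_def)
    then have "c g x = q" by (simp add: c_def)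
    then show ?thesis using q by simp
  qed
  have "c (g \<otimes>\<^bsub>BS n n\<^esub> h) x = c g (mv h x) \<otimes>\<^bsub>FP\<^esub> c h x" if "g \<in> carrier (BS n n)" "h \<in> carrier (BS n n)" "x \<in> X" for g h x
  proof -
    have "\<Phi> (g \<otimes>\<^bsub>BS n n\<^esub> h) (x, \<one>\<^bsub>FP\<^esub>) = \<Phi> g (\<Phi> h (x, \<one>\<^bsub>FP\<^esub>))" using \<Phi>m that by (simp add: S_def)
    also have "\<Phi> h (x, \<one>\<^bsub>FP\<^esub>) = (mv h x, c h x)" using c[of h x] that by simp
    also have "\<Phi> g (mv h x, c h x) = (mv g (mv h x), c g (mv h x) \<otimes>\<^bsub>FP\<^esub> c h x)"
      using c[of g "mv h x"] c[of h x] that mv_closed by blast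
    finally show ?thesis unfolding c_def[of "g \<otimes>\<^bsub>BS n n\<^esub> h" x] by simp
  qed
  moreover have "c a x = ca x" "c t x = ct x" if "x \<in> X" for x
    using \<Phi>a[of "(x, \<one>\<^bsub>FP\<^esub>)"] \<Phi>t[of "(x, \<one>\<^bsub>FP\<^esub>)"] ca_closed[OF that] ct_closed[OF that] that
    by (simp_all add: c_def S_def fa_def ft_def)
  ultimately show ?thesis using c by (intro exI[of _ c]) auto
qed

lemma mv_u: "x \<in> X \<Longrightarrow> mv (u x) H = x"
proof (induction "L x" arbitrary: x rule: less_induct)
  case less
  have b: "bp (orb x) \<in> X" using bp_X less.prems .
  have "mv (if orb x = orb H then \<one>\<^bsub>BS n n\<^esub> else te (snd (par (orb x))) \<otimes>\<^bsub>BS n n\<^esub> u (fst (par (orb x)))) H = bp (orb x)"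
  proof (cases "orb x = orb H")
    case True
    then show ?thesis by (simp add: mv_one H_X bp_def)
  next
    case False
    note p = par_less[OF less.prems False]
    show ?thesis using less.hyps[OF p(2,1)] p(3) False u_closed[OF p(1)] by (simp add: mv_mult H_X)
  qed
  moreover have "(if orb x = orb H then \<one>\<^bsub>BS n n\<^esub> else te (snd (par (orb x))) \<otimes>\<^bsub>BS n n\<^esub> u (fst (par (orb x)))) \<in> carrier (BS n n)"
    using par_less[OF less.prems] u_closed by auto
  ultimately have "mv (u x) H = mv (a [^]\<^bsub>BS n n\<^esub> idx x) (bp (orb x))"
    using u_eq[OF less.prems] by (simp add: mv_mult[OF H_X])
  then show ?case using sa_pow[OF b] idx(1)[OF less.prems] by simp
qed

definition zpow where "zpow = range (\<lambda>k::int. z [^]\<^bsub>BS n n\<^esub> k)"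

lemma zpow_normal: "zpow \<lhd> BS n n"
  unfolding B.normal_inv_iff
proof (intro conjI ballI)
  show "subgroup zpow (BS n n)" unfolding zpow_def by (rule B.subgroup_of_powers) simp
  fix x h assume x: "x \<in> carrier (BS n n)" and "h \<in> zpow"
  then obtain k :: int where h: "h = z [^]\<^bsub>BS n n\<^esub> k" by (auto simp: zpow_def)
  have "inv\<^bsub>BS n n\<^esub> (inv\<^bsub>BS n n\<^esub> x) \<otimes>\<^bsub>BS n n\<^esub> z \<otimes>\<^bsub>BS n n\<^esub> inv\<^bsub>BS n n\<^esub> x = z"
    using bsa_pow_central[OF x] x by (simp flip: bsa_pow_central) (simp add: B.m_assoc)
  then have "x \<otimes>\<^bsub>BS n n\<^esub> h \<otimes>\<^bsub>BS n n\<^esub> inv\<^bsub>BS n n\<^esub> x = h"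
    using B.conj_int_pow[of "inv\<^bsub>BS n n\<^esub> x" z k] x h by simp
  then show "x \<otimes>\<^bsub>BS n n\<^esub> h \<otimes>\<^bsub>BS n n\<^esub> inv\<^bsub>BS n n\<^esub> x \<in> zpow" using \<open>h \<in> zpow\<close> by simp
qed

end

lemma (in group) int_pow_mod:
  assumes "y \<in> carrier G" "y [^] (k::nat) = \<one>"
  shows "y [^] (j mod int k) = y [^] (j::int)"
proof -
  have "y [^] j = y [^] (int k * (j div int k) + j mod int k)" by simp
  also have "\<dots> = (y [^] int k) [^] (j div int k) \<otimes> y [^] (j mod int k)"
    using assms(1) by (simp only: int_pow_mult int_pow_pow)
  finally show ?thesis using assms by (simp add: int_pow_int)
qed

lemma (in group) integer_mod_group_hom:
  assumes "y \<in> carrier G" "y [^] (k::nat) = \<one>"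
  shows "(\<lambda>j::int. y [^] j) \<in> hom (integer_mod_group k) G"
  by (rule homI) (use assms int_pow_mod[OF assms] in \<open>auto simp: int_pow_mult\<close>)

section \<open>The Kurosh argument\<close>

context bs_subgroup
begin

text \<open>The map is \<rho> h = c h H; it is multiplicative on \<open>H\<close> because elements
  of the subgroup fix the base coset. It is onto, since Schreier generators are sent to the
  generators \<open>Y\<close> and \<open>E\<close>. For the kernel, a homomorphism \<gamma> from
  \<open>FP\<close> to BS(n,n) modulo the powers of z takes \<open>Y\<close> and \<open>E\<close>
  back to the classes of these Schreier generators. Then \<gamma> composed with \<rho> is the
  canonical projection, so only powers of z can be killed by \<rho>.\<close>

theorem kurosh:
  "\<exists>\<rho>\<in>hom (BS n n\<lparr>carrier := H\<rparr>) FP. \<rho> ` H = carrier FP \<and> (\<forall>h\<in>H. \<rho> h = \<one>\<^bsub>FP\<^esub> \<longleftrightarrow> h \<in> zpow)"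
proof -
  obtain c where c: "(\<forall>g\<in>carrier (BS n n). \<forall>x\<in>X. c g x \<in> carrier FP) \<and>
    (\<forall>g\<in>carrier (BS n n). \<forall>h\<in>carrier (BS n n). \<forall>x\<in>X. c (g \<otimes>\<^bsub>BS n n\<^esub> h) x = c g (mv h x) \<otimes>\<^bsub>FP\<^esub> c h x) \<and>
    (\<forall>x\<in>X. c a x = ca x) \<and> (\<forall>x\<in>X. c t x = ct x)"
    using cocycle_exists by (elim exE) (rule that)
  have cc: "c g x \<in> carrier FP" if "g \<in> carrier (BS n n)" "x \<in> X" for g x using c that by blast
  have cm: "c (g \<otimes>\<^bsub>BS n n\<^esub> h) x = c g (mv h x) \<otimes>\<^bsub>FP\<^esub> c h x"
    if "g \<in> carrier (BS n n)" "h \<in> carrier (BS n n)" "x \<in> X" for g h x using c that by blast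
  have c_a: "c a x = ca x" and c_t: "c t x = ct x" if "x \<in> X" for x using c that by blast+
  have c1: "c \<one>\<^bsub>BS n n\<^esub> x = \<one>\<^bsub>FP\<^esub>" if x: "x \<in> X" for x
    using cm[of "\<one>\<^bsub>BS n n\<^esub>" "\<one>\<^bsub>BS n n\<^esub>" x] cc[of "\<one>\<^bsub>BS n n\<^esub>" x] x mv_one by simp
  have ci: "c (inv\<^bsub>BS n n\<^esub> g) (mv g x) = inv\<^bsub>FP\<^esub> c g x" if g: "g \<in> carrier (BS n n)" "x \<in> X" for g x
  proof -
    have "c (inv\<^bsub>BS n n\<^esub> g) (mv g x) \<otimes>\<^bsub>FP\<^esub> c g x = \<one>\<^bsub>FP\<^esub>" using cm[of "inv\<^bsub>BS n n\<^esub> g" g x] g c1 by simp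
    then show ?thesis using FP.inv_equality cc g mv_closed by simp
  qed
  have ca_pow: "c (a [^]\<^bsub>BS n n\<^esub> k) b = \<one>\<^bsub>FP\<^esub>" if b: "b \<in> X" "bp (orb b) = b" "k < per b" for b k
    using b(3)
  proof (induction k)
    case (Suc k)
    have "(sa ^^ Suc k) b \<noteq> b" using per_inj[OF b(1), of "Suc k" 0] Suc.prems by auto
    moreover have "orb ((sa ^^ k) b) = orb b" using orb_eq[OF b(1)] by (auto simp: orb_def)
    ultimately have "ca ((sa ^^ k) b) = \<one>\<^bsub>FP\<^esub>" using b(2) by (simp add: ca_def)
    moreover have "c (a \<otimes>\<^bsub>BS n n\<^esub> a [^]\<^bsub>BS n n\<^esub> k) b = ca ((sa ^^ k) b) \<otimes>\<^bsub>FP\<^esub> c (a [^]\<^bsub>BS n n\<^esub> k) b"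
      using cm[of a "a [^]\<^bsub>BS n n\<^esub> k" b] b(1) sa_pow[OF b(1)] c_a[OF sa_pow_closed[OF b(1)]] by simp
    ultimately show ?case using Suc B.nat_pow_Suc2[of a k] by simp
  qed (use c1 b in simp)
  have ca_per: "c (a [^]\<^bsub>BS n n\<^esub> per b) b = Y b" if b: "b \<in> X" "bp (orb b) = b" for b
  proof -
    obtain k where k: "per b = Suc k" using per(1)[OF b(1)] by (cases "per b") auto
    have "orb ((sa ^^ k) b) = orb b" using orb_eq[OF b(1)] by (auto simp: orb_def)
    moreover have "sa ((sa ^^ k) b) = b" using per(2)[OF b(1)] k by simp
    ultimately have "ca ((sa ^^ k) b) = Y b" using b(2) by (simp add: ca_def)
    moreover have "c (a \<otimes>\<^bsub>BS n n\<^esub> a [^]\<^bsub>BS n n\<^esub> k) b = ca ((sa ^^ k) b) \<otimes>\<^bsub>FP\<^esub> c (a [^]\<^bsub>BS n n\<^esub> k) b"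
      using cm[of a "a [^]\<^bsub>BS n n\<^esub> k" b] b(1) sa_pow[OF b(1)] c_a[OF sa_pow_closed[OF b(1)]] by simp
    ultimately show ?thesis using ca_pow[OF b, of k] k B.nat_pow_Suc2[of a k] Y_closed[OF b] by simp
  qed
  have ca_perk: "c (a [^]\<^bsub>BS n n\<^esub> (per b * k)) b = Y b [^]\<^bsub>FP\<^esub> k" if b: "b \<in> X" "bp (orb b) = b" for b k
  proof (induction k)
    case (Suc k)
    have "a [^]\<^bsub>BS n n\<^esub> (per b * Suc k) = a [^]\<^bsub>BS n n\<^esub> (per b * k) \<otimes>\<^bsub>BS n n\<^esub> a [^]\<^bsub>BS n n\<^esub> per b"
      by (simp add: B.nat_pow_mult add.commute)
    then show ?case using cm[of "a [^]\<^bsub>BS n n\<^esub> (per b * k)" "a [^]\<^bsub>BS n n\<^esub> per b" b] b(1) Suc ca_per[OF b]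
      sa_pow[OF b(1), of "per b"] per(2)[OF b(1)] by simp
  qed (use c1 b in simp)
  \<comment> \<open>The representatives follow the spanning tree, along which the cocycle is
    trivial; the induction is over the level \<open>L\<close>.\<close>
  have cu: "c (u x) H = \<one>\<^bsub>FP\<^esub>" if "x \<in> X" for x
    using that
  proof (induction "L x" arbitrary: x rule: less_induct)
    case less
    let ?b = "bp (orb x)"
    have b: "?b \<in> X" "bp (orb ?b) = ?b" using bp_X orb_bp less.prems by auto
    have "c (u ?b) H = \<one>\<^bsub>FP\<^esub>"
    proof (cases "orb x = orb H")
      case True
      then have "?b = H" by (simp add: bp_def)
      then show ?thesis using u_H c1[OF H_X] by simp
    next
      case False
      obtain y e where ye: "par (orb x) = (y, e)" by (cases "par (orb x)")
      have p: "y \<in> X" "L y < L x" "mv (te e) y = ?b" using par_less[OF less.prems False] ye by auto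
      have ub: "u ?b = te e \<otimes>\<^bsub>BS n n\<^esub> u y" using u_eq[OF b(1)] idx_bp[OF less.prems] orb_bp[OF less.prems] False ye p(1) u_closed by simp
      have "c (te e) y = \<one>\<^bsub>FP\<^esub>"
      proof (cases e)
        case True
        then have "tree_arc y" using False ye p(3) orb_bp[OF less.prems] by (simp add: tree_arc_def te_def)
        then show ?thesis using True c_t[OF p(1)] by (simp add: te_def ct_def)
      next
        case e: False
        have y: "y = mv t ?b" using p(3) e mv_inv(2)[OF p(1), of t] by (simp add: te_def)
        then have "tree_arc ?b" using False ye orb_bp[OF less.prems] e by (simp add: tree_arc_def)
        then have "c (inv\<^bsub>BS n n\<^esub> t) (mv t ?b) = \<one>\<^bsub>FP\<^esub>" using ci[of t ?b] b c_t[OF b(1)] by (simp add: ct_def)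
        then show ?thesis using e y by (simp add: te_def)
      qed
      then show ?thesis using ub cm[of "te e" "u y" H] u_closed[OF p(1)] H_X mv_u[OF p(1)] less.hyps[OF p(2,1)] by simp
    qed
    then show ?case
      using u_orb[OF less.prems] cm[of "a [^]\<^bsub>BS n n\<^esub> idx x" "u ?b" H] u_closed[OF b(1)] H_X mv_u[OF b(1)]
        ca_pow[OF b idx(2)[OF less.prems]] by simp
  qed
  define \<rho> where "\<rho> h = c h H" for h
  have HB: "h \<in> H \<Longrightarrow> h \<in> carrier (BS n n)" for h using subgroup.mem_carrier[OF sub] .
  have gH: "Group.group (BS n n\<lparr>carrier := H\<rparr>)" using B.subgroup_imp_group[OF sub] .
  have \<rho>: "\<rho> \<in> hom (BS n n\<lparr>carrier := H\<rparr>) FP"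
  proof (rule homI)
    have mvH: "mv h H = H" if "h \<in> H" for h using mv_H_iff HB that by blast
    fix g h assume "g \<in> carrier (BS n n\<lparr>carrier := H\<rparr>)" "h \<in> carrier (BS n n\<lparr>carrier := H\<rparr>)"
    then show "\<rho> (g \<otimes>\<^bsub>BS n n\<lparr>carrier := H\<rparr>\<^esub> h) = \<rho> g \<otimes>\<^bsub>FP\<^esub> \<rho> h"
      using cm[of g h H] HB H_X mvH by (simp add: \<rho>_def)
  qed (use cc HB H_X in \<open>simp add: \<rho>_def\<close>)
  have \<rho>_pow: "\<rho> (h [^]\<^bsub>BS n n\<^esub> (k::int)) = \<rho> h [^]\<^bsub>FP\<^esub> k \<and> h [^]\<^bsub>BS n n\<^esub> k \<in> H" if "h \<in> H" for h k
    using hom_int_pow[OF \<rho> _ gH fp.group_FP, of h k] B.int_pow_consistent[OF sub that] that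
      B.subgroup_int_pow_closed[OF sub that] by simp
  \<comment> \<open>Schreier generators: by \<open>cu\<close> the two representatives contribute
    nothing to the value of the cocycle.\<close>
  have loop: "inv\<^bsub>BS n n\<^esub> u (mv g x) \<otimes>\<^bsub>BS n n\<^esub> g \<otimes>\<^bsub>BS n n\<^esub> u x \<in> H \<and>
      \<rho> (inv\<^bsub>BS n n\<^esub> u (mv g x) \<otimes>\<^bsub>BS n n\<^esub> g \<otimes>\<^bsub>BS n n\<^esub> u x) = c g x" if g: "g \<in> carrier (BS n n)" and x: "x \<in> X" for g x
  proof -
    let ?y = "mv g x"
    have y: "?y \<in> X" using mv_closed x g .
    note uc = u_closed[OF x] u_closed[OF y]
    have iy: "mv (inv\<^bsub>BS n n\<^esub> u ?y) ?y = H" using mv_inv(1)[OF H_X uc(2)] mv_u[OF y] by simp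
    have "mv (inv\<^bsub>BS n n\<^esub> u ?y \<otimes>\<^bsub>BS n n\<^esub> g \<otimes>\<^bsub>BS n n\<^esub> u x) H = H"
      using uc g iy mv_u[OF x] by (simp add: mv_mult[OF H_X] mv_mult[OF x])
    then have "inv\<^bsub>BS n n\<^esub> u ?y \<otimes>\<^bsub>BS n n\<^esub> g \<otimes>\<^bsub>BS n n\<^esub> u x \<in> H" using mv_H_iff uc g by simp
    moreover have "c (inv\<^bsub>BS n n\<^esub> u ?y) ?y = \<one>\<^bsub>FP\<^esub>" using ci[OF uc(2) H_X] cu[OF y] mv_u[OF y] by simp
    then have "c (inv\<^bsub>BS n n\<^esub> u ?y \<otimes>\<^bsub>BS n n\<^esub> g \<otimes>\<^bsub>BS n n\<^esub> u x) H = c g x"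
      using uc g x H_X cu[OF x] mv_u[OF x] cc by (simp add: cm)
    ultimately show ?thesis by (simp add: \<rho>_def)
  qed
  have surj: "\<exists>h\<in>H. \<rho> h = p" if "p \<in> carrier FP" for p using that
  proof (induction rule: fp.free_product_induct)
    case one
    then show ?case using c1[OF H_X] subgroup.one_closed[OF sub] by (auto simp: \<rho>_def)
  next
    case (letter i g p)
    then obtain h where h: "h \<in> H" "\<rho> h = p" by blast
    have "\<exists>h'\<in>H. \<rho> h' = fcls Ix Kx [(i, g)]"
    proof -
      from letter(1) consider x where "x \<in> X" "bp (orb x) = x" "i = 2 * nx x" | x where "x \<in> X" "\<not> tree_arc x" "i = Suc (2 * nx x)"
        by (auto simp: Ix_def)
      then show ?thesis
      proof cases
        case (1 x)
        have px: "mv (a [^]\<^bsub>BS n n\<^esub> per x) x = x" using sa_pow[OF 1(1)] per(2)[OF 1(1)] by simp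
        define h' where "h' = inv\<^bsub>BS n n\<^esub> u x \<otimes>\<^bsub>BS n n\<^esub> a [^]\<^bsub>BS n n\<^esub> per x \<otimes>\<^bsub>BS n n\<^esub> u x"
        have h': "h' \<in> H" "\<rho> h' = Y x" using loop[of "a [^]\<^bsub>BS n n\<^esub> per x" x] 1 px ca_per[OF 1(1,2)] by (simp_all add: h'_def)
        have "g \<in> carrier (integer_mod_group (n div per x))" using letter(2) 1 by (simp add: Kx_even)
        then have "g mod int (n div per x) = g" using quot_pos[OF 1(1)] by (simp add: carrier_integer_mod_group)
        then have "Y x [^]\<^bsub>FP\<^esub> g = fcls Ix Kx [(i, g)]" using Y_pow[OF 1(1,2), of g] 1(3) by simp
        then show ?thesis using \<rho>_pow[OF h'(1), of g] h'(2) by auto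
      next
        case (2 x)
        have i: "i \<in> Ix" by (rule letter(1))
        define h' where "h' = inv\<^bsub>BS n n\<^esub> u (mv t x) \<otimes>\<^bsub>BS n n\<^esub> t \<otimes>\<^bsub>BS n n\<^esub> u x"
        have h': "h' \<in> H" "\<rho> h' = E x" using loop[of t x] 2 c_t[OF 2(1)] by (simp_all add: h'_def ct_def)
        have "fcls Ix Kx [(i, 1 [^]\<^bsub>Kx i\<^esub> g)] = fcls Ix Kx [(i, 1)] [^]\<^bsub>FP\<^esub> g"
          by (rule hom_int_pow[OF fp.fgen_hom[OF i]]) (use i 2 fp.group_FP fp.factor_group in \<open>auto simp: Kx_odd\<close>)
        then have "E x [^]\<^bsub>FP\<^esub> g = fcls Ix Kx [(i, g)]" using 2(3) by (simp add: E_def Kx_odd)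
        then show ?thesis using \<rho>_pow[OF h'(1), of g] h'(2) by auto
      qed
    qed
    then obtain h' where h': "h' \<in> H" "\<rho> h' = fcls Ix Kx [(i, g)]" by blast
    have "h' \<otimes>\<^bsub>BS n n\<^esub> h \<in> H" using subgroup.m_closed[OF sub] h h' by blast
    moreover have "\<rho> (h' \<otimes>\<^bsub>BS n n\<^esub> h) = fcls Ix Kx [(i, g)] \<otimes>\<^bsub>FP\<^esub> p"
      using hom_mult[OF \<rho>, of h' h] h h' by simp
    ultimately show ?case by blast
  qed
  let ?Q = "BS n n Mod zpow"
  interpret N: normal zpow "BS n n" by (rule zpow_normal)
  interpret Q: Group.group ?Q by (rule N.factorgroup_is_group)
  note mult_FactGroup [simp del] one_FactGroup [simp del]
  define cs where "cs b = zpow #>\<^bsub>BS n n\<^esub> b" for b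
  have cs: "cs \<in> hom (BS n n) ?Q" unfolding cs_def by (rule N.r_coset_hom_Mod)
  interpret cs: group_hom "BS n n" ?Q cs using cs by unfold_locales
  have cs_iff: "cs b = \<one>\<^bsub>?Q\<^esub> \<longleftrightarrow> b \<in> zpow" if "b \<in> carrier (BS n n)" for b
    using B.coset_join1[OF _ that N.subgroup_axioms] B.coset_join2[OF that N.subgroup_axioms] by (auto simp: cs_def one_FactGroup)
  \<comment> \<open>The classes of the Schreier generators form a second cocycle, with values in the
    quotient by the powers of z; it will be compared with c through \<gamma>.\<close>
  define W where "W g x = cs (inv\<^bsub>BS n n\<^esub> u (mv g x) \<otimes>\<^bsub>BS n n\<^esub> g \<otimes>\<^bsub>BS n n\<^esub> u x)" for g x
  have Wc: "W g x \<in> carrier ?Q" if "g \<in> carrier (BS n n)" "x \<in> X" for g x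
    unfolding W_def using that u_closed mv_closed by (intro cs.hom_closed) auto
  have Wm: "W (g \<otimes>\<^bsub>BS n n\<^esub> h) x = W g (mv h x) \<otimes>\<^bsub>?Q\<^esub> W h x" if g: "g \<in> carrier (BS n n)" "h \<in> carrier (BS n n)" "x \<in> X" for g h x
  proof -
    note uc = u_closed[OF g(3)] u_closed[OF mv_closed[OF g(3,2)]] u_closed[OF mv_closed[OF mv_closed[OF g(3,2)] g(1)]]
    have "inv\<^bsub>BS n n\<^esub> u (mv g (mv h x)) \<otimes>\<^bsub>BS n n\<^esub> g \<otimes>\<^bsub>BS n n\<^esub> u (mv h x) \<otimes>\<^bsub>BS n n\<^esub> (inv\<^bsub>BS n n\<^esub> u (mv h x) \<otimes>\<^bsub>BS n n\<^esub> h \<otimes>\<^bsub>BS n n\<^esub> u x) =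
       inv\<^bsub>BS n n\<^esub> u (mv g (mv h x)) \<otimes>\<^bsub>BS n n\<^esub> (g \<otimes>\<^bsub>BS n n\<^esub> h) \<otimes>\<^bsub>BS n n\<^esub> u x"
    proof -
      have "u (mv h x) \<otimes>\<^bsub>BS n n\<^esub> (inv\<^bsub>BS n n\<^esub> u (mv h x) \<otimes>\<^bsub>BS n n\<^esub> w) = w" if "w \<in> carrier (BS n n)" for w
        using that uc by (simp add: B.m_assoc[symmetric])
      then show ?thesis using g uc by (simp add: B.m_assoc)
    qed
    then show ?thesis using g uc by (simp add: W_def mv_mult flip: cs.hom_mult)
  qed
  define y where "y i = (if even i then W (a [^]\<^bsub>BS n n\<^esub> per (xn (i div 2))) (xn (i div 2)) else W t (xn (i div 2)))" for i
  have y_even: "y (2 * nx x) = W (a [^]\<^bsub>BS n n\<^esub> per x) x" "y (Suc (2 * nx x)) = W t x" if "x \<in> X" for x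
    using that by (simp_all add: y_def xn_nx)
  \<comment> \<open>Makes \<gamma> well defined on the factor of an orbit: the Schreier generator is
    conjugate to a power of a, and its power with exponent \<open>n div per x\<close> is conjugate
    to z, hence equal to z and trivial in the quotient.\<close>
  have y_pow: "W (a [^]\<^bsub>BS n n\<^esub> per x) x [^]\<^bsub>?Q\<^esub> (n div per x) = \<one>\<^bsub>?Q\<^esub>" if x: "x \<in> X" for x
  proof -
    have W: "W (a [^]\<^bsub>BS n n\<^esub> per x) x = cs (inv\<^bsub>BS n n\<^esub> u x \<otimes>\<^bsub>BS n n\<^esub> a [^]\<^bsub>BS n n\<^esub> per x \<otimes>\<^bsub>BS n n\<^esub> u x)"
      using sa_pow[OF x] per(2)[OF x] by (simp add: W_def)
    have "(inv\<^bsub>BS n n\<^esub> u x \<otimes>\<^bsub>BS n n\<^esub> a [^]\<^bsub>BS n n\<^esub> per x \<otimes>\<^bsub>BS n n\<^esub> u x) [^]\<^bsub>BS n n\<^esub> (n div per x) =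
        inv\<^bsub>BS n n\<^esub> u x \<otimes>\<^bsub>BS n n\<^esub> z \<otimes>\<^bsub>BS n n\<^esub> u x"
      using u_closed[OF x] per_dvd[OF x] by (simp add: B.conj_nat_pow B.nat_pow_pow)
    also have "\<dots> = z" using bsa_pow_central[OF u_closed[OF x]] u_closed[OF x]
      by (simp add: B.m_assoc) (simp add: B.m_assoc[symmetric])
    finally have pw: "(inv\<^bsub>BS n n\<^esub> u x \<otimes>\<^bsub>BS n n\<^esub> a [^]\<^bsub>BS n n\<^esub> per x \<otimes>\<^bsub>BS n n\<^esub> u x) [^]\<^bsub>BS n n\<^esub> (n div per x) = z" .
    have "W (a [^]\<^bsub>BS n n\<^esub> per x) x [^]\<^bsub>?Q\<^esub> (n div per x) =
        cs ((inv\<^bsub>BS n n\<^esub> u x \<otimes>\<^bsub>BS n n\<^esub> a [^]\<^bsub>BS n n\<^esub> per x \<otimes>\<^bsub>BS n n\<^esub> u x) [^]\<^bsub>BS n n\<^esub> (n div per x))"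
      unfolding W by (rule cs.hom_nat_pow[symmetric]) (use u_closed[OF x] in simp)
    then have "W (a [^]\<^bsub>BS n n\<^esub> per x) x [^]\<^bsub>?Q\<^esub> (n div per x) = cs z" by (simp only: pw)
    moreover have "z \<in> zpow" unfolding zpow_def by (rule range_eqI[of _ _ 1]) simp
    ultimately show ?thesis using cs_iff[of z] by simp
  qed
  have f_hom: "(\<lambda>j. y i [^]\<^bsub>?Q\<^esub> j) \<in> hom (Kx i) ?Q" if "i \<in> Ix" for i
  proof -
    from that consider x where "x \<in> X" "i = 2 * nx x" | x where "x \<in> X" "i = Suc (2 * nx x)" by (auto simp: Ix_def)
    then show ?thesis
    proof cases
      case (1 x)
      have "(\<lambda>j. W (a [^]\<^bsub>BS n n\<^esub> per x) x [^]\<^bsub>?Q\<^esub> j) \<in> hom (integer_mod_group (n div per x)) ?Q"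
        by (rule Q.integer_mod_group_hom) (use 1 Wc y_pow in auto)
      then show ?thesis using 1 by (simp add: y_even Kx_even)
    next
      case (2 x)
      then show ?thesis using Q.hom_integer_group_pow[OF Wc[of t x]] by (simp add: y_even Kx_odd)
    qed
  qed
  obtain \<gamma> where \<gamma>: "\<gamma> \<in> hom FP ?Q" "\<And>i g. i \<in> Ix \<Longrightarrow> g \<in> carrier (Kx i) \<Longrightarrow> \<gamma> (fcls Ix Kx [(i, g)]) = y i [^]\<^bsub>?Q\<^esub> g"
    using fp.free_product_lift[OF Q.is_group f_hom] by blast
  interpret \<gamma>: group_hom FP ?Q \<gamma> using \<gamma>(1) by unfold_locales
  have \<gamma>Y: "\<gamma> (Y x) = W (a [^]\<^bsub>BS n n\<^esub> per x) x" if x: "x \<in> X" "bp (orb x) = x" for x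
    using \<gamma>(2)[OF Y_index[OF x]] y_even[OF x(1)] Q.int_pow_mod[OF _ y_pow[OF x(1)], of 1] Wc[OF _ x(1)]
    by (simp add: Y_def)
  have \<gamma>E: "\<gamma> (E x) = W t x" if x: "x \<in> X" "\<not> tree_arc x" for x
    using \<gamma>(2)[of "Suc (2 * nx x)" 1] y_even[OF x(1)] Wc[of t, OF _ x(1)] x by (simp add: E_def Kx_odd Ix_def)
  \<comment> \<open>At the step that closes an orbit, both sides give the generator of that orbit;
    at every other step the representatives follow a and both sides are trivial.\<close>
  have Wa: "W a x = \<gamma> (c a x)" if x: "x \<in> X" for x
  proof (cases "sa x = bp (orb x)")
    case True
    let ?b = "bp (orb x)"
    have b: "?b \<in> X" "bp (orb ?b) = ?b" using bp_X orb_bp x by auto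
    have sb: "(sa ^^ per ?b) ?b = ?b" using per(2)[OF b(1)] .
    have "a \<otimes>\<^bsub>BS n n\<^esub> u x = a [^]\<^bsub>BS n n\<^esub> per ?b \<otimes>\<^bsub>BS n n\<^esub> u ?b"
      using u_orb[OF x] idx_sa(2)[OF x True] B.nat_pow_Suc2[of a "idx x"] u_closed[OF b(1)] by (simp add: B.m_assoc)
    then have "W a x = W (a [^]\<^bsub>BS n n\<^esub> per ?b) ?b"
      using True sb u_closed[OF x] u_closed[OF b(1)] b by (simp add: W_def B.m_assoc sa_def sa_pow)
    then show ?thesis using \<gamma>Y[OF b] c_a[OF x] True by (simp add: ca_def)
  next
    case False
    then have "W a x = \<one>\<^bsub>?Q\<^esub>" using u_sa[OF x False] u_closed[OF x]
      by (simp add: W_def sa_def[symmetric] B.m_assoc B.l_inv del: cs.hom_mult)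
    then show ?thesis using c_a[OF x] False by (simp add: ca_def)
  qed
  have Wt: "W t x = \<gamma> (c t x)" if x: "x \<in> X" for x
  proof (cases "tree_arc x")
    case True
    then have "W t x = \<one>\<^bsub>?Q\<^esub>" using u_tree[OF x True] u_closed[OF x]
      by (simp add: W_def B.m_assoc B.l_inv del: cs.hom_mult)
    then show ?thesis using c_t[OF x] True by (simp add: ct_def)
  qed (use \<gamma>E[OF x] c_t[OF x] in \<open>simp add: ct_def\<close>)
  have W1: "W \<one>\<^bsub>BS n n\<^esub> x = \<one>\<^bsub>?Q\<^esub>" if x: "x \<in> X" for x
    using Wm[of "\<one>\<^bsub>BS n n\<^esub>" "\<one>\<^bsub>BS n n\<^esub>" x] Wc[of "\<one>\<^bsub>BS n n\<^esub>" x] mv_one[OF x] x by simp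
  \<comment> \<open>Agreement of the two cocycles passes from a and t to products and
    inverses.\<close>
  define good where "good g \<longleftrightarrow> g \<in> carrier (BS n n) \<and> (\<forall>x\<in>X. W g x = \<gamma> (c g x))" for g
  have good_mult: "good (g \<otimes>\<^bsub>BS n n\<^esub> h)" if "good g" "good h" for g h
    using that cc mv_closed by (auto simp: good_def Wm cm)
  have good_inv: "good (inv\<^bsub>BS n n\<^esub> g)" if g: "good g" for g
    unfolding good_def
  proof (intro conjI ballI)
    have gc: "g \<in> carrier (BS n n)" using g by (simp add: good_def)
    then show "inv\<^bsub>BS n n\<^esub> g \<in> carrier (BS n n)" by simp
    fix x assume x: "x \<in> X"
    define v where "v = mv (inv\<^bsub>BS n n\<^esub> g) x"
    have v: "v \<in> X" "mv g v = x" using x gc mv_closed mv_inv by (auto simp: v_def)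
    have "W (inv\<^bsub>BS n n\<^esub> g) x \<otimes>\<^bsub>?Q\<^esub> W g v = \<one>\<^bsub>?Q\<^esub>" using Wm[of "inv\<^bsub>BS n n\<^esub> g" g v] gc v W1 by simp
    then have "W (inv\<^bsub>BS n n\<^esub> g) x = inv\<^bsub>?Q\<^esub> W g v" using Q.inv_equality[symmetric] Wc gc v x by simp
    then show "W (inv\<^bsub>BS n n\<^esub> g) x = \<gamma> (c (inv\<^bsub>BS n n\<^esub> g) x)"
      using ci[OF gc v(1)] v g cc[OF gc v(1)] by (simp add: good_def)
  qed
  have good: "good g" if "g \<in> carrier (BS n n)" for g using that
  proof (induction rule: BS_induct)
    case one
    show ?case using W1 c1 by (simp add: good_def)
  qed (intro good_mult good_inv; simp add: good_def Wa Wt)+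
  have "\<rho> h = \<one>\<^bsub>FP\<^esub> \<longleftrightarrow> h \<in> zpow" if h: "h \<in> H" for h
  proof
    assume "\<rho> h = \<one>\<^bsub>FP\<^esub>"
    then have "W h H = \<one>\<^bsub>?Q\<^esub>" using good[OF HB[OF h]] H_X by (simp add: good_def \<rho>_def)
    \<comment> \<open>The base coset is fixed by h and has representative 1.\<close>
    moreover have "W h H = cs h" using mv_H_iff[OF HB[OF h]] h u_H HB[OF h] by (simp add: W_def)
    ultimately show "h \<in> zpow" using cs_iff[OF HB[OF h]] by simp
  next
    assume "h \<in> zpow"
    then obtain k :: int where k: "h = z [^]\<^bsub>BS n n\<^esub> k" by (auto simp: zpow_def)
    have bH: "bp (orb H) = H" by (simp add: bp_def)
    have "\<rho> z = \<one>\<^bsub>FP\<^esub>" using ca_perk[OF H_X bH, of "n div per H"] per_dvd[OF H_X] Y_pow_one[OF H_X bH] by (simp add: \<rho>_def)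
    then show "\<rho> h = \<one>\<^bsub>FP\<^esub>" using \<rho>_pow[OF zH, of k] k by simp
  qed
  moreover have "\<rho> ` H = carrier FP" 
  proof
    show "\<rho> ` H \<subseteq> carrier FP" using cc HB H_X by (auto simp: \<rho>_def)
    show "carrier FP \<subseteq> \<rho> ` H" using surj by blast
  qed
  ultimately show ?thesis using \<rho> by blast
qed

end

section \<open>From embeddings to the quotient by the centre\<close>

lemma (in free_prod) cyclic_of_one_factor:
  assumes cyc: "\<And>i. i \<in> I \<Longrightarrow> cyclic_group (K i)"
    and one: "\<And>i j x y. i \<in> I \<Longrightarrow> j \<in> I \<Longrightarrow> i \<noteq> j \<Longrightarrow> x \<in> carrier (K i) \<Longrightarrow> y \<in> carrier (K j) \<Longrightarrow>
      x = \<one>\<^bsub>K i\<^esub> \<or> y = \<one>\<^bsub>K j\<^esub>"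
  shows "\<exists>e\<in>carrier FP. \<forall>p\<in>carrier FP. \<exists>j::int. p = e [^]\<^bsub>FP\<^esub> j"
proof (cases "\<exists>i\<in>I. \<exists>x\<in>carrier (K i). x \<noteq> \<one>\<^bsub>K i\<^esub>")
  case True
  interpret FP: Group.group FP by (rule group_FP)
  from True obtain i x where i: "i \<in> I" "x \<in> carrier (K i)" "x \<noteq> \<one>\<^bsub>K i\<^esub>" by blast
  interpret Ki: Group.group "K i" using factor_group i(1) .
  obtain w where w: "w \<in> carrier (K i)" "carrier (K i) = range (\<lambda>n::int. w [^]\<^bsub>K i\<^esub> n)"
    using cyc[OF i(1)] Ki.cyclic_group by auto
  define e where "e = fc [(i, w)]"
  have e: "e \<in> carrier FP" using i w by (simp add: e_def)
  have "\<exists>j::int. p = e [^]\<^bsub>FP\<^esub> j" if "p \<in> carrier FP" for p using that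
  proof (induction rule: free_product_induct)
    case one
    then show ?case by (intro exI[of _ 0]) simp
  next
    case (letter k g p)
    then obtain j :: int where j: "p = e [^]\<^bsub>FP\<^esub> j" by blast
    have "\<exists>l::int. fc [(k, g)] = e [^]\<^bsub>FP\<^esub> l"
    proof (cases "k = i")
      case True
      then obtain l :: int where "g = w [^]\<^bsub>K i\<^esub> l" using letter(2) w(2) by auto
      moreover have "fc [(i, w [^]\<^bsub>K i\<^esub> l)] = fc [(i, w)] [^]\<^bsub>FP\<^esub> l"
        by (rule hom_int_pow[OF fgen_hom[OF i(1)] w(1) Ki.is_group group_FP])
      ultimately show ?thesis using True by (auto simp: e_def)
    next
      case False
      then have "g = \<one>\<^bsub>K k\<^esub>" using one[OF letter(1) i(1) _ letter(2) i(2)] i(3) by blast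
      then show ?thesis using fgen_one[OF letter(1)] by (intro exI[of _ 0]) (simp add: one_free_product)
    qed
    then obtain l :: int where "fc [(k, g)] = e [^]\<^bsub>FP\<^esub> l" by blast
    then show ?case using j FP.int_pow_mult[OF e, of l j] by (intro exI[of _ "l + j"]) simp
  qed
  then show ?thesis using e by blast
next
  case False
  interpret FP: Group.group FP by (rule group_FP)
  have "p = \<one>\<^bsub>FP\<^esub>" if "p \<in> carrier FP" for p using that
  proof (induction rule: free_product_induct)
    case (letter i g p)
    then have "g = \<one>\<^bsub>K i\<^esub>" using False by blast
    then show ?case using letter fgen_one[OF letter(1)] by (simp add: one_free_product[symmetric])
  qed simp
  then have "\<exists>j::int. p = \<one>\<^bsub>FP\<^esub> [^]\<^bsub>FP\<^esub> j" if "p \<in> carrier FP" for p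
    using that by (intro exI[of _ 0]) (simp only: int_pow_0)
  then show ?thesis by blast
qed

lemma mod_center_iso:
  assumes G: "group G" and H: "group H" and h: "h \<in> hom G H" "h ` carrier G = carrier H"
    and ker: "\<And>x. x \<in> carrier G \<Longrightarrow> h x = \<one>\<^bsub>H\<^esub> \<longleftrightarrow> x \<in> group_center G"
  shows "G Mod group_center G \<cong> H"
proof -
  interpret group_hom G H h using G H h(1) by (simp add: group_hom_def group_hom_axioms_def)
  have "kernel G H h = group_center G" using ker by (auto simp: kernel_def group_center_def)
  then show ?thesis using FactGroup_iso[OF h(2)] by simp
qed

lemma commutative_of_cyclic_central_quotient:
  assumes G: "group G" and H: "group H" and h: "h \<in> hom G H" and e: "e \<in> carrier H" "\<exists>w\<in>carrier G. h w = e"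
    and gen: "\<And>p. p \<in> carrier H \<Longrightarrow> \<exists>j::int. p = e [^]\<^bsub>H\<^esub> j"
    and ker: "\<And>g. g \<in> carrier G \<Longrightarrow> h g = \<one>\<^bsub>H\<^esub> \<Longrightarrow> g \<in> group_center G"
    and xy: "x \<in> carrier G" "y \<in> carrier G"
  shows "x \<otimes>\<^bsub>G\<^esub> y = y \<otimes>\<^bsub>G\<^esub> x"
proof -
  interpret G: Group.group G by fact
  interpret H: Group.group H by fact
  interpret h: group_hom G H h using h by unfold_locales
  obtain w where w: "w \<in> carrier G" "h w = e" using e(2) by blast
  have dec: "\<exists>(j::int) c. c \<in> group_center G \<and> c \<in> carrier G \<and> x = w [^]\<^bsub>G\<^esub> j \<otimes>\<^bsub>G\<^esub> c" if x: "x \<in> carrier G" for x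
  proof -
    obtain j :: int where j: "h x = e [^]\<^bsub>H\<^esub> j" using gen[of "h x"] x by auto
    define c where "c = w [^]\<^bsub>G\<^esub> (-j) \<otimes>\<^bsub>G\<^esub> x"
    have "h c = \<one>\<^bsub>H\<^esub>" using x w j e(1) by (simp add: c_def h.hom_int_pow H.int_pow_neg)
    moreover have c: "c \<in> carrier G" using x w by (simp add: c_def)
    moreover have "x = w [^]\<^bsub>G\<^esub> j \<otimes>\<^bsub>G\<^esub> c" using x w by (simp add: c_def G.m_assoc[symmetric] G.int_pow_neg)
    ultimately show ?thesis using ker by blast
  qed
  obtain j :: int and c where c: "c \<in> group_center G" "c \<in> carrier G" "x = w [^]\<^bsub>G\<^esub> j \<otimes>\<^bsub>G\<^esub> c" using dec[OF xy(1)] by blast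
  obtain l :: int and d where d: "d \<in> group_center G" "d \<in> carrier G" "y = w [^]\<^bsub>G\<^esub> l \<otimes>\<^bsub>G\<^esub> d" using dec[OF xy(2)] by blast
  have 1: "c \<otimes>\<^bsub>G\<^esub> v = v \<otimes>\<^bsub>G\<^esub> c" "d \<otimes>\<^bsub>G\<^esub> v = v \<otimes>\<^bsub>G\<^esub> d" if "v \<in> carrier G" for v
    using c d that by (auto simp: group_center_def)
  have "w [^]\<^bsub>G\<^esub> j \<otimes>\<^bsub>G\<^esub> w [^]\<^bsub>G\<^esub> l = w [^]\<^bsub>G\<^esub> l \<otimes>\<^bsub>G\<^esub> w [^]\<^bsub>G\<^esub> j"
    using w(1) by (metis G.int_pow_mult add.commute)
  then have "w [^]\<^bsub>G\<^esub> l \<otimes>\<^bsub>G\<^esub> x = x \<otimes>\<^bsub>G\<^esub> w [^]\<^bsub>G\<^esub> l" using c(2,3) 1(1)[of "w [^]\<^bsub>G\<^esub> l"] w(1)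
    by (metis G.int_pow_closed G.m_assoc)
  then show ?thesis using d(2,3) 1(2)[OF xy(1)] w(1) xy(1) by (metis G.int_pow_closed G.m_assoc)
qed

lemma carrier_empty_free_product: "carrier (free_product {} K) = {\<one>\<^bsub>free_product {} K\<^esub>}"
proof -
  interpret free_prod "{}" K by unfold_locales auto
  interpret FP: Group.group "free_product {} K" by (rule group_FP)
  have "p = \<one>\<^bsub>free_product {} K\<^esub>" if "p \<in> carrier (free_product {} K)" for p
    using that by (induction rule: free_product_induct) auto
  then show ?thesis by auto
qed

text \<open>An abelian group is its own centre, and the trivial quotient is the free product over
  the empty index set.\<close>

lemma commutative_mod_center:
  assumes G: "group G" and comm: "\<And>x y. x \<in> carrier G \<Longrightarrow> y \<in> carrier G \<Longrightarrow> x \<otimes>\<^bsub>G\<^esub> y = y \<otimes>\<^bsub>G\<^esub> x"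
  shows "G Mod group_center G \<cong> free_product {} K"
proof (rule mod_center_iso[OF G, of _ "\<lambda>_. \<one>\<^bsub>free_product {} K\<^esub>"])
  interpret group G by fact
  interpret free_prod "{}" K by unfold_locales auto
  show FP: "group (free_product {} K)" by (rule group_FP)
  interpret FP: group "free_product {} K" by (rule group_FP)
  show "(\<lambda>_. \<one>\<^bsub>free_product {} K\<^esub>) \<in> hom G (free_product {} K)" by (rule homI) auto
  show "(\<lambda>_. \<one>\<^bsub>free_product {} K\<^esub>) ` carrier G = carrier (free_product {} K)"
    using one_closed by (subst carrier_empty_free_product) blast
  fix x assume "x \<in> carrier G"
  then show "(\<one>\<^bsub>free_product {} K\<^esub> = \<one>\<^bsub>free_product {} K\<^esub>) = (x \<in> group_center G)"
    using comm by (simp add: group_center_def)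
qed

lemma cyclic_integer_mod_group: "k > 0 \<Longrightarrow> cyclic_group (integer_mod_group k)"
  unfolding group.cyclic_group[OF group_integer_mod_group]
proof (intro bexI[of _ "1 mod int k"] equalityI subsetI)
  fix x assume k: "k > 0" and "x \<in> carrier (integer_mod_group k)"
  then have "x = (1 mod int k) [^]\<^bsub>integer_mod_group k\<^esub> x"
    by (simp add: int_pow_integer_mod_group mod_mult_right_eq carrier_integer_mod_group)
  then show "x \<in> range (\<lambda>n::int. (1 mod int k) [^]\<^bsub>integer_mod_group k\<^esub> n)" by blast
qed (auto simp: int_pow_integer_mod_group carrier_integer_mod_group)

lemma (in bs_subgroup) Kx_cyclic:
  assumes "i \<in> Ix"
  shows "group (Kx i) \<and> cyclic_group (Kx i) \<and> (finite (carrier (Kx i)) \<longrightarrow> order (Kx i) dvd n)"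
proof -
  from assms consider x where "x \<in> X" "i = 2 * nx x" | x where "x \<in> X" "i = Suc (2 * nx x)" by (auto simp: Ix_def)
  then show ?thesis
  proof cases
    case (1 x)
    have "n div per x dvd n" using per_dvd[OF 1(1)] by (metis dvd_div_mult_self dvd_triv_left)
    then show ?thesis using quot_pos[OF 1(1)] 1
      by (auto simp: Kx_even cyclic_integer_mod_group order_def carrier_integer_mod_group)
  next
    case (2 x)
    then show ?thesis by (simp add: Kx_odd infinite_UNIV_int)
  qed
qed

text \<open>The kernel of the composite from G to the free product consists of elements mapped to
  powers of z, so it is central. If two factors are nontrivial, the free product has trivial centre
  and the kernel is the whole centre of G. Otherwise the free product is cyclic and G is
  abelian.\<close>

theorem embeds_BS_imp_free_product:
  assumes G: "group G" and f: "f \<in> mon G (BS n n)" and n: "n > 0"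
  shows "\<exists>(I :: nat set) (K :: nat \<Rightarrow> int monoid).
               (\<forall>i \<in> I. group (K i) \<and> cyclic_group (K i) \<and>
                        (finite (carrier (K i)) \<longrightarrow> order (K i) dvd n)) \<and>
               G Mod group_center G \<cong> free_product I K"
proof -
  interpret G: Group.group G by fact
  interpret B: Group.group "BS n n" by (rule group_BS)
  have fh: "f \<in> hom G (BS n n)" and finj: "inj_on f (carrier G)" using f by (auto simp: mon_def)
  interpret f: group_hom G "BS n n" f using fh by unfold_locales
  define z where "z = bsa n [^]\<^bsub>BS n n\<^esub> n"
  have z: "z \<in> carrier (BS n n)" by (simp add: z_def)
  have zc: "z [^]\<^bsub>BS n n\<^esub> (k::int) \<otimes>\<^bsub>BS n n\<^esub> p = p \<otimes>\<^bsub>BS n n\<^esub> z [^]\<^bsub>BS n n\<^esub> k" if "p \<in> carrier (BS n n)" for p k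
  proof -
    have "inv\<^bsub>BS n n\<^esub> p \<otimes>\<^bsub>BS n n\<^esub> z \<otimes>\<^bsub>BS n n\<^esub> p = z"
      using bsa_pow_central[OF that] that z unfolding z_def[symmetric] by (simp add: B.m_assoc) (simp add: B.m_assoc[symmetric])
    then have "inv\<^bsub>BS n n\<^esub> p \<otimes>\<^bsub>BS n n\<^esub> z [^]\<^bsub>BS n n\<^esub> k \<otimes>\<^bsub>BS n n\<^esub> p = z [^]\<^bsub>BS n n\<^esub> k"
      using B.conj_int_pow[OF that z, of k] by simp
    then have "p \<otimes>\<^bsub>BS n n\<^esub> (inv\<^bsub>BS n n\<^esub> p \<otimes>\<^bsub>BS n n\<^esub> z [^]\<^bsub>BS n n\<^esub> k \<otimes>\<^bsub>BS n n\<^esub> p) = p \<otimes>\<^bsub>BS n n\<^esub> z [^]\<^bsub>BS n n\<^esub> k" by simp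
    then show ?thesis using that z by (simp add: B.m_assoc[symmetric])
  qed
  \<comment> \<open>The image of G times the powers of z: \<open>bs_subgroup\<close> wants z inside,
    and since z is central the product is a subgroup.\<close>
  define H where "H = {x \<in> carrier (BS n n). \<exists>k::int. x \<otimes>\<^bsub>BS n n\<^esub> z [^]\<^bsub>BS n n\<^esub> k \<in> f ` carrier G}"
  have fH: "f g \<in> H" if "g \<in> carrier G" for g
    unfolding H_def using that by (auto intro!: exI[of _ 0])
  have sub: "subgroup H (BS n n)"
  proof (rule B.subgroupI)
    show "H \<subseteq> carrier (BS n n)" by (auto simp: H_def)
    show "H \<noteq> {}" using fH[OF G.one_closed] by blast
    fix x assume x: "x \<in> H"
    then obtain k :: int and g where kg: "x \<in> carrier (BS n n)" "g \<in> carrier G" "x \<otimes>\<^bsub>BS n n\<^esub> z [^]\<^bsub>BS n n\<^esub> k = f g"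
      by (auto simp: H_def)
    have "f (inv\<^bsub>G\<^esub> g) = inv\<^bsub>BS n n\<^esub> (x \<otimes>\<^bsub>BS n n\<^esub> z [^]\<^bsub>BS n n\<^esub> k)" using kg by simp
    also have "\<dots> = z [^]\<^bsub>BS n n\<^esub> (-k) \<otimes>\<^bsub>BS n n\<^esub> inv\<^bsub>BS n n\<^esub> x" using kg(1) z by (simp add: B.inv_mult_group B.int_pow_neg)
    also have "\<dots> = inv\<^bsub>BS n n\<^esub> x \<otimes>\<^bsub>BS n n\<^esub> z [^]\<^bsub>BS n n\<^esub> (-k)" by (rule zc) (use kg in simp)
    finally have "inv\<^bsub>BS n n\<^esub> x \<otimes>\<^bsub>BS n n\<^esub> z [^]\<^bsub>BS n n\<^esub> (-k) = f (inv\<^bsub>G\<^esub> g)" by simp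
    then have "inv\<^bsub>BS n n\<^esub> x \<otimes>\<^bsub>BS n n\<^esub> z [^]\<^bsub>BS n n\<^esub> (-k) \<in> f ` carrier G"
      using kg(2) by (metis G.inv_closed imageI)
    then show "inv\<^bsub>BS n n\<^esub> x \<in> H" unfolding H_def using kg(1) by blast
    fix y assume y: "y \<in> H"
    then obtain l :: int and g' where lg: "y \<in> carrier (BS n n)" "g' \<in> carrier G" "y \<otimes>\<^bsub>BS n n\<^esub> z [^]\<^bsub>BS n n\<^esub> l = f g'"
      by (auto simp: H_def)
    have "f (g \<otimes>\<^bsub>G\<^esub> g') = x \<otimes>\<^bsub>BS n n\<^esub> (z [^]\<^bsub>BS n n\<^esub> k \<otimes>\<^bsub>BS n n\<^esub> y) \<otimes>\<^bsub>BS n n\<^esub> z [^]\<^bsub>BS n n\<^esub> l"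
      using kg lg z by (simp add: B.m_assoc flip: kg(3) lg(3))
    also have "\<dots> = x \<otimes>\<^bsub>BS n n\<^esub> (y \<otimes>\<^bsub>BS n n\<^esub> z [^]\<^bsub>BS n n\<^esub> k) \<otimes>\<^bsub>BS n n\<^esub> z [^]\<^bsub>BS n n\<^esub> l" using zc[OF lg(1)] by simp
    also have "\<dots> = x \<otimes>\<^bsub>BS n n\<^esub> y \<otimes>\<^bsub>BS n n\<^esub> z [^]\<^bsub>BS n n\<^esub> (k + l)" using kg lg z by (simp add: B.m_assoc B.int_pow_mult)
    finally have "x \<otimes>\<^bsub>BS n n\<^esub> y \<otimes>\<^bsub>BS n n\<^esub> z [^]\<^bsub>BS n n\<^esub> (k + l) = f (g \<otimes>\<^bsub>G\<^esub> g')" by simp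
    then have "x \<otimes>\<^bsub>BS n n\<^esub> y \<otimes>\<^bsub>BS n n\<^esub> z [^]\<^bsub>BS n n\<^esub> (k + l) \<in> f ` carrier G"
      using kg(2) lg(2) by (metis G.m_closed imageI)
    then show "x \<otimes>\<^bsub>BS n n\<^esub> y \<in> H" unfolding H_def using kg(1) lg(1) B.m_closed by blast
  qed
  have zH: "z \<in> H"
  proof -
    have "z \<otimes>\<^bsub>BS n n\<^esub> z [^]\<^bsub>BS n n\<^esub> (-1::int) = f \<one>\<^bsub>G\<^esub>" using z by (simp add: B.int_pow_neg)
    then have "z \<otimes>\<^bsub>BS n n\<^esub> z [^]\<^bsub>BS n n\<^esub> (-1::int) \<in> f ` carrier G" using G.one_closed by (metis imageI)
    then show ?thesis unfolding H_def using z by blast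
  qed
  interpret bs_subgroup n H using sub zH n by (intro bs_subgroup.intro) (simp_all add: z_def)
  obtain \<rho> where \<rho>: "\<rho> \<in> hom (BS n n\<lparr>carrier := H\<rparr>) FP" "\<rho> ` H = carrier FP"
    and \<rho>z: "\<forall>h\<in>H. \<rho> h = \<one>\<^bsub>FP\<^esub> \<longleftrightarrow> h \<in> zpow"
    using kurosh by (elim bexE conjE) (rule that)
  define h where "h g = \<rho> (f g)" for g
  have \<rho>m: "\<rho> (x \<otimes>\<^bsub>BS n n\<^esub> y) = \<rho> x \<otimes>\<^bsub>FP\<^esub> \<rho> y" if "x \<in> H" "y \<in> H" for x y
    using hom_mult[OF \<rho>(1), of x y] that by simp
  have \<rho>c: "\<rho> x \<in> carrier FP" if "x \<in> H" for x using \<rho>(2) that by blast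
  have h: "h \<in> hom G FP" by (rule homI) (auto simp: h_def \<rho>m \<rho>c fH)
  interpret h: group_hom G FP h using h by unfold_locales
  have zk: "z [^]\<^bsub>BS n n\<^esub> (k::int) \<in> zpow" "z [^]\<^bsub>BS n n\<^esub> (k::int) \<in> H" for k
    using B.subgroup_int_pow_closed[OF sub zH] by (auto simp: zpow_def z_def)
  \<comment> \<open>An element of \<open>H\<close> differs from one in the image of G by a power of
    z, which \<rho> kills.\<close>
  have surj: "\<exists>g\<in>carrier G. h g = p" if "p \<in> carrier FP" for p
  proof -
    obtain x where x: "x \<in> H" "p = \<rho> x" using \<rho>(2) \<open>p \<in> carrier FP\<close> by blast
    then obtain k :: int and g where "g \<in> carrier G" "x \<otimes>\<^bsub>BS n n\<^esub> z [^]\<^bsub>BS n n\<^esub> k = f g" by (auto simp: H_def)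
    then show ?thesis using x \<rho>m[OF x(1) zk(2), of k] bspec[OF \<rho>z zk(2)] zk(1) \<rho>c[OF x(1)] by (auto simp: h_def intro!: bexI[of _ g])
  qed
  have ker: "g \<in> group_center G" if g: "g \<in> carrier G" "h g = \<one>\<^bsub>FP\<^esub>" for g
    unfolding group_center_def
  proof (intro CollectI conjI ballI g(1))
    fix y assume y: "y \<in> carrier G"
    have "f g \<in> zpow" using bspec[OF \<rho>z fH[OF g(1)]] g(2) by (simp add: h_def)
    then obtain k :: int where "f g = z [^]\<^bsub>BS n n\<^esub> k" by (auto simp: zpow_def z_def)
    then have "f (g \<otimes>\<^bsub>G\<^esub> y) = f (y \<otimes>\<^bsub>G\<^esub> g)" using zc[of "f y" k] g y by simp
    then show "g \<otimes>\<^bsub>G\<^esub> y = y \<otimes>\<^bsub>G\<^esub> g" using finj g y by (simp add: inj_on_def)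
  qed
  show ?thesis
  proof (cases "\<exists>i\<in>Ix. \<exists>j\<in>Ix. i \<noteq> j \<and> (\<exists>x\<in>carrier (Kx i). \<exists>y\<in>carrier (Kx j). x \<noteq> \<one>\<^bsub>Kx i\<^esub> \<and> y \<noteq> \<one>\<^bsub>Kx j\<^esub>)")
    case True
    then obtain i j x y where ij: "i \<in> Ix" "j \<in> Ix" "i \<noteq> j" "x \<in> carrier (Kx i)" "x \<noteq> \<one>\<^bsub>Kx i\<^esub>" "y \<in> carrier (Kx j)" "y \<noteq> \<one>\<^bsub>Kx j\<^esub>"
      by blast
    have "G Mod group_center G \<cong> FP"
    proof (rule mod_center_iso[OF G fp.group_FP h])
      show "h ` carrier G = carrier FP" using surj h.hom_closed by blast
      fix g assume g: "g \<in> carrier G"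
      show "h g = \<one>\<^bsub>FP\<^esub> \<longleftrightarrow> g \<in> group_center G"
      proof
        assume gc: "g \<in> group_center G"
        show "h g = \<one>\<^bsub>FP\<^esub>"
        proof (rule fp.center_trivial[OF ij])
          fix p assume "p \<in> carrier FP"
          then obtain g' where g': "g' \<in> carrier G" "h g' = p" using surj by blast
          then have "g \<otimes>\<^bsub>G\<^esub> g' = g' \<otimes>\<^bsub>G\<^esub> g" using gc by (simp add: group_center_def)
          then have "h g \<otimes>\<^bsub>FP\<^esub> h g' = h g' \<otimes>\<^bsub>FP\<^esub> h g"
            using h.hom_mult[OF g g'(1)] h.hom_mult[OF g'(1) g] by simp
          then show "h g \<otimes>\<^bsub>FP\<^esub> p = p \<otimes>\<^bsub>FP\<^esub> h g" using g' by simp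
        qed (use g in simp)
      qed (use ker g in blast)
    qed
    then show ?thesis using Kx_cyclic by blast
  next
    case False
    have "\<exists>e\<in>carrier FP. \<forall>p\<in>carrier FP. \<exists>j::int. p = e [^]\<^bsub>FP\<^esub> j"
      by (rule fp.cyclic_of_one_factor) (use Kx_cyclic False in blast)+
    then obtain e where e: "e \<in> carrier FP" "\<And>p. p \<in> carrier FP \<Longrightarrow> \<exists>j::int. p = e [^]\<^bsub>FP\<^esub> j" by blast
    have "x \<otimes>\<^bsub>G\<^esub> y = y \<otimes>\<^bsub>G\<^esub> x" if "x \<in> carrier G" "y \<in> carrier G" for x y
      by (rule commutative_of_cyclic_central_quotient[OF G fp.group_FP h e(1) surj[OF e(1)]]) (use e ker that in blast)+
    then have "G Mod group_center G \<cong> free_product {} Kx" using commutative_mod_center[OF G] by blast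
    then show ?thesis by (intro exI[of _ "{}"] exI[of _ Kx]) simp
  qed
qed

section \<open>Torsion-free groups and cyclic subgroups\<close>

context group
begin

text \<open>For an infinite group both sides are 0.\<close>

lemma cyclic_order:
  assumes w: "w \<in> carrier G" "carrier G = range (\<lambda>k::int. w [^] k)"
  shows "ord w = order G"
proof (cases "finite (carrier G)")
  case True
  have o: "ord w > 0" using ord_dvd_group_order[OF w(1)] order_gt_0_iff_finite True by (auto intro: Nat.gr0I)
  have "carrier G \<subseteq> (\<lambda>k. w [^] int k) ` {..<ord w}"
  proof
    fix x assume "x \<in> carrier G"
    then obtain k :: int where k: "x = w [^] k" using w(2) by auto
    have "w [^] (k mod int (ord w)) = w [^] k" unfolding int_pow_eq[OF w(1)] by (simp add: minus_mod_eq_mult_div)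
    then show "x \<in> (\<lambda>k. w [^] int k) ` {..<ord w}" using o k
      by (intro image_eqI[of _ _ "nat (k mod int (ord w))"]) (auto simp: nat_less_iff)
  qed
  then have "order G \<le> card {..<ord w}" unfolding order_def by (rule surj_card_le[OF finite_lessThan])
  then show ?thesis using ord_le_group_order[OF True w(1)] by simp
next
  case False
  have "ord w = 0"
  proof (rule ccontr)
    assume o: "ord w \<noteq> 0"
    have "carrier G \<subseteq> (\<lambda>k. w [^] int k) ` {..<ord w}"
    proof
      fix x assume "x \<in> carrier G"
      then obtain k :: int where k: "x = w [^] k" using w(2) by auto
      have "w [^] (k mod int (ord w)) = w [^] k" unfolding int_pow_eq[OF w(1)] by (simp add: minus_mod_eq_mult_div)
      then show "x \<in> (\<lambda>k. w [^] int k) ` {..<ord w}" using o k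
        by (intro image_eqI[of _ _ "nat (k mod int (ord w))"]) (auto simp: nat_less_iff)
    qed
    then show False using False finite_subset by blast
  qed
  then show ?thesis using False by (simp add: order_def)
qed

lemma cyclic_group_hom:
  assumes w: "w \<in> carrier G" "carrier G = range (\<lambda>k::int. w [^] k)"
    and H: "group H" and y: "y \<in> carrier H" and fin: "finite (carrier G) \<Longrightarrow> y [^]\<^bsub>H\<^esub> order G = \<one>\<^bsub>H\<^esub>"
  shows "\<exists>f\<in>hom G H. \<forall>k::int. f (w [^] k) = y [^]\<^bsub>H\<^esub> k"
proof -
  interpret H: group H by fact
  have wd: "y [^]\<^bsub>H\<^esub> k = y [^]\<^bsub>H\<^esub> l" if "w [^] k = w [^] l" for k l :: int
  proof -
    have "int (order G) dvd l - k" using that int_pow_eq[OF w(1)] cyclic_order[OF w] by simp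
    moreover have "int (H.ord y) dvd int (order G)"
    proof (cases "finite (carrier G)")
      case True
      then show ?thesis using fin H.pow_eq_id[OF y] by simp
    qed (simp add: order_def)
    ultimately show ?thesis using H.int_pow_eq[OF y] dvd_trans by blast
  qed
  define f where "f x = y [^]\<^bsub>H\<^esub> (SOME k::int. x = w [^] k)" for x
  have f: "f (w [^] k) = y [^]\<^bsub>H\<^esub> k" for k :: int
  proof -
    have "w [^] k = w [^] (SOME l::int. w [^] k = w [^] l)" by (rule someI[of _ k]) simp
    then show ?thesis unfolding f_def using wd by metis
  qed
  have "f \<in> hom G H"
  proof (rule homI)
    fix u assume "u \<in> carrier G" then show "f u \<in> carrier H" using w f y by auto
  next
    fix u v assume "u \<in> carrier G" "v \<in> carrier G"
    then obtain k l :: int where "u = w [^] k" "v = w [^] l" using w by auto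
    then show "f (u \<otimes> v) = f u \<otimes>\<^bsub>H\<^esub> f v" using f w(1) y by (simp add: H.int_pow_mult flip: int_pow_mult)
  qed
  then show ?thesis using f by blast
qed

definition torsion_free :: bool where
  "torsion_free \<longleftrightarrow> (\<forall>x\<in>carrier G. \<forall>k::nat. k > 0 \<longrightarrow> x [^] k = \<one> \<longrightarrow> x = \<one>)"

lemma torsion_free_int:
  assumes tf: torsion_free and x: "x \<in> carrier G" and k: "k \<noteq> 0" "x [^] (k::int) = \<one>"
  shows "x = \<one>"
proof -
  have "int (ord x) dvd k" using int_pow_eq_id[OF x] k by simp
  then have "ord x > 0" using k by (auto intro: Nat.gr0I)
  moreover have "x [^] ord x = \<one>" using x by simp
  ultimately show ?thesis using tf x by (auto simp: torsion_free_def)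
qed

lemma commuting_int_pow:
  assumes "x \<otimes> y = y \<otimes> x" "x \<in> carrier G" "y \<in> carrier G"
  shows "x [^] (k::int) \<otimes> y [^] (l::int) = y [^] l \<otimes> x [^] k"
proof -
  have 1: "u \<otimes> v [^] (l::int) = v [^] l \<otimes> u" if "u \<otimes> v = v \<otimes> u" "u \<in> carrier G" "v \<in> carrier G" for u v l
  proof -
    have "inv u \<otimes> v \<otimes> u = v" using that by (metis inv_closed l_inv l_one m_assoc)
    then have "inv u \<otimes> v [^] l \<otimes> u = v [^] l" using conj_int_pow[of u v l] that by simp
    then have "u \<otimes> (inv u \<otimes> v [^] l \<otimes> u) = u \<otimes> v [^] l" by simp
    then show ?thesis using that by (simp add: m_assoc[symmetric])
  qed
  have "y \<otimes> x [^] k = x [^] k \<otimes> y" using 1[of y x k] assms by simp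
  then show ?thesis using 1[of "x [^] k" y l] assms by simp
qed

text \<open>Two commuting elements with a common power generate a cyclic group if there is no
  torsion. Dividing both exponents by their gcd leaves an equation, because the quotient of the two
  sides has a trivial power; Bezout coefficients for the resulting coprime exponents give the
  generator w. The exponents are exported because \<open>finite_factor_root\<close> determines
  them.\<close>

lemma common_root:
  assumes tf: torsion_free and x: "x \<in> carrier G" and y: "y \<in> carrier G" and comm: "x \<otimes> y = y \<otimes> x"
    and pq: "p \<noteq> 0" "x [^] (p::int) = y [^] (q::int)"
  shows "\<exists>(p'::int) q' \<alpha> \<beta> w. p = gcd p q * p' \<and> q = gcd p q * q' \<and> x [^] p' = y [^] q' \<and> \<alpha> * p' + \<beta> * q' = 1 \<and>
     w = x [^] \<beta> \<otimes> y [^] \<alpha> \<and> w [^] q' = x \<and> w [^] p' = y"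
proof -
  define d where "d = gcd p q"
  have d: "d > 0" using pq by (simp add: d_def)
  obtain p' q' where pq': "p = d * p'" "q = d * q'" unfolding d_def by (meson gcd_dvd1 gcd_dvd2 dvdE)
  obtain \<alpha> \<beta> where "\<alpha> * p + \<beta> * q = d" unfolding d_def using bezout_int by blast
  then have "d * (\<alpha> * p' + \<beta> * q') = d * 1" unfolding pq' by (simp add: algebra_simps)
  then have ab: "\<alpha> * p' + \<beta> * q' = 1" using d by simp
  note cp = commuting_int_pow[OF comm x y]
  \<comment> \<open>The power with exponent d is trivial, so by torsion-freeness the element itself
    is.\<close>
  have "(x [^] p' \<otimes> y [^] (-q')) [^] d = x [^] (p' * d) \<otimes> y [^] (-q' * d)"
    using int_pow_mult_distrib[OF cp[of p' "-q'"]] x y by (simp add: int_pow_pow)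
  also have "\<dots> = x [^] p \<otimes> inv (y [^] q)" using pq' y by (simp add: mult.commute int_pow_neg)
  also have "\<dots> = \<one>" using pq y by simp
  finally have "x [^] p' \<otimes> y [^] (-q') = \<one>" using torsion_free_int[OF tf _ _ ] d x y by (metis int_pow_closed less_irrefl m_closed)
  then have eq: "x [^] p' = y [^] q'" using x y by (metis int_pow_closed int_pow_neg inv_closed inv_equality inv_inv)
  define w where "w = x [^] \<beta> \<otimes> y [^] \<alpha>"
  have "w [^] q' = x [^] (\<beta> * q') \<otimes> y [^] (\<alpha> * q')"
    unfolding w_def using int_pow_mult_distrib[OF cp[of \<beta> \<alpha>]] x y by (simp add: int_pow_pow)
  also have "y [^] (\<alpha> * q') = (y [^] q') [^] \<alpha>" using y by (simp add: int_pow_pow mult.commute)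
  also have "\<dots> = x [^] (\<alpha> * p')" unfolding eq[symmetric] using x by (simp add: int_pow_pow mult.commute)
  also have "x [^] (\<beta> * q') \<otimes> x [^] (\<alpha> * p') = x [^] (\<beta> * q' + \<alpha> * p')" by (rule int_pow_mult[OF x, symmetric])
  also have "\<beta> * q' + \<alpha> * p' = 1" using ab by simp
  finally have wx: "w [^] q' = x" using x by simp
  have "w [^] p' = x [^] (\<beta> * p') \<otimes> y [^] (\<alpha> * p')"
    unfolding w_def using int_pow_mult_distrib[OF cp[of \<beta> \<alpha>]] x y by (simp add: int_pow_pow)
  also have "x [^] (\<beta> * p') = (x [^] p') [^] \<beta>" using x by (simp add: int_pow_pow mult.commute)
  also have "\<dots> = y [^] (\<beta> * q')" unfolding eq using y by (simp add: int_pow_pow mult.commute)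
  also have "y [^] (\<beta> * q') \<otimes> y [^] (\<alpha> * p') = y [^] (\<beta> * q' + \<alpha> * p')" by (rule int_pow_mult[OF y, symmetric])
  also have "\<beta> * q' + \<alpha> * p' = 1" using ab by simp
  finally have wy: "w [^] p' = y" using y by simp
  show ?thesis using pq' eq ab wx wy w_def unfolding d_def by blast
qed

text \<open>Generators are added one at a time. The new generator x and the generator c found so far
  are powers of a common root w, which is itself a product of their powers and hence generates the
  same subgroup. If x or c is trivial, the other one serves as w.\<close>

lemma finitely_generated_commensurable_cyclic:
  assumes tf: torsion_free and A: "subgroup A G"
    and comm: "\<And>x y. x \<in> A \<Longrightarrow> y \<in> A \<Longrightarrow> x \<otimes> y = y \<otimes> x"
    and cms: "\<And>x y. x \<in> A \<Longrightarrow> y \<in> A \<Longrightarrow> x \<noteq> \<one> \<Longrightarrow> y \<noteq> \<one> \<Longrightarrow> \<exists>(p::int) (q::int). p \<noteq> 0 \<and> q \<noteq> 0 \<and> x [^] p = y [^] q"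
    and D: "finite D" "D \<subseteq> A"
  shows "\<exists>c\<in>A. generate G D = range (\<lambda>k::int. c [^] k)"
  using D
proof (induction D rule: finite_induct)
  case empty
  have "generate G {} = range (\<lambda>k::int. \<one> [^] k)" by (simp add: generate_empty)
  then show ?case using subgroup.one_closed[OF A] by blast
next
  case (insert x D)
  then obtain c where c: "c \<in> A" "generate G D = range (\<lambda>k::int. c [^] k)" by blast
  have AG: "A \<subseteq> carrier G" by (rule subgroup.subset[OF A])
  have xc: "x \<in> A" "x \<in> carrier G" "c \<in> carrier G" "insert x D \<subseteq> carrier G" using insert c AG by auto
  have "\<exists>w\<in>A. x \<in> range (\<lambda>k::int. w [^] k) \<and> c \<in> range (\<lambda>k::int. w [^] k) \<and>
     (\<exists>(i::int) (j::int). w = x [^] i \<otimes> c [^] j)"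
  proof (cases "x = \<one> \<or> c = \<one>")
    case True
    then show ?thesis
    proof
      assume x1: "x = \<one>"
      have "x \<in> range (\<lambda>k::int. c [^] k)" using x1 by (intro range_eqI[of _ _ 0]) simp
      moreover have "c \<in> range (\<lambda>k::int. c [^] k)" using xc by (intro range_eqI[of _ _ 1]) simp
      moreover have "\<exists>(i::int) (j::int). c = x [^] i \<otimes> c [^] j" using xc by (intro exI[of _ 0] exI[of _ 1]) simp
      ultimately show ?thesis using c(1) by blast
    next
      assume c1: "c = \<one>"
      have "c \<in> range (\<lambda>k::int. x [^] k)" using c1 by (intro range_eqI[of _ _ 0]) simp
      moreover have "x \<in> range (\<lambda>k::int. x [^] k)" using xc by (intro range_eqI[of _ _ 1]) simp
      moreover have "\<exists>(i::int) (j::int). x = x [^] i \<otimes> c [^] j" using xc by (intro exI[of _ 1] exI[of _ 0]) simp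
      ultimately show ?thesis using xc(1) by blast
    qed
  next
    case False
    then obtain p q :: int where pq: "p \<noteq> 0" "x [^] p = c [^] q" using cms[OF xc(1) c(1)] by blast
    obtain p' q' \<alpha> \<beta> w where w: "w = x [^] (\<beta>::int) \<otimes> c [^] (\<alpha>::int)" "w [^] (q'::int) = x" "w [^] (p'::int) = c"
      using common_root[OF tf xc(2,3) comm[OF xc(1) c(1)] pq] by blast
    have "w \<in> A" unfolding w(1) using subgroup.m_closed[OF A] subgroup_int_pow_closed[OF A] xc c by blast
    moreover have "x \<in> range (\<lambda>k::int. w [^] k)" using w(2) by (intro range_eqI[of _ _ q']) simp
    moreover have "c \<in> range (\<lambda>k::int. w [^] k)" using w(3) by (intro range_eqI[of _ _ p']) simp
    moreover have "\<exists>(i::int) (j::int). w = x [^] i \<otimes> c [^] j" using w(1) by (intro exI)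
    ultimately show ?thesis by blast
  qed
  then obtain w where w: "w \<in> A" "x \<in> range (\<lambda>k::int. w [^] k)" "c \<in> range (\<lambda>k::int. w [^] k)"
    "\<exists>(i::int) (j::int). w = x [^] i \<otimes> c [^] j" by blast
  have wG: "w \<in> carrier G" using w(1) AG by blast
  have sw: "subgroup (range (\<lambda>k::int. w [^] k)) G" by (rule subgroup_of_powers[OF wG])
  have sg: "subgroup (generate G (insert x D)) G" by (rule generate_is_subgroup[OF xc(4)])
  have "generate G (insert x D) \<subseteq> range (\<lambda>k::int. w [^] k)"
  proof (rule generate_subgroup_incl[OF _ sw])
    obtain l :: int where l: "c = w [^] l" using w(3) by auto
    have "D \<subseteq> range (\<lambda>k::int. c [^] k)" using c(2) generate.incl[of _ D G] by blast
    also have "\<dots> \<subseteq> range (\<lambda>k::int. w [^] k)" unfolding l using int_pow_pow[OF wG] by auto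
    finally show "insert x D \<subseteq> range (\<lambda>k::int. w [^] k)" using w(2) by blast
  qed
  moreover have "range (\<lambda>k::int. w [^] k) \<subseteq> generate G (insert x D)"
  proof -
    have "x \<in> generate G (insert x D)" by (rule generate.incl) simp
    moreover have "c \<in> generate G (insert x D)"
    proof -
      have "c \<in> generate G D" unfolding c(2) using xc(3) by (intro range_eqI[of _ _ 1]) simp
      then show ?thesis using mono_generate[of D "insert x D"] by blast
    qed
    ultimately have "w \<in> generate G (insert x D)"
      using w(4) subgroup.m_closed[OF sg] subgroup_int_pow_closed[OF sg] by blast
    then show ?thesis using subgroup_int_pow_closed[OF sg] by blast
  qed
  ultimately show ?case using w(1) by blast
qed

lemma central_subgroup_normal:
  assumes "subgroup N G" "N \<subseteq> group_center G"
  shows "N \<lhd> G"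
  unfolding normal_inv_iff
proof (intro conjI ballI assms(1))
  fix x h assume "x \<in> carrier G" "h \<in> N"
  then have "h \<otimes> x = x \<otimes> h" "h \<in> carrier G" using assms by (auto simp: group_center_def)
  then have "x \<otimes> h \<otimes> inv x = h" using \<open>x \<in> carrier G\<close> by (metis inv_closed m_assoc r_inv r_one)
  then show "x \<otimes> h \<otimes> inv x \<in> N" using \<open>h \<in> N\<close> by simp
qed

lemma subgroup_center: "subgroup (group_center G) G"
proof (rule subgroupI)
  show "group_center G \<noteq> {}" using one_closed by (force simp: group_center_def)
  show "group_center G \<subseteq> carrier G" by (auto simp: group_center_def)
next
  fix x assume x: "x \<in> group_center G"
  then have xG: "x \<in> carrier G" "\<And>g. g \<in> carrier G \<Longrightarrow> g \<otimes> x = x \<otimes> g" by (auto simp: group_center_def)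
  show "inv x \<in> group_center G"
    unfolding group_center_def using xG commutes_inv[OF xG(2) _ xG(1)] by simp
  fix y assume "y \<in> group_center G"
  then have yG: "y \<in> carrier G" "\<And>g. g \<in> carrier G \<Longrightarrow> g \<otimes> y = y \<otimes> g" by (auto simp: group_center_def)
  show "x \<otimes> y \<in> group_center G"
    unfolding group_center_def using xG(1) yG(1) commutes_mult[OF xG(2) yG(2) _ xG(1) yG(1)] by simp
qed

lemma generate_eqI:
  assumes "group_hom G H f" "group_hom G H g" "S \<subseteq> carrier G" "\<And>x. x \<in> S \<Longrightarrow> f x = g x" "x \<in> generate G S"
  shows "f x = g x"
proof -
  interpret f: group_hom G H f by fact
  interpret g: group_hom G H g by fact
  show ?thesis using assms(5)
  proof (induction rule: generate.induct)
    case (inv h)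
    then show ?case using assms(3,4) f.hom_inv g.hom_inv by auto
  next
    case (eng h1 h2)
    then show ?case using generate_in_carrier[OF assms(3)] by simp
  qed (use assms in auto)
qed

end

text \<open>Words for finitely many generators involve finitely many indices. For any other index i,
  the projection onto \<open>K i\<close> that kills all other factors is trivial on the generators,
  hence everywhere.\<close>

lemma (in free_prod) finitely_many_factors:
  assumes S: "finite S" "S \<subseteq> carrier FP" "generate FP S = carrier FP"
  shows "finite {i \<in> I. \<exists>x\<in>carrier (K i). x \<noteq> \<one>\<^bsub>K i\<^esub>}"
proof -
  interpret FP: Group.group FP by (rule group_FP)
  have "\<forall>s\<in>S. \<exists>w. red w \<and> s = fc w" using S(2) red_exists by blast
  then obtain ww where ww: "\<And>s. s \<in> S \<Longrightarrow> red (ww s) \<and> s = fc (ww s)" by metis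
  define U where "U = (\<Union>s\<in>S. fst ` set (ww s))"
  have "i \<in> U" if i: "i \<in> I" "x \<in> carrier (K i)" "x \<noteq> \<one>\<^bsub>K i\<^esub>" for i x
  proof (rule ccontr)
    assume "i \<notin> U"
    interpret Ki: Group.group "K i" using factor_group i(1) .
    define f where "f j y = (if j = i then y else \<one>\<^bsub>K i\<^esub>)" for j y
    have "f j \<in> hom (K j) (K i)" if "j \<in> I" for j
      by (rule homI) (auto simp: f_def)
    then obtain p where p: "p \<in> hom FP (K i)" "\<And>j y. j \<in> I \<Longrightarrow> y \<in> carrier (K j) \<Longrightarrow> p (fc [(j, y)]) = f j y"
      by (rule free_product_lift[OF Ki.is_group]) (assumption | rule that)+
    interpret p: group_hom FP "K i" p using p(1) by unfold_locales
    have "(\<lambda>_. \<one>\<^bsub>K i\<^esub>) \<in> hom FP (K i)" by (rule homI) simp_all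
    then have one: "group_hom FP (K i) (\<lambda>_. \<one>\<^bsub>K i\<^esub>)"
      by (intro group_hom.intro group_hom_axioms.intro group_FP Ki.is_group)
    have word: "p (fc w) = \<one>\<^bsub>K i\<^esub>" if "w \<in> lists alph" "i \<notin> fst ` set w" for w
      using that
    proof (induction w)
      case Nil
      then show ?case by (simp add: one_free_product[symmetric])
    next
      case (Cons y w)
      obtain j g where y: "y = (j, g)" by (cases y)
      have "fc (y # w) = fc [y] \<otimes>\<^bsub>FP\<^esub> fc w" using Cons.hyps by (simp add: fcls_mult)
      moreover have "p (fc [y]) = \<one>\<^bsub>K i\<^esub>" using p(2)[of j g] Cons y by (auto simp: f_def)
      ultimately show ?case using Cons y by simp
    qed
    have "p q = \<one>\<^bsub>K i\<^esub>" if "q \<in> carrier FP" for q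
    proof (rule FP.generate_eqI[OF p.group_hom_axioms one S(2)])
      fix s assume s: "s \<in> S"
      then have "i \<notin> fst ` set (ww s)" using \<open>i \<notin> U\<close> by (auto simp: U_def)
      then show "p s = \<one>\<^bsub>K i\<^esub>" using word[of "ww s"] ww[OF s] red_lists by metis
    qed (use that S(3) in simp)
    then have "p (fc [(i, x)]) = \<one>\<^bsub>K i\<^esub>" using i by simp
    then show False using p(2)[OF i(1,2)] i(3) by (simp add: f_def)
  qed
  then have "{i \<in> I. \<exists>x\<in>carrier (K i). x \<noteq> \<one>\<^bsub>K i\<^esub>} \<subseteq> U" by blast
  moreover have "finite U" using S(1) by (simp add: U_def)
  ultimately show ?thesis by (rule finite_subset)
qed

lemma (in free_prod) fgen_inj:
  assumes "i \<in> I" "g \<in> carrier (K i)" "h \<in> carrier (K i)" "fc [(i, g)] = fc [(i, h)]"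
  shows "g = h"
proof -
  interpret Ki: Group.group "K i" using factor_group assms(1) .
  define k where "k = g \<otimes>\<^bsub>K i\<^esub> inv\<^bsub>K i\<^esub> h"
  have "fc [(i, k)] = fc [(i, g)] \<otimes>\<^bsub>FP\<^esub> fc [(i, inv\<^bsub>K i\<^esub> h)]" using assms(1-3) by (simp add: k_def fcls_mult fgen_mult)
  also have "\<dots> = fc [(i, h)] \<otimes>\<^bsub>FP\<^esub> fc [(i, inv\<^bsub>K i\<^esub> h)]" using assms by simp
  also have "\<dots> = fc []" using assms(1-3) fgen_one by (simp add: fcls_mult fgen_mult)
  finally have k1: "fc [(i, k)] = fc []" .
  have "k = \<one>\<^bsub>K i\<^esub>"
  proof (rule ccontr)
    assume "k \<noteq> \<one>\<^bsub>K i\<^esub>"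
    then have "red [(i, k)]" using assms by (simp add: red_Cons k_def)
    then show False using red_unique[OF _ red_Nil k1] by simp
  qed
  then show ?thesis using assms by (metis Ki.inv_equality Ki.inv_inv Ki.inv_closed k_def)
qed

section \<open>GBS groups modulo their centre\<close>

locale gbs_data = Group.group G for G (structure) +
  fixes v
  assumes v: "v \<in> carrier G" and v_inf: "\<And>n::int. v [^] n = \<one> \<Longrightarrow> n = 0" and v_comm: "commensurated G v"
    and tf: torsion_free and fg: "finitely_generated G"
    and commuting: "\<And>g w. g \<in> carrier G \<Longrightarrow> w \<in> carrier G \<Longrightarrow> g \<otimes> w = w \<otimes> g \<Longrightarrow> \<not> commensurable G v w \<Longrightarrow>
       \<exists>m>(0::nat). \<exists>q::int. commensurable G v (w [^] q \<otimes> g [^] m)"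
begin

abbreviation ell where "ell \<equiv> commensurable G v"

lemma v_ne: "v \<noteq> \<one>" using v_inf[of 1] v by auto

lemma ell_v: "ell v" unfolding commensurable_def by (intro exI[of _ 1]) simp

lemma ell_root: assumes "g \<in> carrier G" "(k::int) \<noteq> 0" "ell (g [^] k)" shows "ell g"
proof -
  obtain a b :: int where "a \<noteq> 0" "(g [^] k) [^] a = v [^] b" using assms(3) by (auto simp: commensurable_def)
  then have "k * a \<noteq> 0" "g [^] (k * a) = v [^] b" using assms by (auto simp: int_pow_pow)
  then show ?thesis unfolding commensurable_def by blast
qed

text \<open>Both elements have powers that are powers of v, with nonzero exponents of v because G is
  torsion-free; raising each to the exponent of the other makes them equal.\<close>

lemma ell_common_power:
  assumes "x \<in> carrier G" "x \<noteq> \<one>" "ell x" and "y \<in> carrier G" "y \<noteq> \<one>" "ell y"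
  shows "\<exists>(p::int) (q::int). p \<noteq> 0 \<and> q \<noteq> 0 \<and> x [^] p = y [^] q"
proof -
  obtain k l :: int where kl: "k \<noteq> 0" "x [^] k = v [^] l" using assms(3) by (auto simp: commensurable_def)
  obtain k' l' :: int where kl': "k' \<noteq> 0" "y [^] k' = v [^] l'" using assms(6) by (auto simp: commensurable_def)
  have "l \<noteq> 0" using kl torsion_free_int[OF tf assms(1) kl(1)] assms(2) by auto
  moreover have "l' \<noteq> 0" using kl' torsion_free_int[OF tf assms(4) kl'(1)] assms(5) by auto
  moreover have "x [^] (k * l') = y [^] (k' * l)"
  proof -
    have "x [^] (k * l') = (x [^] k) [^] l'" using assms by (simp add: int_pow_pow)
    also have "\<dots> = v [^] (l' * l)" unfolding kl(2) using v by (simp add: int_pow_pow mult.commute)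
    also have "\<dots> = (y [^] k') [^] l" unfolding kl'(2) using v by (simp add: int_pow_pow)
    also have "\<dots> = y [^] (k' * l)" using assms by (simp add: int_pow_pow)
    finally show ?thesis .
  qed
  ultimately show ?thesis using kl(1) kl'(1) by (intro exI[of _ "k * l'"] exI[of _ "k' * l"]) simp
qed

lemma fg_set: obtains S where "finite S" "S \<subseteq> carrier G" "generate G S = carrier G"
  using fg by (auto simp: finitely_generated_def)

text \<open>The elements commensurable with \<open>v\<close> form an infinite cyclic subgroup with
  infinite cyclic quotient.\<close>

lemma abelian_case:
  assumes comm: "\<And>x y. x \<in> carrier G \<Longrightarrow> y \<in> carrier G \<Longrightarrow> x \<otimes> y = y \<otimes> x" and nc: "\<not> cyclic_group G"
  shows "G \<cong> hub {0} (\<lambda>_. Suc 0) {2}"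
proof -
  obtain S where S: "finite S" "S \<subseteq> carrier G" "generate G S = carrier G" by (rule fg_set)
  define E where "E = {g \<in> carrier G. ell g}"
  have E_iff: "g \<in> E \<longleftrightarrow> ell g" if "g \<in> carrier G" for g using that by (simp add: E_def)
  have E_sub: "subgroup E G"
  proof (rule subgroupI)
    show "E \<subseteq> carrier G" "E \<noteq> {}" using ell_v v by (auto simp: E_def)
    fix g assume g: "g \<in> E"
    then obtain k l :: int where kl: "g \<in> carrier G" "k \<noteq> 0" "g [^] k = v [^] l" by (auto simp: E_def commensurable_def)
    have "(inv g) [^] k = v [^] (-l)" using kl v by (simp add: int_pow_inv int_pow_neg)
    then show "inv g \<in> E" using kl unfolding E_def commensurable_def by blast
    fix h assume h: "h \<in> E"
    then obtain k' l' :: int where kl': "h \<in> carrier G" "k' \<noteq> 0" "h [^] k' = v [^] l'" by (auto simp: E_def commensurable_def)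
    have "(g \<otimes> h) [^] (k * k') = (g [^] k) [^] k' \<otimes> (h [^] k') [^] k"
      using int_pow_mult_distrib[OF comm[OF kl(1) kl'(1)] kl(1) kl'(1)] kl(1) kl'(1) by (simp add: int_pow_pow mult.commute)
    also have "\<dots> = v [^] (l * k' + l' * k)" unfolding kl(3) kl'(3) using v by (simp add: int_pow_pow int_pow_mult)
    finally have "(g \<otimes> h) [^] (k * k') = v [^] (l * k' + l' * k)" .
    moreover have "k * k' \<noteq> 0" using kl(2) kl'(2) by simp
    ultimately show "g \<otimes> h \<in> E" using kl(1) kl'(1) unfolding E_def commensurable_def by blast
  qed
  \<comment> \<open>Otherwise any two nontrivial elements would have a common power, and the
    finitely generated group G would be cyclic.\<close>
  have "\<exists>w\<in>carrier G. \<not> ell w"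
  proof (rule ccontr)
    assume "\<not> ?thesis"
    then have all: "\<And>x. x \<in> carrier G \<Longrightarrow> ell x" by blast
    have "\<exists>c\<in>carrier G. generate G S = range (\<lambda>k::int. c [^] k)"
      by (rule finitely_generated_commensurable_cyclic[OF tf subgroup_self comm _ S(1,2)])
        (use ell_common_power all in blast)+
    then show False using nc cyclic_group S(3) by auto
  qed
  then obtain w where w: "w \<in> carrier G" "\<not> ell w" by blast
  have "E \<subseteq> group_center G" using comm by (auto simp: E_def group_center_def)
  then interpret E: normal E G using central_subgroup_normal[OF E_sub] by blast
  let ?Q = "G Mod E"
  interpret Q: Group.group ?Q by (rule E.factorgroup_is_group)
  note mult_FactGroup [simp del] one_FactGroup [simp del]
  define cs where "cs g = E #> g" for g
  have cs: "cs \<in> hom G ?Q" unfolding cs_def by (rule E.r_coset_hom_Mod)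
  interpret cs: group_hom G ?Q cs using cs by unfold_locales
  have cs_iff: "cs b = \<one>\<^bsub>?Q\<^esub> \<longleftrightarrow> b \<in> E" if "b \<in> carrier G" for b
    using coset_join1[OF _ that E_sub] coset_join2[OF that E_sub] by (auto simp: cs_def one_FactGroup)
  have Qcarr: "carrier ?Q = cs ` carrier G" by (simp add: carrier_FactGroup cs_def)
  \<comment> \<open>The subgroup \<open>E\<close> is closed under taking roots.\<close>
  have Qtf: "Q.torsion_free" unfolding Q.torsion_free_def
  proof (intro ballI allI impI)
    fix x and k :: nat assume x: "x \<in> carrier ?Q" "k > 0" "x [^]\<^bsub>?Q\<^esub> k = \<one>\<^bsub>?Q\<^esub>"
    then obtain g where g: "g \<in> carrier G" "x = cs g" using Qcarr by auto
    have "cs (g [^] k) = \<one>\<^bsub>?Q\<^esub>" using x g cs.hom_nat_pow by simp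
    then have "g [^] k \<in> E" using cs_iff[of "g [^] k"] g by simp
    then have "ell (g [^] int k)" unfolding E_def int_pow_int by blast
    then have "ell g" by (rule ell_root[OF g(1), rotated]) (use x(2) in simp)
    then have "g \<in> E" using g(1) by (simp add: E_iff)
    then show "x = \<one>\<^bsub>?Q\<^esub>" using cs_iff g by simp
  qed
  \<comment> \<open>By \<open>commuting\<close>, a product of powers of x and w lies in
    \<open>E\<close>. Modulo \<open>E\<close>, all nontrivial elements are therefore commensurable
    with w, which makes the quotient cyclic.\<close>
  have wpow: "\<exists>(m::int) (q::int). m \<noteq> 0 \<and> q \<noteq> 0 \<and> cs x [^]\<^bsub>?Q\<^esub> m = cs w [^]\<^bsub>?Q\<^esub> q"
    if x: "x \<in> carrier G" "cs x \<noteq> \<one>\<^bsub>?Q\<^esub>" for x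
  proof -
    obtain m :: nat and q :: int where m: "m > 0" "ell (w [^] q \<otimes> x [^] m)"
      using commuting[OF x(1) w(1) comm[OF x(1) w(1)] w(2)] by blast
    have mem: "w [^] q \<otimes> x [^] m \<in> carrier G" using x(1) w(1) by simp
    have "cs (w [^] q \<otimes> x [^] m) = \<one>\<^bsub>?Q\<^esub>" unfolding cs_iff[OF mem] E_iff[OF mem] by (rule m(2))
    then have eq: "cs w [^]\<^bsub>?Q\<^esub> q \<otimes>\<^bsub>?Q\<^esub> cs x [^]\<^bsub>?Q\<^esub> int m = \<one>\<^bsub>?Q\<^esub>"
      using x w by (simp add: cs.hom_int_pow cs.hom_nat_pow int_pow_int)
    then have eq2: "cs x [^]\<^bsub>?Q\<^esub> int m = cs w [^]\<^bsub>?Q\<^esub> (-q)"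
      using x w by (metis Q.int_pow_closed Q.int_pow_neg Q.inv_equality Q.inv_inv cs.hom_closed)
    have "q \<noteq> 0"
    proof
      assume "q = 0"
      then have "cs x [^]\<^bsub>?Q\<^esub> int m = \<one>\<^bsub>?Q\<^esub>" using eq2 by simp
      then have "cs x = \<one>\<^bsub>?Q\<^esub>" using Q.torsion_free_int[OF Qtf _ , of "cs x" "int m"] m x by simp
      then show False using x by simp
    qed
    then show ?thesis using eq2 m by (intro exI[of _ "int m"] exI[of _ "-q"]) simp
  qed
  have Qcms: "\<exists>(p::int) (q::int). p \<noteq> 0 \<and> q \<noteq> 0 \<and> X [^]\<^bsub>?Q\<^esub> p = Y [^]\<^bsub>?Q\<^esub> q"
    if XY: "X \<in> carrier ?Q" "Y \<in> carrier ?Q" "X \<noteq> \<one>\<^bsub>?Q\<^esub>" "Y \<noteq> \<one>\<^bsub>?Q\<^esub>" for X Y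
  proof -
    obtain x y where xy: "x \<in> carrier G" "X = cs x" "y \<in> carrier G" "Y = cs y" using XY Qcarr by auto
    obtain m q :: int where mq: "m \<noteq> 0" "q \<noteq> 0" "X [^]\<^bsub>?Q\<^esub> m = cs w [^]\<^bsub>?Q\<^esub> q" using wpow[of x] xy XY by auto
    obtain m' q' :: int where mq': "m' \<noteq> 0" "q' \<noteq> 0" "Y [^]\<^bsub>?Q\<^esub> m' = cs w [^]\<^bsub>?Q\<^esub> q'" using wpow[of y] xy XY by auto
    have "X [^]\<^bsub>?Q\<^esub> (m * q') = (X [^]\<^bsub>?Q\<^esub> m) [^]\<^bsub>?Q\<^esub> q'" using XY by (simp add: Q.int_pow_pow)
    also have "\<dots> = (Y [^]\<^bsub>?Q\<^esub> m') [^]\<^bsub>?Q\<^esub> q" unfolding mq(3) mq'(3) using w by (simp add: Q.int_pow_pow mult.commute)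
    also have "\<dots> = Y [^]\<^bsub>?Q\<^esub> (m' * q)" using XY by (simp add: Q.int_pow_pow)
    finally show ?thesis using mq mq' by (intro exI[of _ "m * q'"] exI[of _ "m' * q"]) simp
  qed
  have Qcomm: "X \<otimes>\<^bsub>?Q\<^esub> Y = Y \<otimes>\<^bsub>?Q\<^esub> X" if "X \<in> carrier ?Q" "Y \<in> carrier ?Q" for X Y
    using that comm unfolding Qcarr by (auto simp flip: cs.hom_mult)
  have "\<exists>C\<in>carrier ?Q. generate ?Q (cs ` S) = range (\<lambda>k::int. C [^]\<^bsub>?Q\<^esub> k)"
    by (rule Q.finitely_generated_commensurable_cyclic[OF Qtf Q.subgroup_self Qcomm Qcms]) (use S cs.hom_closed in auto)
  moreover have "generate ?Q (cs ` S) = carrier ?Q" using cs.generate_img[OF S(2)] S(3) Qcarr by simp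
  ultimately obtain s where s: "s \<in> carrier G" "carrier ?Q = range (\<lambda>k::int. cs s [^]\<^bsub>?Q\<^esub> k)" using Qcarr by auto
  have dec: "\<exists>k::int. g \<otimes> s [^] (-k) \<in> E" if g: "g \<in> carrier G" for g
  proof -
    have "cs g \<in> carrier ?Q" using g by simp
    then obtain k :: int where k: "cs g = cs s [^]\<^bsub>?Q\<^esub> k" using s(2) by auto
    have "cs (g \<otimes> s [^] (-k)) = \<one>\<^bsub>?Q\<^esub>" using k g s(1) by (simp add: cs.hom_int_pow int_pow_neg)
    then show ?thesis using cs_iff[of "g \<otimes> s [^] (-k)"] g s(1) by blast
  qed
  \<comment> \<open>A nonzero power of s in \<open>E\<close> would put s into \<open>E\<close> and
    make the quotient trivial, although w is not in \<open>E\<close>.\<close>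
  have sk: "k = 0" if "s [^] (k::int) \<in> E" for k
  proof (rule ccontr)
    assume "k \<noteq> 0"
    then have "s \<in> E" using ell_root[OF s(1)] that s(1) E_iff by blast
    then have "cs s = \<one>\<^bsub>?Q\<^esub>" using cs_iff[OF s(1)] by blast
    then have "carrier ?Q = {\<one>\<^bsub>?Q\<^esub>}" using s(2) by simp
    then have "cs w = \<one>\<^bsub>?Q\<^esub>" using cs.hom_closed[OF w(1)] by auto
    then show False using cs_iff w E_iff by blast
  qed
  have "\<forall>g\<in>S. \<exists>e. e \<in> E \<and> (\<exists>k::int. g = e \<otimes> s [^] k)"
  proof
    fix g assume "g \<in> S"
    then have g: "g \<in> carrier G" using S by blast
    obtain k :: int where k: "g \<otimes> s [^] (-k) \<in> E" using dec[OF g] by blast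
    have "g = g \<otimes> s [^] (-k) \<otimes> s [^] k" using g s(1) by (simp add: m_assoc int_pow_neg)
    then show "\<exists>e. e \<in> E \<and> (\<exists>k::int. g = e \<otimes> s [^] k)" using k by blast
  qed
  from bchoice[OF this] obtain e where e: "\<forall>g\<in>S. e g \<in> E \<and> (\<exists>k::int. g = e g \<otimes> s [^] k)" ..
  have EG: "E \<subseteq> carrier G" by (rule subgroup.subset[OF E_sub])
  have eS: "e ` S \<subseteq> E" using e by blast
  \<comment> \<open>Shows that \<open>E\<close> is finitely generated: each generator of G is split
    into an element of \<open>E\<close> and a power of s. These elements and s generate G, and as no
    nonzero power of s lies in \<open>E\<close>, the elements alone generate
    \<open>E\<close>.\<close>
  define M where "M = {d \<otimes> s [^] (k::int) | d k. d \<in> generate G (e ` S)}"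
  have gE: "subgroup (generate G (e ` S)) G" by (rule generate_is_subgroup) (use eS EG in blast)
  have gEE: "generate G (e ` S) \<subseteq> E" by (rule generate_subgroup_incl[OF eS E_sub])
  have M_sub: "subgroup M G"
  proof (rule subgroupI)
    show "M \<subseteq> carrier G" using gEE EG s(1) by (auto simp: M_def)
    show "M \<noteq> {}" using subgroup.one_closed[OF gE] by (auto simp: M_def)
    fix x assume "x \<in> M"
    then obtain d and k :: int where x: "x = d \<otimes> s [^] k" "d \<in> generate G (e ` S)" by (auto simp: M_def)
    have dG: "d \<in> carrier G" using x gEE EG by blast
    have "inv x = inv d \<otimes> s [^] (-k)"
      using x(1) dG s(1) comm[of "inv d" "s [^] (-k)"] by (simp add: inv_mult_group int_pow_neg)
    then show "inv x \<in> M" using subgroup.m_inv_closed[OF gE x(2)] by (auto simp: M_def)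
    fix y assume "y \<in> M"
    then obtain d' and k' :: int where y: "y = d' \<otimes> s [^] k'" "d' \<in> generate G (e ` S)" by (auto simp: M_def)
    have d'G: "d' \<in> carrier G" using y gEE EG by blast
    have "x \<otimes> y = d \<otimes> (s [^] k \<otimes> d') \<otimes> s [^] k'" using x(1) y(1) dG d'G s(1) by (simp add: m_assoc)
    also have "\<dots> = d \<otimes> (d' \<otimes> s [^] k) \<otimes> s [^] k'" using comm[of "s [^] k" d'] d'G s(1) by simp
    also have "\<dots> = d \<otimes> d' \<otimes> s [^] (k + k')" using dG d'G s(1) by (simp add: m_assoc int_pow_mult)
    finally show "x \<otimes> y \<in> M" using subgroup.m_closed[OF gE x(2) y(2)] by (auto simp: M_def)
  qed
  have "S \<subseteq> M"
  proof
    fix g assume g: "g \<in> S"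
    then obtain k :: int where "g = e g \<otimes> s [^] k" using e by blast
    moreover have "e g \<in> generate G (e ` S)" using g by (intro generate.incl) simp
    ultimately show "g \<in> M" unfolding M_def by blast
  qed
  then have M: "carrier G \<subseteq> M" using generate_subgroup_incl[OF _ M_sub] S(3) by blast
  have "E \<subseteq> generate G (e ` S)"
  proof
    fix x assume x: "x \<in> E"
    then have "x \<in> M" using M EG by blast
    then obtain d and k :: int where d: "x = d \<otimes> s [^] k" "d \<in> generate G (e ` S)" unfolding M_def by blast
    have dE: "d \<in> E" using d gEE by blast
    have "s [^] k = inv d \<otimes> x" using d(1) dE EG s(1) by (simp add: m_assoc[symmetric] subsetD)
    then have "s [^] k \<in> E" using x dE subgroup.m_closed[OF E_sub] subgroup.m_inv_closed[OF E_sub] by simp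
    then have "k = 0" by (rule sk)
    then show "x \<in> generate G (e ` S)" using d dE EG by auto
  qed
  then have gEeq: "generate G (e ` S) = E" using gEE by blast
  have Ecomm: "x \<otimes> y = y \<otimes> x" if "x \<in> E" "y \<in> E" for x y
    by (rule comm) (use that EG in blast)+
  have Ecms: "\<exists>(p::int) (q::int). p \<noteq> 0 \<and> q \<noteq> 0 \<and> x [^] p = y [^] q"
    if xy: "x \<in> E" "y \<in> E" "x \<noteq> \<one>" "y \<noteq> \<one>" for x y
  proof -
    have "x \<in> carrier G" "y \<in> carrier G" using xy EG by blast+
    then show ?thesis using ell_common_power[of x y] xy E_iff by blast
  qed
  have "\<exists>c\<in>E. generate G (e ` S) = range (\<lambda>k::int. c [^] k)"
    by (rule finitely_generated_commensurable_cyclic[OF tf E_sub Ecomm Ecms _ eS]) (use S(1) in simp_all)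
  then obtain c where c: "c \<in> E" "E = range (\<lambda>k::int. c [^] k)" using gEeq by auto
  have cG: "c \<in> carrier G" using c EG by blast
  have c_inf: "k = 0" if "c [^] (k::int) = \<one>" for k
  proof (rule ccontr)
    assume "k \<noteq> 0"
    then have "c = \<one>" using torsion_free_int[OF tf cG _ that] by blast
    then have "E = {\<one>}" using c(2) by auto
    moreover have "v \<in> E" using v ell_v by (simp add: E_iff)
    ultimately show False using v_ne by simp
  qed
  \<comment> \<open>The free abelian group of rank 2: with exponent 1 the only root is z itself. The
    index 2 of the stable letter is congruent to 2 modulo 4, as the loops of the star have to
    be.\<close>
  let ?H = "hub {0} (\<lambda>_. Suc 0) {2}"
  let ?g = "hgen {0} (\<lambda>_. Suc 0) {2}"
  interpret H: Group.group ?H by (rule group_hub)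
  obtain \<theta> where \<theta>: "\<theta> \<in> hom ?H G" "\<theta> (?g HZ) = c" "\<And>i. i \<in> {0} \<Longrightarrow> \<theta> (?g (HA i)) = c" "\<And>j. j \<in> {2} \<Longrightarrow> \<theta> (?g (HT j)) = s"
  proof (rule hub_lift[OF is_group, of c "{0}" "\<lambda>_. c" "{2}" "\<lambda>_. s" "\<lambda>_. Suc 0"])
    show "c [^] Suc 0 = c" using cG by simp
  qed (use cG s(1) comm in auto)
  interpret \<theta>: group_hom ?H G \<theta> using \<theta>(1) by unfold_locales
  have z: "?g HZ \<in> carrier ?H" and t: "?g (HT 2) \<in> carrier ?H" by auto
  have A: "?g (HA 0) = ?g HZ" using hub_pow[of 0 "{0}" "\<lambda>_. Suc 0" "{2}"] H.l_one[of "?g (HA 0)"] by simp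
  have zt: "?g HZ \<otimes>\<^bsub>?H\<^esub> ?g (HT 2) = ?g (HT 2) \<otimes>\<^bsub>?H\<^esub> ?g HZ" using hub_central[OF t] .
  have step_z: "?g HZ [^]\<^bsub>?H\<^esub> (k::int) \<otimes>\<^bsub>?H\<^esub> (?g HZ [^]\<^bsub>?H\<^esub> (i::int) \<otimes>\<^bsub>?H\<^esub> ?g (HT 2) [^]\<^bsub>?H\<^esub> (j::int)) =
      ?g HZ [^]\<^bsub>?H\<^esub> (k + i) \<otimes>\<^bsub>?H\<^esub> ?g (HT 2) [^]\<^bsub>?H\<^esub> j" for k i j
    using z t by (simp add: H.int_pow_mult H.m_assoc)
  have step_t: "?g (HT 2) [^]\<^bsub>?H\<^esub> (k::int) \<otimes>\<^bsub>?H\<^esub> (?g HZ [^]\<^bsub>?H\<^esub> (i::int) \<otimes>\<^bsub>?H\<^esub> ?g (HT 2) [^]\<^bsub>?H\<^esub> (j::int)) =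
      ?g HZ [^]\<^bsub>?H\<^esub> i \<otimes>\<^bsub>?H\<^esub> ?g (HT 2) [^]\<^bsub>?H\<^esub> (k + j)" for k i j
    using z t H.commuting_int_pow[OF zt z t, of i k] by (simp add: H.int_pow_mult H.m_assoc[symmetric])
  have form: "\<exists>(i::int) (j::int). p = ?g HZ [^]\<^bsub>?H\<^esub> i \<otimes>\<^bsub>?H\<^esub> ?g (HT 2) [^]\<^bsub>?H\<^esub> j" if "p \<in> carrier ?H" for p
    using that unfolding hub_def
  proof (induction rule: presented_group_induct)
    case one
    show ?case unfolding hub_def[symmetric] by (intro exI[of _ 0]) simp
  next
    case (gen x p)
    have *: "pgen (hub_gens {0} {2}) (hub_rels {0} (\<lambda>_. Suc 0) {2}) x = ?g x" by (simp add: hgen_def)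
    obtain i j :: int where p: "p = ?g HZ [^]\<^bsub>?H\<^esub> i \<otimes>\<^bsub>?H\<^esub> ?g (HT 2) [^]\<^bsub>?H\<^esub> j" using gen.IH unfolding hub_def[symmetric] by blast
    have "?g x = ?g HZ [^]\<^bsub>?H\<^esub> (1::int) \<or> ?g x = ?g (HT 2) [^]\<^bsub>?H\<^esub> (1::int)"
      using gen.hyps(1) A z t by (auto simp: hub_gens_def)
    then show ?case unfolding * hub_def[symmetric] using p step_z[of 1 i j] step_t[of 1 i j] by (elim disjE) (simp only:, blast)+
  next
    case (inv x p)
    have *: "pgen (hub_gens {0} {2}) (hub_rels {0} (\<lambda>_. Suc 0) {2}) x = ?g x" by (simp add: hgen_def)
    obtain i j :: int where p: "p = ?g HZ [^]\<^bsub>?H\<^esub> i \<otimes>\<^bsub>?H\<^esub> ?g (HT 2) [^]\<^bsub>?H\<^esub> j" using inv.IH unfolding hub_def[symmetric] by blast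
    have "inv\<^bsub>?H\<^esub> ?g x = ?g HZ [^]\<^bsub>?H\<^esub> (-1::int) \<or> inv\<^bsub>?H\<^esub> ?g x = ?g (HT 2) [^]\<^bsub>?H\<^esub> (-1::int)"
      using inv.hyps(1) A z t by (auto simp: hub_gens_def H.int_pow_neg)
    then show ?case unfolding * hub_def[symmetric] using p step_z[of "-1" i j] step_t[of "-1" i j] by (elim disjE) (simp only:, blast)+
  qed
  have "kernel ?H G \<theta> = {\<one>\<^bsub>?H\<^esub>}"
  proof
    show "kernel ?H G \<theta> \<subseteq> {\<one>\<^bsub>?H\<^esub>}"
    proof
      fix p assume p: "p \<in> kernel ?H G \<theta>"
      then obtain i j :: int where ij: "p = ?g HZ [^]\<^bsub>?H\<^esub> i \<otimes>\<^bsub>?H\<^esub> ?g (HT 2) [^]\<^bsub>?H\<^esub> j" using form[of p] unfolding kernel_def by blast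
      have *: "c [^] i \<otimes> s [^] j = \<one>" using p ij \<theta> z t by (simp add: kernel_def \<theta>.hom_int_pow)
      have "s [^] j = inv (c [^] i)" using * cG s(1) by (metis int_pow_closed inv_equality inv_inv)
      moreover have "inv (c [^] i) \<in> E" using subgroup.m_inv_closed[OF E_sub subgroup_int_pow_closed[OF E_sub c(1)]] .
      ultimately have "j = 0" using sk by simp
      then have "i = 0" using * c_inf cG by simp
      then show "p \<in> {\<one>\<^bsub>?H\<^esub>}" using ij \<open>j = 0\<close> by simp
    qed
  qed (simp add: kernel_def)
  moreover have "\<theta> ` carrier ?H = carrier G"
  proof
    show "carrier G \<subseteq> \<theta> ` carrier ?H"
    proof
      fix g assume g: "g \<in> carrier G"
      then obtain k :: int where "g \<otimes> s [^] (-k) \<in> E" using dec by blast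
      then obtain i :: int where i: "g \<otimes> s [^] (-k) = c [^] i" using c(2) by auto
      have "g = g \<otimes> s [^] (-k) \<otimes> s [^] k" using g s(1) by (simp add: m_assoc int_pow_neg)
      then have "g = \<theta> (?g HZ [^]\<^bsub>?H\<^esub> i \<otimes>\<^bsub>?H\<^esub> ?g (HT 2) [^]\<^bsub>?H\<^esub> k)"
        using i \<theta> z t by (simp add: \<theta>.hom_int_pow)
      then show "g \<in> \<theta> ` carrier ?H" using z t by blast
    qed
  qed auto
  ultimately have "\<theta> \<in> iso ?H G"
    unfolding iso_kernel_image[OF group_hub is_group] using \<theta>(1) by (intro conjI)
  then have "?H \<cong> G" unfolding is_iso_def by blast
  then show ?thesis using H.iso_sym by blast
qed

end

section \<open>The centre when two factors are nontrivial\<close>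

lemma (in free_prod) cyclic_free_product_lift:
  assumes H: "group H" and \<kappa>: "\<And>i. i \<in> I \<Longrightarrow> \<kappa> i \<in> carrier (K i)" "\<And>i. i \<in> I \<Longrightarrow> carrier (K i) = range (\<lambda>k::int. \<kappa> i [^]\<^bsub>K i\<^esub> k)"
    and y: "\<And>i. i \<in> I \<Longrightarrow> y i \<in> carrier H" "\<And>i. i \<in> I \<Longrightarrow> finite (carrier (K i)) \<Longrightarrow> y i [^]\<^bsub>H\<^esub> order (K i) = \<one>\<^bsub>H\<^esub>"
  obtains h where "h \<in> hom FP H" "\<And>i. i \<in> I \<Longrightarrow> h (fc [(i, \<kappa> i)]) = y i"
proof -
  interpret H: Group.group H by fact
  have "\<forall>i\<in>I. \<exists>f. f \<in> hom (K i) H \<and> f (\<kappa> i) = y i"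
  proof
    fix i assume i: "i \<in> I"
    interpret Ki: Group.group "K i" using factor_group i .
    obtain f where f: "f \<in> hom (K i) H" "\<forall>k::int. f (\<kappa> i [^]\<^bsub>K i\<^esub> k) = y i [^]\<^bsub>H\<^esub> k"
      using Ki.cyclic_group_hom[OF \<kappa>(1)[OF i] \<kappa>(2)[OF i] H y(1)[OF i] y(2)[OF i]] by blast
    have "f (\<kappa> i) = y i" using f(2)[rule_format, of 1] \<kappa>(1)[OF i] y(1)[OF i] by simp
    then show "\<exists>f. f \<in> hom (K i) H \<and> f (\<kappa> i) = y i" using f(1) by blast
  qed
  from bchoice[OF this] obtain f where f: "\<forall>i\<in>I. f i \<in> hom (K i) H \<and> f i (\<kappa> i) = y i" ..
  have f1: "\<And>i. i \<in> I \<Longrightarrow> f i \<in> hom (K i) H" using f by blast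
  obtain h where h: "h \<in> hom FP H" "\<And>i g. i \<in> I \<Longrightarrow> g \<in> carrier (K i) \<Longrightarrow> h (fc [(i, g)]) = f i g"
    by (rule free_product_lift[of H f, OF H f1]) (assumption | rule that)+
  show ?thesis by (rule that[OF h(1)]) (use h(2) f \<kappa>(1) in simp)
qed

lemma (in free_prod) fgen_int_pow:
  assumes "i \<in> I" "g \<in> carrier (K i)"
  shows "fc [(i, g [^]\<^bsub>K i\<^esub> (k::int))] = fc [(i, g)] [^]\<^bsub>FP\<^esub> k"
proof -
  interpret FP: Group.group FP by (rule group_FP)
  interpret Ki: Group.group "K i" using factor_group assms(1) .
  interpret h: group_hom "K i" FP "\<lambda>g. fc [(i, g)]" using fgen_hom assms(1) by unfold_locales
  show ?thesis using h.hom_int_pow[OF assms(2)] .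
qed

lemma (in free_prod) subgroup_all:
  assumes "subgroup M FP" and \<kappa>: "\<And>i. i \<in> I \<Longrightarrow> \<kappa> i \<in> carrier (K i)" "\<And>i. i \<in> I \<Longrightarrow> carrier (K i) = range (\<lambda>k::int. \<kappa> i [^]\<^bsub>K i\<^esub> k)"
    and gen: "\<And>i. i \<in> I \<Longrightarrow> fc [(i, \<kappa> i)] \<in> M" and p: "p \<in> carrier FP"
  shows "p \<in> M"
proof -
  interpret FP: Group.group FP by (rule group_FP)
  show ?thesis using p
  proof (induction rule: free_product_induct)
    case one
    show ?case by (rule subgroup.one_closed[OF assms(1)])
  next
    case (letter i g p)
    obtain k :: int where k: "g = \<kappa> i [^]\<^bsub>K i\<^esub> k" using \<kappa>(2)[OF letter(1)] letter(2) by auto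
    have "fc [(i, g)] \<in> M"
      unfolding k fgen_int_pow[OF letter(1) \<kappa>(1)[OF letter(1)]]
      by (rule FP.subgroup_int_pow_closed[OF assms(1) gen[OF letter(1)]])
    then show ?case using letter subgroup.m_closed[OF assms(1)] by blast
  qed
qed

text \<open>The elements \<open>x0\<close> and \<open>y0\<close> witness two nontrivial factors. By
  \<open>ker\<close> the projection \<pi> identifies the free product with G modulo its
  centre.\<close>

locale gbs_quotient = gbs_data G v + free_prod I K
  for G (structure) and v and I :: "nat set" and K :: "nat \<Rightarrow> int monoid" +
  fixes \<pi> i0 j0 x0 y0
  assumes cyclic: "\<And>i. i \<in> I \<Longrightarrow> cyclic_group (K i)"
    and \<pi>: "\<pi> \<in> hom G FP" "\<pi> ` carrier G = carrier FP"
    and ker: "\<And>x. x \<in> carrier G \<Longrightarrow> \<pi> x = \<one>\<^bsub>FP\<^esub> \<longleftrightarrow> x \<in> group_center G"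
    and ij: "i0 \<in> I" "j0 \<in> I" "i0 \<noteq> j0"
    and x0: "x0 \<in> carrier (K i0)" "x0 \<noteq> \<one>\<^bsub>K i0\<^esub>" and y0: "y0 \<in> carrier (K j0)" "y0 \<noteq> \<one>\<^bsub>K j0\<^esub>"
begin

abbreviation Z where "Z \<equiv> group_center G"

text \<open>The nontrivial factors. The index set \<open>I\<close> may be infinite, but only with
  trivial factors beyond finitely many.\<close>

definition I0 where "I0 = {i \<in> I. \<exists>x\<in>carrier (K i). x \<noteq> \<one>\<^bsub>K i\<^esub>}"

lemma FP_group [simp]: "Group.group FP" by (rule group_FP)

lemma \<pi>_hom: "group_hom G FP \<pi>"
  using \<pi>(1) by (intro group_hom.intro group_hom_axioms.intro is_group FP_group)

sublocale \<pi>: group_hom G FP \<pi> by (rule \<pi>_hom)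

lemma Z_sub: "subgroup Z G" by (rule subgroup_center)

lemma Z_carrier: "c \<in> Z \<Longrightarrow> c \<in> carrier G" by (simp add: group_center_def)

lemma Z_comm: "c \<in> Z \<Longrightarrow> g \<in> carrier G \<Longrightarrow> c \<otimes> g = g \<otimes> c" by (simp add: group_center_def)

lemma Z_pow: "c \<in> Z \<Longrightarrow> c [^] (k::int) \<in> Z" by (rule subgroup_int_pow_closed[OF Z_sub])

lemma I0_sub: "I0 \<subseteq> I" by (auto simp: I0_def)

lemma finite_I0: "finite I0"
proof -
  obtain S where S: "finite S" "S \<subseteq> carrier G" "generate G S = carrier G" by (rule fg_set)
  have "generate FP (\<pi> ` S) = carrier FP" using \<pi>.generate_img[OF S(2)] S(3) \<pi>(2) by simp
  then show ?thesis unfolding I0_def by (rule finitely_many_factors[rotated 2]) (use S(1,2) in auto)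
qed

text \<open>The lift is fixed to be 1 outside \<open>I0\<close>, so that only finitely many relators
  remain to be considered.\<close>

lemma generators:
  obtains \<kappa> Y where "\<And>i. i \<in> I \<Longrightarrow> \<kappa> i \<in> carrier (K i)" "\<And>i. i \<in> I \<Longrightarrow> carrier (K i) = range (\<lambda>k::int. \<kappa> i [^]\<^bsub>K i\<^esub> k)"
    "\<And>i. i \<in> I \<Longrightarrow> Y i \<in> carrier G" "\<And>i. i \<in> I \<Longrightarrow> \<pi> (Y i) = fc [(i, \<kappa> i)]" "\<And>i. i \<in> I \<Longrightarrow> i \<notin> I0 \<Longrightarrow> Y i = \<one>"
proof -
  have "\<forall>i\<in>I. \<exists>p. fst p \<in> carrier (K i) \<and> carrier (K i) = range (\<lambda>k::int. fst p [^]\<^bsub>K i\<^esub> k) \<and> snd p \<in> carrier G \<and>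
     \<pi> (snd p) = fc [(i, fst p)] \<and> (i \<notin> I0 \<longrightarrow> snd p = \<one>)"
  proof
    fix i assume i: "i \<in> I"
    interpret Ki: Group.group "K i" using factor_group i .
    obtain k where k: "k \<in> carrier (K i)" "carrier (K i) = range (\<lambda>n::int. k [^]\<^bsub>K i\<^esub> n)"
      using cyclic[OF i] Ki.cyclic_group by auto
    have "\<exists>y\<in>carrier G. \<pi> y = fc [(i, k)] \<and> (i \<notin> I0 \<longrightarrow> y = \<one>)"
    proof (cases "i \<in> I0")
      case True
      have "fc [(i, k)] \<in> \<pi> ` carrier G" unfolding \<pi>(2) using i k(1) by simp
      then show ?thesis using True by auto
    next
      case False
      then have "k = \<one>\<^bsub>K i\<^esub>" using i k(1) by (auto simp: I0_def)
      then show ?thesis using fgen_one[OF i] one_free_product by (intro bexI[of _ \<one>]) simp_all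
    qed
    then obtain y where "y \<in> carrier G" "\<pi> y = fc [(i, k)]" "i \<notin> I0 \<longrightarrow> y = \<one>" by blast
    then show "\<exists>p. fst p \<in> carrier (K i) \<and> carrier (K i) = range (\<lambda>k::int. fst p [^]\<^bsub>K i\<^esub> k) \<and> snd p \<in> carrier G \<and>
     \<pi> (snd p) = fc [(i, fst p)] \<and> (i \<notin> I0 \<longrightarrow> snd p = \<one>)" using k by (intro exI[of _ "(k, y)"] conjI) (simp_all only: fst_conv snd_conv)
  qed
  from bchoice[OF this] obtain p where p: "\<forall>i\<in>I. fst (p i) \<in> carrier (K i) \<and> carrier (K i) = range (\<lambda>k::int. fst (p i) [^]\<^bsub>K i\<^esub> k) \<and>
     snd (p i) \<in> carrier G \<and> \<pi> (snd (p i)) = fc [(i, fst (p i))] \<and> (i \<notin> I0 \<longrightarrow> snd (p i) = \<one>)" ..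
  show ?thesis
    by (rule that[of "\<lambda>i. fst (p i)" "\<lambda>i. snd (p i)"]) (use p in blast)+
qed

lemma fgen_order:
  assumes i: "i \<in> I" "finite (carrier (K i))" "k \<in> carrier (K i)"
  shows "fc [(i, k)] [^]\<^bsub>FP\<^esub> order (K i) = \<one>\<^bsub>FP\<^esub>"
proof -
  interpret Ki: Group.group "K i" using factor_group i(1) .
  have "fc [(i, k)] [^]\<^bsub>FP\<^esub> int (order (K i)) = fc [(i, k [^]\<^bsub>K i\<^esub> int (order (K i)))]"
    using fgen_int_pow[OF i(1,3)] by simp
  also have "k [^]\<^bsub>K i\<^esub> int (order (K i)) = \<one>\<^bsub>K i\<^esub>" using Ki.pow_order_eq_1[OF i(3)] by (simp add: int_pow_int)
  finally show ?thesis using fgen_one[OF i(1)] one_free_product by (simp add: int_pow_int)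
qed

text \<open>\<open>G\<close> is finitely generated and \<open>FP\<close> is finitely presented; \<open>D\<close> consists of the relators and of the errors made when
  the generators of \<open>G\<close> are expressed by the chosen preimages.\<close>

lemma center_generated:
  obtains D where "finite D" "D \<subseteq> Z" "generate G D = Z"
proof -
  obtain S where S: "finite S" "S \<subseteq> carrier G" "generate G S = carrier G" by (rule fg_set)
  obtain \<kappa> Y where \<kappa>: "\<And>i. i \<in> I \<Longrightarrow> \<kappa> i \<in> carrier (K i)" "\<And>i. i \<in> I \<Longrightarrow> carrier (K i) = range (\<lambda>k::int. \<kappa> i [^]\<^bsub>K i\<^esub> k)"
    and Y: "\<And>i. i \<in> I \<Longrightarrow> Y i \<in> carrier G" "\<And>i. i \<in> I \<Longrightarrow> \<pi> (Y i) = fc [(i, \<kappa> i)]" "\<And>i. i \<in> I \<Longrightarrow> i \<notin> I0 \<Longrightarrow> Y i = \<one>"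
    by (rule generators) (assumption | rule that)+
  have YG: "Y ` I \<subseteq> carrier G" using Y(1) by blast
  \<comment> \<open>The lifts generate a subgroup that maps onto the free product but may miss part
    of the centre; the errors \<open>inv (w s) \<otimes> s\<close> make up for it.\<close>
  define W where "W = generate G (Y ` I)"
  have WG: "W \<subseteq> carrier G" unfolding W_def using generate_in_carrier[OF YG] by blast
  have W_sub: "subgroup W G" unfolding W_def by (rule generate_is_subgroup[OF YG])
  have "\<pi> ` W = carrier FP"
  proof
    have sub: "subgroup (\<pi> ` W) FP" by (rule \<pi>.subgroup_img_is_subgroup[OF W_sub])
    have "fc [(i, \<kappa> i)] \<in> \<pi> ` W" if "i \<in> I" for i
    proof -
      have "Y i \<in> W" unfolding W_def using that by (intro generate.incl) simp
      then show ?thesis using Y(2)[OF that] by (metis imageI)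
    qed
    then show "carrier FP \<subseteq> \<pi> ` W" using subgroup_all[OF sub \<kappa>] by blast
  qed (use WG in auto)
  then have "\<forall>s\<in>S. \<exists>w. w \<in> W \<and> \<pi> w = \<pi> s" using S(2) by (metis imageE \<pi>.hom_closed subset_iff)
  from bchoice[OF this] obtain w where w: "\<forall>s\<in>S. w s \<in> W \<and> \<pi> (w s) = \<pi> s" ..
  have wG: "w s \<in> carrier G" "\<pi> (w s) = \<pi> s" "w s \<in> W" "s \<in> carrier G" if "s \<in> S" for s using w WG S(2) that by blast+
  have cZ: "inv (w s) \<otimes> s \<in> Z" if s: "s \<in> S" for s
  proof -
    note * = wG[OF s]
    have m: "inv (w s) \<otimes> s \<in> carrier G" using * by simp
    have "\<pi> (inv (w s) \<otimes> s) = \<one>\<^bsub>FP\<^esub>" using * by (simp add: \<pi>.hom_inv)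
    then show ?thesis using ker[OF m] by blast
  qed
  define D where "D = (\<lambda>i. Y i [^] order (K i)) ` {i \<in> I0. finite (carrier (K i))} \<union> (\<lambda>s. inv (w s) \<otimes> s) ` S"
  have D: "finite D" "D \<subseteq> Z"
  proof -
    show "finite D" unfolding D_def using S(1) finite_I0 by simp
    have "Y i [^] order (K i) \<in> Z" if i: "i \<in> I" "finite (carrier (K i))" for i
    proof -
      have "\<pi> (Y i [^] order (K i)) = \<one>\<^bsub>FP\<^esub>"
        using \<pi>.hom_nat_pow[OF Y(1)[OF i(1)]] fgen_order[OF i \<kappa>(1)[OF i(1)]] Y(2)[OF i(1)] by simp
      then show ?thesis using ker[of "Y i [^] order (K i)"] Y(1)[OF i(1)] by simp
    qed
    then show "D \<subseteq> Z" using cZ I0_sub by (auto simp: D_def)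
  qed
  have DG: "D \<subseteq> carrier G" using D(2) Z_carrier by blast
  define N where "N = generate G D"
  have N_sub: "subgroup N G" unfolding N_def by (rule generate_is_subgroup[OF DG])
  have NZ: "N \<subseteq> Z" unfolding N_def by (rule generate_subgroup_incl[OF D(2) Z_sub])
  have DN: "D \<subseteq> N" unfolding N_def by (blast intro: generate.incl)
  interpret N: normal N G by (rule central_subgroup_normal[OF N_sub NZ])
  let ?Q = "G Mod N"
  interpret Q: Group.group ?Q by (rule N.factorgroup_is_group)
  note mult_FactGroup [simp del] one_FactGroup [simp del]
  define cs where "cs g = N #> g" for g
  have cs: "cs \<in> hom G ?Q" unfolding cs_def by (rule N.r_coset_hom_Mod)
  interpret cs: group_hom G ?Q cs using cs by unfold_locales
  have cs_iff: "cs b = \<one>\<^bsub>?Q\<^esub> \<longleftrightarrow> b \<in> N" if "b \<in> carrier G" for b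
    using coset_join1[OF _ that N_sub] coset_join2[OF that N_sub] by (auto simp: cs_def one_FactGroup)
  have "cs (Y i) [^]\<^bsub>?Q\<^esub> order (K i) = \<one>\<^bsub>?Q\<^esub>" if i: "i \<in> I" "finite (carrier (K i))" for i
  proof -
    have "Y i [^] order (K i) \<in> N"
    proof (cases "i \<in> I0")
      case True
      then show ?thesis using i(2) DN unfolding D_def by blast
    next
      case False
      then show ?thesis using Y(3)[OF i(1)] subgroup.one_closed[OF N_sub] by simp
    qed
    then show ?thesis using cs_iff[of "Y i [^] order (K i)"] cs.hom_nat_pow[OF Y(1)[OF i(1)]] Y(1)[OF i(1)] by simp
  qed
  \<comment> \<open>Modulo the relators in \<open>D\<close> the lifts satisfy the relations of the
    free product, so there is a homomorphism back.\<close>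
  then obtain \<psi> where \<psi>: "\<psi> \<in> hom FP ?Q" "\<And>i. i \<in> I \<Longrightarrow> \<psi> (fc [(i, \<kappa> i)]) = cs (Y i)"
    using cyclic_free_product_lift[OF Q.is_group \<kappa>, of "\<lambda>i. cs (Y i)"] cs.hom_closed[OF Y(1)] by blast
  have "\<psi> \<circ> \<pi> \<in> hom G ?Q" using \<pi>(1) \<psi>(1) by (rule Group.hom_compose)
  then have hom: "group_hom G ?Q (\<psi> \<circ> \<pi>)" by (intro group_hom.intro group_hom_axioms.intro is_group Q.is_group)
  have onW: "(\<psi> \<circ> \<pi>) x = cs x" if x: "x \<in> W" for x
    by (rule generate_eqI[OF hom cs.group_hom_axioms YG _ x[unfolded W_def]]) (use \<psi>(2) Y(2) in auto)
  \<comment> \<open>The projection modulo \<open>N\<close> thus factors through \<pi>, so the kernel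
    \<open>Z\<close> of \<pi> lies in \<open>N\<close>.\<close>
  have all: "(\<psi> \<circ> \<pi>) x = cs x" if x: "x \<in> carrier G" for x
  proof (rule generate_eqI[OF hom cs.group_hom_axioms S(2)])
    fix s assume s: "s \<in> S"
    note * = wG[OF s]
    have "inv (w s) \<otimes> s \<in> N" using DN s unfolding D_def by blast
    then have "cs (inv (w s) \<otimes> s) = \<one>\<^bsub>?Q\<^esub>" using cs_iff[of "inv (w s) \<otimes> s"] * by simp
    then have "inv\<^bsub>?Q\<^esub> cs (w s) \<otimes>\<^bsub>?Q\<^esub> cs s = \<one>\<^bsub>?Q\<^esub>" using * by (simp add: cs.hom_inv)
    then have "cs s = cs (w s)" using * by (metis Q.inv_equality Q.inv_inv Q.inv_closed cs.hom_closed)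
    also have "\<dots> = (\<psi> \<circ> \<pi>) s" using onW[OF *(3)] *(2) by simp
    finally show "(\<psi> \<circ> \<pi>) s = cs s" by simp
  qed (use x S(3) in simp)
  have "Z \<subseteq> N"
  proof
    fix c assume c: "c \<in> Z"
    then have cG: "c \<in> carrier G" by (rule Z_carrier)
    interpret \<psi>: group_hom FP ?Q \<psi> using \<psi>(1) by unfold_locales
    have "cs c = \<psi> \<one>\<^bsub>FP\<^esub>" using all[OF cG] ker[OF cG] c by simp
    then have "cs c = \<one>\<^bsub>?Q\<^esub>" using \<psi>.hom_one by simp
    then show "c \<in> N" using cs_iff[OF cG] by blast
  qed
  then show ?thesis using that[OF D] NZ unfolding N_def by blast
qed

text \<open>By u some nonzero power of v is central. Every g commutes with x, so some x^q g^m with m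
  > 0 is commensurable with v; since x and a power of v are central, a nonzero power of g is central
  too. Every element of the free product would then have finite order, contrary to
  \<open>infinite_order_element\<close>.\<close>

lemma center_no_mixed:
  assumes x: "x \<in> Z" "\<not> ell x" and u: "u \<in> Z" "u \<noteq> \<one>" "ell u"
  shows False
proof -
  have xG: "x \<in> carrier G" "u \<in> carrier G" using x u Z_carrier by blast+
  obtain k l :: int where kl: "k \<noteq> 0" "u [^] k = v [^] l" using u(3) by (auto simp: commensurable_def)
  have l0: "l \<noteq> 0" using kl torsion_free_int[OF tf xG(2) kl(1)] u(2) by auto
  have vlZ: "v [^] l \<in> Z" using Z_pow[OF u(1), of k] kl(2) by simp
  have tors: "\<exists>N::int. N \<noteq> 0 \<and> g [^] N \<in> Z" if g: "g \<in> carrier G" for g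
  proof -
    have gx: "g \<otimes> x = x \<otimes> g" using Z_comm[OF x(1) g] by simp
    obtain m :: nat and q :: int where m: "m > 0" "ell (x [^] q \<otimes> g [^] m)"
      using commuting[OF g xG(1) gx x(2)] by blast
    obtain a b :: int where ab: "a \<noteq> 0" "(x [^] q \<otimes> g [^] m) [^] a = v [^] b" using m(2) by (auto simp: commensurable_def)
    have c: "x [^] q \<otimes> g [^] m = g [^] m \<otimes> x [^] q" using commuting_int_pow[OF gx g xG(1), of "int m" q] by (simp add: int_pow_int)
    have "(x [^] q) [^] (a * l) \<otimes> (g [^] m) [^] (a * l) = (x [^] q \<otimes> g [^] m) [^] (a * l)"
      using int_pow_mult_distrib[OF c] xG(1) g by simp
    also have "\<dots> = (v [^] b) [^] l" using ab(2) xG(1) g by (simp add: int_pow_pow[symmetric])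
    also have "\<dots> = (v [^] l) [^] b" using v by (simp add: int_pow_pow mult.commute)
    finally have e: "(x [^] q) [^] (a * l) \<otimes> (g [^] m) [^] (a * l) = (v [^] l) [^] b" .
    define A where "A = (x [^] q) [^] (a * l)"
    define B where "B = (v [^] l) [^] b"
    have AB: "A \<in> Z" "B \<in> Z" unfolding A_def B_def using Z_pow x(1) vlZ by blast+
    have GG: "(g [^] m) [^] (a * l) \<in> carrier G" "A \<in> carrier G" "B \<in> carrier G" using g AB Z_carrier by auto
    have "(g [^] m) [^] (a * l) = inv A \<otimes> B"
      using e GG unfolding A_def[symmetric] B_def[symmetric] by (metis inv_solve_left)
    also have "\<dots> \<in> Z" using AB subgroup.m_closed[OF Z_sub] subgroup.m_inv_closed[OF Z_sub] by blast
    finally have "g [^] (int m * (a * l)) \<in> Z" using g by (simp add: int_pow_pow[symmetric] int_pow_int)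
    then show ?thesis using m(1) ab(1) l0 by (intro exI[of _ "int m * (a * l)"]) simp
  qed
  obtain p where p: "p \<in> carrier FP" "\<And>k::nat. k > 0 \<Longrightarrow> p [^]\<^bsub>FP\<^esub> k \<noteq> \<one>\<^bsub>FP\<^esub>"
    by (rule infinite_order_element[OF ij x0 y0]) (assumption | rule that)+
  obtain g where g: "g \<in> carrier G" "p = \<pi> g" using p(1) \<pi>(2) by auto
  obtain N :: int where N: "N \<noteq> 0" "g [^] N \<in> Z" using tors[OF g(1)] by blast
  have "\<pi> (g [^] N) = \<one>\<^bsub>FP\<^esub>" using ker[OF Z_carrier[OF N(2)]] N(2) by blast
  then have "p [^]\<^bsub>FP\<^esub> N = \<one>\<^bsub>FP\<^esub>" using \<pi>.hom_int_pow[OF g(1)] g(2) by simp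
  then have "int (\<pi>.H.ord p) dvd N" using \<pi>.H.int_pow_eq_id[OF p(1)] by simp
  then have "\<pi>.H.ord p > 0" using N(1) by (auto intro: Nat.gr0I)
  then show False using p(2)[of "\<pi>.H.ord p"] \<pi>.H.pow_ord_eq_1[OF p(1)] by simp
qed

text \<open>If x is not commensurable with v, \<open>commuting\<close> gives a central element x^q
  y^m commensurable with v, which is trivial by \<open>center_no_mixed\<close>. If both are
  commensurable with v, \<open>ell_common_power\<close> applies.\<close>

lemma center_commensurable:
  assumes x: "x \<in> Z" "x \<noteq> \<one>" and y: "y \<in> Z" "y \<noteq> \<one>"
  shows "\<exists>(p::int) (q::int). p \<noteq> 0 \<and> q \<noteq> 0 \<and> x [^] p = y [^] q"
proof -
  have *: "\<exists>(p::int) (q::int). p \<noteq> 0 \<and> q \<noteq> 0 \<and> x [^] p = y [^] q"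
    if x: "x \<in> Z" "x \<noteq> \<one>" "\<not> ell x" and y: "y \<in> Z" "y \<noteq> \<one>" for x y
  proof -
    have G: "x \<in> carrier G" "y \<in> carrier G" using x y Z_carrier by blast+
    obtain m :: nat and q :: int where m: "m > 0" "ell (x [^] q \<otimes> y [^] m)"
      using commuting[OF G(2,1) Z_comm[OF y(1) G(1)] x(3)] by blast
    have mZ: "x [^] q \<otimes> y [^] m \<in> Z"
      using Z_pow[OF x(1), of q] Z_pow[OF y(1), of "int m"] subgroup.m_closed[OF Z_sub] by (simp add: int_pow_int)
    have "x [^] q \<otimes> y [^] m = \<one>" using center_no_mixed[OF x(1,3) mZ _ m(2)] by blast
    then have e: "x [^] q = y [^] (- int m)" using G by (metis int_pow_closed int_pow_int int_pow_neg inv_equality inv_inv nat_pow_closed)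
    have "q \<noteq> 0"
    proof
      assume "q = 0"
      then have "y [^] (- int m) = \<one>" using e by simp
      then show False using torsion_free_int[OF tf G(2), of "- int m"] m(1) y(2) by simp
    qed
    then show ?thesis using e m(1) by (intro exI[of _ q] exI[of _ "- int m"]) simp
  qed
  show ?thesis
  proof (cases "ell x")
    case False
    then show ?thesis using * x y by blast
  next
    case xe: True
    show ?thesis
    proof (cases "ell y")
      case True
      then show ?thesis using ell_common_power[of x y] xe x y Z_carrier by blast
    next
      case False
      then obtain p q :: int where "p \<noteq> 0 \<and> q \<noteq> 0 \<and> y [^] p = x [^] q" using *[of y x] x y by blast
      then show ?thesis by (intro exI[of _ q] exI[of _ p]) simp
    qed
  qed
qed

text \<open>If the centre were trivial, \<pi> would be injective. The factors would inherit
  torsion-freeness from G, and the image of v would be a nontrivial commensurated element of the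
  free product.\<close>

lemma center_nontrivial: "Z \<noteq> {\<one>}"
proof
  assume Z: "Z = {\<one>}"
  have "commensurated FP (\<pi> v)"
    unfolding commensurated_def
  proof
    fix p assume "p \<in> carrier FP"
    then obtain g where g: "g \<in> carrier G" "p = \<pi> g" using \<pi>(2) by auto
    obtain k l :: int where kl: "k \<noteq> 0" "l \<noteq> 0" "g \<otimes> v [^] k = v [^] l \<otimes> g" using v_comm g(1) unfolding commensurated_def by blast
    have "\<pi> (g \<otimes> v [^] k) = \<pi> (v [^] l \<otimes> g)" using kl(3) by simp
    then have "p \<otimes>\<^bsub>FP\<^esub> \<pi> v [^]\<^bsub>FP\<^esub> k = \<pi> v [^]\<^bsub>FP\<^esub> l \<otimes>\<^bsub>FP\<^esub> p" using g v by (simp add: \<pi>.hom_int_pow)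
    then show "\<exists>(k::int) (l::int). k \<noteq> 0 \<and> l \<noteq> 0 \<and> p \<otimes>\<^bsub>FP\<^esub> \<pi> v [^]\<^bsub>FP\<^esub> k = \<pi> v [^]\<^bsub>FP\<^esub> l \<otimes>\<^bsub>FP\<^esub> p"
      using kl(1,2) by blast
  qed
  moreover have "\<not> commensurated FP (\<pi> v)"
  proof (rule no_commensurated[OF _ ij x0 y0])
    show "\<pi> v \<in> carrier FP" using v by simp
    show "\<pi> v \<noteq> \<one>\<^bsub>FP\<^esub>" using ker[OF v] Z v_ne by simp
    fix i g and k :: nat assume i: "i \<in> I" "g \<in> carrier (K i)" "g \<noteq> \<one>\<^bsub>K i\<^esub>" "k > 0"
    interpret Ki: Group.group "K i" using factor_group i(1) .
    show "g [^]\<^bsub>K i\<^esub> k \<noteq> \<one>\<^bsub>K i\<^esub>"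
    proof
      assume gk: "g [^]\<^bsub>K i\<^esub> k = \<one>\<^bsub>K i\<^esub>"
      have "fc [(i, g)] \<in> \<pi> ` carrier G" unfolding \<pi>(2) using i by simp
      then obtain h where h: "h \<in> carrier G" "\<pi> h = fc [(i, g)]" by auto
      have "\<pi> (h [^] k) = fc [(i, g [^]\<^bsub>K i\<^esub> k)]"
        using \<pi>.hom_nat_pow[OF h(1), of k] h(2) fgen_int_pow[OF i(1,2), of "int k"] by (simp add: int_pow_int)
      also have "\<dots> = \<one>\<^bsub>FP\<^esub>" using gk fgen_one[OF i(1)] one_free_product by simp
      finally have "h [^] k = \<one>" using ker[of "h [^] k"] h(1) Z by simp
      then have "h = \<one>" using tf h(1) i(4) by (simp add: torsion_free_def)
      then have "fc [(i, g)] = fc [(i, \<one>\<^bsub>K i\<^esub>)]" using h(2) fgen_one[OF i(1)] one_free_product by simp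
      then show False using fgen_inj[OF i(1,2)] i(3) by simp
    qed
  qed
  ultimately show False by blast
qed

lemma center_cyclic:
  obtains z where "z \<in> Z" "z \<noteq> \<one>" "Z = range (\<lambda>k::int. z [^] k)"
proof -
  obtain D where D: "finite D" "D \<subseteq> Z" "generate G D = Z" by (rule center_generated)
  have "\<exists>c\<in>Z. generate G D = range (\<lambda>k::int. c [^] k)"
    by (rule finitely_generated_commensurable_cyclic[OF tf Z_sub _ _ D(1,2)]) (use center_commensurable Z_comm Z_carrier in blast)+
  then obtain z where z: "z \<in> Z" "Z = range (\<lambda>k::int. z [^] k)" using D(3) by auto
  moreover have "z \<noteq> \<one>"
  proof
    assume "z = \<one>"
    then have "Z = {\<one>}" using z(2) by auto
    then show False using center_nontrivial by blast
  qed
  ultimately show ?thesis using that by blast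
qed

end

section \<open>Roots of the central generator and the isomorphism with \<open>hub\<close>\<close>

context gbs_quotient
begin

text \<open>Let m be the order of the factor. A lift y of its generator \<kappa> has y^m in the
  centre, so y and z have a common root a, say a^q' = y and a^p' = z with p' dividing m. As y^p' =
  z^q' is central, \<kappa>^p' = 1 and m divides p', so p' = m. The root projects to a power of
  \<kappa> that generates the factor as well, and \<kappa> is replaced by it.\<close>

lemma finite_factor_root:
  assumes z: "z \<in> Z" "Z = range (\<lambda>k::int. z [^] k)" and i: "i \<in> I0" "finite (carrier (K i))"
    and \<kappa>: "\<kappa> \<in> carrier (K i)" "carrier (K i) = range (\<lambda>k::int. \<kappa> [^]\<^bsub>K i\<^esub> k)" and y: "y \<in> carrier G" "\<pi> y = fc [(i, \<kappa>)]"
  shows "\<exists>a \<kappa>'. a \<in> carrier G \<and> \<kappa>' \<in> carrier (K i) \<and> carrier (K i) = range (\<lambda>k::int. \<kappa>' [^]\<^bsub>K i\<^esub> k) \<and>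
    \<pi> a = fc [(i, \<kappa>')] \<and> a [^] order (K i) = z"
proof -
  have iI: "i \<in> I" using i I0_sub by blast
  interpret Ki: Group.group "K i" using factor_group iI .
  define n where "n = order (K i)"
  have n0: "n > 0" unfolding n_def using Ki.order_gt_0_iff_finite i(2) by blast
  have zG: "z \<in> carrier G" using z Z_carrier by blast
  have piz: "\<pi> z = \<one>\<^bsub>FP\<^esub>" using ker[OF zG] z(1) by blast
  have "\<pi> (y [^] n) = \<one>\<^bsub>FP\<^esub>" using \<pi>.hom_nat_pow[OF y(1), of n] fgen_order[OF iI i(2) \<kappa>(1)] y(2) by (simp add: n_def)
  then have "y [^] n \<in> Z" using ker[of "y [^] n"] y(1) by simp
  then obtain e :: int where "y [^] n = z [^] e" using z(2) by auto
  then have e: "y [^] int n = z [^] e" by (simp add: int_pow_int)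
  have "int n \<noteq> 0" using n0 by simp
  obtain p' q' \<alpha> \<beta> a where a: "int n = gcd (int n) e * p'" "\<alpha> * p' + \<beta> * q' = (1::int)" "a = y [^] \<beta> \<otimes> z [^] \<alpha>"
      "a [^] q' = y" "a [^] p' = z"
    using common_root[OF tf y(1) zG Z_comm[OF z(1) y(1), symmetric] \<open>int n \<noteq> 0\<close> e] by (elim exE conjE) (rule that)
  have aG: "a \<in> carrier G" using a(3) y(1) zG by simp
  have p'0: "p' > 0"
  proof (rule ccontr)
    assume "\<not> p' > 0"
    then have "gcd (int n) e * p' \<le> 0" by (intro mult_nonneg_nonpos) simp_all
    then show False using a(1) n0 by simp
  qed
  \<comment> \<open>Since z dies under \<pi>, only the factor y^\<beta> of a contributes.\<close>
  define k' where "k' = \<kappa> [^]\<^bsub>K i\<^esub> \<beta>"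
  have k'c: "k' \<in> carrier (K i)" using \<kappa>(1) by (simp add: k'_def)
  have pia: "\<pi> a = fc [(i, k')]"
  proof -
    have "\<pi> a = \<pi> y [^]\<^bsub>FP\<^esub> \<beta> \<otimes>\<^bsub>FP\<^esub> \<pi> z [^]\<^bsub>FP\<^esub> \<alpha>" unfolding a(3) using y(1) zG by (simp add: \<pi>.hom_int_pow)
    also have "\<dots> = fc [(i, \<kappa>)] [^]\<^bsub>FP\<^esub> \<beta>" unfolding piz y(2) using iI \<kappa>(1) by simp
    also have "\<dots> = fc [(i, k')]" unfolding k'_def by (rule fgen_int_pow[OF iI \<kappa>(1), symmetric])
    finally show ?thesis .
  qed
  have "fc [(i, \<kappa> [^]\<^bsub>K i\<^esub> p')] = \<one>\<^bsub>FP\<^esub>"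
  proof -
    have "fc [(i, \<kappa> [^]\<^bsub>K i\<^esub> p')] = \<pi> (y [^] p')" using fgen_int_pow[OF iI \<kappa>(1)] \<pi>.hom_int_pow[OF y(1)] y(2) by simp
    also have "y [^] p' = (a [^] q') [^] p'" using a(4) by simp
    also have "\<dots> = (a [^] p') [^] q'" using aG by (simp add: int_pow_pow mult.commute)
    also have "\<dots> = z [^] q'" using a(5) by simp
    finally show ?thesis using ker[of "z [^] q'"] Z_pow[OF z(1)] zG by simp
  qed
  then have "fc [(i, \<kappa> [^]\<^bsub>K i\<^esub> p')] = fc [(i, \<one>\<^bsub>K i\<^esub>)]" using fgen_one[OF iI] one_free_product by simp
  then have kp: "\<kappa> [^]\<^bsub>K i\<^esub> p' = \<one>\<^bsub>K i\<^esub>" using fgen_inj[OF iI] \<kappa>(1) by simp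
  have ordk: "Ki.ord \<kappa> = n" unfolding n_def by (rule Ki.cyclic_order[OF \<kappa>])
  have "int n dvd p'" using kp Ki.int_pow_eq_id[OF \<kappa>(1)] ordk by simp
  moreover have "p' dvd int n" using a(1) by (metis dvd_triv_right)
  ultimately have p'n: "p' = int n" using p'0 n0 by (simp add: zdvd_antisym_nonneg)
  \<comment> \<open>The new element generates the factor: \<beta> q' is 1 modulo p', and \<kappa>^p'
    = 1.\<close>
  have "k' [^]\<^bsub>K i\<^esub> q' = \<kappa>"
  proof -
    have "\<beta> * q' = 1 + p' * (- \<alpha>)" using a(2) by (simp add: algebra_simps)
    then have "k' [^]\<^bsub>K i\<^esub> q' = \<kappa> [^]\<^bsub>K i\<^esub> (1 + p' * (- \<alpha>))" unfolding k'_def Ki.int_pow_pow[OF \<kappa>(1)] by simp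
    also have "\<dots> = \<kappa> [^]\<^bsub>K i\<^esub> (1::int) \<otimes>\<^bsub>K i\<^esub> (\<kappa> [^]\<^bsub>K i\<^esub> p') [^]\<^bsub>K i\<^esub> (- \<alpha>)"
      unfolding Ki.int_pow_pow[OF \<kappa>(1)] by (rule Ki.int_pow_mult[OF \<kappa>(1)])
    also have "\<dots> = \<kappa>" unfolding kp using \<kappa>(1) by simp
    finally show ?thesis .
  qed
  then have pw: "\<kappa> [^]\<^bsub>K i\<^esub> k = k' [^]\<^bsub>K i\<^esub> (q' * k)" for k :: int using Ki.int_pow_pow[OF k'c, of q' k] by simp
  have "carrier (K i) \<subseteq> range (\<lambda>k::int. k' [^]\<^bsub>K i\<^esub> k)" unfolding \<kappa>(2) using pw by (simp add: image_subset_iff)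
  moreover have "range (\<lambda>k::int. k' [^]\<^bsub>K i\<^esub> k) \<subseteq> carrier (K i)" using Ki.int_pow_closed[OF k'c] by blast
  ultimately have "carrier (K i) = range (\<lambda>k::int. k' [^]\<^bsub>K i\<^esub> k)" by (rule subset_antisym)
  moreover have "a [^] order (K i) = z" using a(5) p'n n_def int_pow_int by metis
  ultimately show ?thesis using aG k'c pia by blast
qed

lemma adapted_generators:
  assumes z: "z \<in> Z" "Z = range (\<lambda>k::int. z [^] k)"
  obtains \<kappa> a where "\<And>i. i \<in> I \<Longrightarrow> \<kappa> i \<in> carrier (K i)" "\<And>i. i \<in> I \<Longrightarrow> carrier (K i) = range (\<lambda>k::int. \<kappa> i [^]\<^bsub>K i\<^esub> k)"
    "\<And>i. i \<in> I \<Longrightarrow> a i \<in> carrier G" "\<And>i. i \<in> I \<Longrightarrow> \<pi> (a i) = fc [(i, \<kappa> i)]"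
    "\<And>i. i \<in> I0 \<Longrightarrow> finite (carrier (K i)) \<Longrightarrow> a i [^] order (K i) = z"
proof -
  obtain \<kappa> Y where \<kappa>: "\<And>i. i \<in> I \<Longrightarrow> \<kappa> i \<in> carrier (K i)" "\<And>i. i \<in> I \<Longrightarrow> carrier (K i) = range (\<lambda>k::int. \<kappa> i [^]\<^bsub>K i\<^esub> k)"
    and Y: "\<And>i. i \<in> I \<Longrightarrow> Y i \<in> carrier G" "\<And>i. i \<in> I \<Longrightarrow> \<pi> (Y i) = fc [(i, \<kappa> i)]" "\<And>i. i \<in> I \<Longrightarrow> i \<notin> I0 \<Longrightarrow> Y i = \<one>"
    by (rule generators) (assumption | rule that)+
  have "\<forall>i\<in>I. \<exists>p. snd p \<in> carrier G \<and> fst p \<in> carrier (K i) \<and> carrier (K i) = range (\<lambda>k::int. fst p [^]\<^bsub>K i\<^esub> k) \<and>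
     \<pi> (snd p) = fc [(i, fst p)] \<and> (i \<in> I0 \<longrightarrow> finite (carrier (K i)) \<longrightarrow> snd p [^] order (K i) = z)"
  proof
    fix i assume i: "i \<in> I"
    show "\<exists>p. snd p \<in> carrier G \<and> fst p \<in> carrier (K i) \<and> carrier (K i) = range (\<lambda>k::int. fst p [^]\<^bsub>K i\<^esub> k) \<and>
     \<pi> (snd p) = fc [(i, fst p)] \<and> (i \<in> I0 \<longrightarrow> finite (carrier (K i)) \<longrightarrow> snd p [^] order (K i) = z)"
    proof (cases "i \<in> I0 \<and> finite (carrier (K i))")
      case True
      then obtain a k where "a \<in> carrier G" "k \<in> carrier (K i)" "carrier (K i) = range (\<lambda>n::int. k [^]\<^bsub>K i\<^esub> n)"
          "\<pi> a = fc [(i, k)]" "a [^] order (K i) = z"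
        using finite_factor_root[OF z _ _ \<kappa>(1,2)[OF i] Y(1,2)[OF i]] by (elim conjE) blast
      then show ?thesis by (intro exI[of _ "(k, a)"] conjI impI) (simp_all only: fst_conv snd_conv)
    next
      case False
      show ?thesis by (intro exI[of _ "(\<kappa> i, Y i)"] conjI impI) (use False \<kappa>[OF i] Y[OF i] in \<open>simp_all only: fst_conv snd_conv, blast\<close>)
    qed
  qed
  from bchoice[OF this] obtain p where p: "\<forall>i\<in>I. snd (p i) \<in> carrier G \<and> fst (p i) \<in> carrier (K i) \<and>
     carrier (K i) = range (\<lambda>k::int. fst (p i) [^]\<^bsub>K i\<^esub> k) \<and>
     \<pi> (snd (p i)) = fc [(i, fst (p i))] \<and> (i \<in> I0 \<longrightarrow> finite (carrier (K i)) \<longrightarrow> snd (p i) [^] order (K i) = z)" ..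
  show ?thesis
    by (rule that[of "\<lambda>i. fst (p i)" "\<lambda>i. snd (p i)"]) (use p I0_sub in blast)+
qed

text \<open>Nontrivial finite factors give roots of z, infinite ones give stable letters. The map
  \<theta> from \<open>hub\<close> to G is injective because \<psi>, \<pi> and \<theta> compose to
  the projection modulo z: its kernel consists of powers of z, and z has infinite order in G. It is
  onto because its image contains the centre and maps onto the free product.\<close>

lemma iso_hub:
  assumes n: "n > 0" "\<And>i. i \<in> I \<Longrightarrow> finite (carrier (K i)) \<Longrightarrow> order (K i) dvd n"
  shows "\<exists>I' \<nu> J b. G \<cong> hub I' \<nu> J \<and> finite I' \<and> finite J \<and> b \<in> I' \<and> (\<forall>j\<in>J. j mod 4 = 2) \<and>
    (\<forall>i\<in>I'. \<nu> i dvd n) \<and> (\<forall>i\<in>I'. I' \<noteq> {b} \<longrightarrow> \<nu> i \<ge> 2)"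
proof -
  obtain z where z: "z \<in> Z" "z \<noteq> \<one>" "Z = range (\<lambda>k::int. z [^] k)" by (rule center_cyclic)
  have zG: "z \<in> carrier G" using z Z_carrier by blast
  have piz: "\<pi> z = \<one>\<^bsub>FP\<^esub>" using ker[OF zG] z(1) by blast
  obtain \<kappa> a where \<kappa>: "\<And>i. i \<in> I \<Longrightarrow> \<kappa> i \<in> carrier (K i)" "\<And>i. i \<in> I \<Longrightarrow> carrier (K i) = range (\<lambda>k::int. \<kappa> i [^]\<^bsub>K i\<^esub> k)"
    and a: "\<And>i. i \<in> I \<Longrightarrow> a i \<in> carrier G" "\<And>i. i \<in> I \<Longrightarrow> \<pi> (a i) = fc [(i, \<kappa> i)]"
    "\<And>i. i \<in> I0 \<Longrightarrow> finite (carrier (K i)) \<Longrightarrow> a i [^] order (K i) = z"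
    by (rule adapted_generators[OF z(1,3)]) (assumption | rule that)+
  define If where "If = {i \<in> I0. finite (carrier (K i))}"
  define Jf where "Jf = {i \<in> I0. infinite (carrier (K i))}"
  \<comment> \<open>The star needs a centre: without finite nontrivial factors, a single vertex 0
    with exponent 1 and root z is used.\<close>
  define I' where "I' = (if If = {} then {0} else If)"
  define \<nu> where "\<nu> i = (if If = {} then Suc 0 else order (K i))" for i
  define A where "A i = (if If = {} then z else a i)" for i
  \<comment> \<open>The indices of the infinite factors are coded as loops of the star, which must
    be congruent to 2 modulo 4; \<open>T\<close> undoes the coding.\<close>
  define J where "J = (\<lambda>i. 4 * i + 2) ` Jf"
  define T where "T j = a ((j - 2) div 4)" for j
  have J_cases: "\<exists>i\<in>Jf. j = 4 * i + 2 \<and> T j = a i" if "j \<in> J" for j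
    using that by (auto simp: J_def T_def)
  have fin: "finite I'" "finite J" using finite_I0 by (simp_all add: I'_def J_def If_def Jf_def)
  have IfI: "If \<subseteq> I" and JfI: "Jf \<subseteq> I" using I0_sub by (auto simp: If_def Jf_def)
  have I': "A i = z \<and> \<nu> i = Suc 0 \<or> i \<in> If \<and> A i = a i \<and> \<nu> i = order (K i)" if "i \<in> I'" for i
    using that by (auto simp: I'_def \<nu>_def A_def split: if_splits)
  have If: "i \<in> I' \<and> A i = a i \<and> \<nu> i = order (K i)" if "i \<in> If" for i
    using that by (auto simp: I'_def \<nu>_def A_def)
  have A: "A i \<in> carrier G" "A i [^] \<nu> i = z" if "i \<in> I'" for i
    using I'[OF that] a(1,3) zG IfI by (auto simp: If_def)
  have T: "T j \<in> carrier G" if "j \<in> J" for j using J_cases[OF that] a(1) JfI by auto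
  let ?H = "hub I' \<nu> J"
  let ?g = "hgen I' \<nu> J"
  interpret H: Group.group ?H by (rule group_hub)
  have zA: "\<And>i. i \<in> I' \<Longrightarrow> z \<otimes> A i = A i \<otimes> z" using Z_comm[OF z(1)] A by blast
  have zT: "\<And>j. j \<in> J \<Longrightarrow> z \<otimes> T j = T j \<otimes> z" using Z_comm[OF z(1)] T by blast
  obtain \<theta> where \<theta>: "\<theta> \<in> hom ?H G" "\<theta> (?g HZ) = z" "\<And>i. i \<in> I' \<Longrightarrow> \<theta> (?g (HA i)) = A i" "\<And>j. j \<in> J \<Longrightarrow> \<theta> (?g (HT j)) = T j"
    by (rule hub_lift[OF is_group zG A(1) T zA zT A(2)]) (assumption | rule that)+
  interpret \<theta>: group_hom ?H G \<theta> using \<theta>(1) by unfold_locales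
  have gZ: "?g HZ \<in> carrier ?H" by simp
  define N where "N = range (\<lambda>k::int. ?g HZ [^]\<^bsub>?H\<^esub> k)"
  have N_sub: "subgroup N ?H" unfolding N_def by (rule H.subgroup_of_powers[OF gZ])
  have "N \<subseteq> group_center ?H"
  proof
    fix x assume "x \<in> N"
    then obtain k :: int where x: "x = ?g HZ [^]\<^bsub>?H\<^esub> k" by (auto simp: N_def)
    have "x \<otimes>\<^bsub>?H\<^esub> p = p \<otimes>\<^bsub>?H\<^esub> x" if p: "p \<in> carrier ?H" for p
      using H.commuting_int_pow[OF hub_central[OF p] gZ p, of k 1] p x by simp
    then show "x \<in> group_center ?H" using x gZ by (simp add: group_center_def)
  qed
  then interpret N: normal N ?H using H.central_subgroup_normal[OF N_sub] by blast
  let ?Q = "?H Mod N"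
  interpret Q: Group.group ?Q by (rule N.factorgroup_is_group)
  note mult_FactGroup [simp del] one_FactGroup [simp del]
  define cs where "cs g = N #>\<^bsub>?H\<^esub> g" for g
  have cs: "cs \<in> hom ?H ?Q" unfolding cs_def by (rule N.r_coset_hom_Mod)
  interpret cs: group_hom ?H ?Q cs using cs by unfold_locales
  have cs_iff: "cs b = \<one>\<^bsub>?Q\<^esub> \<longleftrightarrow> b \<in> N" if "b \<in> carrier ?H" for b
    using H.coset_join1[OF _ that N_sub] H.coset_join2[OF that N_sub] by (auto simp: cs_def one_FactGroup)
  have csZ: "cs (?g HZ) = \<one>\<^bsub>?Q\<^esub>"
  proof -
    have "?g HZ \<in> N" unfolding N_def by (rule range_eqI[of _ _ 1]) simp
    then show ?thesis using cs_iff[OF gZ] by blast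
  qed
  \<comment> \<open>Images of the factor generators in \<open>hub\<close> modulo z; a trivial factor
    goes to the identity.\<close>
  define q where "q i = (if i \<in> If then cs (?g (HA i)) else if i \<in> Jf then cs (?g (HT (4 * i + 2))) else \<one>\<^bsub>?Q\<^esub>)" for i
  have JfJ: "4 * i + 2 \<in> J" if "i \<in> Jf" for i using that by (simp add: J_def)
  have q1: "q i \<in> carrier ?Q" for i
  proof -
    have "cs (?g (HA i)) \<in> carrier ?Q" if "i \<in> If" using If[OF that] by simp
    moreover have "cs (?g (HT (4 * i + 2))) \<in> carrier ?Q" if "i \<in> Jf" using JfJ[OF that] hgen_closed cs.hom_closed hub_gens_simps(3) by blast
    ultimately show ?thesis by (simp add: q_def)
  qed
  have csA: "cs (?g (HA i)) [^]\<^bsub>?Q\<^esub> \<nu> i = \<one>\<^bsub>?Q\<^esub>" if "i \<in> I'" for i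
    using cs.hom_nat_pow[of "?g (HA i)" "\<nu> i"] hub_pow[OF that, of \<nu> J] csZ that by simp
  have q2: "q i [^]\<^bsub>?Q\<^esub> order (K i) = \<one>\<^bsub>?Q\<^esub>" if i: "i \<in> I" "finite (carrier (K i))" for i
  proof (cases "i \<in> If")
    case True
    then show ?thesis using csA[of i] If[OF True] by (simp add: q_def)
  next
    case False
    then have "q i = \<one>\<^bsub>?Q\<^esub>" using i by (simp add: q_def Jf_def)
    then show ?thesis by simp
  qed
  obtain \<psi> where \<psi>: "\<psi> \<in> hom FP ?Q" "\<And>i. i \<in> I \<Longrightarrow> \<psi> (fc [(i, \<kappa> i)]) = q i"
    by (rule cyclic_free_product_lift[OF Q.is_group \<kappa> q1 q2]) (assumption | rule that)+
  interpret \<psi>: group_hom FP ?Q \<psi> using \<psi>(1) by unfold_locales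
  have \<psi>z: "\<psi> (\<pi> z) = \<one>\<^bsub>?Q\<^esub>" unfolding piz by simp
  have \<psi>\<theta>: "(\<psi> \<circ> (\<pi> \<circ> \<theta>)) p = cs p" if p: "p \<in> carrier ?H" for p
  proof (rule hub_hom_eq[OF Q.is_group _ cs _ _ _ p])
    show "\<psi> \<circ> (\<pi> \<circ> \<theta>) \<in> hom ?H ?Q" by (rule Group.hom_compose[OF Group.hom_compose[OF \<theta>(1) \<pi>(1)] \<psi>(1)])
    show "(\<psi> \<circ> (\<pi> \<circ> \<theta>)) (?g HZ) = cs (?g HZ)" using \<theta>(2) \<psi>z csZ by simp
  next
    fix i assume i: "i \<in> I'"
    from I'[OF i] show "(\<psi> \<circ> (\<pi> \<circ> \<theta>)) (?g (HA i)) = cs (?g (HA i))"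
    proof (elim disjE conjE)
      assume "A i = z" "\<nu> i = Suc 0"
      then show ?thesis using csA[OF i] \<theta>(3)[OF i] \<psi>z i by simp
    next
      assume "i \<in> If" "A i = a i"
      then show ?thesis using \<theta>(3)[OF i] a(2)[of i] \<psi>(2)[of i] IfI by (auto simp: q_def)
    qed
  next
    fix j assume j: "j \<in> J"
    then obtain i where i: "i \<in> Jf" "j = 4 * i + 2" "T j = a i" using J_cases by blast
    moreover have "i \<notin> If" using i(1) by (simp add: If_def Jf_def)
    ultimately have "q i = cs (?g (HT j))" by (simp add: q_def)
    moreover have "i \<in> I" using i(1) JfI by blast
    ultimately show "(\<psi> \<circ> (\<pi> \<circ> \<theta>)) (?g (HT j)) = cs (?g (HT j))"
      using \<theta>(4)[OF j] i(3) a(2) \<psi>(2) by simp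
  qed
  have "kernel ?H G \<theta> = {\<one>\<^bsub>?H\<^esub>}"
  proof
    show "kernel ?H G \<theta> \<subseteq> {\<one>\<^bsub>?H\<^esub>}"
    proof
      fix p assume "p \<in> kernel ?H G \<theta>"
      then have p: "p \<in> carrier ?H" "\<theta> p = \<one>" by (auto simp: kernel_def)
      have "cs p = \<one>\<^bsub>?Q\<^esub>" using \<psi>\<theta>[OF p(1)] p(2) by simp
      then have "p \<in> N" using cs_iff[OF p(1)] by blast
      then obtain k :: int where k: "p = ?g HZ [^]\<^bsub>?H\<^esub> k" by (auto simp: N_def)
      have "z [^] k = \<one>" using p(2) k \<theta>.hom_int_pow[OF gZ, of k] \<theta>(2) by simp
      then have "k = 0" using torsion_free_int[OF tf zG, of k] z(2) by blast
      then show "p \<in> {\<one>\<^bsub>?H\<^esub>}" using k by simp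
    qed
  qed (simp add: kernel_def)
  moreover have "\<theta> ` carrier ?H = carrier G"
  proof
    define M where "M = \<theta> ` carrier ?H"
    have M: "subgroup M G" unfolding M_def by (rule \<theta>.img_is_subgroup)
    have zM: "z \<in> M" unfolding M_def using \<theta>(2) gZ by (metis imageI)
    have ZM: "Z \<subseteq> M" unfolding z(3) using subgroup_int_pow_closed[OF M zM] by blast
    have "subgroup (\<pi> ` M) FP" by (rule \<pi>.subgroup_img_is_subgroup[OF M])
    moreover have "fc [(i, \<kappa> i)] \<in> \<pi> ` M" if i: "i \<in> I" for i
    proof -
      consider "i \<in> If" | "i \<in> Jf" | "i \<notin> I0" by (auto simp: If_def Jf_def)
      then show ?thesis
      proof cases
        case 1
        then have "a i \<in> M" unfolding M_def using \<theta>(3)[of i] If[OF 1] by (metis hgen_closed hub_gens_simps(2) imageI)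
        then show ?thesis using a(2)[OF i] by (metis imageI)
      next
        case 2
        have "T (4 * i + 2) = a i" by (simp add: T_def)
        then have "a i \<in> M" unfolding M_def using \<theta>(4)[OF JfJ[OF 2]] JfJ[OF 2] by (metis hgen_closed hub_gens_simps(3) imageI)
        then show ?thesis using a(2)[OF i] by (metis imageI)
      next
        case 3
        then have "\<kappa> i = \<one>\<^bsub>K i\<^esub>" using i \<kappa>(1) by (auto simp: I0_def)
        then have "fc [(i, \<kappa> i)] = \<pi> \<one>" using fgen_one[OF i] one_free_product by simp
        then show ?thesis using subgroup.one_closed[OF M] by blast
      qed
    qed
    ultimately have FPM: "carrier FP \<subseteq> \<pi> ` M" using subgroup_all[OF _ \<kappa>] by blast
    have "carrier G \<subseteq> M"
    proof
      fix g assume g: "g \<in> carrier G"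
      then have "\<pi> g \<in> \<pi> ` M" using FPM by auto
      then obtain m where m: "m \<in> M" "\<pi> g = \<pi> m" by blast
      have mG: "m \<in> carrier G" using m(1) subgroup.subset[OF M] by blast
      have mem: "inv m \<otimes> g \<in> carrier G" using g mG by simp
      have "\<pi> (inv m \<otimes> g) = \<one>\<^bsub>FP\<^esub>" using g mG m(2) by (simp add: \<pi>.hom_inv)
      then have "inv m \<otimes> g \<in> M" using ker[OF mem] ZM by blast
      then have "m \<otimes> (inv m \<otimes> g) \<in> M" using subgroup.m_closed[OF M m(1)] by blast
      then show "g \<in> M" using g mG by (simp add: m_assoc[symmetric])
    qed
    then show "carrier G \<subseteq> \<theta> ` carrier ?H" unfolding M_def .
  qed auto
  ultimately have "\<theta> \<in> iso ?H G" unfolding iso_kernel_image[OF group_hub is_group] using \<theta>(1) by (intro conjI)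
  then have "?H \<cong> G" unfolding is_iso_def by blast
  then have iso: "G \<cong> ?H" by (rule H.iso_sym)
  obtain b where b: "b \<in> I'" "If = {} \<Longrightarrow> b = 0" by (cases "If = {}") (auto simp: I'_def)
  have d: "\<forall>i\<in>I'. \<nu> i dvd n"
    using n(2) IfI I' by (metis (no_types, lifting) If_def One_nat_def mem_Collect_eq one_dvd subsetD)
  \<comment> \<open>If \<open>I'\<close> has more than one vertex, all of them come from nontrivial
    finite factors, whose order is at least 2.\<close>
  have two: "\<nu> i \<ge> 2" if i: "i \<in> I'" "I' \<noteq> {b}" for i
  proof -
    have "If \<noteq> {}" using i(2) b(2) by (auto simp: I'_def)
    then have "i \<in> If" "\<nu> i = order (K i)" using i(1) by (auto simp: I'_def \<nu>_def)
    then have i': "i \<in> I" "finite (carrier (K i))" "\<exists>x\<in>carrier (K i). x \<noteq> \<one>\<^bsub>K i\<^esub>" by (auto simp: If_def I0_def)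
    interpret Ki: Group.group "K i" using factor_group i'(1) .
    obtain x where x: "x \<in> carrier (K i)" "x \<noteq> \<one>\<^bsub>K i\<^esub>" using i'(3) by blast
    have "card {\<one>\<^bsub>K i\<^esub>, x} \<le> card (carrier (K i))" by (rule card_mono) (use i'(2) x in auto)
    then show ?thesis using x \<open>\<nu> i = order (K i)\<close> by (simp add: order_def)
  qed
  have J4: "\<forall>j\<in>J. j mod 4 = 2" unfolding J_def by (intro ballI, elim imageE) presburger
  show ?thesis using iso fin b(1) J4 d two by (intro exI[of _ I'] exI[of _ \<nu>] exI[of _ J] exI[of _ b] conjI ballI impI) simp_all
qed

end

text \<open>With two nontrivial factors the analysis of the centre applies. With at most one, G
  modulo its centre is cyclic, so G is abelian, and since it is not cyclic it has rank 2. The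
  conditions on \<open>I'\<close>, \<open>J\<close> and b are those under which a star with reduced
  labels exists.\<close>

lemma free_product_quotient_imp_hub:
  fixes G :: "('a, 'b) monoid_scheme" and K :: "nat \<Rightarrow> int monoid"
  assumes gbs: "gbs_group TYPE('v) TYPE('e) G" and nc: "\<not> cyclic_group G" and n: "n > 0"
    and K: "\<forall>i\<in>I. group (K i) \<and> cyclic_group (K i) \<and> (finite (carrier (K i)) \<longrightarrow> order (K i) dvd n)"
    and iso: "G Mod group_center G \<cong> free_product I K"
  shows "\<exists>I' \<nu> J b. G \<cong> hub I' \<nu> J \<and> finite I' \<and> finite J \<and> b \<in> I' \<and> (\<forall>j\<in>J. j mod 4 = 2) \<and>
    (\<forall>i\<in>I'. \<nu> i dvd n) \<and> (\<forall>i\<in>I'. I' \<noteq> {b} \<longrightarrow> \<nu> i \<ge> 2)"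
proof -
  interpret G: Group.group G using gbs by (simp add: gbs_group_def)
  interpret free_prod I K by (rule free_prod.intro) (use K in blast)
  obtain v where v: "v \<in> carrier G" "\<And>n::int. v [^]\<^bsub>G\<^esub> n = \<one>\<^bsub>G\<^esub> \<Longrightarrow> n = 0" "commensurated G v"
    "\<And>g n. g \<in> carrier G \<Longrightarrow> n > (0::nat) \<Longrightarrow> g [^]\<^bsub>G\<^esub> n = \<one>\<^bsub>G\<^esub> \<Longrightarrow> g = \<one>\<^bsub>G\<^esub>"
    "\<And>g w. g \<in> carrier G \<Longrightarrow> w \<in> carrier G \<Longrightarrow> g \<otimes>\<^bsub>G\<^esub> w = w \<otimes>\<^bsub>G\<^esub> g \<Longrightarrow> \<not> commensurable G v w \<Longrightarrow>
       \<exists>m>(0::nat). \<exists>q::int. commensurable G v (w [^]\<^bsub>G\<^esub> q \<otimes>\<^bsub>G\<^esub> g [^]\<^bsub>G\<^esub> m)"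
    by (rule gbs_group_algebraic[OF gbs]) (assumption | rule that)+
  have data: "gbs_data G v"
  proof (intro gbs_data.intro gbs_data_axioms.intro G.is_group v(1) v(3))
    show "G.torsion_free" unfolding G.torsion_free_def using v(4) by blast
    show "finitely_generated G" using gbs by (simp add: gbs_group_def)
  qed (use v(2,5) in blast)+
  interpret Z: normal "group_center G" G by (rule G.central_subgroup_normal[OF G.subgroup_center]) simp
  obtain \<iota> where \<iota>: "\<iota> \<in> Group.iso (G Mod group_center G) FP" using iso by (auto simp: is_iso_def)
  define \<pi> where "\<pi> = \<iota> \<circ> (\<lambda>g. group_center G #>\<^bsub>G\<^esub> g)"
  have \<iota>_hom: "\<iota> \<in> hom (G Mod group_center G) FP" and \<iota>_bij: "bij_betw \<iota> (carrier (G Mod group_center G)) (carrier FP)"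
    using \<iota> by (auto simp: Group.iso_def)
  have \<pi>: "\<pi> \<in> hom G FP" unfolding \<pi>_def by (rule Group.hom_compose[OF Z.r_coset_hom_Mod \<iota>_hom])
  have carr: "carrier (G Mod group_center G) = (\<lambda>g. group_center G #>\<^bsub>G\<^esub> g) ` carrier G" by (simp add: carrier_FactGroup)
  have surj: "\<pi> ` carrier G = carrier FP"
    using \<iota>_bij unfolding \<pi>_def image_comp[symmetric] carr[symmetric] by (rule bij_betw_imp_surj_on)
  interpret \<iota>: group_hom "G Mod group_center G" FP \<iota>
    using \<iota>_hom by (intro group_hom.intro group_hom_axioms.intro Z.factorgroup_is_group group_FP)
  have ker: "\<pi> x = \<one>\<^bsub>FP\<^esub> \<longleftrightarrow> x \<in> group_center G" if x: "x \<in> carrier G" for x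
  proof -
    have mem: "group_center G #>\<^bsub>G\<^esub> x \<in> carrier (G Mod group_center G)" unfolding carr using x by blast
    have "\<pi> x = \<one>\<^bsub>FP\<^esub> \<longleftrightarrow> group_center G #>\<^bsub>G\<^esub> x = \<one>\<^bsub>G Mod group_center G\<^esub>"
      using inj_on_eq_iff[OF bij_betw_imp_inj_on[OF \<iota>_bij] mem \<iota>.G.one_closed] \<iota>.hom_one by (simp add: \<pi>_def)
    also have "\<dots> \<longleftrightarrow> x \<in> group_center G"
      using G.coset_join1[OF _ x G.subgroup_center] G.coset_join2[OF x G.subgroup_center] by (auto simp: one_FactGroup)
    finally show ?thesis .
  qed
  show ?thesis
  proof (cases "\<exists>i0 j0 x0 y0. i0 \<in> I \<and> j0 \<in> I \<and> i0 \<noteq> j0 \<and> x0 \<in> carrier (K i0) \<and> x0 \<noteq> \<one>\<^bsub>K i0\<^esub> \<and> y0 \<in> carrier (K j0) \<and> y0 \<noteq> \<one>\<^bsub>K j0\<^esub>")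
    case True
    then obtain i0 j0 x0 y0 where ij: "i0 \<in> I" "j0 \<in> I" "i0 \<noteq> j0" "x0 \<in> carrier (K i0)" "x0 \<noteq> \<one>\<^bsub>K i0\<^esub>" "y0 \<in> carrier (K j0)" "y0 \<noteq> \<one>\<^bsub>K j0\<^esub>"
      by (elim exE conjE) (rule that)
    have "gbs_quotient G v I K \<pi> i0 j0 x0 y0"
      by (intro gbs_quotient.intro gbs_quotient_axioms.intro data free_prod_axioms \<pi> surj ker ij) (use K in blast)
    then show ?thesis by (rule gbs_quotient.iso_hub[OF _ n]) (use K in blast)
  next
    case False
    have "\<exists>e\<in>carrier FP. \<forall>p\<in>carrier FP. \<exists>j::int. p = e [^]\<^bsub>FP\<^esub> j"
      by (rule cyclic_of_one_factor) (use K False in blast)+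
    then obtain e where e: "e \<in> carrier FP" "\<And>p. p \<in> carrier FP \<Longrightarrow> \<exists>j::int. p = e [^]\<^bsub>FP\<^esub> j" by blast
    have "\<exists>w\<in>carrier G. \<pi> w = e" using e(1) surj by (metis imageE)
    then have "x \<otimes>\<^bsub>G\<^esub> y = y \<otimes>\<^bsub>G\<^esub> x" if "x \<in> carrier G" "y \<in> carrier G" for x y
      by (rule commutative_of_cyclic_central_quotient[OF G.is_group group_FP \<pi> e(1) _ e(2) _ that]) (use ker in blast)+
    then have "G \<cong> hub {0} (\<lambda>_. Suc 0) {2}" by (rule gbs_data.abelian_case[OF data _ nc])
    then show ?thesis by (intro exI[of _ "{0}"] exI[of _ "\<lambda>_. Suc 0"] exI[of _ "{2}"] exI[of _ 0]) simp
  qed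
qed

theorem theorem8p1:
  fixes G :: "('a, 'b) monoid_scheme" and n :: nat
  assumes "gbs_group TYPE('v) TYPE('e) G"
    and "\<not> cyclic_group G"
    and "n \<ge> 2"
  shows "(mon G (BS n n) \<noteq> {} \<longleftrightarrow>
            (\<exists>(I :: nat set) (K :: nat \<Rightarrow> int monoid).
               (\<forall>i \<in> I. group (K i) \<and> cyclic_group (K i) \<and>
                        (finite (carrier (K i)) \<longrightarrow> order (K i) dvd n)) \<and>
               G Mod group_center G \<cong> free_product I K)) \<and>
         (mon G (BS n n) \<noteq> {} \<longleftrightarrow>
            (\<exists>(\<Gamma> :: (nat, nat) pre_digraph) arev lab.
               labelled_graph \<Gamma> arev lab \<and> reduced_labelled_graph \<Gamma> lab \<and>
               represents \<Gamma> arev lab G \<and>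
               (\<forall>e \<in> arcs \<Gamma>. \<forall>f \<in> arcs \<Gamma>. tail \<Gamma> e = tail \<Gamma> f \<longrightarrow> lab e = lab f) \<and>
               (\<forall>e \<in> arcs \<Gamma>. lab e dvd int n)))"
proof -
  let ?two = "\<exists>(I :: nat set) (K :: nat \<Rightarrow> int monoid).
               (\<forall>i \<in> I. group (K i) \<and> cyclic_group (K i) \<and>
                        (finite (carrier (K i)) \<longrightarrow> order (K i) dvd n)) \<and>
               G Mod group_center G \<cong> free_product I K"
  let ?three = "\<exists>(\<Gamma> :: (nat, nat) pre_digraph) arev lab.
               labelled_graph \<Gamma> arev lab \<and> reduced_labelled_graph \<Gamma> lab \<and>
               represents \<Gamma> arev lab G \<and>
               (\<forall>e \<in> arcs \<Gamma>. \<forall>f \<in> arcs \<Gamma>. tail \<Gamma> e = tail \<Gamma> f \<longrightarrow> lab e = lab f) \<and>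
               (\<forall>e \<in> arcs \<Gamma>. lab e dvd int n)"
  have G: "group G" using assms(1) by (simp add: gbs_group_def)
  have n: "n > 0" using assms(3) by simp
  have 12: "?two" if "mon G (BS n n) \<noteq> {}"
  proof -
    obtain f where "f \<in> mon G (BS n n)" using \<open>mon G (BS n n) \<noteq> {}\<close> by blast
    then show ?thesis using embeds_BS_imp_free_product[OF G _ n] by blast
  qed
  have hub: "\<exists>I' \<nu> J b. G \<cong> hub I' \<nu> J \<and> finite I' \<and> finite J \<and> b \<in> I' \<and> (\<forall>j\<in>J. j mod 4 = 2) \<and>
    (\<forall>i\<in>I'. \<nu> i dvd n) \<and> (\<forall>i\<in>I'. I' \<noteq> {b} \<longrightarrow> \<nu> i \<ge> 2)" if two: "?two"
    using two by (elim exE conjE) (rule free_product_quotient_imp_hub[OF assms(1,2) n])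
  have 21: "mon G (BS n n) \<noteq> {}" if two: "?two"
  proof -
    obtain I' \<nu> J b where h: "G \<cong> hub I' \<nu> J \<and> finite I' \<and> finite J \<and> b \<in> I' \<and> (\<forall>j\<in>J. j mod 4 = 2) \<and>
      (\<forall>i\<in>I'. \<nu> i dvd n) \<and> (\<forall>i\<in>I'. I' \<noteq> {b} \<longrightarrow> \<nu> i \<ge> 2)"
      using hub[OF two] by (elim exE) (rule that)
    then have iso: "G \<cong> hub I' \<nu> J" and d: "\<And>i. i \<in> I' \<Longrightarrow> \<nu> i dvd n" by simp_all
    show ?thesis by (rule mon_iso_trans[OF iso hub_embeds_BS[OF assms(3) d]])
  qed
  have 23: "?three" if two: "?two"
  proof -
    obtain I' \<nu> J b where h: "G \<cong> hub I' \<nu> J \<and> finite I' \<and> finite J \<and> b \<in> I' \<and> (\<forall>j\<in>J. j mod 4 = 2) \<and>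
      (\<forall>i\<in>I'. \<nu> i dvd n) \<and> (\<forall>i\<in>I'. I' \<noteq> {b} \<longrightarrow> \<nu> i \<ge> 2)"
      using hub[OF two] by (elim exE) (rule that)
    show ?thesis by (rule hub_labelled_graph[OF G, of I' \<nu> J b n]) (use h n in simp_all)
  qed
  have 31: "mon G (BS n n) \<noteq> {}" if "?three"
    using that
  proof (elim exE conjE)
    fix \<Gamma> :: "(nat, nat) pre_digraph" and arev lab
    assume g: "labelled_graph \<Gamma> arev lab" "represents \<Gamma> arev lab G"
      and lab: "\<forall>e\<in>arcs \<Gamma>. \<forall>f\<in>arcs \<Gamma>. tail \<Gamma> e = tail \<Gamma> f \<longrightarrow> lab e = lab f" "\<forall>e\<in>arcs \<Gamma>. lab e dvd int n"
    show ?thesis by (rule uniform_graph_embeds[OF g assms(3)]) (use lab in blast)+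
  qed
  have A: "mon G (BS n n) \<noteq> {} \<longleftrightarrow> ?two" using 12 21 by (rule iffI)
  have B: "mon G (BS n n) \<noteq> {} \<longleftrightarrow> ?three" by (rule iffI[OF 23[OF 12] 31])
  show ?thesis by (rule conjI[OF A B])
qed

end
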